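(* Let $X$ be a random element of the Hilbert sphere $\mathcal S^\infty$ whose support $\mathcal U\subset\mathcal S^\infty$ satisfies $P(X\in\mathcal U)=1$ and $\sup_{x,y\in\mathcal U}\rho(x,y)\le \pi/2$. Let $\mu$ be the intrinsic mean of $X$ and $\hat\mu$ the sample intrinsic mean of independent copies $X_1,\dots,X_n$ of $X$. Let $(U,\tau)$, $\tau:U\subset\mathcal S^\infty\to\mathbb E$, be a smooth chart of $\mathcal S^\infty$ in a neighborhood $U$ of $\mu$, and write $\mu_\tau=\tau(\mu)$, $\hat\mu_\tau=\tau(\hat\mu)$. Then the operator $\Lambda_\tau=E\,D_2^2\rho_\tau^2(X,\mu_\tau)\in\mathcal B(\mathbb E,\mathbb E^* )$ is continuously invertible, and $$\sqrt n\,(\hat\mu_\tau-\mu_\tau)\to Z\quad\text{in distribution as } n\to\infty,$$ where $Z$ is a Gaussian random element in $\mathbb E$ with mean zero and covariance operator $\mathscr T:\mathbb E\to\mathbb E$, $\mathscr T=\Lambda_\tau^{-1}\mathcal F_\tau(\Lambda_\tau^{-1})^*$, which satisfies $$\langle h_1,\mathscr T h_2\rangle_{\mathbb E}=\operatorname{cov}\big(\langle\Lambda_\tau^{-1}\psi_\tau(X,\mu_\tau),h_1\rangle_{\mathbb E},\ \langle\Lambda_\tau^{-1}\psi_\tau(X,\mu_\tau),h_2\rangle_{\mathbb E}\big)\quad\text{for all } h_1,h_2\in\mathbb E.$$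
   Context: $\mathbb H$ is a separable infinite-dimensional real Hilbert space with inner product $\langle\cdot,\cdot\rangle$ and norm $\|\cdot\|$. The Hilbert sphere is $\mathcal S^\infty=\{f\in\mathbb H : \|f\|=1\}$, with geodesic distance $\rho(f,g)=\arccos\langle f,g\rangle$. A random element $X$ of $\mathcal S^\infty$ is a map from a complete probability space to $\mathcal S^\infty$, measurable with respect to the Borel $\sigma$-algebra induced by $\rho$. The intrinsic (Fréchet) mean of $X$ is the unique minimizer $\mu$ over $p\in\mathcal S^\infty$ of $M(p)=E\rho^2(X,p)$; the sample intrinsic mean $\hat\mu$ is the unique minimizer over $p\in\mathcal S^\infty$ of $M_n(p)=n^{-1}\sum_{i=1}^n\rho^2(X_i,p)$. Under the stated condition on the support, $\mu$ exists and is unique, and almost surely so does $\hat\mu$; moreover $\hat\mu\to\mu$ almost surely, so $\tau(\hat\mu)$ is almost surely defined for all large $n$ (it may be defined arbitrarily when $\hat\mu\notin U$). A smooth chart $\tau:U\to\mathbb E$ is a homeomorphism of an open set $U\subset\mathcal S^\infty$ onto an open subset $\tau(U)$ of a Hilbert space $(\mathbb E,\langle\cdot,\cdot\rangle_{\mathbb E})$, which is a smooth diffeomorphism onto its image. $\mathcal B(E_1,E_2)$ is the space of bounded linear operators from $E_1$ to $E_2$; $\mathbb E^*=\mathcal B(\mathbb E,\mathbb R)$, and $f\in\mathbb E$ is identified with $f^*=\langle f,\cdot\rangle_{\mathbb E}\in\mathbb E^*$. $\mathcal A^*$ is the adjoint of an operator $\mathcal A$ between Hilbert spaces. The tensor product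 is $(f^*\otimes g^* )h^*=\langle f,h\rangle_{\mathbb E}\,g^*$ for $f^*,g^*,h^*\in\mathbb E^*$. Set $\rho_\tau(x,e)=\rho(x,\tau^{-1}(e))$ for $x\in\mathcal S^\infty$, $e\in\tau(U)$. $D_2$ denotes the partial Fréchet derivative in the second argument, and $\psi_\tau(x,e)=D_2\rho_\tau^2(x,e)\in\mathbb E^*$. Finally $\mathcal F_\tau=E[\psi_\tau(X,\mu_\tau)\otimes\psi_\tau(X,\mu_\tau)]\in\mathcal B(\mathbb E^*,\mathbb E^* )$ and $\Lambda_\tau=E\,D_2^2\rho_\tau^2(X,\mu_\tau)\in\mathcal B(\mathbb E,\mathcal B(\mathbb E,\mathbb R))=\mathcal B(\mathbb E,\mathbb E^* )$. *)

theory Defs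
  imports "HOL-Probability.Probability"
begin

definition rho :: "'h::real_inner \<Rightarrow> 'h \<Rightarrow> real" where
  "rho f g = arccos (f \<bullet> g)"

text \<open>
  The topology induced by \<^const>\<open>rho\<close> on the unit sphere is the subspace topology inherited from
  the norm; the sphere therefore carries \<open>top_of_set (sphere 0 1)\<close> and its Borel sigma-algebra
  \<open>restrict_space borel (sphere 0 1)\<close> throughout.
\<close>

lemma openin_sphere_iff_rho:
  fixes W :: "'h::real_inner set"
  shows "openin (top_of_set (sphere 0 1)) W \<longleftrightarrow>
    W \<subseteq> sphere 0 1 \<and> (\<forall>x\<in>W. \<exists>e>0. \<forall>y\<in>sphere 0 1. rho x y < e \<longrightarrow> y \<in> W)"
proof -
  have ip: "\<bar>x \<bullet> y\<bar> \<le> 1" if "norm x = 1" "norm y = 1" for x y :: 'h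
    using Cauchy_Schwarz_ineq2[of x y] that by simp
  have d: "(dist y x)\<^sup>2 = 2 - 2 * (x \<bullet> y)" if "norm x = 1" "norm y = 1" for x y :: 'h
    using that by (simp add: dist_norm power2_norm_eq_inner inner_diff norm_eq_1 inner_commute)
  have small_dist: "\<exists>d>0. \<forall>y\<in>sphere 0 1. dist y x < d \<longrightarrow> rho x y < e"
    if x: "norm x = 1" and e: "e > 0" for x :: 'h and e
  proof -
    have c: "continuous_on (sphere 0 1) (\<lambda>y. rho x y)"
      unfolding rho_def using ip[OF x]
      by (intro continuous_on_arccos continuous_intros) (auto simp: abs_le_iff)
    have "x \<in> sphere 0 1" "rho x x = 0"
      using x by (simp_all add: rho_def norm_eq_1)
    with c[unfolded continuous_on_iff] e obtain d where
      "d > 0" "\<forall>y\<in>sphere 0 1. dist y x < d \<longrightarrow> dist (rho x y) (rho x x) < e" by blast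
    then show ?thesis using \<open>rho x x = 0\<close>
      by (auto simp: dist_real_def intro!: exI[of _ d])
  qed
  have small_rho: "\<exists>d>0. \<forall>y\<in>sphere 0 1. rho x y < d \<longrightarrow> dist y x < e"
    if x: "norm x = 1" and e: "e > 0" for x :: 'h and e
  proof -
    define c where "c = max 0 (1 - e\<^sup>2 / 2)"
    have c: "0 \<le> c" "c < 1" "1 - e\<^sup>2 / 2 \<le> c" using e by (auto simp: c_def)
    have "dist y x < e" if y: "norm y = 1" and r: "rho x y < arccos c" for y
    proof -
      have "c < x \<bullet> y"
      proof (rule ccontr)
        assume "\<not> c < x \<bullet> y"
        then have "arccos c \<le> arccos (x \<bullet> y)"
          using ip[OF x y] c by (intro arccos_le_arccos) (auto simp: abs_le_iff)
        with r show False by (simp add: rho_def)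
      qed
      then have "(dist y x)\<^sup>2 < e\<^sup>2" using d[OF x y] c by simp
      then show ?thesis using e power2_less_imp_less[of "dist y x" e] by simp
    qed
    moreover have "arccos c > 0" using arccos_less_arccos[of c 1] c by simp
    ultimately show ?thesis by (auto intro!: exI[of _ "arccos c"])
  qed
  show ?thesis
    unfolding openin_euclidean_subtopology_iff
  proof (intro conj_cong refl ball_cong)
    fix x assume W: "W \<subseteq> sphere 0 1" and "x \<in> W"
    then have x: "norm x = 1" by auto
    show "(\<exists>e>0. \<forall>x'\<in>sphere 0 1. dist x' x < e \<longrightarrow> x' \<in> W) \<longleftrightarrow>
          (\<exists>e>0. \<forall>y\<in>sphere 0 1. rho x y < e \<longrightarrow> y \<in> W)"
      using small_dist[OF x] small_rho[OF x] by meson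
  qed
qed

definition random_element :: "'w measure \<Rightarrow> ('w \<Rightarrow> 'h::real_inner) \<Rightarrow> bool" where
  "random_element M X \<longleftrightarrow> X \<in> M \<rightarrow>\<^sub>M restrict_space borel (sphere 0 1)"

definition support_of :: "'w measure \<Rightarrow> ('w \<Rightarrow> 'h::real_inner) \<Rightarrow> 'h set" where
  "support_of M X = {x \<in> sphere 0 1. \<forall>W. openin (top_of_set (sphere 0 1)) W \<and> x \<in> W \<longrightarrow>
     measure M {\<omega> \<in> space M. X \<omega> \<in> W} > 0}"

definition sphere_minimizer :: "('h::real_inner \<Rightarrow> real) \<Rightarrow> 'h" where
  "sphere_minimizer F = (THE p. p \<in> sphere 0 1 \<and> (\<forall>q\<in>sphere 0 1. F p \<le> F q))"

definition intrinsic_mean :: "'w measure \<Rightarrow> ('w \<Rightarrow> 'h::real_inner) \<Rightarrow> 'h" where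
  "intrinsic_mean M X = sphere_minimizer (\<lambda>p. \<integral>\<omega>. (rho (X \<omega>) p)\<^sup>2 \<partial>M)"

text \<open>The sample is \<open>Xs 0, \<dots>, Xs (n - 1)\<close>.\<close>

definition sample_intrinsic_mean :: "(nat \<Rightarrow> 'w \<Rightarrow> 'h::real_inner) \<Rightarrow> nat \<Rightarrow> 'w \<Rightarrow> 'h" where
  "sample_intrinsic_mean Xs n \<omega> =
     sphere_minimizer (\<lambda>p. (1 / real n) * (\<Sum>i<n. (rho (Xs i \<omega>) p)\<^sup>2))"

definition bounded_multilinear ::
    "nat \<Rightarrow> ('a::real_normed_vector list \<Rightarrow> 'b::real_normed_vector) \<Rightarrow> bool" where
  "bounded_multilinear k T \<longleftrightarrow>
     (\<forall>vs i. length vs = k \<and> i < k \<longrightarrow> linear (\<lambda>v. T (vs[i := v]))) \<and>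
     (\<exists>C. \<forall>vs. length vs = k \<longrightarrow> norm (T vs) \<le> C * prod_list (map norm vs))"

text \<open>
  Infinite Frechet differentiability on an open set. \<open>D k x\<close> is the \<open>k\<close>-th derivative at \<open>x\<close>, a
  bounded \<open>k\<close>-linear map presented as a function on lists of length \<open>k\<close> (the spaces of such maps
  form no single HOL type), and \<open>D (Suc k)\<close> is the Frechet derivative of \<open>D k\<close> with respect to
  the operator norm of \<open>k\<close>-linear maps.
\<close>

definition smooth_on_open :: "'a::real_normed_vector set \<Rightarrow> ('a \<Rightarrow> 'b::real_normed_vector) \<Rightarrow> bool" where
  "smooth_on_open S f \<longleftrightarrow> open S \<and> (\<exists>D :: nat \<Rightarrow> 'a \<Rightarrow> 'a list \<Rightarrow> 'b.
     (\<forall>x\<in>S. D 0 x [] = f x) \<and>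
     (\<forall>k. \<forall>x\<in>S. bounded_multilinear k (D k x)) \<and>
     (\<forall>k. \<forall>x\<in>S. \<forall>\<epsilon>>0. \<forall>\<^sub>F y in at x. \<forall>vs. length vs = k \<longrightarrow>
        norm (D k y vs - D k x vs - D (Suc k) x ((y - x) # vs))
          \<le> \<epsilon> * norm (y - x) * prod_list (map norm vs)))"

text \<open>
  A map defined on a subset of the ambient space, such as an open piece of the sphere, is smooth if
  it extends locally to a smooth map on an ambient open set. For the sphere, an embedded
  submanifold, this is smoothness with respect to its usual manifold structure.
\<close>

definition smooth_on_subset :: "'a::real_normed_vector set \<Rightarrow> ('a \<Rightarrow> 'b::real_normed_vector) \<Rightarrow> bool" where
  "smooth_on_subset A f \<longleftrightarrow>
     (\<forall>a\<in>A. \<exists>V g. a \<in> V \<and> smooth_on_open V g \<and> (\<forall>x\<in>A \<inter> V. g x = f x))"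

definition smooth_chart :: "'h::real_inner set \<Rightarrow> ('h \<Rightarrow> 'e::real_inner) \<Rightarrow> bool" where
  "smooth_chart U \<tau> \<longleftrightarrow>
     openin (top_of_set (sphere 0 1)) U \<and> open (\<tau> ` U) \<and>
     homeomorphism U (\<tau> ` U) \<tau> (inv_into U \<tau>) \<and>
     smooth_on_subset U \<tau> \<and> smooth_on_open (\<tau> ` U) (inv_into U \<tau>)"

definition rho_chart :: "'h set \<Rightarrow> ('h \<Rightarrow> 'e) \<Rightarrow> 'h::real_inner \<Rightarrow> 'e \<Rightarrow> real" where
  "rho_chart U \<tau> x e = rho x (inv_into U \<tau> e)"

definition frechet_deriv ::
    "('a::real_normed_vector \<Rightarrow> 'b::real_normed_vector) \<Rightarrow> 'a \<Rightarrow> 'a \<Rightarrow>\<^sub>L 'b" where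
  "frechet_deriv f x = (THE D. (f has_derivative blinfun_apply D) (at x))"

definition psi_chart :: "'h set \<Rightarrow> ('h \<Rightarrow> 'e) \<Rightarrow> 'h::real_inner \<Rightarrow> 'e::real_inner \<Rightarrow> 'e \<Rightarrow>\<^sub>L real" where
  "psi_chart U \<tau> x e = frechet_deriv (\<lambda>e'. (rho_chart U \<tau> x e')\<^sup>2) e"

definition hess_chart ::
    "'h set \<Rightarrow> ('h \<Rightarrow> 'e) \<Rightarrow> 'h::real_inner \<Rightarrow> 'e::real_inner \<Rightarrow> 'e \<Rightarrow>\<^sub>L 'e \<Rightarrow>\<^sub>L real" where
  "hess_chart U \<tau> x e = frechet_deriv (\<lambda>e'. psi_chart U \<tau> x e') e"

text \<open>
  \<open>f\<^sup>* = \<langle>f, \<cdot>\<rangle>\<close> is \<open>blinfun_inner_right f\<close>. By the Riesz representation theorem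
  \<^const>\<open>blinfun_inner_right\<close> is a bijection when the space is complete, so its inverse transports
  the inner product to the dual.
\<close>

definition dual_inner :: "('e::real_inner \<Rightarrow>\<^sub>L real) \<Rightarrow> ('e \<Rightarrow>\<^sub>L real) \<Rightarrow> real" where
  "dual_inner \<phi> \<theta> = inv blinfun_inner_right \<phi> \<bullet> inv blinfun_inner_right \<theta>"

definition dual_tensor ::
    "('e::real_inner \<Rightarrow>\<^sub>L real) \<Rightarrow> ('e \<Rightarrow>\<^sub>L real) \<Rightarrow> ('e \<Rightarrow>\<^sub>L real) \<Rightarrow>\<^sub>L ('e \<Rightarrow>\<^sub>L real)" where
  "dual_tensor \<phi> \<theta> = Blinfun (\<lambda>\<eta>. dual_inner \<phi> \<eta> *\<^sub>R \<theta>)"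

definition dual_adjoint :: "(('e::real_inner \<Rightarrow>\<^sub>L real) \<Rightarrow>\<^sub>L 'e) \<Rightarrow> 'e \<Rightarrow>\<^sub>L ('e \<Rightarrow>\<^sub>L real)" where
  "dual_adjoint A = (THE B. \<forall>\<phi> h. blinfun_apply A \<phi> \<bullet> h = dual_inner \<phi> (blinfun_apply B h))"

definition is_blinfun_inverse ::
    "('a::real_normed_vector \<Rightarrow>\<^sub>L 'b::real_normed_vector) \<Rightarrow> ('b \<Rightarrow>\<^sub>L 'a) \<Rightarrow> bool" where
  "is_blinfun_inverse A B \<longleftrightarrow> B o\<^sub>L A = id_blinfun \<and> A o\<^sub>L B = id_blinfun"

definition continuously_invertible ::
    "('a::real_normed_vector \<Rightarrow>\<^sub>L 'b::real_normed_vector) \<Rightarrow> bool" where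
  "continuously_invertible A \<longleftrightarrow> (\<exists>B. is_blinfun_inverse A B)"

definition blinfun_inverse ::
    "('a::real_normed_vector \<Rightarrow>\<^sub>L 'b::real_normed_vector) \<Rightarrow> 'b \<Rightarrow>\<^sub>L 'a" where
  "blinfun_inverse A = (THE B. is_blinfun_inverse A B)"

text \<open>
  The library's \<^const>\<open>has_bochner_integral\<close> requires a second countable range, which spaces of
  operators are not. This is the same definition without that restriction.
\<close>

definition has_expectation :: "'w measure \<Rightarrow> ('w \<Rightarrow> 'b::real_normed_vector) \<Rightarrow> 'b \<Rightarrow> bool" where
  "has_expectation M f v \<longleftrightarrow> f \<in> borel_measurable M \<and>
     (\<exists>s. (\<forall>i::nat. Bochner_Integration.simple_bochner_integrable M (s i)) \<and>
          (\<lambda>i. \<integral>\<^sup>+\<omega>. norm (f \<omega> - s i \<omega>) \<partial>M) \<longlonglongrightarrow> 0 \<and>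
          (\<lambda>i. Bochner_Integration.simple_bochner_integral M (s i)) \<longlonglongrightarrow> v)"

definition operator_expectation :: "'w measure \<Rightarrow> ('w \<Rightarrow> 'b::real_normed_vector) \<Rightarrow> 'b" where
  "operator_expectation M f = (THE v. has_expectation M f v)"

definition covariance :: "'w measure \<Rightarrow> ('w \<Rightarrow> real) \<Rightarrow> ('w \<Rightarrow> real) \<Rightarrow> real" where
  "covariance M A B = (\<integral>\<omega>. (A \<omega> - (\<integral>\<omega>'. A \<omega>' \<partial>M)) * (B \<omega> - (\<integral>\<omega>'. B \<omega>' \<partial>M)) \<partial>M)"

text \<open>Normal law with mean \<open>m\<close> and variance \<open>v \<ge> 0\<close>, a point mass if \<open>v = 0\<close>.\<close>

definition normal_law :: "real \<Rightarrow> real \<Rightarrow> real measure" where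
  "normal_law m v =
     (if v = 0 then return borel m else density lborel (\<lambda>x. ennreal (normal_density m (sqrt v) x)))"

definition gaussian_law :: "'e::real_inner measure \<Rightarrow> bool" where
  "gaussian_law L \<longleftrightarrow> prob_space L \<and> sets L = sets borel \<and>
     (\<forall>h. \<exists>m v. v \<ge> 0 \<and> distr L borel (\<lambda>z. z \<bullet> h) = normal_law m v)"

definition has_mean :: "'e::real_inner measure \<Rightarrow> 'e \<Rightarrow> bool" where
  "has_mean L m \<longleftrightarrow> (\<forall>h. integrable L (\<lambda>z. z \<bullet> h) \<and> (\<integral>z. z \<bullet> h \<partial>L) = m \<bullet> h)"

definition has_covariance_operator :: "'e::real_inner measure \<Rightarrow> ('e \<Rightarrow>\<^sub>L 'e) \<Rightarrow> bool" where
  "has_covariance_operator L T \<longleftrightarrow>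
     (\<forall>h1 h2. h1 \<bullet> blinfun_apply T h2 = covariance L (\<lambda>z. z \<bullet> h1) (\<lambda>z. z \<bullet> h2))"

definition converges_in_distribution ::
    "'w measure \<Rightarrow> (nat \<Rightarrow> 'w \<Rightarrow> 'e::real_normed_vector) \<Rightarrow> 'e measure \<Rightarrow> bool" where
  "converges_in_distribution M Y L \<longleftrightarrow> (\<forall>n. Y n \<in> borel_measurable M) \<and>
     prob_space L \<and> sets L = sets borel \<and>
     (\<forall>f :: 'e \<Rightarrow> real. continuous_on UNIV f \<and> bounded (range f) \<longrightarrow>
        (\<lambda>n. \<integral>\<omega>. f (Y n \<omega>) \<partial>M) \<longlonglongrightarrow> (\<integral>z. f z \<partial>L))"

end

theory Submission
  imports Defs "HOL-Real_Asymp.Real_Asymp"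
begin

text \<open>
  The function \<open>arccos\<^sup>2\<close> is convex and strictly decreasing, so \<open>p \<mapsto> E (arccos \<langle>X, p\<rangle>)\<^sup>2\<close>, extended to the closed
  unit ball, is a convex functional whose minimum is attained on the sphere and grows quadratically away
  from it; the support condition makes all inner products with the minimizer nonnegative. This gives existence
  and uniqueness of \<open>\<mu>\<close> and of the sample mean, and, the same growth holding for the sample functional, the bound
  \<open>\<parallel>\<mu>hat - \<mu>\<parallel> \<le> C \<parallel>score\<parallel>\<close>. The gradient of the functional at \<open>\<mu>\<close> is a negative multiple of \<open>\<mu>\<close>, hence normal to the
  sphere, and its product with the second fundamental form makes \<open>\<Lambda>\<close> coercive. Expanding the stationarity
  condition in the chart to first order turns \<open>\<surd>n (\<mu>hat\<^sub>\<tau> - \<mu>\<^sub>\<tau>)\<close> into a bounded linear image of a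
  normalized sum of bounded centred vectors, up to an error that vanishes in probability. The central limit theorem for
  these sums follows from tightness, the one-dimensional theorem applied to all projections, density of
  trigonometric polynomials on compact sets, and a Gaussian series realising the limit law.
\<close>

subsection \<open>The squared arc cosine\<close>

text \<open>The functional need not be strictly convex: it is constant in directions orthogonal to
  the support. The missing growth is supplied by the curvature of the ball, since the midpoint of a
  chord lies strictly inside and can be shifted along a support point, which lowers the functional
  at a fixed rate. This works for the law and for samples alike, without compactness. The second
  obstacle is that Hessians live in a space of operators that is not separable, where sums and
  differences of measurable functions may fail to be measurable. They are therefore treated as
  continuous functions of the observation, which takes values in a separable space: the observation
  is approximated by simple functions first and the operator-valued function is applied afterwards.
  The chart space carries no countability assumption either, so the Gaussian law is constructed in
  the space of the observations and pushed forward. Consistency of the sample mean is contained in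
  its bound by the score, which is of order n^(-1/2) in probability; the expansion in the chart is
  deterministic, with the randomness confined to three events of small probability.\<close>

lemma uniform_mean_value:
  fixes F f :: "real \<Rightarrow> real"
  assumes F: "continuous_on {a..b} F" and f: "continuous_on {a..b} f"
    and der: "\<And>x. a < x \<Longrightarrow> x < b \<Longrightarrow> (F has_real_derivative f x) (at x)" and e: "0 < e"
  shows "\<exists>d>0. \<forall>s\<in>{a..b}. \<forall>t\<in>{a..b}. \<bar>t - s\<bar> < d \<longrightarrow> \<bar>F t - F s - f s * (t - s)\<bar> \<le> e * \<bar>t - s\<bar>"
proof -
  have mv: "\<exists>z. min s t \<le> z \<and> z \<le> max s t \<and> F t - F s = f z * (t - s)"
    if s: "s \<in> {a..b}" and t: "t \<in> {a..b}" for s t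
  proof -
    have mv: "\<exists>z. p < z \<and> z < q \<and> F q - F p = f z * (q - p)"
      if "p < q" "a \<le> p" "q \<le> b" for p q
    proof -
      have "\<exists>z. p < z \<and> z < q \<and> F q - F p = (\<lambda>h. f z * h) (q - p)"
      proof (rule mvt[OF \<open>p < q\<close>, of F "\<lambda>z h. f z * h"])
        show "continuous_on {p..q} F" using F that by (rule_tac continuous_on_subset) auto
        show "(F has_derivative (*) (f x)) (at x)" if "p < x" "x < q" for x
          using der[of x] that \<open>a \<le> p\<close> \<open>q \<le> b\<close> by (simp add: has_field_derivative_def)
      qed auto
      then show ?thesis by simp
    qed
    consider "s < t" | "s = t" | "t < s" by linarith
    then show ?thesis
    proof cases
      case 1 then show ?thesis using mv[of s t] s t by (auto intro: less_imp_le)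
    next
      case 2 then show ?thesis by auto
    next
      case 3
      then obtain z where "t < z" "z < s" "F s - F t = f z * (s - t)" using mv[of t s] s t by auto
      then show ?thesis by (intro exI[of _ z]) (auto simp: algebra_simps)
    qed
  qed
  \<comment> \<open>The intermediate point lies within \<open>d\<close> of \<open>s\<close>, so one
    modulus of continuity serves every base point. The endpoints are included although derivatives
    are assumed only inside, as the mean value theorem asks for no more.\<close>
  have "uniformly_continuous_on {a..b} f" using f compact_uniformly_continuous by blast
  then obtain d where "d > 0"
      "\<forall>x\<in>{a..b}. \<forall>x'\<in>{a..b}. dist x' x < d \<longrightarrow> dist (f x') (f x) < e"
    using e unfolding uniformly_continuous_on_def by meson
  then have d: "d > 0" "\<And>s t. s \<in> {a..b} \<Longrightarrow> t \<in> {a..b} \<Longrightarrow> dist t s < d \<Longrightarrow> dist (f t) (f s) < e" by auto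
  have "\<bar>F t - F s - f s * (t - s)\<bar> \<le> e * \<bar>t - s\<bar>"
    if s: "s \<in> {a..b}" and t: "t \<in> {a..b}" and st: "\<bar>t - s\<bar> < d" for s t
  proof -
    obtain z where z: "min s t \<le> z" "z \<le> max s t" "F t - F s = f z * (t - s)" using mv[OF s t] by auto
    then have "\<bar>f z - f s\<bar> < e" using d(2)[of s z] s t st by (auto simp: dist_real_def min_def max_def split: if_splits)
    then have "\<bar>f z - f s\<bar> * \<bar>t - s\<bar> \<le> e * \<bar>t - s\<bar>" by (intro mult_right_mono) auto
    moreover have "F t - F s - f s * (t - s) = (f z - f s) * (t - s)" using z by (simp add: algebra_simps)
    ultimately show ?thesis by (simp add: abs_mult)
  qed
  then show ?thesis using d by blast
qed

text \<open>\<open>arccos\<^sup>2\<close> is continued constantly outside \<open>[-1, 1]\<close>; at \<open>1\<close>, where the quotients are undefined,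
  its derivatives are given their limits.\<close>

definition sqarc :: "real \<Rightarrow> real" where
  "sqarc t = (arccos (max (-1) (min 1 t)))\<^sup>2"

definition dsqarc :: "real \<Rightarrow> real" where
  "dsqarc t = (if t = 1 then -2 else - 2 * arccos t / sqrt (1 - t\<^sup>2))"

definition ddsqarc :: "real \<Rightarrow> real" where
  "ddsqarc t = (if t = 1 then 2/3 else 2 / (1 - t\<^sup>2) - 2 * t * arccos t / (sqrt (1 - t\<^sup>2)) ^ 3)"

lemma sqarc_eq: "\<bar>t\<bar> \<le> 1 \<Longrightarrow> sqarc t = (arccos t)\<^sup>2"
  by (auto simp: sqarc_def abs_le_iff min_def max_def)

lemma sqarc_nonneg: "0 \<le> sqarc t"
  by (simp add: sqarc_def)

lemma sqarc_le: "sqarc t \<le> pi\<^sup>2"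
  unfolding sqarc_def by (intro power_mono arccos_ubound arccos_lbound) (auto simp: min_def max_def)

lemma continuous_sqarc: "continuous_on S sqarc"
proof -
  have "continuous_on UNIV (\<lambda>t. (arccos (max (-1) (min 1 t)))\<^sup>2)"
    by (intro continuous_intros continuous_on_arccos) (auto simp: min_def max_def)
  then show ?thesis unfolding sqarc_def using continuous_on_subset by blast
qed

text \<open>With t = cos x this says that x^2 + 2 cos x is nondecreasing for x >= 0, which is sin x
  <= x. The slope -2 is the limit of the derivative at 1, where the function falls most
  slowly.\<close>

lemma sqarc_decrease:
  assumes "-1 \<le> s" "s \<le> t" "t \<le> 1"
  shows "sqarc t \<le> sqarc s - 2 * (t - s)"
proof -
  have "arccos t \<le> arccos s" using assms by (intro arccos_le_arccos) auto
  moreover have "0 \<le> arccos t" "arccos s \<le> pi" using assms by (auto intro: arccos_lbound arccos_ubound)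
  then have "(\<lambda>x. x\<^sup>2 + 2 * cos x) (arccos t) \<le> (\<lambda>x. x\<^sup>2 + 2 * cos x) (arccos s)"
    if le: "arccos t \<le> arccos s"
  proof (rule_tac DERIV_nonneg_imp_nondecreasing[OF le])
    fix x assume x: "arccos t \<le> x" "x \<le> arccos s"
    then have "0 \<le> x" using \<open>0 \<le> arccos t\<close> by simp
    have "((\<lambda>x. x\<^sup>2 + 2 * cos x) has_real_derivative 2 * x - 2 * sin x) (at x)"
      by (auto intro!: derivative_eq_intros)
    moreover have "0 \<le> 2 * x - 2 * sin x" using sin_x_le_x[OF \<open>0 \<le> x\<close>] by simp
    ultimately show "\<exists>y. ((\<lambda>x. x\<^sup>2 + 2 * cos x) has_real_derivative y) (at x) \<and> 0 \<le> y" by blast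
  qed
  then show ?thesis using assms \<open>arccos t \<le> arccos s\<close> by (simp add: sqarc_eq)
qed

lemma has_derivative_sqarc:
  assumes "-1 < t" "t < 1"
  shows "(sqarc has_real_derivative dsqarc t) (at t)"
proof -
  have "((\<lambda>t. (arccos t)\<^sup>2) has_real_derivative dsqarc t) (at t)"
    using DERIV_power[OF DERIV_arccos[OF assms], of 2] assms by (simp add: dsqarc_def divide_inverse mult_ac)
  then show ?thesis
  proof (rule DERIV_cong_ev[THEN iffD1, rotated -1])
    have "\<forall>\<^sub>F x in nhds t. x \<in> {-1<..<1}" using assms by (intro eventually_nhds_in_open) auto
    then show "\<forall>\<^sub>F x in nhds t. (arccos x)\<^sup>2 = sqarc x" by eventually_elim (auto simp: sqarc_eq)
  qed auto
qed

lemma has_derivative_dsqarc: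
  assumes "-1 < t" "t < 1"
  shows "(dsqarc has_real_derivative ddsqarc t) (at t)"
proof -
  have pos: "1 - t\<^sup>2 > 0" using assms by (simp add: abs_square_less_1 abs_less_iff)
  have *: "sqrt (1 - t\<^sup>2) > 0" "sqrt (1 - t\<^sup>2) * sqrt (1 - t\<^sup>2) = 1 - t\<^sup>2" using pos by auto
  define r where "r = sqrt (1 - t\<^sup>2)"
  have r: "r > 0" "r\<^sup>2 = 1 - t\<^sup>2" using pos by (auto simp: r_def)
  have s: "((\<lambda>t. sqrt (1 - t\<^sup>2)) has_real_derivative - t / r) (at t)"
  proof -
    have "((\<lambda>t. 1 - t\<^sup>2) has_real_derivative - 2 * t) (at t)" by (auto intro!: derivative_eq_intros)
    from DERIV_chain2[where f = sqrt and g = "\<lambda>t. 1 - t\<^sup>2", OF DERIV_real_sqrt[OF pos] this]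
    have "((\<lambda>t. sqrt (1 - t\<^sup>2)) has_real_derivative inverse (sqrt (1 - t\<^sup>2)) / 2 * (- 2 * t)) (at t)" .
    moreover have "inverse (sqrt (1 - t\<^sup>2)) / 2 * (- 2 * t) = - t / r"
      using r(1) by (simp add: r_def[symmetric] field_simps)
    ultimately show ?thesis by metis
  qed
  have a: "((\<lambda>t. - 2 * arccos t) has_real_derivative 2 / r) (at t)"
  proof -
    have "-2 * inverse (- sqrt (1 - t\<^sup>2)) = 2 / r"
      using r(1) by (simp add: r_def[symmetric] field_simps)
    then show ?thesis using DERIV_cmult[OF DERIV_arccos[OF assms], of "-2"] by metis
  qed
  have "((\<lambda>t. - 2 * arccos t / sqrt (1 - t\<^sup>2)) has_real_derivative
      (2 / r * r - (- 2 * arccos t) * (- t / r)) / (r * r)) (at t)"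
    using DERIV_divide[OF a s] r(1) by (metis less_irrefl r_def)
  also have "(2 / r * r - (- 2 * arccos t) * (- t / r)) / (r * r) = 2 / r\<^sup>2 - 2 * t * arccos t / r ^ 3"
    using r(1) by (simp add: diff_divide_distrib power2_eq_square power3_eq_cube mult_ac)
  also have "\<dots> = ddsqarc t"
    using assms r by (simp add: ddsqarc_def r_def)
  finally show ?thesis
  proof (rule DERIV_cong_ev[THEN iffD1, rotated -1])
    have "\<forall>\<^sub>F x in nhds t. x \<in> {-1<..<1}" using assms by (intro eventually_nhds_in_open) auto
    then show "\<forall>\<^sub>F x in nhds t. - 2 * arccos x / sqrt (1 - x\<^sup>2) = dsqarc x" by eventually_elim (auto simp: dsqarc_def)
  qed auto
qed

lemma filterlim_arccos_1: "filterlim arccos (at_right 0) (at_left 1)"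
proof -
  have "continuous_on {-1..1} arccos" by (rule continuous_on_arccos') 
  then have "(arccos \<longlongrightarrow> arccos 1) (at 1 within {-1..1})" by (simp add: continuous_on del: arccos_1)
  then have "(arccos \<longlongrightarrow> 0) (at_left 1)"
    by (simp add: at_within_Icc_at_left)
  moreover have "\<forall>\<^sub>F x in at_left (1::real). x \<in> {-1<..<1}"
    by (rule eventually_at_left_real) auto
  then have "\<forall>\<^sub>F x in at_left (1::real). arccos x \<in> {0<..} \<and> arccos x \<noteq> 0"
  proof eventually_elim
    case (elim x)
    then show ?case using arccos_less_arccos[of x 1] by auto
  qed
  ultimately show ?thesis by (simp add: filterlim_at)
qed

text \<open>The substitution t = cos x moves the removable singularity at 1 to x = 0, where the
  quotients become expressions in x, sin x and cos x that can be expanded.\<close>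

lemma tendsto_at_1_via_cos:
  fixes F :: "real \<Rightarrow> real"
  assumes "((\<lambda>x. F (cos x)) \<longlongrightarrow> l) (at_right 0)"
  shows "(F \<longlongrightarrow> l) (at_left 1)"
proof -
  have "((\<lambda>t. F (cos (arccos t))) \<longlongrightarrow> l) (at_left 1)"
    using filterlim_compose[OF assms filterlim_arccos_1] by simp
  moreover have "\<forall>\<^sub>F x in at_left (1::real). x \<in> {-1<..<1}"
    by (rule eventually_at_left_real) auto
  then have "\<forall>\<^sub>F x in at_left (1::real). F (cos (arccos x)) = F x"
    by eventually_elim auto
  ultimately show ?thesis by (simp add: tendsto_cong)
qed

lemma at_right_0_cos:
  "\<forall>\<^sub>F x in at_right (0::real). 0 < x \<and> x < pi \<and> sqrt (1 - (cos x)\<^sup>2) = sin x \<and> arccos (cos x) = x \<and> cos x \<noteq> 1"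
proof -
  have "\<forall>\<^sub>F x in at_right (0::real). x \<in> {0<..<pi}" by (rule eventually_at_right_real) auto
  then show ?thesis
  proof eventually_elim
    case (elim x)
    then have "cos x < 1" using cos_monotone_0_pi[of 0 x] by auto
    then show ?case using elim by (simp add: sin_squared_eq[symmetric] arccos_cos sin_ge_zero)
  qed
qed

lemma continuous_on_left_end:
  fixes f :: "real \<Rightarrow> real"
  assumes "\<And>t. -1 < t \<Longrightarrow> t < 1 \<Longrightarrow> isCont f t" "(f \<longlongrightarrow> f 1) (at_left 1)"
  shows "continuous_on {-1<..1} f"
  unfolding continuous_on
proof
  fix t :: real assume t: "t \<in> {-1<..1}"
  show "(f \<longlongrightarrow> f t) (at t within {-1<..1})"
  proof (cases "t = 1")
    case True
    have "at 1 within {-1<..1::real} = at_left 1" by (rule at_within_nhd[of _ "{-1<..}"]) auto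
    then show ?thesis using True assms(2) by simp
  next
    case False
    then show ?thesis using t assms(1)[of t] by (auto simp: isCont_def intro: tendsto_within_subset)
  qed
qed

lemma continuous_dsqarc: "continuous_on {-1<..1} dsqarc"
proof (rule continuous_on_left_end)
  show "isCont dsqarc t" if "-1 < t" "t < 1" for t
    using has_derivative_dsqarc[OF that] by (rule DERIV_isCont)
  have "((\<lambda>x::real. - 2 * x / sin x) \<longlongrightarrow> -2) (at_right 0)" by real_asymp
  then have "((\<lambda>x. dsqarc (cos x)) \<longlongrightarrow> -2) (at_right 0)"
    by (rule tendsto_cong[THEN iffD1, rotated])
      (rule eventually_mono[OF at_right_0_cos], auto simp: dsqarc_def)
  then show "(dsqarc \<longlongrightarrow> dsqarc 1) (at_left 1)"
    using tendsto_at_1_via_cos by (simp add: dsqarc_def)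
qed

lemma continuous_ddsqarc: "continuous_on {-1<..<1} ddsqarc"
  unfolding ddsqarc_def
proof (rule continuous_on_cong[THEN iffD1, rotated 2])
  show "continuous_on {-1<..<1} (\<lambda>t. 2 / (1 - t\<^sup>2) - 2 * t * arccos t / (sqrt (1 - t\<^sup>2)) ^ 3)"
    using abs_square_less_1 by (intro continuous_intros) (auto simp: power2_eq_1_iff)
qed auto

lemma continuous_ddsqarc': "continuous_on {-1<..1} ddsqarc"
proof (rule continuous_on_left_end)
  show "isCont ddsqarc t" if "-1 < t" "t < 1" for t
    using continuous_ddsqarc that by (simp add: continuous_on_eq_continuous_at)
  have "((\<lambda>x::real. 2 / (sin x)^2 - 2 * cos x * x / (sin x)^3) \<longlongrightarrow> 2/3) (at_right 0)" by real_asymp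
  then have "((\<lambda>x. ddsqarc (cos x)) \<longlongrightarrow> 2/3) (at_right 0)"
    by (rule tendsto_cong[THEN iffD1, rotated])
      (rule eventually_mono[OF at_right_0_cos], auto simp: ddsqarc_def sin_squared_eq)
  then show "(ddsqarc \<longlongrightarrow> ddsqarc 1) (at_left 1)"
    using tendsto_at_1_via_cos by (simp add: ddsqarc_def)
qed

text \<open>The derivative of sin x - x cos x is x sin x. With x = arccos t the inequality is
  exactly the sign of the numerator of \<open>ddsqarc\<close>.\<close>

lemma sin_ge_x_cos:
  assumes "0 \<le> x" "x \<le> pi"
  shows "x * cos x \<le> sin x"
proof -
  have "(\<lambda>x. sin x - x * cos x) 0 \<le> (\<lambda>x. sin x - x * cos x) x"
  proof (rule DERIV_nonneg_imp_nondecreasing[OF assms(1)])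
    fix y assume y: "0 \<le> y" "y \<le> x"
    have "((\<lambda>x. sin x - x * cos x) has_real_derivative y * sin y) (at y)"
      by (auto intro!: derivative_eq_intros)
    moreover have "0 \<le> y * sin y" using y assms by (simp add: sin_ge_zero)
    ultimately show "\<exists>d. ((\<lambda>x. sin x - x * cos x) has_real_derivative d) (at y) \<and> 0 \<le> d" by blast
  qed
  then show ?thesis by simp
qed

lemma ddsqarc_nonneg:
  assumes "-1 < t" "t \<le> 1"
  shows "0 \<le> ddsqarc t"
proof (cases "t = 1")
  case False
  then have t: "-1 < t" "t < 1" using assms by auto
  define r where "r = sqrt (1 - t\<^sup>2)"
  have "1 - t\<^sup>2 > 0" using t by (simp add: abs_square_less_1 abs_less_iff)
  then have r: "r > 0" "r\<^sup>2 = 1 - t\<^sup>2" by (auto simp: r_def)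
  have "arccos t * cos (arccos t) \<le> sin (arccos t)"
    using t by (intro sin_ge_x_cos arccos_lbound arccos_ubound) auto
  then have le: "arccos t * t \<le> r" using t by (simp add: sin_arccos r_def)
  have "ddsqarc t = 2 / r\<^sup>2 - 2 * t * arccos t / r ^ 3"
    using False r(2) by (simp add: ddsqarc_def r_def[symmetric])
  also have "\<dots> = 2 * (r - arccos t * t) / r ^ 3"
    using r(1) by (simp add: field_simps power2_eq_square power3_eq_cube)
  also have "\<dots> \<ge> 0" using le r by simp
  finally show ?thesis .
qed (simp add: ddsqarc_def)

section \<open>Convexity up to the endpoints\<close>

lemma convex_on_sqarc_open: "convex_on {-1<..<1} sqarc"
proof (rule f''_ge0_imp_convex)
  show "DERIV sqarc x :> dsqarc x" if "x \<in> {-1<..<1}" for x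
    using that by (intro has_derivative_sqarc) auto
  show "DERIV dsqarc x :> ddsqarc x" if "x \<in> {-1<..<1}" for x
    using that by (intro has_derivative_dsqarc) auto
  show "0 \<le> ddsqarc x" if "x \<in> {-1<..<1}" for x
    using that by (intro ddsqarc_nonneg) auto
qed auto

text \<open>Convexity is available in the open interval. Scaling the arguments by c < 1 and letting
  c tend to 1 carries the midpoint and tangent inequalities over to the closed interval.\<close>

lemma eventually_shrink: "\<forall>\<^sub>F c in at_left (1::real). 0 < c \<and> c < 1"
  using eventually_at_left_real[of 0 "1::real"] by auto

lemma shrink_bounds:
  fixes c x :: real assumes "0 < c \<and> c < 1" "-1 \<le> x" "x \<le> 1"
  shows "c * x \<in> {-1<..<1}"
proof -
  have "\<bar>c * x\<bar> \<le> c * 1" unfolding abs_mult using assms by (intro mult_mono) auto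
  then show ?thesis using assms by auto
qed

lemma tendsto_sqarc_shrink: "((\<lambda>c. sqarc (c * x)) \<longlongrightarrow> sqarc x) (at_left 1)"
proof -
  have "((\<lambda>c. c * x) \<longlongrightarrow> 1 * x) (at_left 1)" by (intro tendsto_intros)
  moreover have "isCont sqarc x" using continuous_sqarc[of UNIV] by (simp add: continuous_on_eq_continuous_at)
  ultimately show ?thesis using isCont_tendsto_compose[of x sqarc] by simp
qed

lemma sqarc_midconvex:
  assumes x: "-1 \<le> x" "x \<le> 1" and y: "-1 \<le> y" "y \<le> 1"
  shows "sqarc ((x + y) / 2) \<le> (sqarc x + sqarc y) / 2"
proof (rule tendsto_le[of "at_left 1"])
  show "\<forall>\<^sub>F c in at_left (1::real). sqarc (c * ((x + y) / 2)) \<le> (sqarc (c * x) + sqarc (c * y)) / 2"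
    using eventually_shrink
  proof eventually_elim
    case (elim c)
    have "sqarc ((1 - 1/2) *\<^sub>R (c * x) + (1/2) *\<^sub>R (c * y)) \<le> (1 - 1/2) * sqarc (c * x) + (1/2) * sqarc (c * y)"
      using convex_on_sqarc_open shrink_bounds[OF elim x] shrink_bounds[OF elim y]
      by (intro convex_onD) auto
    then show ?case by (simp add: field_simps)
  qed
  show "((\<lambda>c. sqarc (c * ((x + y) / 2))) \<longlongrightarrow> sqarc ((x + y) / 2)) (at_left 1)"
    by (rule tendsto_sqarc_shrink)
qed (auto intro!: tendsto_sqarc_shrink tendsto_intros)

text \<open>The base point is kept nonnegative because \<open>dsqarc\<close> tends to minus infinity
  at -1. At s = 1 the line has the one-sided slope -2, which the limit in c delivers.\<close>

lemma sqarc_tangent: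
  assumes s: "0 \<le> s" "s \<le> 1" and t: "-1 \<le> t" "t \<le> 1"
  shows "sqarc s + dsqarc s * (t - s) \<le> sqarc t"
proof (rule tendsto_le[of "at_left 1"])
  show "((\<lambda>c. sqarc (c * s) + dsqarc (c * s) * (c * t - c * s)) \<longlongrightarrow> sqarc s + dsqarc s * (t - s)) (at_left 1)"
  proof -
    have "((\<lambda>c. c * s) \<longlongrightarrow> 1 * s) (at_left 1)" by (intro tendsto_intros)
    moreover have "\<forall>\<^sub>F c in at_left (1::real). c * s \<in> {-1<..1}"
      using eventually_shrink
    proof eventually_elim
      case (elim c)
      then show ?case using shrink_bounds[OF elim, of s] s by auto
    qed
    ultimately have "((\<lambda>c. dsqarc (c * s)) \<longlongrightarrow> dsqarc s) (at_left 1)"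
      using s by (intro continuous_on_tendsto_compose[OF continuous_dsqarc]) auto
    moreover have "((\<lambda>c. c * t - c * s) \<longlongrightarrow> 1 * t - 1 * s) (at_left 1)" by (intro tendsto_intros)
    ultimately show ?thesis by (intro tendsto_add tendsto_mult tendsto_sqarc_shrink) auto
  qed
  show "\<forall>\<^sub>F c in at_left (1::real). sqarc (c * s) + dsqarc (c * s) * (c * t - c * s) \<le> sqarc (c * t)"
    using eventually_shrink
  proof eventually_elim
    case (elim c)
    have *: "c * s \<in> {-1<..<1}" "c * t \<in> {-1<..<1}" using shrink_bounds[OF elim] s t by auto
    then have "(sqarc has_real_derivative dsqarc (c * s)) (at (c * s) within {-1<..<1})"
      by (intro DERIV_subset[OF has_derivative_sqarc]) auto
    then have "sqarc (c * t) - sqarc (c * s) \<ge> dsqarc (c * s) * (c * t - c * s)"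
      using convex_on_sqarc_open * by (intro convex_on_imp_above_tangent[where A="{-1<..<1}"]) (auto simp: interior_open)
    then show ?case by simp
  qed
qed (auto intro!: tendsto_sqarc_shrink)

text \<open>At the point 1 the tangent from s lies below \<open>sqarc 1\<close>, while
  \<open>sqarc 1\<close> lies below the line of slope -2 through the same point of the graph;
  comparing the two compares the slopes.\<close>

lemma dsqarc_le:
  assumes "0 \<le> s" "s \<le> 1"
  shows "dsqarc s \<le> -2"
proof (cases "s = 1")
  case False
  then have "dsqarc s * (1 - s) \<le> -2 * (1 - s)"
    using sqarc_tangent[of s 1] sqarc_decrease[of s 1] assms by simp
  moreover have "1 - s > 0" using False assms by simp
  ultimately show ?thesis using mult_le_cancel_right_pos by blast
qed (simp add: dsqarc_def)

text \<open>Inner products of support points with the mean will be nonnegative; -1/2 leaves room for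
  small perturbations of them while staying away from the singular point -1.\<close>

lemma ex_bound_dsqarc: "\<exists>C. 0 \<le> C \<and> (\<forall>s\<in>{-1/2..1}. \<bar>dsqarc s\<bar> \<le> C) \<and> (\<forall>s\<in>{-1/2..1}. \<bar>ddsqarc s\<bar> \<le> C)"
proof -
  have "compact (dsqarc ` {-1/2..1})" "compact (ddsqarc ` {-1/2..1})"
    using continuous_dsqarc continuous_ddsqarc'
    by (auto intro!: compact_continuous_image elim!: continuous_on_subset)
  then have "bounded (dsqarc ` {-1/2..1})" "bounded (ddsqarc ` {-1/2..1})"
    by (auto intro: compact_imp_bounded)
  then obtain A B where "\<forall>x\<in>{-1/2..1}. \<bar>dsqarc x\<bar> \<le> A" "\<forall>x\<in>{-1/2..1}. \<bar>ddsqarc x\<bar> \<le> B"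
    unfolding bounded_iff by auto
  then show ?thesis by (intro exI[of _ "max 0 (max A B)"]) (auto simp: le_max_iff_disj)
qed

lemma sqarc_expansion:
  assumes "0 < e"
  shows "\<exists>d>0. \<forall>s\<in>{-1/2..1}. \<forall>t\<in>{-1/2..1}. \<bar>t - s\<bar> < d \<longrightarrow>
    \<bar>sqarc t - sqarc s - dsqarc s * (t - s)\<bar> \<le> e * \<bar>t - s\<bar>"
  using assms continuous_dsqarc
  by (intro uniform_mean_value has_derivative_sqarc continuous_sqarc) (auto elim!: continuous_on_subset)

lemma dsqarc_expansion:
  assumes "0 < e"
  shows "\<exists>d>0. \<forall>s\<in>{-1/2..1}. \<forall>t\<in>{-1/2..1}. \<bar>t - s\<bar> < d \<longrightarrow>
    \<bar>dsqarc t - dsqarc s - ddsqarc s * (t - s)\<bar> \<le> e * \<bar>t - s\<bar>"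
  using assms continuous_dsqarc continuous_ddsqarc'
  by (intro uniform_mean_value has_derivative_dsqarc) (auto elim!: continuous_on_subset)

text \<open>Inner products of support points with the mean lie in [0, 1]. Clamping changes nothing
  there and turns functions continuous on (-1, 1] into continuous functions on the whole
  line.\<close>

definition clamp01 :: "real \<Rightarrow> real" where "clamp01 t = max 0 (min 1 t)"

lemma clamp01: "0 \<le> clamp01 t" "clamp01 t \<le> 1" "0 \<le> t \<Longrightarrow> t \<le> 1 \<Longrightarrow> clamp01 t = t"
  by (auto simp: clamp01_def)

lemma continuous_clamp01:
  assumes "continuous_on {-1<..1} f"
  shows "continuous_on UNIV (\<lambda>t. f (clamp01 t))"
proof (rule continuous_on_compose2[OF assms])
  show "continuous_on UNIV clamp01" unfolding clamp01_def by (intro continuous_intros)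
  have "-1 < clamp01 t" for t using clamp01(1)[of t] by linarith
  then show "range clamp01 \<subseteq> {-1<..1}" using clamp01(2) by auto
qed

subsection \<open>Minimisation in Hilbert spaces\<close>

text \<open>There is no compactness to draw on; instead the hypothesis makes every minimizing
  sequence Cauchy, since two points with values below infimum + r are at distance less than sqrt (r
  / k).\<close>

lemma minimizer_attained:
  fixes f :: "'a::complete_space \<Rightarrow> real"
  assumes S: "closed S" "S \<noteq> {}" and cont: "continuous_on S f" and bdd: "bdd_below (f ` S)" and k: "0 < k"
    and conv: "\<And>x y. x \<in> S \<Longrightarrow> y \<in> S \<Longrightarrow> k * (dist x y)\<^sup>2 \<le> (f x + f y) / 2 - Inf (f ` S)"
  shows "\<exists>x\<in>S. f x = Inf (f ` S)"
proof -
  define m where "m = Inf (f ` S)"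
  define r where "r n = 1 / real (Suc n)" for n
  have "\<exists>x\<in>S. f x < m + r n" for n
  proof -
    have "m < m + r n" by (simp add: r_def)
    then show ?thesis using cInf_lessD[of "f ` S" "m + r n"] S(2) unfolding m_def by auto
  qed
  then obtain x where x: "\<And>n. x n \<in> S" "\<And>n. f (x n) < m + r n" by metis
  have m_le: "m \<le> f y" if "y \<in> S" for y unfolding m_def using bdd that by (intro cInf_lower) auto
  have "Cauchy x"
    unfolding Cauchy_def
  proof (intro allI impI)
    fix e :: real assume e: "0 < e"
    obtain K where K: "r K < k * e\<^sup>2" unfolding r_def inverse_eq_divide[symmetric] using reals_Archimedean[of "k * e\<^sup>2"] k e by auto
    have "dist (x i) (x j) < e" if ij: "i \<ge> K" "j \<ge> K" for i j
    proof -
      have "r i \<le> r K" "r j \<le> r K"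
        using ij by (auto simp: frac_le r_def)
      then have "k * (dist (x i) (x j))\<^sup>2 < k * e\<^sup>2"
        using conv[OF x(1) x(1), of i j, folded m_def] x(2)[of i] x(2)[of j] K by argo
      then show ?thesis using k e power2_less_imp_less[of "dist (x i) (x j)" e] by simp
    qed
    then show "\<exists>M. \<forall>m\<ge>M. \<forall>n\<ge>M. dist (x m) (x n) < e" by blast
  qed
  then obtain l where l: "x \<longlonglongrightarrow> l" using Cauchy_convergent convergent_def by blast
  have lS: "l \<in> S" using closed_sequentially[OF S(1)] x(1) l by blast
  have "(\<lambda>n. f (x n)) \<longlonglongrightarrow> f l"
    by (rule continuous_on_tendsto_compose[OF cont l lS]) (simp add: x)
  moreover have "(\<lambda>n. m + r n) \<longlonglongrightarrow> m + 0"
    unfolding r_def by (intro tendsto_add tendsto_const LIMSEQ_Suc[OF lim_const_over_n[of 1]]) 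
  ultimately have "f l \<le> m + 0"
    by (rule LIMSEQ_le) (use x(2) less_imp_le in blast)
  then show ?thesis using m_le[OF lS] lS unfolding m_def by force
qed

lemma linear_coeff_zero:
  fixes p q :: real
  assumes "\<And>t. 0 \<le> t * p + t\<^sup>2 * q"
  shows "p = 0"
proof (rule ccontr)
  assume p: "p \<noteq> 0"
  \<comment> \<open>The quadratic is tested at t = - s * p; any s > 0 with s * q < 1 makes its value
    negative.\<close>
  define s where "s = 1 / (\<bar>q\<bar> + 1)"
  have s: "0 < s" "s * q < 1" by (auto simp: s_def field_simps abs_if)
  have "0 \<le> (- s * p) * p + (- s * p)\<^sup>2 * q" by (rule assms)
  also have "\<dots> = s * p\<^sup>2 * (s * q - 1)" by (simp add: algebra_simps power2_eq_square)
  also have "\<dots> < 0" using s p by (intro mult_pos_neg) auto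
  finally show False by simp
qed

text \<open>The solution minimizes the energy \<open>J\<close>. The parallelogram identity
  \<open>mid\<close> and coercivity make this an instance of \<open>minimizer_attained\<close>, and
  minimality along each line through \<open>u\<close> kills the linear coefficient. Both the Riesz
  representation and the inverse of the Hessian come from here.\<close>

lemma symmetric_lax_milgram:
  fixes a :: "'e::{real_normed_vector, complete_space} \<Rightarrow> 'e \<Rightarrow> real"
  assumes a: "bounded_bilinear a" and sym: "\<And>x y. a x y = a y x"
    and c: "0 < c" "\<And>x. c * (norm x)\<^sup>2 \<le> a x x" and p: "bounded_linear p"
  shows "\<exists>u. \<forall>v. a u v = p v"
proof -
  interpret a: bounded_bilinear a by fact
  interpret p: bounded_linear p by fact
  define J where "J x = a x x / 2 - p x" for x
  obtain K where K: "\<And>x. norm (p x) \<le> norm x * K" "0 < K" using p.pos_bounded by blast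
  have lower: "- K\<^sup>2 / (2 * c) \<le> J x" for x
  proof -
    have "p x \<le> norm x * K" using K(1)[of x] by simp
    moreover have "c / 2 * (norm x)\<^sup>2 - norm x * K + K\<^sup>2 / (2 * c) = (c * norm x - K)\<^sup>2 / (2 * c)"
      using c(1) by (simp add: field_simps power2_eq_square)
    moreover have "0 \<le> (c * norm x - K)\<^sup>2 / (2 * c)" using c(1) by simp
    ultimately show ?thesis unfolding J_def using c(2)[of x] by simp
  qed
  have bdd: "bdd_below (range J)" using lower by (auto intro!: bdd_belowI)
  have mid: "J ((1/2) *\<^sub>R (x + y)) = (J x + J y) / 2 - a (x - y) (x - y) / 8" for x y
    unfolding J_def by (simp add: a.add_left a.add_right a.diff_left a.diff_right a.scaleR_left a.scaleR_right
        p.add p.scaleR sym[of y x] field_simps)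
  have "\<exists>x\<in>UNIV. J x = Inf (range J)"
  proof (rule minimizer_attained[where k = "c / 8"])
    show "continuous_on UNIV J"
      unfolding J_def by (intro continuous_intros a.continuous_on p.continuous_on) auto
    show "c / 8 * (dist x y)\<^sup>2 \<le> (J x + J y) / 2 - Inf (range J)" for x y
    proof -
      have "Inf (range J) \<le> J ((1/2) *\<^sub>R (x + y))" by (rule cInf_lower[OF _ bdd]) auto
      then show ?thesis using mid[of x y] c(2)[of "x - y"] unfolding dist_norm by linarith
    qed
  qed (use c bdd in auto)
  then obtain u where u: "J u = Inf (range J)" by blast
  have "a u v - p v = 0" for v
  proof (rule linear_coeff_zero[where q = "a v v / 2"])
    fix t
    have "J u \<le> J (u + t *\<^sub>R v)" unfolding u by (rule cInf_lower[OF _ bdd]) auto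
    then show "0 \<le> t * (a u v - p v) + t\<^sup>2 * (a v v / 2)"
      unfolding J_def by (simp add: a.add_left a.add_right a.scaleR_left a.scaleR_right p.add p.scaleR
        sym[of v u] algebra_simps power2_eq_square)
  qed
  then show ?thesis by (intro exI[of _ u]) simp
qed

lemma riesz:
  fixes p :: "'e::{real_inner, complete_space} \<Rightarrow> real"
  assumes "bounded_linear p"
  shows "\<exists>u. \<forall>v. u \<bullet> v = p v"
  using symmetric_lax_milgram[OF bounded_bilinear_inner inner_commute, of 1 p] assms
  by (simp add: power2_norm_eq_inner)

text \<open>The growth comes from the ball, not from \<open>G\<close>: the midpoint of p and q has
  norm at most 1 - |p - q|^2 / 8, so it can be shifted by that depth along \<open>x0\<close> without
  leaving the ball, and this lowers \<open>G\<close> by at least k |p - q|^2 / 4.\<close>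

lemma ball_strong_minimizer:
  fixes G :: "'h::{real_inner, complete_space} \<Rightarrow> real"
  assumes x0: "norm x0 = 1" and k: "0 < k" and cont: "continuous_on (cball 0 1) G"
    and nonneg: "\<And>p. norm p \<le> 1 \<Longrightarrow> 0 \<le> G p"
    and mid: "\<And>p q. norm p \<le> 1 \<Longrightarrow> norm q \<le> 1 \<Longrightarrow> G ((1/2) *\<^sub>R (p + q)) \<le> (G p + G q) / 2"
    and dec: "\<And>p d. norm p \<le> 1 \<Longrightarrow> norm (p + d *\<^sub>R x0) \<le> 1 \<Longrightarrow> 0 \<le> d \<Longrightarrow> G (p + d *\<^sub>R x0) \<le> G p - 2 * d * k"
  shows "\<exists>p. norm p = 1 \<and> (\<forall>q. norm q \<le> 1 \<longrightarrow> G p + k / 2 * (norm (p - q))\<^sup>2 \<le> G q)"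
proof -
  define m where "m = Inf (G ` cball 0 1)"
  have bdd: "bdd_below (G ` cball 0 1)" using nonneg by (auto intro!: bdd_belowI[of _ 0])
  have m_le: "m \<le> G q" if "norm q \<le> 1" for q unfolding m_def using bdd that by (intro cInf_lower) auto
  have key: "k / 4 * (dist p q)\<^sup>2 \<le> (G p + G q) / 2 - m" if p: "norm p \<le> 1" and q: "norm q \<le> 1" for p q
  proof -
    define D where "D = norm (p - q)"
    define z where "z = (1/2) *\<^sub>R (p + q)"
    have "(norm z)\<^sup>2 = ((norm p)\<^sup>2 + (norm q)\<^sup>2) / 2 - D\<^sup>2 / 4"
      unfolding z_def D_def power2_norm_eq_inner by (simp add: inner_simps inner_commute field_simps)
    moreover have "(norm p)\<^sup>2 \<le> 1" "(norm q)\<^sup>2 \<le> 1" using p q by (auto simp: power_le_one)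
    moreover have "a \<le> 1 - d" if "a = (b + c) / 2 - d" "b \<le> 1" "c \<le> 1" for a b c d :: real
      using that by simp
    ultimately have "(norm z)\<^sup>2 \<le> 1 - D\<^sup>2 / 4" by blast
    \<comment> \<open>The summand (D^2 / 8)^2 completes a square, which gives a bound on the norm of
      z rather than on the square of the norm.\<close>
    also have "1 - D\<^sup>2 / 4 \<le> 1 - D\<^sup>2 / 4 + (D\<^sup>2 / 8)\<^sup>2" by simp
    also have "\<dots> = (1 - D\<^sup>2 / 8)\<^sup>2" by (simp add: power2_eq_square field_simps)
    finally have "(norm z)\<^sup>2 \<le> (1 - D\<^sup>2 / 8)\<^sup>2" .
    moreover have "D \<le> 2" using norm_triangle_ineq4[of p q] p q by (simp add: D_def)
    then have "D\<^sup>2 \<le> 2\<^sup>2" by (intro power_mono) (auto simp: D_def)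
    then have "0 \<le> 1 - D\<^sup>2 / 8" by simp
    ultimately have nz: "norm z \<le> 1 - D\<^sup>2 / 8" by (rule power2_le_imp_le)
    have "norm (z + (D\<^sup>2 / 8) *\<^sub>R x0) \<le> norm z + D\<^sup>2 / 8"
      using norm_triangle_ineq[of z "(D\<^sup>2 / 8) *\<^sub>R x0"] x0 by simp
    then have n1: "norm (z + (D\<^sup>2 / 8) *\<^sub>R x0) \<le> 1" using nz by linarith
    have "0 \<le> D\<^sup>2" by simp
    then have "norm z \<le> 1" using nz by linarith
    then have "m \<le> G z - 2 * (D\<^sup>2 / 8) * k" using m_le[OF n1] dec[OF _ n1] by simp
    also have "G z \<le> (G p + G q) / 2" unfolding z_def by (rule mid[OF p q])
    finally have "m \<le> (G p + G q) / 2 - k / 4 * (dist p q)\<^sup>2" by (simp add: D_def dist_norm mult.commute)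
    then show ?thesis by (simp only: le_diff_eq add.commute)
  qed
  have "\<exists>p\<in>cball 0 1. G p = Inf (G ` cball 0 1)"
    by (rule minimizer_attained[where k = "k / 4"]) (use k key cont bdd in \<open>auto simp: m_def\<close>)
  then obtain p where p: "norm p \<le> 1" "G p = m" by (auto simp: m_def)
  have "norm p = 1"
  proof (rule ccontr)
    \<comment> \<open>An interior minimizer could still be moved outward along \<open>x0\<close>, to
      a strictly smaller value.\<close>
    assume "norm p \<noteq> 1"
    then have d: "0 < 1 - norm p" using p by simp
    have n1: "norm (p + (1 - norm p) *\<^sub>R x0) \<le> 1"
      using norm_triangle_ineq[of p "(1 - norm p) *\<^sub>R x0"] x0 d by simp
    then have "m \<le> m - 2 * (1 - norm p) * k" using dec[OF p(1) n1] m_le[OF n1] p d by simp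
    moreover have "0 < 2 * (1 - norm p) * k" using d k by simp
    ultimately show False by simp
  qed
  \<comment> \<open>As \<open>G p\<close> is the minimum, the mean in \<open>key\<close> exceeds it
    by half of \<open>G q - G p\<close>, which doubles the constant k / 4.\<close>
  moreover have "G p + k / 2 * (norm (p - q))\<^sup>2 \<le> G q" if "norm q \<le> 1" for q
    using key[OF p(1) that] p(2) by (simp add: dist_norm)
  ultimately show ?thesis by blast
qed

text \<open>\<open>F\<close> is the functional written with \<open>rho\<close>, meaningful on the
  sphere, and \<open>G\<close> its extension to the ball. The growth term supplies the uniqueness
  that \<open>THE\<close> asks for.\<close>

lemma sphere_minimizer_eqI:
  fixes p :: "'h::real_inner"
  assumes p: "norm p = 1" and k: "0 < k"
    and min: "\<And>q. norm q \<le> 1 \<Longrightarrow> G p + k * (norm (p - q))\<^sup>2 \<le> G q"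
    and eq: "\<And>q. norm q = 1 \<Longrightarrow> F q = G q"
  shows "sphere_minimizer F = p"
  unfolding sphere_minimizer_def
proof (rule the_equality)
  have "G p \<le> G q" if "norm q = 1" for q
    using min[of q] that k by (smt (verit) mult_nonneg_nonneg zero_le_power2)
  then show "p \<in> sphere 0 1 \<and> (\<forall>q\<in>sphere 0 1. F p \<le> F q)" using p by (auto simp: eq)
next
  fix q assume "q \<in> sphere 0 1 \<and> (\<forall>r\<in>sphere 0 1. F q \<le> F r)"
  then have q: "norm q = 1" "G q \<le> G p" using p by (auto simp: eq)
  then have "k * (norm (p - q))\<^sup>2 \<le> 0" using min[of q] by simp
  then have "(norm (p - q))\<^sup>2 \<le> 0" using k by (simp add: mult_le_0_iff)
  then show "q = p" by simp
qed

text \<open>A type of sort \<open>{real_inner, polish_space}\<close> does not have class \<open>banach\<close>, so vector-valued Bochner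
  integrals are replaced by weak ones.\<close>

lemma (in prob_space) weak_integral_exists:
  fixes f :: "'a \<Rightarrow> 'h::{real_inner, polish_space}"
  assumes f[measurable]: "f \<in> borel_measurable M" and B: "AE x in M. norm (f x) \<le> B"
  shows "\<exists>b. \<forall>h. b \<bullet> h = (\<integral>x. f x \<bullet> h \<partial>M)"
proof (rule riesz)
  have bd: "AE x in M. norm (f x \<bullet> h) \<le> B * norm h" for h
    using B
  proof eventually_elim
    case (elim x)
    then show ?case using Cauchy_Schwarz_ineq2[of "f x" h] mult_right_mono[of "norm (f x)" B "norm h"] by simp
  qed
  have int: "integrable M (\<lambda>x. f x \<bullet> h)" for h
    by (rule integrable_const_bound[OF bd]) measurable
  show "bounded_linear (\<lambda>h. \<integral>x. f x \<bullet> h \<partial>M)"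
  proof (rule bounded_linear_intro)
    show "norm (\<integral>x. f x \<bullet> h \<partial>M) \<le> norm h * B" for h
    proof -
      have "norm (\<integral>x. f x \<bullet> h \<partial>M) \<le> (\<integral>x. B * norm h \<partial>M)"
        using int bd by (intro integral_norm_bound[THEN order.trans] integral_mono_AE) auto
      then show ?thesis by (simp add: prob_space mult.commute)
    qed
  qed (auto simp: inner_add_right int)
qed

subsection \<open>Laws with pairwise acute support\<close>

text \<open>\<open>S\<close> stands for the support. A diameter of at most pi / 2 means nonnegative
  cosines, which is \<open>inner_S\<close>; \<open>pos_S\<close> says that no neighbourhood of a
  point of \<open>S\<close> is null, and is what makes mean cosines strictly positive.\<close>

locale acute_law = prob_space N for N :: "'h::{real_inner, polish_space} measure" +
  fixes S :: "'h set"
  assumes sets_N[measurable_cong]: "sets N = sets borel"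
    and AE_S: "AE x in N. x \<in> S"
    and norm_S: "x \<in> S \<Longrightarrow> norm x = 1"
    and inner_S: "x \<in> S \<Longrightarrow> y \<in> S \<Longrightarrow> 0 \<le> x \<bullet> y"
    and pos_S: "x \<in> S \<Longrightarrow> open V \<Longrightarrow> x \<in> V \<Longrightarrow> 0 < measure N V"
begin

lemma S_nonempty: "S \<noteq> {}"
proof
  assume "S = {}"
  then have "AE x in N. False" using AE_S by simp
  then show False using AE_False by blast
qed

lemma abs_inner_S: "x \<in> S \<Longrightarrow> \<bar>x \<bullet> p\<bar> \<le> norm p"
  using Cauchy_Schwarz_ineq2[of x p] norm_S by simp

lemma inner_S_bounds: "x \<in> S \<Longrightarrow> norm p \<le> 1 \<Longrightarrow> -1 \<le> x \<bullet> p \<and> x \<bullet> p \<le> 1"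
  using abs_inner_S[of x p] by auto

lemma integrable_bounded_S:
  fixes f :: "'h \<Rightarrow> real"
  assumes "f \<in> borel_measurable N" "\<And>x. x \<in> S \<Longrightarrow> \<bar>f x\<bar> \<le> B"
  shows "integrable N f"
  using assms AE_S by (intro integrable_const_bound[of _ B]) (auto elim: eventually_mono)

lemma integrable_inner: "integrable N (\<lambda>x. x \<bullet> p)"
  by (rule integrable_bounded_S[of _ "norm p"]) (auto simp: abs_inner_S)

definition G :: "'h \<Rightarrow> real" where "G p = (\<integral>x. sqarc (x \<bullet> p) \<partial>N)"

lemma measurable_sqarc[measurable]: "sqarc \<in> borel_measurable borel"
  using continuous_sqarc by (rule borel_measurable_continuous_onI)

lemma integrable_sqarc: "integrable N (\<lambda>x. sqarc (x \<bullet> p))"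
  by (rule integrable_bounded_S[of _ "pi\<^sup>2"]) (auto simp: sqarc_nonneg sqarc_le)

lemma continuous_G: "continuous_on UNIV G"
  unfolding continuous_on_sequentially
proof (safe)
  fix f :: "nat \<Rightarrow> 'h" and a assume f: "f \<longlonglongrightarrow> a"
  show "(G \<circ> f) \<longlonglongrightarrow> G a"
    unfolding G_def o_def
  proof (rule integral_dominated_convergence[where w = "\<lambda>_. pi\<^sup>2"])
    show "AE x in N. (\<lambda>i. sqarc (x \<bullet> f i)) \<longlonglongrightarrow> sqarc (x \<bullet> a)"
      by (auto intro!: continuous_on_tendsto_compose[OF continuous_sqarc[of UNIV]] tendsto_intros f)
  qed (auto simp: sqarc_nonneg sqarc_le)
qed

text \<open>The points with cosine to y above 1/2 form a neighbourhood of y, which is not null, and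
  the integrand is nonnegative on the rest of \<open>S\<close>.\<close>

lemma inner_mean_pos:
  assumes "y \<in> S" shows "0 < (\<integral>x. x \<bullet> y \<partial>N)"
proof -
  have "open {x. x \<bullet> y > 1/2}" by (intro open_Collect_less continuous_intros)
  moreover have "y \<bullet> y > 1/2" using norm_S[OF assms] by (simp add: norm_eq_1)
  ultimately have "0 < measure N {x. x \<bullet> y > 1/2}" using pos_S[OF assms] by blast
  then have "0 < (\<integral>x. (1/2::real) * indicator {x. x \<bullet> y > 1/2} x \<partial>N)"
    using sets_eq_imp_space_eq[OF sets_N] by simp
  also have "\<dots> \<le> (\<integral>x. x \<bullet> y \<partial>N)"
  proof (rule integral_mono_AE)
    show "integrable N (\<lambda>x. (1/2) * indicator {x. x \<bullet> y > 1/2} x :: real)"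
      by (intro integrable_mult_right integrable_real_indicator) (auto simp: less_top[symmetric])
    show "AE x in N. (1/2) * indicator {x. x \<bullet> y > 1/2} x \<le> x \<bullet> y"
      using AE_S by eventually_elim (use inner_S assms in \<open>auto simp: indicator_def\<close>)
  qed (rule integrable_inner)
  finally show ?thesis .
qed

text \<open>A shift by d along a support point y raises every x . p by d (x . y) >= 0, so the
  pointwise decrease of \<open>sqarc\<close> can be integrated.\<close>

lemma G_decrease:
  assumes y: "y \<in> S" and p: "norm p \<le> 1" "norm (p + d *\<^sub>R y) \<le> 1" and d: "0 \<le> d"
  shows "G (p + d *\<^sub>R y) \<le> G p - 2 * d * (\<integral>x. x \<bullet> y \<partial>N)"
proof -
  have "G (p + d *\<^sub>R y) \<le> (\<integral>x. sqarc (x \<bullet> p) - 2 * d * (x \<bullet> y) \<partial>N)"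
    unfolding G_def
  proof (rule integral_mono_AE)
    show "AE x in N. sqarc (x \<bullet> (p + d *\<^sub>R y)) \<le> sqarc (x \<bullet> p) - 2 * d * (x \<bullet> y)"
      using AE_S
    proof eventually_elim
      case (elim x)
      have "sqarc (x \<bullet> (p + d *\<^sub>R y)) \<le> sqarc (x \<bullet> p) - 2 * (x \<bullet> (p + d *\<^sub>R y) - x \<bullet> p)"
        using inner_S_bounds[OF elim p(1)] inner_S_bounds[OF elim p(2)] inner_S[OF elim y] d
        by (intro sqarc_decrease) (auto simp: inner_add_right)
      then show ?case by (simp add: inner_add_right)
    qed
  qed (auto intro!: integrable_sqarc integrable_inner)
  also have "\<dots> = G p - 2 * d * (\<integral>x. x \<bullet> y \<partial>N)"
    unfolding G_def by (simp add: integrable_sqarc integrable_inner)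
  finally show ?thesis .
qed

lemma ex_mean:
  "\<exists>\<mu>. norm \<mu> = 1 \<and> (\<exists>k>0. \<forall>q. norm q \<le> 1 \<longrightarrow> G \<mu> + k * (norm (\<mu> - q))\<^sup>2 \<le> G q)"
proof -
  obtain y where y: "y \<in> S" using S_nonempty by auto
  define k where "k = (\<integral>x. x \<bullet> y \<partial>N)"
  have k: "0 < k" unfolding k_def by (rule inner_mean_pos[OF y])
  have "\<exists>p. norm p = 1 \<and> (\<forall>q. norm q \<le> 1 \<longrightarrow> G p + k / 2 * (norm (p - q))\<^sup>2 \<le> G q)"
  proof (rule ball_strong_minimizer[where ?x0.0 = y])
    show "continuous_on (cball 0 1) G" using continuous_G continuous_on_subset by blast
    show "0 \<le> G p" for p unfolding G_def by (simp add: sqarc_nonneg)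
    show "G ((1/2) *\<^sub>R (p + q)) \<le> (G p + G q) / 2" if p: "norm p \<le> 1" and q: "norm q \<le> 1" for p q
    proof -
      have "G ((1/2) *\<^sub>R (p + q)) \<le> (\<integral>x. (sqarc (x \<bullet> p) + sqarc (x \<bullet> q)) / 2 \<partial>N)"
        unfolding G_def
      proof (rule integral_mono_AE)
        show "AE x in N. sqarc (x \<bullet> (1/2) *\<^sub>R (p + q)) \<le> (sqarc (x \<bullet> p) + sqarc (x \<bullet> q)) / 2"
          using AE_S
        proof eventually_elim
          case (elim x)
          then show ?case
            using sqarc_midconvex[of "x \<bullet> p" "x \<bullet> q"] inner_S_bounds[OF elim p] inner_S_bounds[OF elim q]
            by (simp add: inner_add_right)
        qed
      qed (auto intro!: integrable_sqarc simp del: inner_scaleR_right)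
      also have "\<dots> = (G p + G q) / 2" unfolding G_def by (simp add: integrable_sqarc)
      finally show ?thesis .
    qed
  qed (use y k G_decrease norm_S in \<open>auto simp: k_def\<close>)
  then show ?thesis using k by (metis half_gt_zero)
qed

text \<open>If y . \<mu> were negative, the shift by d = - (y . \<mu>) along y, which projects \<mu>
  orthogonally onto the complement of y, would stay in the ball and lower \<open>G\<close>
  strictly.\<close>

lemma mean_inner_nonneg:
  assumes mu: "norm \<mu> = 1" and min: "\<And>q. norm q \<le> 1 \<Longrightarrow> G \<mu> \<le> G q" and y: "y \<in> S"
  shows "0 \<le> y \<bullet> \<mu>"
proof (rule ccontr)
  assume "\<not> 0 \<le> y \<bullet> \<mu>"
  define d where "d = - (y \<bullet> \<mu>)"
  have d: "0 < d" using \<open>\<not> 0 \<le> y \<bullet> \<mu>\<close> by (simp add: d_def)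
  have "(norm (\<mu> + d *\<^sub>R y))\<^sup>2 = (norm \<mu>)\<^sup>2 + 2 * d * (y \<bullet> \<mu>) + d\<^sup>2 * (norm y)\<^sup>2"
    unfolding power2_norm_eq_inner by (simp add: inner_simps inner_commute power2_eq_square)
  also have "\<dots> = 1 - d\<^sup>2" using mu norm_S[OF y] by (simp add: d_def power2_eq_square)
  also have "\<dots> \<le> 1\<^sup>2" by simp
  finally have n: "norm (\<mu> + d *\<^sub>R y) \<le> 1" by (rule power2_le_imp_le) simp
  have "G \<mu> \<le> G \<mu> - 2 * d * (\<integral>x. x \<bullet> y \<partial>N)"
    using min[OF n] G_decrease[OF y _ n] mu d by simp
  moreover have "0 < 2 * d * (\<integral>x. x \<bullet> y \<partial>N)" using d inner_mean_pos[OF y] by simp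
  ultimately show False by simp
qed

end

section \<open>The gradient of the functional at the mean\<close>

definition dsq :: "real \<Rightarrow> real" where "dsq t = dsqarc (clamp01 t)"
definition ddsq :: "real \<Rightarrow> real" where "ddsq t = ddsqarc (clamp01 t)"

lemma dsq_eq: "0 \<le> t \<Longrightarrow> t \<le> 1 \<Longrightarrow> dsq t = dsqarc t"
  by (simp add: dsq_def clamp01)

lemma ddsq_eq: "0 \<le> t \<Longrightarrow> t \<le> 1 \<Longrightarrow> ddsq t = ddsqarc t"
  by (simp add: ddsq_def clamp01)

lemma continuous_dsq: "continuous_on UNIV dsq"
  using continuous_clamp01[OF continuous_dsqarc] by (simp add: dsq_def[abs_def])

lemma continuous_ddsq: "continuous_on UNIV ddsq"
  using continuous_clamp01[OF continuous_ddsqarc'] by (simp add: ddsq_def[abs_def])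

lemma dsq_le: "dsq t \<le> -2"
  unfolding dsq_def by (intro dsqarc_le clamp01)

lemma ddsq_nonneg: "0 \<le> ddsq t"
  unfolding ddsq_def using clamp01(1)[of t] by (intro ddsqarc_nonneg clamp01) linarith

lemma ex_bound_dsq: "\<exists>C. 0 < C \<and> (\<forall>s. \<bar>dsq s\<bar> \<le> C) \<and> (\<forall>s. \<bar>ddsq s\<bar> \<le> C)"
proof -
  obtain C where C: "0 \<le> C" "\<And>s. s \<in> {-1/2..1} \<Longrightarrow> \<bar>dsqarc s\<bar> \<le> C" "\<And>s. s \<in> {-1/2..1} \<Longrightarrow> \<bar>ddsqarc s\<bar> \<le> C"
    using ex_bound_dsqarc by blast
  have "clamp01 s \<in> {-1/2..1}" for s using clamp01(1)[of s] clamp01(2)[of s] by auto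
  then have "\<bar>dsq s\<bar> \<le> C + 1" "\<bar>ddsq s\<bar> \<le> C + 1" for s
    using C(2)[of "clamp01 s"] C(3)[of "clamp01 s"] by (simp_all add: dsq_def ddsq_def)
  then show ?thesis using C(1) by (intro exI[of _ "C + 1"]) auto
qed

lemma measurable_dsq[measurable]: "dsq \<in> borel_measurable borel"
  using continuous_dsq by (rule borel_measurable_continuous_onI)

lemma measurable_ddsq[measurable]: "ddsq \<in> borel_measurable borel"
  using continuous_ddsq by (rule borel_measurable_continuous_onI)

context acute_law
begin

text \<open>Minimality over the ball gives b . v >= 0 for every v that points into it. The direction
  from \<mu> to - b / |b| then forces b . \<mu> <= - |b|, the equality case of Cauchy-Schwarz. That
  b is nonzero follows from \<open>dsq_le\<close> and the positive mean cosine with a support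
  point.\<close>

lemma mean_gradient:
  assumes mu: "norm \<mu> = 1" and min: "\<And>q. norm q \<le> 1 \<Longrightarrow> G \<mu> \<le> G q"
    and b: "\<And>h. b \<bullet> h = (\<integral>x. (dsq (x \<bullet> \<mu>) *\<^sub>R x) \<bullet> h \<partial>N)"
  shows "b = - norm b *\<^sub>R \<mu>" "0 < norm b"
proof -
  have mu1: "norm \<mu> \<le> 1" using mu by simp
  obtain C where C: "0 < C" "\<And>s. \<bar>dsq s\<bar> \<le> C" using ex_bound_dsq by blast
  have int: "integrable N (\<lambda>x. dsq (x \<bullet> \<mu>) * (x \<bullet> h))" for h
    by (rule integrable_bounded_S[of _ "C * norm h"])
      (auto simp: abs_mult intro!: mult_mono C abs_inner_S less_imp_le[OF C(1)])
  obtain y where y: "y \<in> S" using S_nonempty by auto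
  have "b \<bullet> y \<le> (\<integral>x. -2 * (x \<bullet> y) \<partial>N)"
    unfolding b inner_scaleR_left
  proof (rule integral_mono_AE[OF int])
    show "AE x in N. dsq (x \<bullet> \<mu>) * (x \<bullet> y) \<le> -2 * (x \<bullet> y)"
      using AE_S by eventually_elim (intro mult_right_mono dsq_le inner_S y)
  qed (auto intro!: integrable_inner)
  also have "\<dots> < 0" using inner_mean_pos[OF y] by simp
  finally have "b \<noteq> 0" by auto
  then show nb: "0 < norm b" by simp
  have dir: "0 \<le> b \<bullet> v" if v: "norm (\<mu> + v) \<le> 1" for v
  proof (rule ccontr)
    assume "\<not> 0 \<le> b \<bullet> v"
    then have neg: "b \<bullet> v < 0" by simp
    then have v0: "0 < norm v" by auto
    \<comment> \<open>With this e the error term e |v| is half of - (b . v), so the linear term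
      wins.\<close>
    define e where "e = - (b \<bullet> v) / (2 * norm v)"
    have e: "0 < e" unfolding e_def using neg v0 by (intro divide_pos_pos) auto
    obtain d where d: "0 < d" and exp: "\<And>s t. s \<in> {-1/2..1} \<Longrightarrow> t \<in> {-1/2..1} \<Longrightarrow> \<bar>t - s\<bar> < d \<Longrightarrow>
        \<bar>sqarc t - sqarc s - dsqarc s * (t - s)\<bar> \<le> e * \<bar>t - s\<bar>"
      using sqarc_expansion[OF e] by blast
    \<comment> \<open>The step is at most 1, to stay in the ball by convexity, and so short that |s
      v| is below both d and 1/2; the latter keeps the perturbed cosines above -1/2.\<close>
    define s where "s = min 1 (min d (1/2) / (2 * norm v))"
    have s: "0 < s" "s \<le> 1" using d v0 by (auto simp: s_def)
    have "s * norm v \<le> min d (1/2) / (2 * norm v) * norm v" unfolding s_def by (intro mult_right_mono) auto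
    also have "\<dots> = min d (1/2) / 2" using v0 by simp
    finally have sv: "s * norm v < d" "s * norm v < 1/2" using d by auto
    have "\<mu> + s *\<^sub>R v = (1 - s) *\<^sub>R \<mu> + s *\<^sub>R (\<mu> + v)" by (simp add: algebra_simps)
    also have "norm \<dots> \<le> (1 - s) * norm \<mu> + s * norm (\<mu> + v)"
      using s norm_triangle_ineq[of "(1 - s) *\<^sub>R \<mu>" "s *\<^sub>R (\<mu> + v)"] by simp
    also have "\<dots> \<le> (1 - s) * 1 + s * 1" using s mu v by (intro add_mono mult_left_mono) auto
    finally have n: "norm (\<mu> + s *\<^sub>R v) \<le> 1" by simp
    have "G (\<mu> + s *\<^sub>R v) \<le> (\<integral>x. sqarc (x \<bullet> \<mu>) + s * (dsq (x \<bullet> \<mu>) * (x \<bullet> v)) + e * (s * norm v) \<partial>N)"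
      unfolding G_def
    proof (rule integral_mono_AE)
      show "AE x in N. sqarc (x \<bullet> (\<mu> + s *\<^sub>R v)) \<le> sqarc (x \<bullet> \<mu>) + s * (dsq (x \<bullet> \<mu>) * (x \<bullet> v)) + e * (s * norm v)"
        using AE_S
      proof eventually_elim
        case (elim x)
        have diff: "x \<bullet> (\<mu> + s *\<^sub>R v) - x \<bullet> \<mu> = s * (x \<bullet> v)" by (simp add: inner_add_right)
        have sm: "\<bar>s * (x \<bullet> v)\<bar> \<le> s * norm v"
          using s abs_inner_S[OF elim, of v] by (simp add: abs_mult)
        have x0: "0 \<le> x \<bullet> \<mu>" "x \<bullet> \<mu> \<le> 1"
          using mean_inner_nonneg[OF mu min elim] inner_S_bounds[OF elim mu1] by auto
        have t: "x \<bullet> (\<mu> + s *\<^sub>R v) \<in> {-1/2..1}"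
          using x0 diff sm sv inner_S_bounds[OF elim n] by (auto simp: abs_le_iff)
        have "\<bar>sqarc (x \<bullet> (\<mu> + s *\<^sub>R v)) - sqarc (x \<bullet> \<mu>) - dsqarc (x \<bullet> \<mu>) * (s * (x \<bullet> v))\<bar> \<le> e * \<bar>s * (x \<bullet> v)\<bar>"
          using exp[OF _ t, of "x \<bullet> \<mu>"] x0 diff sm sv by simp
        also have "\<dots> \<le> e * (s * norm v)" using sm e by (intro mult_left_mono) auto
        finally show ?case using x0 by (simp add: dsq_eq abs_le_iff algebra_simps)
      qed
    qed (intro Bochner_Integration.integrable_add integrable_mult_right integrable_sqarc int integrable_const)+
    also have "\<dots> = G \<mu> + s * (b \<bullet> v) + e * (s * norm v)"
      unfolding G_def b by (simp add: integrable_sqarc int prob_space)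
    finally have "0 \<le> s * (b \<bullet> v) + e * (s * norm v)" using min[OF n] by simp
    also have "\<dots> = s * (b \<bullet> v) / 2" using v0 by (simp add: e_def field_simps)
    also have "\<dots> < 0" using s neg by (simp add: mult_pos_neg)
    finally show False by simp
  qed
  have "0 \<le> b \<bullet> (- (1 / norm b) *\<^sub>R b - \<mu>)" using nb by (intro dir) simp
  then have bm: "b \<bullet> \<mu> \<le> - norm b"
    using nb by (simp add: inner_diff_right dot_square_norm power2_eq_square)
  have "(norm (b + norm b *\<^sub>R \<mu>))\<^sup>2 = (norm b)\<^sup>2 + 2 * norm b * (b \<bullet> \<mu>) + (norm b)\<^sup>2 * (norm \<mu>)\<^sup>2"
    unfolding power2_norm_eq_inner[of "b + norm b *\<^sub>R \<mu>"] power2_norm_eq_inner[of \<mu>]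
    by (simp add: inner_simps inner_commute power2_eq_square) (simp add: norm_eq_sqrt_inner)
  also have "\<dots> = 2 * norm b * (norm b + b \<bullet> \<mu>)" using mu by (simp add: power2_eq_square algebra_simps)
  also have "\<dots> \<le> 0" using nb bm by (simp add: mult_le_0_iff)
  finally have "b + norm b *\<^sub>R \<mu> = 0" by simp
  then show "b = - norm b *\<^sub>R \<mu>" by (simp add: eq_neg_iff_add_eq_0)
qed

end

subsection \<open>Independent sequences and the law of large numbers\<close>

text \<open>Sums of measurable functions with values in a nonseparable space need not be measurable.
  Such a sum is obtained instead as a continuous function on a countable power of the separable
  space, composed with a measurable sequence.\<close>

lemma measurable_tuple:
  fixes \<Phi> :: "(nat \<Rightarrow> 'h::{second_countable_topology}) \<Rightarrow> 'c::topological_space"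
  assumes \<Phi>: "continuous_on UNIV \<Phi>" and Y: "\<And>i. Y i \<in> borel_measurable M"
  shows "(\<lambda>\<omega>. \<Phi> (\<lambda>i. Y i \<omega>)) \<in> borel_measurable M"
proof -
  have "(\<lambda>\<omega> i. Y i \<omega>) \<in> borel_measurable M"
    by (rule measurable_coordinatewise_then_product) (rule Y)
  from measurable_compose[OF this borel_measurable_continuous_onI[OF \<Phi>]] show ?thesis .
qed

lemma (in prob_space) indep_vars_pair:
  assumes "indep_vars (\<lambda>_. N) Y UNIV" "i \<noteq> j"
  shows "indep_var N (Y i) N (Y j)"
proof -
  have "indep_vars (\<lambda>_. N) Y {i, j}" using assms(1) indep_vars_subset by blast
  moreover have "{i, j} = {i} \<union> {j}" by auto
  ultimately have "indep_vars (\<lambda>_. N) Y ({i} \<union> {j})" by simp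
  then have "indep_var (PiM {i} (\<lambda>_. N)) (\<lambda>\<omega>. restrict (\<lambda>k. Y k \<omega>) {i}) (PiM {j} (\<lambda>_. N)) (\<lambda>\<omega>. restrict (\<lambda>k. Y k \<omega>) {j})"
    using assms(2) by (intro indep_var_restrict[of _ _ "{i} \<union> {j}"]) auto
  from indep_var_compose[OF this measurable_component_singleton[of i] measurable_component_singleton[of j]]
  show ?thesis by (simp add: o_def)
qed

lemma (in prob_space) integrable_bounded:
  fixes f :: "'a \<Rightarrow> real"
  assumes "f \<in> borel_measurable M" "\<And>\<omega>. \<omega> \<in> space M \<Longrightarrow> \<bar>f \<omega>\<bar> \<le> B"
  shows "integrable M f"
  using assms by (intro integrable_const_bound[of _ B]) auto

lemma abs_inner_le:
  fixes x y :: "'h::real_inner"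
  assumes "norm x \<le> B" shows "\<bar>x \<bullet> y\<bar> \<le> B * norm y"
  using Cauchy_Schwarz_ineq2[of x y] mult_right_mono[OF assms norm_ge_zero[of y]] by linarith

text \<open>Fubini on the product law: for each fixed value x of \<open>A\<close> the integral of x
  . B vanishes.\<close>

lemma (in prob_space) indep_inner_centered:
  fixes A B :: "'a \<Rightarrow> 'b::{real_inner, second_countable_topology}"
  assumes ind: "indep_var borel A borel B"
    and bd: "\<And>\<omega>. \<omega> \<in> space M \<Longrightarrow> norm (A \<omega>) \<le> K" "\<And>\<omega>. \<omega> \<in> space M \<Longrightarrow> norm (B \<omega>) \<le> K"
    and cent: "\<And>h. (\<integral>\<omega>. B \<omega> \<bullet> h \<partial>M) = 0"
  shows "(\<integral>\<omega>. A \<omega> \<bullet> B \<omega> \<partial>M) = 0"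
proof -
  have [measurable]: "A \<in> borel_measurable M" "B \<in> borel_measurable M"
    using ind indep_var_rv1 indep_var_rv2 by blast+
  have K: "0 \<le> K" using bd(1) not_empty norm_ge_zero order.trans by (metis all_not_in_conv)
  interpret A: prob_space "distr M borel A" by (rule prob_space_distr) measurable
  interpret B: prob_space "distr M borel B" by (rule prob_space_distr) measurable
  interpret P: pair_sigma_finite "distr M borel A" "distr M borel B" ..
  have eq: "distr M borel A \<Otimes>\<^sub>M distr M borel B = distr M (borel \<Otimes>\<^sub>M borel) (\<lambda>\<omega>. (A \<omega>, B \<omega>))"
    using ind by (simp add: indep_var_distribution_eq)
  have int: "integrable M (\<lambda>\<omega>. A \<omega> \<bullet> B \<omega>)"
  proof (rule integrable_bounded)
    show "\<bar>A \<omega> \<bullet> B \<omega>\<bar> \<le> K * K" if "\<omega> \<in> space M" for \<omega>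
      using abs_inner_le[OF bd(1)[OF that], of "B \<omega>"] mult_left_mono[OF bd(2)[OF that] K] by linarith
  qed measurable
  have int2: "integrable (distr M borel A \<Otimes>\<^sub>M distr M borel B) (\<lambda>p. fst p \<bullet> snd p)"
    unfolding eq using int by (subst integrable_distr_eq) auto
  have "(\<integral>\<omega>. A \<omega> \<bullet> B \<omega> \<partial>M) = (\<integral>p. fst p \<bullet> snd p \<partial>(distr M borel A \<Otimes>\<^sub>M distr M borel B))"
    unfolding eq by (subst integral_distr) auto
  also have "\<dots> = (\<integral>x. (\<integral>y. x \<bullet> y \<partial>distr M borel B) \<partial>distr M borel A)"
    using P.integral_fst'[OF int2] by simp
  also have "\<dots> = (\<integral>x. 0 \<partial>distr M borel A)"
  proof (intro Bochner_Integration.integral_cong refl)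
    fix x show "(\<integral>y. x \<bullet> y \<partial>distr M borel B) = 0"
      using cent[of x] by (subst integral_distr) (auto simp: inner_commute)
  qed
  finally show ?thesis by simp
qed

lemma (in prob_space) second_moment_sum:
  fixes Y :: "nat \<Rightarrow> 'a \<Rightarrow> 'b::{real_inner, second_countable_topology}"
  assumes ind: "indep_vars (\<lambda>_. borel) Y UNIV"
    and bd: "\<And>i \<omega>. \<omega> \<in> space M \<Longrightarrow> norm (Y i \<omega>) \<le> K"
    and cent: "\<And>i h. (\<integral>\<omega>. Y i \<omega> \<bullet> h \<partial>M) = 0"
  shows "(\<integral>\<omega>. (norm (\<Sum>i<n. Y i \<omega>))\<^sup>2 \<partial>M) = (\<Sum>i<n. \<integral>\<omega>. (norm (Y i \<omega>))\<^sup>2 \<partial>M)"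
    and "integrable M (\<lambda>\<omega>. (norm (\<Sum>i<n. Y i \<omega>))\<^sup>2)"
proof -
  have [measurable]: "\<And>i. Y i \<in> borel_measurable M"
    using ind unfolding indep_vars_def by auto
  have K: "0 \<le> K" using bd not_empty norm_ge_zero order.trans by (metis all_not_in_conv)
  have int: "integrable M (\<lambda>\<omega>. Y i \<omega> \<bullet> Y j \<omega>)" for i j
  proof (rule integrable_bounded)
    show "\<bar>Y i \<omega> \<bullet> Y j \<omega>\<bar> \<le> K * K" if "\<omega> \<in> space M" for \<omega>
      using abs_inner_le[OF bd[OF that], of i "Y j \<omega>"] mult_left_mono[OF bd[OF that, of j] K] by linarith
  qed measurable
  have exp: "(norm (\<Sum>i<n. Y i \<omega>))\<^sup>2 = (\<Sum>i<n. \<Sum>j<n. Y i \<omega> \<bullet> Y j \<omega>)" for \<omega>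
    unfolding power2_norm_eq_inner by (simp add: inner_sum_left inner_sum_right) (rule sum.swap)
  show "integrable M (\<lambda>\<omega>. (norm (\<Sum>i<n. Y i \<omega>))\<^sup>2)" unfolding exp by (intro Bochner_Integration.integrable_sum int)
  have off: "(\<integral>\<omega>. Y i \<omega> \<bullet> Y j \<omega> \<partial>M) = 0" if "i \<noteq> j" for i j
    by (rule indep_inner_centered[OF indep_vars_pair[OF ind that]]) (use bd cent in auto)
  have "(\<integral>\<omega>. (norm (\<Sum>i<n. Y i \<omega>))\<^sup>2 \<partial>M) = (\<Sum>i<n. \<Sum>j<n. \<integral>\<omega>. Y i \<omega> \<bullet> Y j \<omega> \<partial>M)"
    unfolding exp by (simp add: int Bochner_Integration.integral_sum)
  also have "\<dots> = (\<Sum>i<n. \<Sum>j<n. if i = j then \<integral>\<omega>. (norm (Y i \<omega>))\<^sup>2 \<partial>M else 0)"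
    by (intro sum.cong refl) (auto simp: off power2_norm_eq_inner)
  also have "\<dots> = (\<Sum>i<n. \<integral>\<omega>. (norm (Y i \<omega>))\<^sup>2 \<partial>M)" by simp
  finally show "(\<integral>\<omega>. (norm (\<Sum>i<n. Y i \<omega>))\<^sup>2 \<partial>M) = (\<Sum>i<n. \<integral>\<omega>. (norm (Y i \<omega>))\<^sup>2 \<partial>M)" .
qed

section \<open>Expectations and averages in nonseparable spaces\<close>

lemma ex_simple_identity:
  "\<exists>F :: nat \<Rightarrow> 'h::{real_normed_vector, second_countable_topology} \<Rightarrow> 'h.
    (\<forall>i. simple_function borel (F i)) \<and> (\<forall>x. (\<lambda>i. F i x) \<longlonglongrightarrow> x) \<and> (\<forall>i x. norm (F i x) \<le> 2 * norm x)"
  using borel_measurable_implies_sequence_metric[of "\<lambda>x::'h. x" borel 0] by simp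

text \<open>Pairing with bounded functionals reduces operator expectations to scalar integrals; both
  their uniqueness and their values are obtained in this way.\<close>

lemma has_expectation_bounded_linear:
  fixes f :: "'a \<Rightarrow> 'b::real_normed_vector"
  assumes f: "has_expectation M f v" and l: "bounded_linear l"
  shows "has_bochner_integral M (\<lambda>\<omega>. l (f \<omega>)) (l v :: real)"
proof -
  interpret l: bounded_linear l by fact
  obtain s where fm[measurable]: "f \<in> borel_measurable M"
    and s: "\<And>i. Bochner_Integration.simple_bochner_integrable M (s i)"
      "(\<lambda>i. \<integral>\<^sup>+\<omega>. norm (f \<omega> - s i \<omega>) \<partial>M) \<longlonglongrightarrow> 0"
      "(\<lambda>i. Bochner_Integration.simple_bochner_integral M (s i)) \<longlonglongrightarrow> v"
    using f unfolding has_expectation_def by auto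
  have lm[measurable]: "l \<in> borel_measurable borel"
    by (intro borel_measurable_continuous_onI l.continuous_on continuous_on_id)
  obtain K where K: "K > 0" "\<And>x. norm (l x) \<le> norm x * K" using l.pos_bounded by auto
  have si: "Bochner_Integration.simple_bochner_integrable M (\<lambda>\<omega>. l (s i \<omega>))" for i
    using simple_bochner_integrable_compose2[where p = "\<lambda>x y. l x", OF _ s(1) s(1)] l.zero by simp
  show ?thesis
  proof (rule has_bochner_integral.intros[where s = "\<lambda>i \<omega>. l (s i \<omega>)"])
    show "(\<lambda>\<omega>. l (f \<omega>)) \<in> borel_measurable M" by measurable
    show "(\<lambda>i. \<integral>\<^sup>+\<omega>. norm (l (f \<omega>) - l (s i \<omega>)) \<partial>M) \<longlonglongrightarrow> 0"
    proof (rule tendsto_sandwich[of "\<lambda>_. 0"])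
      have le: "(\<integral>\<^sup>+\<omega>. norm (l (f \<omega>) - l (s i \<omega>)) \<partial>M) \<le> ennreal K * (\<integral>\<^sup>+\<omega>. norm (f \<omega> - s i \<omega>) \<partial>M)" for i
      proof -
        \<comment> \<open>The difference of two measurable functions need not be measurable here, so
          the norm is split over the finitely many values of \<open>s i\<close>; on each piece only
          f minus a constant remains.\<close>
        have "(\<lambda>\<omega>. ennreal (norm (f \<omega> - s i \<omega>))) \<in> borel_measurable M"
        proof -
          have sm: "simple_function M (s i)" using s(1)[of i] by (auto elim: simple_bochner_integrable.cases)
          have "(\<lambda>\<omega>. \<Sum>y\<in>s i ` space M. ennreal (norm (f \<omega> - y)) * indicator (s i -` {y} \<inter> space M) \<omega>) \<in> borel_measurable M"
          proof (intro borel_measurable_sum borel_measurable_times_ennreal)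
            fix y :: 'b
            have "continuous_on UNIV (\<lambda>x. norm (x - y))" by (intro continuous_intros)
            then have "(\<lambda>\<omega>. norm (f \<omega> - y)) \<in> borel_measurable M"
              by (rule measurable_compose[OF fm borel_measurable_continuous_onI])
            then show "(\<lambda>\<omega>. ennreal (norm (f \<omega> - y))) \<in> borel_measurable M" by measurable
            assume "y \<in> s i ` space M"
            then show "(\<lambda>\<omega>. indicator (s i -` {y} \<inter> space M) \<omega> :: ennreal) \<in> borel_measurable M"
              using sm by (auto simp: simple_function_def)
          qed
          moreover have "(\<Sum>y\<in>s i ` space M. ennreal (norm (f \<omega> - y)) * indicator (s i -` {y} \<inter> space M) \<omega>) = ennreal (norm (f \<omega> - s i \<omega>))"
            if "\<omega> \<in> space M" for \<omega>
          proof -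
            have "finite (s i ` space M)" using sm by (simp add: simple_function_def)
            then have "(\<Sum>y\<in>s i ` space M. ennreal (norm (f \<omega> - y)) * indicator (s i -` {y} \<inter> space M) \<omega>)
              = (\<Sum>y\<in>{s i \<omega>}. ennreal (norm (f \<omega> - y)) * indicator (s i -` {y} \<inter> space M) \<omega>)"
              using that by (intro sum.mono_neutral_right) (auto simp: indicator_def)
            then show ?thesis using that by simp
          qed
          ultimately show ?thesis by (subst measurable_cong) auto
        qed
        then have "(\<integral>\<^sup>+\<omega>. ennreal K * ennreal (norm (f \<omega> - s i \<omega>)) \<partial>M) = ennreal K * (\<integral>\<^sup>+\<omega>. norm (f \<omega> - s i \<omega>) \<partial>M)"
          by (rule nn_integral_cmult)
        moreover have "ennreal (norm (l (f \<omega>) - l (s i \<omega>))) \<le> ennreal K * ennreal (norm (f \<omega> - s i \<omega>))" for \<omega>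
          using K(2)[of "f \<omega> - s i \<omega>"] K(1)
          by (simp add: l.diff[symmetric] ennreal_mult[symmetric] mult.commute)
        then have "(\<integral>\<^sup>+\<omega>. norm (l (f \<omega>) - l (s i \<omega>)) \<partial>M) \<le> (\<integral>\<^sup>+\<omega>. ennreal K * ennreal (norm (f \<omega> - s i \<omega>)) \<partial>M)"
          by (intro nn_integral_mono) auto
        ultimately show ?thesis by simp
      qed
      show "\<forall>\<^sub>F i in sequentially. (\<integral>\<^sup>+\<omega>. norm (l (f \<omega>) - l (s i \<omega>)) \<partial>M) \<le> ennreal K * (\<integral>\<^sup>+\<omega>. norm (f \<omega> - s i \<omega>) \<partial>M)"
        using le by simp
      show "(\<lambda>i. ennreal K * (\<integral>\<^sup>+\<omega>. norm (f \<omega> - s i \<omega>) \<partial>M)) \<longlonglongrightarrow> 0"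
        using ennreal_tendsto_cmult[OF _ s(2), of "ennreal K"] by simp
    qed auto
    have "Bochner_Integration.simple_bochner_integral M (\<lambda>\<omega>. l (s i \<omega>)) = l (Bochner_Integration.simple_bochner_integral M (s i))" for i
      by (rule simple_bochner_integral_linear[OF l.linear_axioms s(1)])
    then show "(\<lambda>i. Bochner_Integration.simple_bochner_integral M (\<lambda>\<omega>. l (s i \<omega>))) \<longlonglongrightarrow> l v"
      using l.tendsto[OF s(3)] by simp
  qed (rule si)
qed

text \<open>Approximating the identity of the separable space by simple functions and applying
  \<open>g\<close> afterwards yields simple approximations with nonseparable values. The
  approximants stay within radius 2, where \<open>g\<close> is bounded, so dominated convergence
  applies.\<close>

lemma (in prob_space) L1_simple_approximation:
  fixes X :: "'a \<Rightarrow> 'h::{real_normed_vector, second_countable_topology}"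
    and g :: "'h \<Rightarrow> 'b::real_normed_vector"
  assumes X[measurable]: "X \<in> borel_measurable M" and X1: "\<And>\<omega>. \<omega> \<in> space M \<Longrightarrow> norm (X \<omega>) \<le> 1"
    and g: "continuous_on UNIV g" and C: "\<And>x. norm x \<le> 2 \<Longrightarrow> norm (g x) \<le> C"
    and F: "\<And>i. simple_function borel (F i)" "\<And>x. (\<lambda>i. F i x) \<longlonglongrightarrow> x" "\<And>i x. norm (F i x) \<le> 2 * norm x"
  shows "(\<lambda>i. \<integral>\<omega>. norm (g (X \<omega>) - g (F i (X \<omega>))) \<partial>M) \<longlonglongrightarrow> 0"
    and "integrable M (\<lambda>\<omega>. norm (g (X \<omega>) - g (F i (X \<omega>))))"
proof -
  have [measurable]: "F i \<in> borel_measurable borel" for i using F(1) by (rule borel_measurable_simple_function)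
  have m[measurable]: "(\<lambda>\<omega>. norm (g (X \<omega>) - g (F i (X \<omega>)))) \<in> borel_measurable M" for i
  proof -
    have "continuous_on UNIV (\<lambda>p. norm (g (fst p) - g (snd p)))"
      by (intro continuous_intros continuous_on_compose2[OF g]) auto
    from borel_measurable_continuous_Pair[OF _ _ this, of X M "\<lambda>\<omega>. F i (X \<omega>)"] show ?thesis by simp
  qed
  have bd: "norm (g (X \<omega>) - g (F i (X \<omega>))) \<le> 2 * C" if "\<omega> \<in> space M" for \<omega> i
  proof -
    have "norm (X \<omega>) \<le> 2" "norm (F i (X \<omega>)) \<le> 2" using X1[OF that] F(3)[of i "X \<omega>"] by auto
    then show ?thesis using C[of "X \<omega>"] C[of "F i (X \<omega>)"] norm_triangle_ineq4[of "g (X \<omega>)" "g (F i (X \<omega>))"] by simp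
  qed
  show "integrable M (\<lambda>\<omega>. norm (g (X \<omega>) - g (F i (X \<omega>))))"
    by (rule integrable_bounded[of _ "2 * C"]) (use bd in auto)
  have "(\<lambda>i. \<integral>\<omega>. norm (g (X \<omega>) - g (F i (X \<omega>))) \<partial>M) \<longlonglongrightarrow> (\<integral>\<omega>. 0 \<partial>M)"
  proof (rule integral_dominated_convergence[where w = "\<lambda>_. 2 * C"])
    show "AE \<omega> in M. (\<lambda>i. norm (g (X \<omega>) - g (F i (X \<omega>)))) \<longlonglongrightarrow> 0"
    proof (rule AE_I2)
      fix \<omega>
      have "(\<lambda>i. g (F i (X \<omega>))) \<longlonglongrightarrow> g (X \<omega>)"
        by (rule continuous_on_tendsto_compose[OF g F(2)]) auto
      then show "(\<lambda>i. norm (g (X \<omega>) - g (F i (X \<omega>)))) \<longlonglongrightarrow> 0"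
        by (intro tendsto_norm_zero) (auto intro!: tendsto_eq_intros)
    qed
  qed (use bd in auto)
  then show "(\<lambda>i. \<integral>\<omega>. norm (g (X \<omega>) - g (F i (X \<omega>))) \<partial>M) \<longlonglongrightarrow> 0" by simp
qed

text \<open>Integrates |z| <= a / 2 + z^2 / (2 a), which takes the place of the Cauchy-Schwarz
  inequality.\<close>

lemma (in prob_space) expectation_abs_le_sqrt:
  fixes z :: "'a \<Rightarrow> real"
  assumes z: "integrable M z" "integrable M (\<lambda>\<omega>. (z \<omega>)\<^sup>2)" and a: "0 < a" "(\<integral>\<omega>. (z \<omega>)\<^sup>2 \<partial>M) \<le> a\<^sup>2"
  shows "(\<integral>\<omega>. \<bar>z \<omega>\<bar> \<partial>M) \<le> a"
proof -
  have "(\<integral>\<omega>. \<bar>z \<omega>\<bar> \<partial>M) \<le> (\<integral>\<omega>. a / 2 + (z \<omega>)\<^sup>2 / (2 * a) \<partial>M)"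
  proof (rule integral_mono)
    show "\<bar>z \<omega>\<bar> \<le> a / 2 + (z \<omega>)\<^sup>2 / (2 * a)" for \<omega>
    proof -
      have "0 \<le> (\<bar>z \<omega>\<bar> - a)\<^sup>2 / (2 * a)" using a by simp
      also have "\<dots> = a / 2 + (z \<omega>)\<^sup>2 / (2 * a) - \<bar>z \<omega>\<bar>"
        using a by (simp add: power2_eq_square field_simps abs_mult_self_eq)
      finally show ?thesis by simp
    qed
  qed (use z in auto)
  also have "\<dots> = a / 2 + (\<integral>\<omega>. (z \<omega>)\<^sup>2 \<partial>M) / (2 * a)" using z by (simp add: prob_space)
  also have "\<dots> \<le> a / 2 + a\<^sup>2 / (2 * a)" using a by (intro add_left_mono divide_right_mono) auto
  also have "\<dots> = a" using a by (simp add: power2_eq_square)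
  finally show ?thesis .
qed

text \<open>Comparison through \<open>f\<close>, which enters only by its scalar distances to
  \<open>s\<close> and \<open>t\<close>; this makes the integrals of the simple approximants a
  Cauchy sequence.\<close>

lemma (in prob_space) simple_bochner_distance:
  fixes s t :: "'a \<Rightarrow> 'b::real_normed_vector"
  assumes s: "Bochner_Integration.simple_bochner_integrable M s" and t: "Bochner_Integration.simple_bochner_integrable M t"
    and f: "integrable M (\<lambda>\<omega>. norm (f \<omega> - s \<omega>))" "integrable M (\<lambda>\<omega>. norm (f \<omega> - t \<omega>))"
  shows "norm (Bochner_Integration.simple_bochner_integral M s - Bochner_Integration.simple_bochner_integral M t)
    \<le> (\<integral>\<omega>. norm (f \<omega> - s \<omega>) \<partial>M) + (\<integral>\<omega>. norm (f \<omega> - t \<omega>) \<partial>M)"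
proof -
  have st: "Bochner_Integration.simple_bochner_integrable M (\<lambda>\<omega>. s \<omega> - t \<omega>)"
    "Bochner_Integration.simple_bochner_integrable M (\<lambda>\<omega>. norm (s \<omega> - t \<omega>))"
    using simple_bochner_integrable_compose2[where p = "\<lambda>x y. x - y", OF _ s t]
      simple_bochner_integrable_compose2[where p = "\<lambda>x y. norm (x - y)", OF _ s t] by auto
  note hb = has_bochner_integral_simple_bochner_integrable[OF st(2)]
  have "norm (Bochner_Integration.simple_bochner_integral M s - Bochner_Integration.simple_bochner_integral M t)
    \<le> Bochner_Integration.simple_bochner_integral M (\<lambda>\<omega>. norm (s \<omega> - t \<omega>))"
    unfolding simple_bochner_integral_diff[OF s t, symmetric] by (rule simple_bochner_integral_norm_bound[OF st(1)])
  also have "\<dots> = (\<integral>\<omega>. norm (s \<omega> - t \<omega>) \<partial>M)"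
    using has_bochner_integral_integral_eq[OF hb] by simp
  also have "\<dots> \<le> (\<integral>\<omega>. norm (f \<omega> - s \<omega>) + norm (f \<omega> - t \<omega>) \<partial>M)"
  proof (rule integral_mono)
    show "integrable M (\<lambda>\<omega>. norm (s \<omega> - t \<omega>))" using hb by (rule integrable.intros)
    show "norm (s \<omega> - t \<omega>) \<le> norm (f \<omega> - s \<omega>) + norm (f \<omega> - t \<omega>)" for \<omega>
      using norm_triangle_ineq4[of "f \<omega> - t \<omega>" "f \<omega> - s \<omega>"] by simp
  qed (use f in auto)
  also have "\<dots> = (\<integral>\<omega>. norm (f \<omega> - s \<omega>) \<partial>M) + (\<integral>\<omega>. norm (f \<omega> - t \<omega>) \<partial>M)" using f by simp
  finally show ?thesis .
qed

lemma (in prob_space) ex_expectation_limit: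
  fixes X :: "'a \<Rightarrow> 'h::{real_normed_vector, second_countable_topology}"
    and g :: "'h \<Rightarrow> 'b::banach"
  assumes X[measurable]: "X \<in> borel_measurable M" and X1: "\<And>\<omega>. \<omega> \<in> space M \<Longrightarrow> norm (X \<omega>) \<le> 1"
    and g: "continuous_on UNIV g" and C: "\<And>x. norm x \<le> 2 \<Longrightarrow> norm (g x) \<le> C"
    and F: "\<And>i. simple_function borel (F i)" "\<And>x. (\<lambda>i. F i x) \<longlonglongrightarrow> x" "\<And>i x. norm (F i x) \<le> 2 * norm x"
  obtains v where "\<And>i. Bochner_Integration.simple_bochner_integrable M (\<lambda>\<omega>. g (F i (X \<omega>)))"
    "(\<lambda>i. Bochner_Integration.simple_bochner_integral M (\<lambda>\<omega>. g (F i (X \<omega>)))) \<longlonglongrightarrow> v"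
proof -
  note L1 = L1_simple_approximation[OF X X1 g C F]
  define V where "V i = Bochner_Integration.simple_bochner_integral M (\<lambda>\<omega>. g (F i (X \<omega>)))" for i
  have sb: "Bochner_Integration.simple_bochner_integrable M (\<lambda>\<omega>. g (F i (X \<omega>)))" for i
  proof (rule simple_bochner_integrable.intros)
    have "simple_function M (\<lambda>\<omega>. F i (X \<omega>))"
      using simple_function_comp[OF X F(1)[of i]] by (simp add: o_def)
    then show "simple_function M (\<lambda>\<omega>. g (F i (X \<omega>)))" by (rule simple_function_compose1)
    show "emeasure M {y \<in> space M. g (F i (X y)) \<noteq> 0} \<noteq> \<infinity>" by simp
  qed
  have "Cauchy V"
    unfolding Cauchy_def
  proof (intro allI impI)
    fix e :: real assume e: "0 < e"
    obtain K where K: "\<And>i. i \<ge> K \<Longrightarrow> (\<integral>\<omega>. norm (g (X \<omega>) - g (F i (X \<omega>))) \<partial>M) < e / 2"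
      using order_tendstoD(2)[OF L1(1), of "e / 2"] e unfolding eventually_sequentially by auto
    have "dist (V i) (V j) < e" if "i \<ge> K" "j \<ge> K" for i j
      using simple_bochner_distance[OF sb sb L1(2) L1(2), of i j] K[OF that(1)] K[OF that(2)]
      by (simp add: V_def dist_norm)
    then show "\<exists>M. \<forall>m\<ge>M. \<forall>n\<ge>M. dist (V m) (V n) < e" by blast
  qed
  then obtain v where "V \<longlonglongrightarrow> v" using Cauchy_convergent convergent_def by blast
  then show ?thesis using sb that unfolding V_def by blast
qed

text \<open>Chart derivatives and sample means are identified with measurable functions only up to a
  null set; completeness of the space makes them measurable.\<close>

lemma (in complete_measure) borel_measurable_AE_cong:
  fixes f g :: "'a \<Rightarrow> 'b::topological_space"
  assumes g: "g \<in> borel_measurable M" and ae: "AE x in M. f x = g x"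
  shows "f \<in> borel_measurable M"
proof (rule measurableI)
  fix A :: "'b set" assume "A \<in> sets borel"
  then have "g -` A \<inter> space M \<in> sets M" using g by (rule measurable_sets[rotated])
  then show "f -` A \<inter> space M \<in> sets M"
    by (rule in_sets_AE[rotated]) (use ae in \<open>auto elim!: eventually_mono\<close>)
qed auto

lemma ex_has_expectation:
  fixes X :: "'a \<Rightarrow> 'h::{real_normed_vector, second_countable_topology}"
    and g :: "'h \<Rightarrow> 'b::banach"
  assumes "prob_space M" "complete_measure M"
    and X[measurable]: "X \<in> borel_measurable M" and X1: "\<And>\<omega>. \<omega> \<in> space M \<Longrightarrow> norm (X \<omega>) \<le> 1"
    and g: "continuous_on UNIV g" and C: "\<And>x. norm x \<le> 2 \<Longrightarrow> norm (g x) \<le> C"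
    and f: "AE \<omega> in M. f \<omega> = g (X \<omega>)"
    and F: "\<And>i. simple_function borel (F i)" "\<And>x. (\<lambda>i. F i x) \<longlonglongrightarrow> x" "\<And>i x. norm (F i x) \<le> 2 * norm x"
    and v: "(\<lambda>i. Bochner_Integration.simple_bochner_integral M (\<lambda>\<omega>. g (F i (X \<omega>)))) \<longlonglongrightarrow> v"
    and sb: "\<And>i. Bochner_Integration.simple_bochner_integrable M (\<lambda>\<omega>. g (F i (X \<omega>)))"
  shows "has_expectation M f v"
  unfolding has_expectation_def
proof (intro conjI exI allI)
  interpret prob_space M by fact
  interpret complete_measure M by fact
  note L1 = L1_simple_approximation[OF X X1 g C F]
  have "(\<lambda>\<omega>. g (X \<omega>)) \<in> borel_measurable M"
    using measurable_compose[OF X borel_measurable_continuous_onI[OF g]] .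
  then show "f \<in> borel_measurable M" using f by (rule borel_measurable_AE_cong)
  show "(\<lambda>i. \<integral>\<^sup>+\<omega>. norm (f \<omega> - g (F i (X \<omega>))) \<partial>M) \<longlonglongrightarrow> 0"
  proof -
    have "(\<integral>\<^sup>+\<omega>. norm (f \<omega> - g (F i (X \<omega>))) \<partial>M) = ennreal (\<integral>\<omega>. norm (g (X \<omega>) - g (F i (X \<omega>))) \<partial>M)" for i
    proof -
      have "(\<integral>\<^sup>+\<omega>. norm (f \<omega> - g (F i (X \<omega>))) \<partial>M) = (\<integral>\<^sup>+\<omega>. norm (g (X \<omega>) - g (F i (X \<omega>))) \<partial>M)"
        by (rule nn_integral_cong_AE) (use f in \<open>auto elim!: eventually_mono\<close>)
      then show ?thesis using nn_integral_eq_integral[OF L1(2)[of i]] by simp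
    qed
    then show ?thesis using tendsto_ennrealI[OF L1(1)] by simp
  qed
qed (use v sb in auto)

text \<open>After composing \<open>g\<close> with a simple function, an average is a finite
  combination of vectors with empirical frequencies as coefficients. These converge at rate n^(-1/2)
  by a scalar second moment bound, and the replacement costs little in L1, uniformly in n.\<close>

lemma (in prob_space) law_of_large_numbers_L1:
  fixes X :: "'a \<Rightarrow> 'h::{real_normed_vector, second_countable_topology}"
    and g :: "'h \<Rightarrow> 'b::banach"
  assumes ind: "indep_vars (\<lambda>_. borel) Xs UNIV" and law: "\<And>i. distr M borel (Xs i) = distr M borel X"
    and X[measurable]: "X \<in> borel_measurable M"
    and X1: "\<And>\<omega>. \<omega> \<in> space M \<Longrightarrow> norm (X \<omega>) \<le> 1" "\<And>i \<omega>. \<omega> \<in> space M \<Longrightarrow> norm (Xs i \<omega>) \<le> 1"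
    and g: "continuous_on UNIV g" and C: "\<And>x. norm x \<le> 2 \<Longrightarrow> norm (g x) \<le> C"
    and F: "\<And>i. simple_function borel (F i)" "\<And>x. (\<lambda>i. F i x) \<longlonglongrightarrow> x" "\<And>i x. norm (F i x) \<le> 2 * norm x"
    and v: "(\<lambda>i. Bochner_Integration.simple_bochner_integral M (\<lambda>\<omega>. g (F i (X \<omega>)))) \<longlonglongrightarrow> v"
    and sb: "\<And>i. Bochner_Integration.simple_bochner_integrable M (\<lambda>\<omega>. g (F i (X \<omega>)))"
  shows "(\<lambda>n. \<integral>\<omega>. norm ((1 / real n) *\<^sub>R (\<Sum>i<n. g (Xs i \<omega>)) - v) \<partial>M) \<longlonglongrightarrow> 0"
    and "(\<lambda>\<omega>. norm ((1 / real n) *\<^sub>R (\<Sum>i<n. g (Xs i \<omega>)) - v)) \<in> borel_measurable M"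
    and "integrable M (\<lambda>\<omega>. norm ((1 / real n) *\<^sub>R (\<Sum>i<n. g (Xs i \<omega>)) - v))"
proof -
  have L1: "(\<lambda>i. \<integral>\<omega>. norm (g (X \<omega>) - g (F i (X \<omega>))) \<partial>M) \<longlonglongrightarrow> 0"
    by (rule L1_simple_approximation(1)[where C = C]) (use X1(1) g C F in auto)
  have Xm[measurable]: "\<And>i. Xs i \<in> borel_measurable M" using ind unfolding indep_vars_def by auto
  have Fm[measurable]: "F i \<in> borel_measurable borel" for i using F(1) by (rule borel_measurable_simple_function)
  show meas: "(\<lambda>\<omega>. norm ((1 / real n) *\<^sub>R (\<Sum>i<n. g (Xs i \<omega>)) - v)) \<in> borel_measurable M" for n
  proof -
    have "continuous_on UNIV (\<lambda>z :: nat \<Rightarrow> 'h. norm ((1 / real n) *\<^sub>R (\<Sum>i<n. g (z i)) - v))"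
      by (intro continuous_intros continuous_on_compose2[OF g] continuous_on_product_coordinates) auto
    from measurable_tuple[OF this, of Xs M] show ?thesis by simp
  qed
  have "norm (g 0) \<le> C" by (rule C) simp
  then have C0: "0 \<le> C" using norm_ge_zero[of "g 0"] by linarith
  have bd: "norm ((1 / real n) *\<^sub>R (\<Sum>i<n. g (Xs i \<omega>)) - v) \<le> C + norm v" if "\<omega> \<in> space M" for n \<omega>
  proof -
    have "norm (Xs i \<omega>) \<le> 2" for i using X1(2)[OF that, of i] by simp
    then have "norm (\<Sum>i<n. g (Xs i \<omega>)) \<le> (\<Sum>i<n. C)"
      by (intro sum_norm_le C)
    then have "norm ((1 / real n) *\<^sub>R (\<Sum>i<n. g (Xs i \<omega>))) \<le> C"
      using C0 by (cases "n = 0") (auto simp: field_simps)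
    then show ?thesis using norm_triangle_ineq4[of "(1 / real n) *\<^sub>R (\<Sum>i<n. g (Xs i \<omega>))" v] by linarith
  qed
  show int: "integrable M (\<lambda>\<omega>. norm ((1 / real n) *\<^sub>R (\<Sum>i<n. g (Xs i \<omega>)) - v))" for n
    by (rule integrable_bounded[OF meas, of _ "C + norm v"]) (use bd in auto)
  show "(\<lambda>n. \<integral>\<omega>. norm ((1 / real n) *\<^sub>R (\<Sum>i<n. g (Xs i \<omega>)) - v) \<partial>M) \<longlonglongrightarrow> 0"
  proof (rule LIMSEQ_I)
    fix r :: real assume r: "0 < r"
    \<comment> \<open>Three contributions of size e stay below r: the replacement of
      \<open>g\<close>, the frequencies, and the distance from \<open>V k\<close> to v.\<close>
    define e where "e = r / 4"
    have e: "0 < e" using r by (simp add: e_def)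
    define V where "V i = Bochner_Integration.simple_bochner_integral M (\<lambda>\<omega>. g (F i (X \<omega>)))" for i
    have "\<forall>\<^sub>F i in sequentially. (\<integral>\<omega>. norm (g (X \<omega>) - g (F i (X \<omega>))) \<partial>M) < e \<and> dist (V i) v < e"
      using order_tendstoD(2)[OF L1 e] tendstoD[OF v[folded V_def] e] by eventually_elim auto
    then obtain k where k: "(\<integral>\<omega>. norm (g (X \<omega>) - g (F k (X \<omega>))) \<partial>M) < e" "norm (V k - v) < e"
      unfolding eventually_sequentially dist_norm by blast
    define R where "R = range (F k)"
    have R: "finite R" using F(1)[of k] by (simp add: simple_function_def R_def)
    have Fk[measurable]: "{x. F k x = y} \<in> sets borel" for y
    proof -
      have "{x. F k x = y} = F k -` {y} \<inter> space borel" by auto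
      moreover have "F k -` {y} = {}" if "y \<notin> range (F k)" using that by auto
      ultimately show ?thesis using F(1)[of k] unfolding simple_function_def
        by (cases "y \<in> range (F k)") auto
    qed
    define p where "p y = measure M {\<omega> \<in> space M. F k (X \<omega>) = y}" for y
    have p: "0 \<le> p y" "p y \<le> 1" for y by (auto simp: p_def)
    have Vk: "V k = (\<Sum>y\<in>R. p y *\<^sub>R g y)"
    proof -
      have "simple_function M (\<lambda>\<omega>. F k (X \<omega>))"
        using simple_function_comp[OF X F(1)[of k]] by (simp add: o_def)
      then have "V k = (\<Sum>y\<in>(\<lambda>\<omega>. F k (X \<omega>)) ` space M. p y *\<^sub>R g y)"
        unfolding V_def p_def by (rule simple_bochner_integral_partition[OF sb]) auto
      also have "\<dots> = (\<Sum>y\<in>R. p y *\<^sub>R g y)"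
      proof (rule sum.mono_neutral_left[OF R])
        show "\<forall>y\<in>R - (\<lambda>\<omega>. F k (X \<omega>)) ` space M. p y *\<^sub>R g y = 0"
        proof
          fix y assume "y \<in> R - (\<lambda>\<omega>. F k (X \<omega>)) ` space M"
          then have "{\<omega> \<in> space M. F k (X \<omega>) = y} = {}" by auto
          then show "p y *\<^sub>R g y = 0" unfolding p_def by (simp only: measure_empty scaleR_zero_left)
        qed
      qed (auto simp: R_def)
      finally show ?thesis .
    qed
    define I where "I y x = (indicator {x. F k x = y} x :: real)" for y x
    have Im[measurable]: "I y \<in> borel_measurable borel" for y unfolding I_def by measurable
    have I01: "0 \<le> I y x" "I y x \<le> 1" for y x by (auto simp: I_def indicator_def)
    have mean: "(\<integral>\<omega>. I y (Xs i \<omega>) \<partial>M) = p y" for i y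
    proof -
      have "(\<integral>\<omega>. I y (Xs i \<omega>) \<partial>M) = (\<integral>x. I y x \<partial>distr M borel (Xs i))" by (subst integral_distr) auto
      also have "\<dots> = (\<integral>\<omega>. I y (X \<omega>) \<partial>M)" unfolding law by (subst integral_distr) auto
      also have "\<dots> = (\<integral>\<omega>. indicator {\<omega> \<in> space M. F k (X \<omega>) = y} \<omega> \<partial>M)"
        by (intro Bochner_Integration.integral_cong) (auto simp: I_def indicator_def)
      also have "\<dots> = p y" by (simp add: p_def)
      finally show ?thesis .
    qed
    \<comment> \<open>Centred indicators: their sums measure how far the empirical frequency of the
      value y is from \<open>p y\<close>.\<close>
    define Y where "Y y i \<omega> = I y (Xs i \<omega>) - p y" for y i \<omega>
    have Ym[measurable]: "Y y i \<in> borel_measurable M" for y i unfolding Y_def by measurable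
    have Yb: "\<bar>Y y i \<omega>\<bar> \<le> 1" for y i \<omega> using p[of y] I01[of y "Xs i \<omega>"] by (auto simp: Y_def abs_le_iff)
    have Ysq: "(\<integral>\<omega>. (\<Sum>i<n. Y y i \<omega>)\<^sup>2 \<partial>M) \<le> real n" "integrable M (\<lambda>\<omega>. (\<Sum>i<n. Y y i \<omega>)\<^sup>2)" for y n
    proof -
      have ind': "indep_vars (\<lambda>_. borel) (Y y) UNIV"
        unfolding Y_def[abs_def] by (rule indep_vars_compose2[OF ind, where Y = "\<lambda>_ x. I y x - p y"]) measurable
      have int: "integrable M (\<lambda>\<omega>. I y (Xs i \<omega>))" for i
      proof (rule integrable_bounded)
        show "\<bar>I y (Xs i \<omega>)\<bar> \<le> 1" for \<omega> by (auto simp: I_def indicator_def)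
      qed measurable
      have cent: "(\<integral>\<omega>. Y y i \<omega> \<bullet> h \<partial>M) = 0" for i h
        using int[of i] by (simp add: Y_def mean prob_space)
      note sm = second_moment_sum[OF ind', of 1, simplified real_norm_def, OF Yb cent]
      show "integrable M (\<lambda>\<omega>. (\<Sum>i<n. Y y i \<omega>)\<^sup>2)" using sm(2)[of n] by simp
      have "(\<integral>\<omega>. (\<Sum>i<n. Y y i \<omega>)\<^sup>2 \<partial>M) = (\<Sum>i<n. \<integral>\<omega>. (Y y i \<omega>)\<^sup>2 \<partial>M)" using sm(1)[of n] by simp
      also have "\<dots> \<le> (\<Sum>i<n. \<integral>\<omega>. 1 \<partial>M)"
      proof (intro sum_mono integral_mono)
        show le: "(Y y i \<omega>)\<^sup>2 \<le> 1" for i \<omega> using Yb[of y i \<omega>] by (simp add: abs_square_le_1)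
        show "integrable M (\<lambda>\<omega>. (Y y i \<omega>)\<^sup>2)" for i
          by (rule integrable_bounded[of _ 1]) (use le in auto)
      qed auto
      finally show "(\<integral>\<omega>. (\<Sum>i<n. Y y i \<omega>)\<^sup>2 \<partial>M) \<le> real n" by (simp add: prob_space)
    qed
    have Yint: "integrable M (\<lambda>\<omega>. \<bar>\<Sum>i<n. Y y i \<omega>\<bar>)" "integrable M (\<lambda>\<omega>. \<Sum>i<n. Y y i \<omega>)" for y n
    proof -
      show "integrable M (\<lambda>\<omega>. \<Sum>i<n. Y y i \<omega>)"
        by (intro Bochner_Integration.integrable_sum integrable_bounded[of _ 1]) (use Yb in auto)
      then show "integrable M (\<lambda>\<omega>. \<bar>\<Sum>i<n. Y y i \<omega>\<bar>)" by simp
    qed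
    define K where "K = (\<Sum>y\<in>R. norm (g y))"
    have K: "0 \<le> K" unfolding K_def by (intro sum_nonneg) auto
    define D where "D i \<omega> = norm (g (Xs i \<omega>) - g (F k (Xs i \<omega>)))" for i \<omega>
    have D: "integrable M (D i)" "(\<integral>\<omega>. D i \<omega> \<partial>M) < e" for i
    proof -
      show "integrable M (D i)" unfolding D_def[abs_def]
        by (rule L1_simple_approximation(2)[where C = C]) (use X1(2) g C F in auto)
      have "continuous_on UNIV (\<lambda>p. norm (g (fst p) - g (snd p)))"
        by (intro continuous_intros continuous_on_compose2[OF g]) auto
      from borel_measurable_continuous_Pair[OF _ _ this, of "\<lambda>x. x" borel "F k"]
      have [measurable]: "(\<lambda>x. norm (g x - g (F k x))) \<in> borel_measurable borel" by simp
      have "(\<integral>\<omega>. D i \<omega> \<partial>M) = (\<integral>x. norm (g x - g (F k x)) \<partial>distr M borel (Xs i))"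
        unfolding D_def by (subst integral_distr) auto
      also have "\<dots> = (\<integral>\<omega>. norm (g (X \<omega>) - g (F k (X \<omega>))) \<partial>M)" unfolding law by (subst integral_distr) auto
      finally show "(\<integral>\<omega>. D i \<omega> \<partial>M) < e" using k by simp
    qed
    have main: "(\<integral>\<omega>. norm ((1 / real n) *\<^sub>R (\<Sum>i<n. g (Xs i \<omega>)) - v) \<partial>M) \<le> e + K * (1 / sqrt (real n)) + e"
      if n: "0 < n" for n
    proof -
      have pw: "norm ((1 / real n) *\<^sub>R (\<Sum>i<n. g (Xs i \<omega>)) - v)
        \<le> (1 / real n) * (\<Sum>i<n. D i \<omega>) + (\<Sum>y\<in>R. norm (g y) * ((1 / real n) * \<bar>\<Sum>i<n. Y y i \<omega>\<bar>)) + e" for \<omega>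
      proof -
        define A where "A = (1 / real n) *\<^sub>R (\<Sum>i<n. g (Xs i \<omega>) - g (F k (Xs i \<omega>)))"
        define B where "B = (\<Sum>y\<in>R. ((1 / real n) * (\<Sum>i<n. Y y i \<omega>)) *\<^sub>R g y)"
        have gF: "g (F k x) = (\<Sum>y\<in>R. I y x *\<^sub>R g y)" for x
        proof -
          have "(\<Sum>y\<in>R. I y x *\<^sub>R g y) = (\<Sum>y\<in>{F k x}. I y x *\<^sub>R g y)"
            by (rule sum.mono_neutral_right[OF R]) (auto simp: R_def I_def)
          then show ?thesis by (simp add: I_def)
        qed
        have "(1 / real n) *\<^sub>R (\<Sum>i<n. g (F k (Xs i \<omega>))) - V k
          = (\<Sum>y\<in>R. ((1 / real n) * (\<Sum>i<n. I y (Xs i \<omega>))) *\<^sub>R g y) - (\<Sum>y\<in>R. p y *\<^sub>R g y)"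
          unfolding gF Vk
          by (subst sum.swap) (simp add: scaleR_sum_right scaleR_sum_left sum_distrib_left)
        also have "\<dots> = B"
          using n unfolding B_def Y_def sum_subtractf[symmetric]
          by (intro sum.cong refl) (simp add: sum_subtractf right_diff_distrib scaleR_diff_left)
        finally have eq: "(1 / real n) *\<^sub>R (\<Sum>i<n. g (Xs i \<omega>)) - v = A + B + (V k - v)"
          unfolding A_def by (simp add: sum_subtractf scaleR_diff_right algebra_simps)
        have "norm A \<le> (1 / real n) * (\<Sum>i<n. D i \<omega>)"
          unfolding A_def D_def using norm_sum[of "\<lambda>i. g (Xs i \<omega>) - g (F k (Xs i \<omega>))" "{..<n}"]
          by (simp add: divide_right_mono)
        moreover have "norm B \<le> (\<Sum>y\<in>R. norm (g y) * ((1 / real n) * \<bar>\<Sum>i<n. Y y i \<omega>\<bar>))"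
          unfolding B_def by (rule order.trans[OF norm_sum]) (auto simp: abs_mult mult.commute intro!: sum_mono)
        ultimately show ?thesis
          unfolding eq using k(2) norm_triangle_ineq[of "A + B" "V k - v"] norm_triangle_ineq[of A B] by linarith
      qed
      have "(\<integral>\<omega>. norm ((1 / real n) *\<^sub>R (\<Sum>i<n. g (Xs i \<omega>)) - v) \<partial>M)
        \<le> (\<integral>\<omega>. (1 / real n) * (\<Sum>i<n. D i \<omega>) + (\<Sum>y\<in>R. norm (g y) * ((1 / real n) * \<bar>\<Sum>i<n. Y y i \<omega>\<bar>)) + e \<partial>M)"
        by (rule integral_mono[OF int _ pw])
          (intro Bochner_Integration.integrable_add integrable_mult_right Bochner_Integration.integrable_sum D Yint integrable_const)
      also have "\<dots> = (1 / real n) * (\<Sum>i<n. \<integral>\<omega>. D i \<omega> \<partial>M)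
          + (\<Sum>y\<in>R. norm (g y) * ((1 / real n) * (\<integral>\<omega>. \<bar>\<Sum>i<n. Y y i \<omega>\<bar> \<partial>M))) + e"
        by (simp add: D Yint prob_space del: integral_divide_zero)
      also have "\<dots> \<le> (1 / real n) * (\<Sum>i<n. e) + (\<Sum>y\<in>R. norm (g y) * ((1 / real n) * sqrt (real n))) + e"
      proof (intro add_mono mult_left_mono sum_mono order_refl)
        fix y
        show "(\<integral>\<omega>. \<bar>\<Sum>i<n. Y y i \<omega>\<bar> \<partial>M) \<le> sqrt (real n)"
          by (rule expectation_abs_le_sqrt[OF Yint(2) Ysq(2)]) (use n Ysq(1) in auto)
      qed (use D(2) in \<open>auto intro: less_imp_le\<close>)
      also have "(1 / real n) * sqrt (real n) = 1 / sqrt (real n)"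
        using n by (simp add: field_simps)
      finally show ?thesis using n by (simp add: K_def sum_distrib_right sum_divide_distrib)
    qed
    have "(\<lambda>n. K * (1 / sqrt (real n))) \<longlonglongrightarrow> K * 0"
      by (intro tendsto_mult tendsto_const) real_asymp
    then have "\<forall>\<^sub>F n in sequentially. K * (1 / sqrt (real n)) < e" using e by (intro order_tendstoD(2)) auto
    then obtain n0 where n0: "\<And>n. n \<ge> n0 \<Longrightarrow> K * (1 / sqrt (real n)) < e" unfolding eventually_sequentially by blast
    have "norm ((\<integral>\<omega>. norm ((1 / real n) *\<^sub>R (\<Sum>i<n. g (Xs i \<omega>)) - v) \<partial>M) - 0) < r" if "n \<ge> max n0 1" for n
    proof -
      have "0 \<le> (\<integral>\<omega>. norm ((1 / real n) *\<^sub>R (\<Sum>i<n. g (Xs i \<omega>)) - v) \<partial>M)" by simp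
      moreover have "(\<integral>\<omega>. norm ((1 / real n) *\<^sub>R (\<Sum>i<n. g (Xs i \<omega>)) - v) \<partial>M) < 4 * e"
        using main[of n] n0[of n] that e by linarith
      ultimately show ?thesis by (simp add: e_def)
    qed
    then show "\<exists>no. \<forall>n\<ge>no. norm ((\<integral>\<omega>. norm ((1 / real n) *\<^sub>R (\<Sum>i<n. g (Xs i \<omega>)) - v) \<partial>M) - 0) < r" by blast
  qed
qed

subsection \<open>Tightness and weak convergence\<close>

text \<open>In infinite dimension a continuous function need not be uniformly continuous on bounded
  sets. Near a compact set it is, even with only one of the two points inside the set.\<close>

lemma uniform_near_compact:
  fixes f :: "'e::metric_space \<Rightarrow> real"
  assumes K: "compact K" and f: "continuous_on UNIV f" and e: "0 < e"
  shows "\<exists>d>0. \<forall>x\<in>K. \<forall>y. dist y x < d \<longrightarrow> \<bar>f y - f x\<bar> < e"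
proof (rule ccontr)
  assume "\<not> ?thesis"
  then have "\<forall>n. \<exists>x y. x \<in> K \<and> dist y x < 1 / real (Suc n) \<and> \<not> \<bar>f y - f x\<bar> < e"
    by (meson of_nat_0_less_iff zero_less_Suc zero_less_divide_1_iff)
  then obtain x y where xy: "\<And>n. x n \<in> K" "\<And>n. dist (y n) (x n) < 1 / real (Suc n)" "\<And>n. \<not> \<bar>f (y n) - f (x n)\<bar> < e"
    by metis
  obtain l r where l: "strict_mono r" "(x \<circ> r) \<longlonglongrightarrow> l"
    using K xy(1) unfolding compact_def by meson
  have "(\<lambda>n. dist (y (r n)) (x (r n))) \<longlonglongrightarrow> 0"
  proof (rule tendsto_sandwich[of "\<lambda>_. 0"])
    have "(\<lambda>n. 1 / real (Suc n)) \<longlonglongrightarrow> 0" by real_asymp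
    then show "((\<lambda>n. 1 / real (Suc n)) \<circ> r) \<longlonglongrightarrow> 0" using l(1) by (rule LIMSEQ_subseq_LIMSEQ)
    show "\<forall>\<^sub>F n in sequentially. dist (y (r n)) (x (r n)) \<le> ((\<lambda>n. 1 / real (Suc n)) \<circ> r) n"
      by (intro always_eventually allI) (simp only: o_apply less_imp_le[OF xy(2)])
  qed auto
  moreover have "(\<lambda>n. dist (x (r n)) l) \<longlonglongrightarrow> 0" using l(2) unfolding tendsto_dist_iff[of "x \<circ> r"] o_apply .
  ultimately have "(\<lambda>n. dist (y (r n)) (x (r n)) + dist (x (r n)) l) \<longlonglongrightarrow> 0 + 0" by (rule tendsto_add)
  then have s: "(\<lambda>n. dist (y (r n)) (x (r n)) + dist (x (r n)) l) \<longlonglongrightarrow> 0" unfolding add_0_left .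
  have "(\<lambda>n. dist (y (r n)) l) \<longlonglongrightarrow> 0"
    by (rule tendsto_sandwich[OF _ _ tendsto_const s]; intro always_eventually allI) (rule zero_le_dist dist_triangle)+
  then have yl: "(\<lambda>n. y (r n)) \<longlonglongrightarrow> l" by (rule tendsto_dist_iff[THEN iffD2])
  have c: "isCont f l" using f by (simp add: continuous_on_eq_continuous_at)
  have "(\<lambda>n. f (y (r n)) - f (x (r n))) \<longlonglongrightarrow> f l - f l"
    using l(2) by (intro tendsto_diff isCont_tendsto_compose[OF c] yl) (simp add: o_def)
  then have "(\<lambda>n. \<bar>f (y (r n)) - f (x (r n))\<bar>) \<longlonglongrightarrow> 0" using tendsto_rabs_zero by simp
  from order_tendstoD(2)[OF this e] obtain n where "\<bar>f (y (r n)) - f (x (r n))\<bar> < e"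
    unfolding eventually_sequentially by blast
  then show False using xy(3) by blast
qed

lemma (in prob_space) markov_prob:
  fixes Z :: "'a \<Rightarrow> real"
  assumes Z: "integrable M Z" "\<And>\<omega>. 0 \<le> Z \<omega>" and c: "0 < c"
  shows "prob {\<omega> \<in> space M. c < Z \<omega>} \<le> (\<integral>\<omega>. Z \<omega> \<partial>M) / c"
proof -
  have [measurable]: "Z \<in> borel_measurable M" using Z(1) by (rule borel_measurable_integrable)
  let ?A = "{\<omega> \<in> space M. c < Z \<omega>}"
  have A: "?A \<in> sets M" by measurable
  have "c * prob ?A = (\<integral>\<omega>. c * indicator ?A \<omega> \<partial>M)" using A by simp
  also have "\<dots> \<le> (\<integral>\<omega>. Z \<omega> \<partial>M)"
  proof (rule integral_mono[OF _ Z(1)])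
    show "integrable M (\<lambda>\<omega>. c * indicator ?A \<omega>)"
      by (intro integrable_mult_right integrable_real_indicator A) (simp add: less_top[symmetric])
    show "c * indicator ?A \<omega> \<le> Z \<omega>" for \<omega> using Z(2)[of \<omega>] by (auto simp: indicator_def)
  qed
  finally show ?thesis using c by (simp add: field_simps)
qed

lemma (in prob_space) markov_tendsto:
  fixes Z :: "nat \<Rightarrow> 'a \<Rightarrow> real"
  assumes Z: "\<And>n. integrable M (Z n)" "\<And>n \<omega>. 0 \<le> Z n \<omega>" and lim: "(\<lambda>n. \<integral>\<omega>. Z n \<omega> \<partial>M) \<longlonglongrightarrow> 0" and c: "0 < c" and e: "0 < e"
  shows "\<forall>\<^sub>F n in sequentially. prob {\<omega> \<in> space M. c < Z n \<omega>} < e"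
proof -
  have "\<forall>\<^sub>F n in sequentially. (\<integral>\<omega>. Z n \<omega> \<partial>M) < e * c" using e c by (intro order_tendstoD(2)[OF lim]) simp
  then show ?thesis
  proof eventually_elim
    case (elim n)
    have "prob {\<omega> \<in> space M. c < Z n \<omega>} \<le> (\<integral>\<omega>. Z n \<omega> \<partial>M) / c" by (rule markov_prob[OF Z c])
    also have "\<dots> < e" using elim c by (simp add: field_simps)
    finally show ?case .
  qed
qed

text \<open>Each set in the intersection lies close to the compact \<open>C j\<close>, so a finite
  net of \<open>C j\<close> is a net of the intersection at a slightly larger scale; closedness and
  total boundedness give compactness.\<close>

lemma compact_Inter_infdist:
  fixes C :: "nat \<Rightarrow> 'h::complete_space set"
  assumes C: "\<And>j. compact (C j)" "\<And>j. C j \<noteq> {}"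
  shows "compact (\<Inter>j. {x. infdist x (C j) \<le> (1/2) ^ j})"
  unfolding compact_eq_totally_bounded complete_eq_closed
proof (intro conjI allI impI)
  show "closed (\<Inter>j. {x. infdist x (C j) \<le> (1/2) ^ j})"
    by (intro closed_INT ballI closed_Collect_le continuous_intros)
next
  fix e :: real assume e: "0 < e"
  have "(\<lambda>j. (1/2 :: real) ^ j) \<longlonglongrightarrow> 0" by (intro LIMSEQ_power_zero) simp
  then have "\<forall>\<^sub>F j in sequentially. (1/2 :: real) ^ j < e / 2" using e by (intro order_tendstoD(2)) auto
  then obtain j where j: "(1/2 :: real) ^ j < e / 2" unfolding eventually_sequentially by blast
  have "\<exists>k. finite k \<and> C j \<subseteq> (\<Union>x\<in>k. ball x (e / 2))"
    using C(1)[of j] e unfolding compact_eq_totally_bounded by auto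
  then obtain k where k: "finite k" "C j \<subseteq> (\<Union>x\<in>k. ball x (e / 2))" by blast
  have "x \<in> (\<Union>x\<in>k. ball x e)" if x: "infdist x (C j) \<le> (1/2) ^ j" for x
  proof -
    have "Inf (dist x ` C j) < e / 2" using x j C(2)[of j] by (simp add: infdist_def)
    then obtain c where c: "c \<in> C j" "dist x c < e / 2"
      using cInf_lessD[of "dist x ` C j" "e / 2"] C(2)[of j] by auto
    then obtain z where z: "z \<in> k" "dist z c < e / 2" using k(2) by auto
    have "dist z x \<le> dist z c + dist x c" by (rule dist_triangle2)
    then have "dist z x < e" using c z by linarith
    then show ?thesis using z by auto
  qed
  then show "\<exists>k. finite k \<and> (\<Inter>j. {x. infdist x (C j) \<le> (1/2) ^ j}) \<subseteq> (\<Union>x\<in>k. ball x e)"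
    using k(1) by blast
qed

text \<open>Bounded moments do not give tightness in infinite dimension; closeness to some compact
  set at every scale does. The exceptional events of all scales are collected by a countable union
  bound.\<close>

lemma (in prob_space) tight_if_near_compact:
  fixes S :: "nat \<Rightarrow> 'a \<Rightarrow> 'h::{complete_space, second_countable_topology}"
  assumes S[measurable]: "\<And>n. S n \<in> borel_measurable M"
    and near: "\<And>e. 0 < e \<Longrightarrow> \<exists>C. compact C \<and> C \<noteq> {} \<and> (\<forall>n. prob {\<omega> \<in> space M. e < infdist (S n \<omega>) C} \<le> e)"
    and e: "0 < e"
  shows "\<exists>K. compact K \<and> (\<forall>n. prob {\<omega> \<in> space M. S n \<omega> \<notin> K} \<le> e)"
proof -
  \<comment> \<open>The \<open>d j\<close> add up to at most e, for the union bound, and satisfy d j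
    <= (1/2)^j, for \<open>compact_Inter_infdist\<close>.\<close>
  define d where "d j = min 1 e * (1/2 :: real) ^ Suc j" for j
  have d: "0 < d j" for j using e by (simp add: d_def)
  have "\<forall>j. \<exists>C. compact C \<and> C \<noteq> {} \<and> (\<forall>n. prob {\<omega> \<in> space M. d j < infdist (S n \<omega>) C} \<le> d j)"
    using near[OF d] by blast
  then obtain C where C: "\<And>j. compact (C j)" "\<And>j. C j \<noteq> {}"
    "\<And>j n. prob {\<omega> \<in> space M. d j < infdist (S n \<omega>) (C j)} \<le> d j" by metis
  define K where "K = (\<Inter>j. {x. infdist x (C j) \<le> (1/2) ^ j})"
  have "prob {\<omega> \<in> space M. S n \<omega> \<notin> K} \<le> e" for n
  proof -
    define A where "A j = {\<omega> \<in> space M. d j < infdist (S n \<omega>) (C j)}" for j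
    have [measurable]: "A j \<in> sets M" for j
    proof -
      have "continuous_on UNIV (\<lambda>x. infdist x (C j))" by (intro continuous_intros)
      then have [measurable]: "(\<lambda>x. infdist x (C j)) \<in> borel_measurable borel" by (rule borel_measurable_continuous_onI)
      show ?thesis unfolding A_def by measurable
    qed
    have sums: "d sums (min 1 e * 1)"
      unfolding d_def by (intro sums_mult power_half_series)
    have dj: "d j \<le> (1/2) ^ j" for j
    proof -
      have "d j \<le> 1 * (1/2) ^ Suc j" unfolding d_def by (intro mult_right_mono) auto
      also have "\<dots> \<le> (1/2) ^ j" by simp
      finally show ?thesis .
    qed
    have sm: "summable (\<lambda>j. prob (A j))"
      by (rule summable_comparison_test'[OF sums_summable[OF sums], of 0]) (use C(3) in \<open>auto simp: A_def\<close>)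
    have "{\<omega> \<in> space M. S n \<omega> \<notin> K} \<subseteq> (\<Union>j. A j)"
    proof
      fix \<omega> assume "\<omega> \<in> {\<omega> \<in> space M. S n \<omega> \<notin> K}"
      then obtain j where "\<omega> \<in> space M" "(1/2) ^ j < infdist (S n \<omega>) (C j)" unfolding K_def by (auto simp: not_le)
      then show "\<omega> \<in> (\<Union>j. A j)" using dj[of j] unfolding A_def by (auto intro: le_less_trans)
    qed
    then have "prob {\<omega> \<in> space M. S n \<omega> \<notin> K} \<le> prob (\<Union>j. A j)" by (intro finite_measure_mono) auto
    also have "\<dots> \<le> (\<Sum>j. prob (A j))" by (intro finite_measure_subadditive_countably sm) auto
    also have "\<dots> \<le> (\<Sum>j. d j)" by (intro suminf_le sm sums_summable[OF sums]) (use C(3) in \<open>auto simp: A_def\<close>)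
    also have "\<dots> \<le> e" using sums_unique[OF sums] by simp
    finally show ?thesis .
  qed
  moreover have "compact K" unfolding K_def by (rule compact_Inter_infdist[OF C(1,2)])
  ultimately show ?thesis by blast
qed

section \<open>Trigonometric polynomials\<close>

inductive_set trig_polys :: "('h::real_inner \<Rightarrow> complex) set" where
  monom: "(\<lambda>x. c * iexp (x \<bullet> u)) \<in> trig_polys"
| add: "f \<in> trig_polys \<Longrightarrow> g \<in> trig_polys \<Longrightarrow> (\<lambda>x. f x + g x) \<in> trig_polys"

lemma trig_polys_mult:
  assumes "f \<in> trig_polys" "g \<in> trig_polys"
  shows "(\<lambda>x. f x * g x) \<in> trig_polys"
  using assms(1)
proof induction
  case (monom c u)
  show ?case using assms(2)
  proof induction
    case (monom d v)
    have "(\<lambda>x. c * iexp (x \<bullet> u) * (d * iexp (x \<bullet> v))) = (\<lambda>x. (c * d) * iexp (x \<bullet> (u + v)))"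
      by (auto simp: fun_eq_iff inner_add_right distrib_left exp_add algebra_simps)
    then show ?case using trig_polys.monom by metis
  next
    case (add f g)
    then show ?case by (simp add: distrib_left trig_polys.add)
  qed
next
  case (add f g)
  then show ?case by (simp add: distrib_right trig_polys.add)
qed

lemma trig_polys_continuous: "f \<in> trig_polys \<Longrightarrow> continuous_on UNIV f"
  by (induction rule: trig_polys.induct) (auto intro!: continuous_intros)

lemma trig_polys_bounded: "f \<in> trig_polys \<Longrightarrow> \<exists>B. \<forall>x. norm (f x) \<le> B"
proof (induction rule: trig_polys.induct)
  case (monom c u)
  then show ?case by (intro exI[of _ "norm c"]) (simp add: norm_mult)
next
  case (add f g)
  then obtain A B where "\<forall>x. norm (f x) \<le> A" "\<forall>x. norm (g x) \<le> B" by blast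
  then show ?case by (intro exI[of _ "A + B"]) (auto intro: norm_triangle_mono)
qed

lemma (in prob_space) integrable_trig_poly:
  fixes Y :: "'a \<Rightarrow> 'h::{real_inner, second_countable_topology}"
  assumes "f \<in> trig_polys" "Y \<in> borel_measurable M"
  shows "integrable M (\<lambda>\<omega>. f (Y \<omega>))"
proof -
  obtain B where B: "\<And>x. norm (f x) \<le> B" using trig_polys_bounded[OF assms(1)] by blast
  have "(\<lambda>\<omega>. f (Y \<omega>)) \<in> borel_measurable M"
    using measurable_compose[OF assms(2) borel_measurable_continuous_onI[OF trig_polys_continuous[OF assms(1)]]] .
  then show ?thesis by (intro integrable_const_bound[of _ B]) (auto simp: B)
qed

text \<open>The real-valued ones form an algebra of functions, to which the real Stone-Weierstrass
  theorem applies, while convergence of expectations is known for the complex exponentials they are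
  made of.\<close>

definition real_trig_polys :: "('h::real_inner \<Rightarrow> real) set" where
  "real_trig_polys = {f. (\<lambda>x. complex_of_real (f x)) \<in> trig_polys}"

lemma real_trig_polys_add: "f \<in> real_trig_polys \<Longrightarrow> g \<in> real_trig_polys \<Longrightarrow> (\<lambda>x. f x + g x) \<in> real_trig_polys"
  by (simp add: real_trig_polys_def trig_polys.add)

lemma real_trig_polys_mult: "f \<in> real_trig_polys \<Longrightarrow> g \<in> real_trig_polys \<Longrightarrow> (\<lambda>x. f x * g x) \<in> real_trig_polys"
  by (simp add: real_trig_polys_def trig_polys_mult)

lemma real_trig_polys_const: "(\<lambda>_. c) \<in> real_trig_polys"
  using trig_polys.monom[of "complex_of_real c" 0] by (simp add: real_trig_polys_def)

lemma real_trig_polys_sin: "(\<lambda>x. sin (x \<bullet> u)) \<in> real_trig_polys"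
proof -
  have "complex_of_real (sin (x \<bullet> u)) = (1 / (2 * \<i>)) * iexp (x \<bullet> u) + (- 1 / (2 * \<i>)) * iexp (x \<bullet> (- u))" for x
    unfolding sin_of_real[symmetric] sin_exp_eq by (simp add: diff_divide_distrib right_diff_distrib)
  then show ?thesis
    using trig_polys.add[OF trig_polys.monom[of "1 / (2 * \<i>)" u] trig_polys.monom[of "- 1 / (2 * \<i>)" "- u"]]
    by (simp add: real_trig_polys_def)
qed

lemma real_trig_polys_continuous: "f \<in> real_trig_polys \<Longrightarrow> continuous_on UNIV f"
proof -
  assume "f \<in> real_trig_polys"
  then have "continuous_on UNIV (\<lambda>x. Re (complex_of_real (f x)))"
    unfolding real_trig_polys_def by (intro continuous_on_Re trig_polys_continuous) simp
  then show ?thesis by simp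
qed

lemma real_trig_polys_bounded: "f \<in> real_trig_polys \<Longrightarrow> \<exists>B. \<forall>x. \<bar>f x\<bar> \<le> B"
  using trig_polys_bounded[of "\<lambda>x. complex_of_real (f x)"] by (simp add: real_trig_polys_def)

lemma real_trig_polys_compose:
  assumes "real_polynomial_function q" "f \<in> real_trig_polys"
  shows "(\<lambda>x. q (f x) :: real) \<in> real_trig_polys"
  using assms(1)
proof induction
  case (linear l)
  then obtain c where "l = (\<lambda>x. x * c)" using real_bounded_linear by blast
  then show ?case using real_trig_polys_mult[OF assms(2) real_trig_polys_const] by simp
next
  case (const c)
  show ?case by (rule real_trig_polys_const)
next
  case (add p q)
  from add.IH show ?case by (rule real_trig_polys_add)
next
  case (mult p q)
  from mult.IH show ?case by (rule real_trig_polys_mult)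
qed

text \<open>The functional z . (x - y) separates x and y; scaled so that both values lie in [-1, 1],
  where the sine is injective, it still does so after taking sines.\<close>

lemma real_trig_polys_separate:
  fixes x y :: "'h::real_inner"
  assumes "x \<noteq> y"
  shows "\<exists>f\<in>real_trig_polys. f x \<noteq> f y"
proof -
  define d where "d = x - y"
  define s where "s = 1 / (1 + \<bar>x \<bullet> d\<bar> + \<bar>y \<bullet> d\<bar>)"
  have den: "1 + \<bar>x \<bullet> d\<bar> + \<bar>y \<bullet> d\<bar> > 0" by (simp add: add_pos_nonneg)
  have s: "0 < s" using den by (simp add: s_def)
  have le: "\<bar>z \<bullet> (s *\<^sub>R d)\<bar> \<le> 1" if "z = x \<or> z = y" for z
    using that den by (auto simp: s_def abs_mult field_simps)
  have "x \<bullet> (s *\<^sub>R d) - y \<bullet> (s *\<^sub>R d) = s * (d \<bullet> d)" by (simp add: d_def inner_diff_left right_diff_distrib)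
  moreover have "d \<bullet> d \<noteq> 0" using assms by (simp add: d_def)
  ultimately have ne: "x \<bullet> (s *\<^sub>R d) \<noteq> y \<bullet> (s *\<^sub>R d)" using s by auto
  have "1 \<le> pi / 2" using pi_ge_two by simp
  then have "sin (x \<bullet> (s *\<^sub>R d)) \<noteq> sin (y \<bullet> (s *\<^sub>R d))"
    using le[of x] le[of y] ne sin_inj_pi[of "x \<bullet> (s *\<^sub>R d)" "y \<bullet> (s *\<^sub>R d)"] by (auto simp: abs_le_iff)
  then show ?thesis by (intro bexI[OF _ real_trig_polys_sin[of "s *\<^sub>R d"]])
qed

text \<open>Composing with a polynomial that approximates truncation keeps the approximation bounded off \<open>K\<close>.\<close>

lemma real_trig_polys_dense:
  fixes f :: "'h::real_inner \<Rightarrow> real"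
  assumes f: "continuous_on UNIV f" "\<And>x. \<bar>f x\<bar> \<le> B" and K: "compact K" and e: "0 < e"
  shows "\<exists>g\<in>real_trig_polys. (\<forall>x\<in>K. \<bar>f x - g x\<bar> \<le> 2 * e) \<and> (\<forall>x. \<bar>g x\<bar> \<le> B + 2 * e)"
proof -
  interpret function_ring_on "real_trig_polys" K
  proof
    show "continuous_on K f" if "f \<in> real_trig_polys" for f :: "'h \<Rightarrow> real"
      using real_trig_polys_continuous[OF that] continuous_on_subset by blast
  qed (fact K real_trig_polys_add real_trig_polys_mult real_trig_polys_const | rule real_trig_polys_separate, assumption)+
  have "continuous_on K f" using f(1) continuous_on_subset by blast
  from Stone_Weierstrass_basic[OF this e] obtain g where g: "g \<in> real_trig_polys" "\<And>x. x \<in> K \<Longrightarrow> \<bar>f x - g x\<bar> < e"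
    by blast
  obtain C where C: "\<And>x. \<bar>g x\<bar> \<le> C" using real_trig_polys_bounded[OF g(1)] by blast
  have B: "0 \<le> B" using f(2)[of 0] by linarith
  \<comment> \<open>On \<open>K\<close> the approximation is bounded by B + e, so clipping at this
    level changes nothing there.\<close>
  define clip where "clip t = max (- (B + e)) (min (B + e) t)" for t :: real
  have "continuous_on {-C..C} clip" unfolding clip_def by (intro continuous_intros)
  then obtain q where q: "real_polynomial_function q" "\<And>t. t \<in> {-C..C} \<Longrightarrow> \<bar>clip t - q t\<bar> < e"
    using Stone_Weierstrass_real_polynomial_function[OF compact_Icc _ e] by blast
  have Cg: "g x \<in> {-C..C}" for x using C[of x] by (auto simp: abs_le_iff)
  show ?thesis
  proof (intro bexI conjI ballI allI)
    show "(\<lambda>x. q (g x)) \<in> real_trig_polys" by (rule real_trig_polys_compose[OF q(1) g(1)])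
    show "\<bar>q (g x)\<bar> \<le> B + 2 * e" for x
    proof -
      have "\<bar>clip (g x)\<bar> \<le> B + e" using B e by (auto simp: clip_def)
      then show ?thesis using q(2)[OF Cg[of x]] by linarith
    qed
    show "\<bar>f x - q (g x)\<bar> \<le> 2 * e" if "x \<in> K" for x
    proof -
      have "\<bar>g x\<bar> \<le> B + e" using g(2)[OF that] f(2)[of x] by linarith
      then have "clip (g x) = g x" by (auto simp: clip_def)
      then show ?thesis using q(2)[OF Cg[of x]] g(2)[OF that] by linarith
    qed
  qed
qed

lemma (in prob_space) expectation_diff_le:
  fixes F1 F2 :: "'a \<Rightarrow> real"
  assumes int: "integrable M F1" "integrable M F2" and A: "A \<in> sets M" "prob A \<le> e"
    and on: "AE \<omega> in M. \<omega> \<notin> A \<longrightarrow> \<bar>F1 \<omega> - F2 \<omega>\<bar> \<le> a" and off: "\<And>\<omega>. \<omega> \<in> space M \<Longrightarrow> \<bar>F1 \<omega> - F2 \<omega>\<bar> \<le> b"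
    and nn: "0 \<le> a" "0 \<le> b"
  shows "\<bar>(\<integral>\<omega>. F1 \<omega> \<partial>M) - (\<integral>\<omega>. F2 \<omega> \<partial>M)\<bar> \<le> a + b * e"
proof -
  have "\<bar>(\<integral>\<omega>. F1 \<omega> \<partial>M) - (\<integral>\<omega>. F2 \<omega> \<partial>M)\<bar> = \<bar>\<integral>\<omega>. F1 \<omega> - F2 \<omega> \<partial>M\<bar>" using int by simp
  also have "\<dots> \<le> (\<integral>\<omega>. \<bar>F1 \<omega> - F2 \<omega>\<bar> \<partial>M)" by (rule integral_abs_bound)
  also have "\<dots> \<le> (\<integral>\<omega>. a + b * indicator A \<omega> \<partial>M)"
  proof (rule integral_mono_AE)
    show "integrable M (\<lambda>\<omega>. a + b * indicator A \<omega>)"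
      using A by (intro Bochner_Integration.integrable_add integrable_mult_right integrable_real_indicator) (auto simp: less_top[symmetric])
    show "AE \<omega> in M. \<bar>F1 \<omega> - F2 \<omega>\<bar> \<le> a + b * indicator A \<omega>"
      using on AE_space by eventually_elim (use off nn in \<open>force simp: indicator_def\<close>)
  qed (use int in auto)
  also have "\<dots> = a + b * prob A" using A(1) by (simp add: prob_space less_top[symmetric])
  also have "\<dots> \<le> a + b * e" using A(2) nn by (intro add_left_mono mult_left_mono) auto
  finally show ?thesis .
qed

text \<open>Up to probability e all laws live on one compact set. There \<open>f\<close> is close to
  a trigonometric polynomial, and off it both are bounded by constants that do not depend on the
  compact set, so the small mass controls the error.\<close>

theorem (in prob_space) weak_convergence_from_char:
  fixes S :: "nat \<Rightarrow> 'a \<Rightarrow> 'h::{real_inner, polish_space}"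
  assumes S[measurable]: "\<And>n. S n \<in> borel_measurable M"
    and tight: "\<And>e. 0 < e \<Longrightarrow> \<exists>K. compact K \<and> (\<forall>n. prob {\<omega> \<in> space M. S n \<omega> \<notin> K} \<le> e)"
    and L: "prob_space L" "sets L = sets borel"
    and char: "\<And>u. (\<lambda>n. \<integral>\<omega>. iexp (S n \<omega> \<bullet> u) \<partial>M) \<longlonglongrightarrow> (\<integral>z. iexp (z \<bullet> u) \<partial>L)"
    and f: "continuous_on UNIV f" "\<And>x. \<bar>f x :: real\<bar> \<le> B"
  shows "(\<lambda>n. \<integral>\<omega>. f (S n \<omega>) \<partial>M) \<longlonglongrightarrow> (\<integral>z. f z \<partial>L)"
proof -
  interpret L: prob_space L by (rule L)
  note L(2)[measurable_cong]
  have spL: "space L = UNIV" using sets_eq_imp_space_eq[OF L(2)] by simp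
  have [measurable]: "(\<lambda>z. z) \<in> borel_measurable L" using measurable_ident_sets[OF L(2)] by simp
  have trig: "(\<lambda>n. \<integral>\<omega>. h (S n \<omega>) \<partial>M) \<longlonglongrightarrow> (\<integral>z. h z \<partial>L)" if "h \<in> trig_polys" for h
    using that
  proof induction
    case (monom c u)
    show ?case by (simp add: tendsto_mult_left char)
  next
    case (add h k)
    have "integrable M (\<lambda>\<omega>. h (S n \<omega>))" "integrable M (\<lambda>\<omega>. k (S n \<omega>))" for n
      using add by (auto intro: integrable_trig_poly)
    moreover have "integrable L h" "integrable L k"
      using add L.integrable_trig_poly[of h "\<lambda>z. z"] L.integrable_trig_poly[of k "\<lambda>z. z"] by auto
    ultimately show ?case using tendsto_add[OF add.IH] by simp
  qed
  have rtrig: "(\<lambda>n. \<integral>\<omega>. g (S n \<omega>) \<partial>M) \<longlonglongrightarrow> (\<integral>z. g z \<partial>L)" if "g \<in> real_trig_polys" for g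
    using trig[of "\<lambda>x. complex_of_real (g x)"] that by (simp add: real_trig_polys_def tendsto_of_real_iff)
  have B: "0 \<le> B" using f(2)[of 0] by linarith
  have fm[measurable]: "f \<in> borel_measurable borel" using f(1) by (rule borel_measurable_continuous_onI)
  show ?thesis
  proof (rule LIMSEQ_I)
    fix r :: real assume r: "0 < r"
    \<comment> \<open>The replacement costs at most (2 B + 4) e under either law, which this choice
      keeps below r / 4; e <= 1 turns the bound on the polynomial into B + 2.\<close>
    define e where "e = min 1 (r / (4 * (2 * B + 4 + 1)))"
    have e: "0 < e" "e \<le> 1" using r B by (auto simp: e_def)
    have er: "(2 * B + 4 + 1) * e \<le> r / 4"
    proof -
      have "(2 * B + 4 + 1) * e \<le> (2 * B + 4 + 1) * (r / (4 * (2 * B + 4 + 1)))"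
        unfolding e_def using B by (intro mult_left_mono) auto
      also have "\<dots> = r / 4" using B by (simp add: field_simps)
      finally show ?thesis .
    qed
    obtain K1 where K1: "compact K1" "\<And>n. prob {\<omega> \<in> space M. S n \<omega> \<notin> K1} \<le> e" using tight[OF e(1)] by blast
    \<comment> \<open>The limit law is tight by itself, as a finite measure on a Polish space is
      inner regular.\<close>
    obtain K2 where K2: "compact K2" "L.prob (UNIV - K2) \<le> e"
    proof -
      have "emeasure L (space L) = (SUP K\<in>{K. K \<subseteq> UNIV \<and> compact K}. emeasure L K)"
        unfolding spL by (rule inner_regular) (auto simp: L)
      then have "(SUP K\<in>{K. K \<subseteq> UNIV \<and> compact K}. emeasure L K) = ennreal 1"
        using L.emeasure_space_1 by simp
      moreover have "ennreal (1 - e) < ennreal 1" using e by (intro ennreal_lessI) auto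
      ultimately have "ennreal (1 - e) < (SUP K\<in>{K. K \<subseteq> UNIV \<and> compact K}. emeasure L K)" by metis
      then obtain K where K: "compact K" "ennreal (1 - e) < emeasure L K" unfolding less_SUP_iff by auto
      have "ennreal (1 - e) < ennreal (L.prob K)"
        using K(2) by (simp add: L.emeasure_eq_measure)
      then have "1 - e < L.prob K" by (simp add: ennreal_less_iff e)
      moreover have "K \<in> sets L" using K(1) by (simp add: L borel_compact)
      then have "L.prob (UNIV - K) = 1 - L.prob K" using L.prob_compl[of K] by (simp add: spL)
      ultimately show ?thesis using that[OF K(1)] by simp
    qed
    have K: "compact (K1 \<union> K2)" using K1 K2 by (intro compact_Un)
    obtain g where g: "g \<in> real_trig_polys" "\<And>x. x \<in> K1 \<union> K2 \<Longrightarrow> \<bar>f x - g x\<bar> \<le> 2 * e" "\<And>x. \<bar>g x\<bar> \<le> B + 2 * e"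
      using real_trig_polys_dense[OF f K e(1)] by blast
    have [measurable]: "g \<in> borel_measurable borel"
      using real_trig_polys_continuous[OF g(1)] by (rule borel_measurable_continuous_onI)
    have [measurable]: "K1 \<in> sets borel" "K2 \<in> sets borel" using K1 K2 by (auto intro: borel_compact)
    have fg: "\<bar>f x - g x\<bar> \<le> 2 * B + 2" for x using f(2)[of x] g(3)[of x] e by linarith
    have d1: "\<bar>(\<integral>\<omega>. f (S n \<omega>) \<partial>M) - (\<integral>\<omega>. g (S n \<omega>) \<partial>M)\<bar> \<le> 2 * e + (2 * B + 2) * e" for n
    proof (rule expectation_diff_le[where A = "{\<omega> \<in> space M. S n \<omega> \<notin> K1}"])
      show "integrable M (\<lambda>\<omega>. f (S n \<omega>))" by (rule integrable_bounded[of _ B]) (use f(2) in auto)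
      show "integrable M (\<lambda>\<omega>. g (S n \<omega>))" by (rule integrable_bounded[of _ "B + 2 * e"]) (use g(3) in auto)
    qed (use K1(2) g(2) fg e B in auto)
    have d2: "\<bar>(\<integral>z. f z \<partial>L) - (\<integral>z. g z \<partial>L)\<bar> \<le> 2 * e + (2 * B + 2) * e"
    proof (rule L.expectation_diff_le[where A = "UNIV - K2"])
      show "integrable L f" by (rule L.integrable_bounded[of _ B]) (use f(2) in auto)
      show "integrable L g" by (rule L.integrable_bounded[of _ "B + 2 * e"]) (use g(3) in auto)
      show "UNIV - K2 \<in> sets L" by (simp add: L) measurable
    qed (use K2(2) g(2) fg e B in auto)
    obtain n0 where n0: "\<And>n. n \<ge> n0 \<Longrightarrow> norm ((\<integral>\<omega>. g (S n \<omega>) \<partial>M) - (\<integral>z. g z \<partial>L)) < r / 4"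
      using LIMSEQ_D[OF rtrig[OF g(1)], of "r / 4"] r by auto
    have "norm ((\<integral>\<omega>. f (S n \<omega>) \<partial>M) - (\<integral>z. f z \<partial>L)) < r" if "n \<ge> n0" for n
    proof -
      have "2 * e + (2 * B + 2) * e = (2 * B + 4) * e" by (simp add: algebra_simps)
      also have "\<dots> \<le> r / 4" using er e by (simp add: algebra_simps)
      finally show ?thesis using d1[of n] d2 n0[OF that] r unfolding real_norm_def by linarith
    qed
    then show "\<exists>no. \<forall>n\<ge>no. norm ((\<integral>\<omega>. f (S n \<omega>) \<partial>M) - (\<integral>z. f z \<partial>L)) < r" by blast
  qed
qed

subsection \<open>Gaussian laws on a separable Hilbert space\<close>

text \<open>One step of a Gram--Schmidt procedure in \<open>L\<^sup>2\<close>: subtracting from \<open>z\<close> its projection onto the scalar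
  function \<open>\<langle>z, d\<rangle>\<close> splits off a rank one part of the covariance.\<close>

lemma (in prob_space) covariance_split:
  fixes z :: "'a \<Rightarrow> 'h::{real_inner, polish_space}"
  assumes z[measurable]: "z \<in> borel_measurable M" and bd: "\<And>\<omega>. \<omega> \<in> space M \<Longrightarrow> norm (z \<omega>) \<le> B"
  shows "\<exists>a z'. z' \<in> borel_measurable M \<and> (\<exists>B'. \<forall>\<omega>\<in>space M. norm (z' \<omega>) \<le> B') \<and>
    (\<forall>h. (\<integral>\<omega>. (z' \<omega> \<bullet> h)\<^sup>2 \<partial>M) = (\<integral>\<omega>. (z \<omega> \<bullet> h)\<^sup>2 \<partial>M) - (a \<bullet> h)\<^sup>2) \<and>
    (\<integral>\<omega>. (norm (z' \<omega>))\<^sup>2 \<partial>M) = (\<integral>\<omega>. (norm (z \<omega>))\<^sup>2 \<partial>M) - (norm a)\<^sup>2 \<and>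
    (\<integral>\<omega>. (z' \<omega> \<bullet> d)\<^sup>2 \<partial>M) = 0"
proof (cases "(\<integral>\<omega>. (z \<omega> \<bullet> d)\<^sup>2 \<partial>M) = 0")
  case True
  show ?thesis
    by (rule exI[of _ 0], rule exI[of _ z]) (use True bd z in auto)
next
  case False
  define s where "s = (\<integral>\<omega>. (z \<omega> \<bullet> d)\<^sup>2 \<partial>M)"
  have "0 \<le> s" unfolding s_def by simp
  then have s: "0 < s" using False s_def by linarith
  \<comment> \<open>\<open>q\<close> has unit norm in L2. With a the mean of q z, the remainder z -
    q a is uncorrelated with q, which is why exactly (a . h)^2 is split off.\<close>
  define q where "q \<omega> = (z \<omega> \<bullet> d) / sqrt s" for \<omega>
  have qm[measurable]: "q \<in> borel_measurable M" unfolding q_def by measurable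
  have zb: "\<bar>z \<omega> \<bullet> h\<bar> \<le> B * norm h" if "\<omega> \<in> space M" for \<omega> h by (rule abs_inner_le[OF bd[OF that]])
  have qb: "\<bar>q \<omega>\<bar> \<le> B * norm d / sqrt s" if "\<omega> \<in> space M" for \<omega>
    using zb[OF that, of d] s by (simp add: q_def divide_right_mono)
  define C where "C = B * norm d / sqrt s"
  obtain \<omega>0 where "\<omega>0 \<in> space M" using not_empty by blast
  then have B: "0 \<le> B" using bd norm_ge_zero order.trans by metis
  have C: "0 \<le> C" unfolding C_def using B s by simp
  have qz: "norm (q \<omega> *\<^sub>R z \<omega>) \<le> C * B" if "\<omega> \<in> space M" for \<omega>
    using mult_mono[OF qb[OF that] bd[OF that]] C by (simp add: C_def)
  have "AE \<omega> in M. norm (q \<omega> *\<^sub>R z \<omega>) \<le> C * B" using AE_space by eventually_elim (rule qz)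
  then obtain a where a: "\<And>h. a \<bullet> h = (\<integral>\<omega>. (q \<omega> *\<^sub>R z \<omega>) \<bullet> h \<partial>M)"
    using weak_integral_exists[of "\<lambda>\<omega>. q \<omega> *\<^sub>R z \<omega>" "C * B"] by auto
  define z' where "z' \<omega> = z \<omega> - q \<omega> *\<^sub>R a" for \<omega>
  have z'm: "z' \<in> borel_measurable M" unfolding z'_def by measurable
  have z'b: "norm (z' \<omega>) \<le> B + C * norm a" if "\<omega> \<in> space M" for \<omega>
  proof -
    have "norm (q \<omega> *\<^sub>R a) \<le> C * norm a" using mult_right_mono[OF qb[OF that] norm_ge_zero[of a]] by (simp add: C_def)
    then show ?thesis using bd[OF that] norm_triangle_ineq4[of "z \<omega>" "q \<omega> *\<^sub>R a"] unfolding z'_def by linarith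
  qed
  have int_zz: "integrable M (\<lambda>\<omega>. (z \<omega> \<bullet> h)\<^sup>2)" for h
  proof (rule integrable_bounded)
    show "\<bar>(z \<omega> \<bullet> h)\<^sup>2\<bar> \<le> (B * norm h)\<^sup>2" if "\<omega> \<in> space M" for \<omega>
      using power_mono[OF zb[OF that, of h], of 2] by simp
  qed measurable
  have int_q2: "integrable M (\<lambda>\<omega>. (q \<omega>)\<^sup>2)"
  proof (rule integrable_bounded)
    show "\<bar>(q \<omega>)\<^sup>2\<bar> \<le> C\<^sup>2" if "\<omega> \<in> space M" for \<omega>
      using power_mono[OF qb[OF that], of 2] by (simp add: C_def)
  qed measurable
  have int_qz: "integrable M (\<lambda>\<omega>. q \<omega> * (z \<omega> \<bullet> h))" for h
  proof (rule integrable_bounded)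
    show "\<bar>q \<omega> * (z \<omega> \<bullet> h)\<bar> \<le> C * B * norm h" if "\<omega> \<in> space M" for \<omega>
      using abs_inner_le[OF qz[OF that], of h] by simp
  qed measurable
  have int_n: "integrable M (\<lambda>\<omega>. (norm (z \<omega>))\<^sup>2)"
  proof (rule integrable_bounded)
    show "\<bar>(norm (z \<omega>))\<^sup>2\<bar> \<le> B\<^sup>2" if "\<omega> \<in> space M" for \<omega>
      using power_mono[OF bd[OF that], of 2] by simp
  qed measurable
  have q1: "(\<integral>\<omega>. (q \<omega>)\<^sup>2 \<partial>M) = 1"
    using s by (simp add: q_def power_divide s_def[symmetric])
  have aq: "a \<bullet> h = (\<integral>\<omega>. q \<omega> * (z \<omega> \<bullet> h) \<partial>M)" for h unfolding a by simp
  have ii: "(\<integral>\<omega>. (z' \<omega> \<bullet> h)\<^sup>2 \<partial>M) = (\<integral>\<omega>. (z \<omega> \<bullet> h)\<^sup>2 \<partial>M) - (a \<bullet> h)\<^sup>2" for h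
  proof -
    have "(z' \<omega> \<bullet> h)\<^sup>2 = (z \<omega> \<bullet> h)\<^sup>2 - (2 * (a \<bullet> h)) * (q \<omega> * (z \<omega> \<bullet> h)) + (a \<bullet> h)\<^sup>2 * (q \<omega>)\<^sup>2" for \<omega>
      by (simp add: z'_def inner_diff_left power2_eq_square algebra_simps)
    then have "(\<integral>\<omega>. (z' \<omega> \<bullet> h)\<^sup>2 \<partial>M) = (\<integral>\<omega>. (z \<omega> \<bullet> h)\<^sup>2 \<partial>M) - (2 * (a \<bullet> h)) * (\<integral>\<omega>. q \<omega> * (z \<omega> \<bullet> h) \<partial>M) + (a \<bullet> h)\<^sup>2 * (\<integral>\<omega>. (q \<omega>)\<^sup>2 \<partial>M)"
      using int_zz int_qz int_q2 by simp
    then show ?thesis unfolding q1 aq[symmetric] by (simp add: power2_eq_square)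
  qed
  have iii: "(\<integral>\<omega>. (norm (z' \<omega>))\<^sup>2 \<partial>M) = (\<integral>\<omega>. (norm (z \<omega>))\<^sup>2 \<partial>M) - (norm a)\<^sup>2"
  proof -
    have "(norm (z' \<omega>))\<^sup>2 = (norm (z \<omega>))\<^sup>2 - 2 * (q \<omega> * (z \<omega> \<bullet> a)) + (norm a)\<^sup>2 * (q \<omega>)\<^sup>2" for \<omega>
      unfolding z'_def power2_norm_eq_inner
      by (simp add: inner_simps inner_commute power2_eq_square algebra_simps)
    then have "(\<integral>\<omega>. (norm (z' \<omega>))\<^sup>2 \<partial>M) = (\<integral>\<omega>. (norm (z \<omega>))\<^sup>2 \<partial>M) - 2 * (\<integral>\<omega>. q \<omega> * (z \<omega> \<bullet> a) \<partial>M) + (norm a)\<^sup>2 * (\<integral>\<omega>. (q \<omega>)\<^sup>2 \<partial>M)"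
      using int_n int_qz int_q2 by simp
    then show ?thesis unfolding q1 aq[symmetric] by (simp add: dot_square_norm)
  qed
  have "a \<bullet> d = (\<integral>\<omega>. (z \<omega> \<bullet> d)\<^sup>2 / sqrt s \<partial>M)"
    unfolding aq q_def by (intro Bochner_Integration.integral_cong) (auto simp: power2_eq_square)
  also have "\<dots> = s / sqrt s" by (simp add: s_def)
  also have "\<dots> = sqrt s" using s by (simp add: real_div_sqrt)
  finally have "(a \<bullet> d)\<^sup>2 = s" using s by simp
  then have "(\<integral>\<omega>. (z' \<omega> \<bullet> d)\<^sup>2 \<partial>M) = 0" unfolding ii s_def by simp
  then show ?thesis using z'm z'b ii iii by (intro exI[of _ a] exI[of _ z'] conjI) auto
qed

text \<open>Splitting along a dense sequence of directions yields rank one parts. The residual form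
  vanishes at \<open>d n\<close> from step n + 1 on and never increases, so by density it tends to
  zero at every u. This plays the role of a spectral decomposition of the covariance.\<close>

lemma (in prob_space) covariance_series:
  fixes \<zeta> :: "'a \<Rightarrow> 'h::{real_inner, polish_space}"
  assumes \<zeta>[measurable]: "\<zeta> \<in> borel_measurable M" and bd: "\<And>\<omega>. \<omega> \<in> space M \<Longrightarrow> norm (\<zeta> \<omega>) \<le> B"
  shows "\<exists>a :: nat \<Rightarrow> 'h. summable (\<lambda>k. (norm (a k))\<^sup>2) \<and>
    (\<forall>u. (\<lambda>k. (a k \<bullet> u)\<^sup>2) sums (\<integral>\<omega>. (\<zeta> \<omega> \<bullet> u)\<^sup>2 \<partial>M))"
proof -
  obtain D :: "'h set" where D: "countable D" "\<And>X. open X \<Longrightarrow> X \<noteq> {} \<Longrightarrow> \<exists>d\<in>D. d \<in> X"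
    by (erule countable_dense_setE)
  have Dne: "D \<noteq> {}" using D(2)[of UNIV] by auto
  define d where "d = from_nat_into D"
  have d: "\<exists>j. dist u (d j) < e" if "0 < e" for u e
  proof -
    obtain x where "x \<in> D" "x \<in> ball u e" using D(2)[of "ball u e"] \<open>0 < e\<close> by auto
    then show ?thesis using from_nat_into_surj[OF D(1)] unfolding d_def by force
  qed
  define P where "P z \<longleftrightarrow> z \<in> borel_measurable M \<and> (\<exists>B. \<forall>\<omega>\<in>space M. norm (z \<omega>) \<le> B)" for z :: "'a \<Rightarrow> 'h"
  define Q where "Q n z z' a \<longleftrightarrow>
    (\<forall>h. (\<integral>\<omega>. (z' \<omega> \<bullet> h)\<^sup>2 \<partial>M) = (\<integral>\<omega>. (z \<omega> \<bullet> h)\<^sup>2 \<partial>M) - (a \<bullet> h)\<^sup>2) \<and>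
    (\<integral>\<omega>. (norm (z' \<omega>))\<^sup>2 \<partial>M) = (\<integral>\<omega>. (norm (z \<omega>))\<^sup>2 \<partial>M) - (norm a)\<^sup>2 \<and>
    (\<integral>\<omega>. (z' \<omega> \<bullet> d n)\<^sup>2 \<partial>M) = 0" for n z z' and a :: 'h
  have "\<exists>f. \<forall>n. (P (f n) \<and> (n = 0 \<longrightarrow> f n = \<zeta>)) \<and> (\<exists>a. Q n (f n) (f (Suc n)) a)"
  proof (rule dependent_nat_choice)
    show "\<exists>x. P x \<and> (0 = (0::nat) \<longrightarrow> x = \<zeta>)" using bd \<zeta> by (intro exI[of _ \<zeta>]) (auto simp: P_def)
    fix x and n :: nat assume "P x \<and> (n = 0 \<longrightarrow> x = \<zeta>)"
    then obtain B where "x \<in> borel_measurable M" "\<And>\<omega>. \<omega> \<in> space M \<Longrightarrow> norm (x \<omega>) \<le> B" unfolding P_def by auto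
    from covariance_split[OF this, of "d n"]
    show "\<exists>y. (P y \<and> (Suc n = 0 \<longrightarrow> y = \<zeta>)) \<and> (\<exists>a. Q n x y a)" unfolding P_def Q_def by blast
  qed
  then obtain z where z: "\<And>n. P (z n)" "z 0 = \<zeta>" "\<And>n. \<exists>a. Q n (z n) (z (Suc n)) a" by metis
  then obtain a where a: "\<And>n. Q n (z n) (z (Suc n)) (a n)" by metis
  have zm[measurable]: "z n \<in> borel_measurable M" for n using z(1) by (simp add: P_def)
  define v where "v n h = (\<integral>\<omega>. (z n \<omega> \<bullet> h)\<^sup>2 \<partial>M)" for n h
  have vS: "v (Suc n) h = v n h - (a n \<bullet> h)\<^sup>2" for n h using a[of n] by (auto simp: Q_def v_def)
  have v0: "0 \<le> v n h" for n h by (simp add: v_def)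
  have vd: "v (Suc n) (d n) = 0" for n using a[of n] by (auto simp: Q_def v_def)
  have vsum: "v n h = v 0 h - (\<Sum>k<n. (a k \<bullet> h)\<^sup>2)" for n h by (induction n) (auto simp: vS)
  have dec: "v m h \<le> v n h" if "n \<le> m" for m n h
    using that by (induction m rule: dec_induct) (auto simp: vS intro: order.trans[rotated])
  have nS: "(\<integral>\<omega>. (norm (z (Suc n) \<omega>))\<^sup>2 \<partial>M) = (\<integral>\<omega>. (norm (z n \<omega>))\<^sup>2 \<partial>M) - (norm (a n))\<^sup>2" for n
    using a[of n] by (auto simp: Q_def)
  have nsum: "(\<integral>\<omega>. (norm (z n \<omega>))\<^sup>2 \<partial>M) = (\<integral>\<omega>. (norm (z 0 \<omega>))\<^sup>2 \<partial>M) - (\<Sum>k<n. (norm (a k))\<^sup>2)" for n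
    by (induction n) (auto simp: nS)
  have "summable (\<lambda>k. (norm (a k))\<^sup>2)"
  proof (rule bounded_imp_summable)
    show "(\<Sum>k\<le>n. (norm (a k))\<^sup>2) \<le> (\<integral>\<omega>. (norm (z 0 \<omega>))\<^sup>2 \<partial>M)" for n
    proof -
      have "0 \<le> (\<integral>\<omega>. (norm (z (Suc n) \<omega>))\<^sup>2 \<partial>M)" by simp
      then show ?thesis unfolding nsum[of "Suc n"] lessThan_Suc_atMost by simp
    qed
  qed simp
  moreover have "(\<lambda>k. (a k \<bullet> u)\<^sup>2) sums (\<integral>\<omega>. (\<zeta> \<omega> \<bullet> u)\<^sup>2 \<partial>M)" for u
  proof -
    have int: "integrable M (\<lambda>\<omega>. (z n \<omega> \<bullet> h)\<^sup>2)" for n h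
    proof -
      obtain B where B: "\<And>\<omega>. \<omega> \<in> space M \<Longrightarrow> norm (z n \<omega>) \<le> B" using z(1)[of n] unfolding P_def by blast
      show ?thesis
      proof (rule integrable_bounded)
        show "\<bar>(z n \<omega> \<bullet> h)\<^sup>2\<bar> \<le> (B * norm h)\<^sup>2" if "\<omega> \<in> space M" for \<omega>
          using power_mono[OF abs_inner_le[OF B[OF that], of h], of 2] by simp
      qed measurable
    qed
    have v0u: "v 0 h \<le> (B * norm h)\<^sup>2" for h
    proof -
      have "v 0 h \<le> (\<integral>\<omega>. (B * norm h)\<^sup>2 \<partial>M)" unfolding v_def z(2)
      proof (rule integral_mono)
        show "integrable M (\<lambda>\<omega>. (\<zeta> \<omega> \<bullet> h)\<^sup>2)" using int[of 0 h] z(2) by simp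
        show "(\<zeta> \<omega> \<bullet> h)\<^sup>2 \<le> (B * norm h)\<^sup>2" if "\<omega> \<in> space M" for \<omega>
          using power_mono[OF abs_inner_le[OF bd[OF that], of h], of 2] by simp
      qed simp
      then show ?thesis by (simp add: prob_space)
    qed
    have "(\<lambda>n. v n u) \<longlonglongrightarrow> 0"
    proof (rule LIMSEQ_I)
      fix r :: real assume r: "0 < r"
      \<comment> \<open>Scaled so that |B| e is at most sqrt (r / 4); once the residual at
        \<open>d j\<close> vanishes, the residual at u is at most twice that at u - d j.\<close>
      define e where "e = sqrt (r / 4) / (\<bar>B\<bar> + 1)"
      have e: "0 < e" using r by (simp add: e_def add_nonneg_pos)
      obtain j where j: "dist u (d j) < e" using d[OF e] by blast
      have "norm (v n u - 0) < r" if n: "n \<ge> Suc j" for n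
      proof -
        have pt: "(z n \<omega> \<bullet> u)\<^sup>2 \<le> 2 * (z n \<omega> \<bullet> (u - d j))\<^sup>2 + 2 * (z n \<omega> \<bullet> d j)\<^sup>2" for \<omega>
        proof -
          have "(x + y)\<^sup>2 \<le> 2 * x\<^sup>2 + 2 * y\<^sup>2" for x y :: real
            using zero_le_power2[of "x - y"] by (simp add: power2_eq_square algebra_simps)
          from this[of "z n \<omega> \<bullet> (u - d j)" "z n \<omega> \<bullet> d j"] show ?thesis by (simp add: inner_diff_right)
        qed
        have "v n u \<le> (\<integral>\<omega>. 2 * (z n \<omega> \<bullet> (u - d j))\<^sup>2 + 2 * (z n \<omega> \<bullet> d j)\<^sup>2 \<partial>M)"
          unfolding v_def by (rule integral_mono[OF int _ pt]) (intro Bochner_Integration.integrable_add integrable_mult_right int)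
        also have "\<dots> = 2 * v n (u - d j) + 2 * v n (d j)" unfolding v_def by (simp add: int)
        also have "v n (d j) = 0" using dec[OF n, of "d j"] v0[of n "d j"] vd[of j] by simp
        also have "2 * v n (u - d j) + 2 * 0 \<le> 2 * (B * norm (u - d j))\<^sup>2"
          using dec[of 0 n "u - d j"] v0u[of "u - d j"] by simp
        also have "\<dots> \<le> 2 * (r / 4)"
        proof -
          have "\<bar>B\<bar> * norm (u - d j) \<le> (\<bar>B\<bar> + 1) * e" using j e by (intro mult_mono) (auto simp: dist_norm)
          also have "\<dots> = sqrt (r / 4)" unfolding e_def by simp
          finally have "(\<bar>B\<bar> * norm (u - d j))\<^sup>2 \<le> (sqrt (r / 4))\<^sup>2" by (intro power_mono) auto
          then show ?thesis using r by (simp add: power_mult_distrib)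
        qed
        finally show ?thesis using v0[of n u] r by simp
      qed
      then show "\<exists>no. \<forall>n\<ge>no. norm (v n u - 0) < r" by blast
    qed
    then have "(\<lambda>n. v 0 u - v n u) \<longlonglongrightarrow> v 0 u - 0" by (intro tendsto_diff tendsto_const)
    moreover have "v 0 u - v n u = (\<Sum>k<n. (a k \<bullet> u)\<^sup>2)" for n using vsum[of n u] by simp
    ultimately show ?thesis unfolding sums_def by (simp add: v_def z(2))
  qed
  ultimately show ?thesis by blast
qed

section \<open>Gaussian series\<close>

abbreviation (input) normal_product :: "(nat \<Rightarrow> real) measure" where
  "normal_product \<equiv> PiM UNIV (\<lambda>_. std_normal_distribution)"

lemma std_normal_moments:
  "(\<integral>x. x \<partial>std_normal_distribution) = 0" "(\<integral>x. x\<^sup>2 \<partial>std_normal_distribution) = 1"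
  "integrable std_normal_distribution (\<lambda>x. x)" "integrable std_normal_distribution (\<lambda>x. x\<^sup>2)"
proof -
  show "(\<integral>x. x \<partial>std_normal_distribution) = 0"
    using integral_std_normal_distribution_moment_odd[of 1] by simp
  show "(\<integral>x. x\<^sup>2 \<partial>std_normal_distribution) = 1"
    using std_normal_distribution_even_moments[of 1] by (simp add: fact_numeral)
  show "integrable std_normal_distribution (\<lambda>x. x)"
    using integrable_std_normal_distribution_moment[of 1] by simp
  show "integrable std_normal_distribution (\<lambda>x. x\<^sup>2)"
    using integrable_std_normal_distribution_moment[of 2] .
qed

lemma prob_space_std_normal: "prob_space std_normal_distribution"
  by (rule prob_space_normal_density) simp

lemma prob_space_normal_product: "prob_space normal_product"
  by (rule prob_space_PiM) (rule prob_space_std_normal)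

lemma normal_product_facts:
  shows "(\<lambda>\<omega>. \<omega> i) \<in> borel_measurable normal_product"
    and "distr normal_product borel (\<lambda>\<omega>. \<omega> i) = std_normal_distribution"
    and "prob_space.indep_vars normal_product (\<lambda>_. borel) (\<lambda>i \<omega>. \<omega> i) UNIV"
proof -
  interpret prob_space normal_product by (rule prob_space_normal_product)
  have S: "sets normal_product = sets (PiM UNIV (\<lambda>_. borel))"
    by (intro sets_PiM_cong) auto
  show m: "(\<lambda>\<omega>. \<omega> i) \<in> borel_measurable normal_product" for i
    using measurable_component_singleton[of i UNIV "\<lambda>_. borel :: real measure"]
    by (simp add: measurable_cong_sets[OF S refl])
  show d: "distr normal_product borel (\<lambda>\<omega>. \<omega> i) = std_normal_distribution" for i
  proof -
    have "distr normal_product std_normal_distribution (\<lambda>\<omega>. \<omega> i) = std_normal_distribution"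
      using distr_PiM_component[of UNIV "\<lambda>_. std_normal_distribution" i] prob_space_std_normal by simp
    then show ?thesis using distr_cong[of normal_product normal_product borel std_normal_distribution "\<lambda>\<omega>. \<omega> i" "\<lambda>\<omega>. \<omega> i"] by simp
  qed
  have "distr normal_product (PiM UNIV (\<lambda>_. borel)) (\<lambda>\<omega>. \<lambda>i\<in>UNIV. \<omega> i) = PiM UNIV (\<lambda>i. distr normal_product borel (\<lambda>\<omega>. \<omega> i))"
  proof -
    have "distr normal_product (PiM UNIV (\<lambda>_. borel)) (\<lambda>\<omega>. \<lambda>i\<in>UNIV. \<omega> i) = distr normal_product normal_product (\<lambda>\<omega>. \<omega>)"
      by (intro distr_cong) (auto simp: S)
    then show ?thesis by (simp add: d distr_id)
  qed
  then show "indep_vars (\<lambda>_. borel) (\<lambda>i \<omega>. \<omega> i) UNIV"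
    by (subst indep_vars_iff_distr_eq_PiM) (auto simp: m)
qed

text \<open>The law is that of the series of independent standard normals times the vectors a k.
  Square summability controls increments in L2; almost sure convergence is obtained along a
  subsequence of partial sums whose increments are summable in L1.\<close>

lemma ex_gaussian_series_law:
  fixes a :: "nat \<Rightarrow> 'h::{real_inner, polish_space}"
  assumes sm: "summable (\<lambda>k. (norm (a k))\<^sup>2)"
  shows "\<exists>L. prob_space L \<and> sets L = sets borel \<and>
    (\<forall>u v. (\<lambda>k. (a k \<bullet> u)\<^sup>2) sums v \<longrightarrow> (\<integral>z. iexp (z \<bullet> u) \<partial>L) = complex_of_real (exp (- v / 2)))"
proof -
  interpret prob_space normal_product by (rule prob_space_normal_product)
  note meas[measurable] = normal_product_facts(1)
  note ind = normal_product_facts(3)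
  have tr: "(\<integral>\<omega>. f (\<omega> i) \<partial>normal_product) = (\<integral>x. f x \<partial>std_normal_distribution)"
    if "f \<in> borel_measurable borel" for f :: "real \<Rightarrow> real" and i
    using integral_distr[OF meas that, of i] normal_product_facts(2)[of i] by simp
  have tri: "integrable normal_product (\<lambda>\<omega>. f (\<omega> i)) \<longleftrightarrow> integrable std_normal_distribution f"
    if "f \<in> borel_measurable borel" for f :: "real \<Rightarrow> real" and i
    using integrable_distr_eq[OF meas that, of i] normal_product_facts(2)[of i] by simp
  have mid: "(\<lambda>x::real. x) \<in> borel_measurable borel" "(\<lambda>x::real. x\<^sup>2) \<in> borel_measurable borel" by simp_all
  have i1: "integrable normal_product (\<lambda>\<omega>. \<omega> i)" "(\<integral>\<omega>. \<omega> i \<partial>normal_product) = 0" for i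
    by (rule iffD2[OF tri[OF mid(1)] std_normal_moments(3)], rule trans[OF tr[OF mid(1)] std_normal_moments(1)])
  have i2: "integrable normal_product (\<lambda>\<omega>. (\<omega> i)\<^sup>2)" "(\<integral>\<omega>. (\<omega> i)\<^sup>2 \<partial>normal_product) = 1" for i
    by (rule iffD2[OF tri[OF mid(2)] std_normal_moments(4)], rule trans[OF tr[OF mid(2)] std_normal_moments(2)])
  have ip: "integrable normal_product (\<lambda>\<omega>. \<omega> i * \<omega> j)" "(\<integral>\<omega>. \<omega> i * \<omega> j \<partial>normal_product) = (if i = j then 1 else 0)" for i j
  proof -
    have "integrable normal_product (\<lambda>\<omega>. \<omega> i * \<omega> j) \<and> (\<integral>\<omega>. \<omega> i * \<omega> j \<partial>normal_product) = (if i = j then 1 else 0)"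
    proof (cases "i = j")
      case True then show ?thesis using i2[of i] by (simp add: power2_eq_square)
    next
      case False
      note iv = indep_vars_pair[OF ind False]
      show ?thesis using indep_var_lebesgue_integral[OF iv i1(1) i1(1)] indep_var_integrable[OF iv i1(1) i1(1)] i1(2) False by simp
    qed
    then show "integrable normal_product (\<lambda>\<omega>. \<omega> i * \<omega> j)" "(\<integral>\<omega>. \<omega> i * \<omega> j \<partial>normal_product) = (if i = j then 1 else 0)" by auto
  qed
  have sq: "integrable normal_product (\<lambda>\<omega>. (norm (\<Sum>k\<in>I. \<omega> k *\<^sub>R a k))\<^sup>2)"
    "(\<integral>\<omega>. (norm (\<Sum>k\<in>I. \<omega> k *\<^sub>R a k))\<^sup>2 \<partial>normal_product) = (\<Sum>k\<in>I. (norm (a k))\<^sup>2)" if I: "finite I" for I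
  proof -
    have exp: "(norm (\<Sum>k\<in>I. \<omega> k *\<^sub>R a k))\<^sup>2 = (\<Sum>j\<in>I. \<Sum>k\<in>I. (\<omega> j * \<omega> k) * (a j \<bullet> a k))" for \<omega>
      unfolding power2_norm_eq_inner inner_sum_left inner_sum_right
      by (subst sum.swap) (simp add: mult.assoc mult.left_commute)
    show "integrable normal_product (\<lambda>\<omega>. (norm (\<Sum>k\<in>I. \<omega> k *\<^sub>R a k))\<^sup>2)"
      unfolding exp by (intro Bochner_Integration.integrable_sum integrable_mult_left ip)
    have "(\<integral>\<omega>. (norm (\<Sum>k\<in>I. \<omega> k *\<^sub>R a k))\<^sup>2 \<partial>normal_product) = (\<Sum>j\<in>I. \<Sum>k\<in>I. (if j = k then 1 else 0) * (a j \<bullet> a k))"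
      unfolding exp by (simp add: ip Bochner_Integration.integral_sum del: mult_cancel_right)
    also have "\<dots> = (\<Sum>j\<in>I. \<Sum>k\<in>I. if j = k then (norm (a j))\<^sup>2 else 0)"
      by (intro sum.cong refl) (auto simp: power2_norm_eq_inner)
    also have "\<dots> = (\<Sum>k\<in>I. (norm (a k))\<^sup>2)" using I by simp
    finally show "(\<integral>\<omega>. (norm (\<Sum>k\<in>I. \<omega> k *\<^sub>R a k))\<^sup>2 \<partial>normal_product) = (\<Sum>k\<in>I. (norm (a k))\<^sup>2)" .
  qed
  have "\<exists>N. \<forall>m\<ge>N. \<forall>n. (\<Sum>k\<in>{m..<n}. (norm (a k))\<^sup>2) < ((1/2) ^ j)\<^sup>2" for j :: nat
  proof -
    have "0 < ((1/2 :: real) ^ j)\<^sup>2" by simp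
    then obtain N where "\<forall>m\<ge>N. \<forall>n. norm (\<Sum>k\<in>{m..<n}. (norm (a k))\<^sup>2) < ((1/2) ^ j)\<^sup>2"
      using sm unfolding summable_Cauchy by blast
    then have "\<forall>m\<ge>N. \<forall>n. (\<Sum>k\<in>{m..<n}. (norm (a k))\<^sup>2) < ((1/2) ^ j)\<^sup>2"
      by (simp add: sum_nonneg)
    then show ?thesis by (rule exI)
  qed
  then obtain N where N: "\<And>j m n. m \<ge> N j \<Longrightarrow> (\<Sum>k\<in>{m..<n}. (norm (a k))\<^sup>2) < ((1/2) ^ j)\<^sup>2" by metis
  \<comment> \<open>The indices are at least \<open>N j\<close>, for increments of L2 norm at most
    2^-j, do not decrease, and are at least j, so that the partial sums exhaust the series.\<close>
  define r where "r j = (\<Sum>i\<le>j. N i) + j" for j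
  have rN: "N j \<le> r j" for j using member_le_sum[of j "{..j}" N] by (simp add: r_def)
  have rS: "r j \<le> r (Suc j)" for j by (simp add: r_def)
  have rge: "j \<le> r j" for j by (simp add: r_def)
  define T where "T j \<omega> = (\<Sum>k<r j. \<omega> k *\<^sub>R a k)" for j and \<omega> :: "nat \<Rightarrow> real"
  have Tm[measurable]: "T j \<in> borel_measurable normal_product" for j unfolding T_def by measurable
  have Tdiff: "T (Suc j) \<omega> - T j \<omega> = (\<Sum>k\<in>{r j..<r (Suc j)}. \<omega> k *\<^sub>R a k)" for j \<omega>
    unfolding T_def using sum_diff_nat_ivl[of 0 "r j" "r (Suc j)" "\<lambda>k. \<omega> k *\<^sub>R a k"] rS[of j] by (simp add: atLeast0LessThan)
  have Tint: "(\<integral>\<omega>. \<bar>norm (T (Suc j) \<omega> - T j \<omega>)\<bar> \<partial>normal_product) \<le> (1/2) ^ j" "integrable normal_product (\<lambda>\<omega>. norm (T (Suc j) \<omega> - T j \<omega>))" for j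
  proof -
    have i: "integrable normal_product (\<lambda>\<omega>. (norm (T (Suc j) \<omega> - T j \<omega>))\<^sup>2)" unfolding Tdiff by (rule sq(1)) simp
    show ii: "integrable normal_product (\<lambda>\<omega>. norm (T (Suc j) \<omega> - T j \<omega>))"
      by (rule square_integrable_imp_integrable[OF _ i]) measurable
    have "(\<integral>\<omega>. (norm (T (Suc j) \<omega> - T j \<omega>))\<^sup>2 \<partial>normal_product) \<le> ((1/2) ^ j)\<^sup>2"
      unfolding Tdiff using N[OF rN, of j "r (Suc j)"] by (subst sq(2)) auto
    then show "(\<integral>\<omega>. \<bar>norm (T (Suc j) \<omega> - T j \<omega>)\<bar> \<partial>normal_product) \<le> (1/2) ^ j"
      by (intro expectation_abs_le_sqrt ii i) auto
  qed
  have "AE \<omega> in normal_product. summable (\<lambda>j. norm (T (Suc j) \<omega> - T j \<omega>))"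
  proof -
    have "(\<integral>\<^sup>+\<omega>. (\<Sum>j. ennreal (norm (T (Suc j) \<omega> - T j \<omega>))) \<partial>normal_product) = (\<Sum>j. \<integral>\<^sup>+\<omega>. ennreal (norm (T (Suc j) \<omega> - T j \<omega>)) \<partial>normal_product)"
      by (rule nn_integral_suminf) measurable
    also have "\<dots> \<le> (\<Sum>j. ennreal ((1/2) ^ j))"
    proof (intro suminf_le)
      fix j
      have "(\<integral>\<^sup>+\<omega>. ennreal (norm (T (Suc j) \<omega> - T j \<omega>)) \<partial>normal_product) = ennreal (\<integral>\<omega>. norm (T (Suc j) \<omega> - T j \<omega>) \<partial>normal_product)"
        by (rule nn_integral_eq_integral[OF Tint(2)]) auto
      also have "\<dots> \<le> ennreal ((1/2) ^ j)" using Tint(1)[of j] by (intro ennreal_leI) simp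
      finally show "(\<integral>\<^sup>+\<omega>. ennreal (norm (T (Suc j) \<omega> - T j \<omega>)) \<partial>normal_product) \<le> ennreal ((1/2) ^ j)" .
    qed auto
    also have "\<dots> = ennreal (\<Sum>j. (1/2) ^ j)" by (intro suminf_ennreal_eq) (auto intro!: summable_sums summable_geometric)
    also have "\<dots> < \<infinity>" by simp
    finally have "AE \<omega> in normal_product. (\<Sum>j. ennreal (norm (T (Suc j) \<omega> - T j \<omega>))) \<noteq> \<infinity>"
      by (intro nn_integral_PInf_AE) (auto simp: less_top)
    then show ?thesis by eventually_elim (rule summable_suminf_not_top; simp)
  qed
  then have aeC: "AE \<omega> in normal_product. Cauchy (\<lambda>j. T j \<omega>)"
  proof eventually_elim
    case (elim \<omega>)
    show ?case unfolding Cauchy_altdef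
    proof (intro allI impI)
      fix e :: real assume "0 < e"
      then obtain K where K: "\<And>m n. m \<ge> K \<Longrightarrow> norm (\<Sum>j\<in>{m..<n}. norm (T (Suc j) \<omega> - T j \<omega>)) < e"
        using elim unfolding summable_Cauchy by metis
      have "dist (T m \<omega>) (T n \<omega>) < e" if "m \<ge> K" "n > m" for m n
      proof -
        have "T n \<omega> - T m \<omega> = (\<Sum>j\<in>{m..<n}. T (Suc j) \<omega> - T j \<omega>)" using that sum_Suc_diff'[of m n "\<lambda>j. T j \<omega>"] by simp
        then have "norm (T n \<omega> - T m \<omega>) \<le> (\<Sum>j\<in>{m..<n}. norm (T (Suc j) \<omega> - T j \<omega>))" using norm_sum by metis
        also have "\<dots> < e" using K[OF that(1), of n] by simp
        finally show ?thesis by (simp add: dist_norm norm_minus_commute)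
      qed
      then show "\<exists>M. \<forall>m\<ge>M. \<forall>n>m. dist (T m \<omega>) (T n \<omega>) < e" by blast
    qed
  qed
  \<comment> \<open>Setting the sums to 0 where they are not Cauchy makes the limit exist
    everywhere, so that \<open>Z\<close> is measurable as a pointwise limit.\<close>
  define T' where "T' j \<omega> = (if Cauchy (\<lambda>j. T j \<omega>) then T j \<omega> else 0)" for j \<omega>
  have T'm[measurable]: "T' j \<in> borel_measurable normal_product" for j
  proof -
    have [measurable]: "{\<omega> \<in> space normal_product. Cauchy (\<lambda>j. T j \<omega>)} \<in> sets normal_product" by (rule sets_Collect_Cauchy) measurable
    show ?thesis unfolding T'_def by (rule measurable_If) measurable
  qed
  have conv: "\<exists>l. (\<lambda>j. T' j \<omega>) \<longlonglongrightarrow> l" for \<omega>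
  proof (cases "Cauchy (\<lambda>j. T j \<omega>)")
    case True
    then show ?thesis unfolding T'_def using Cauchy_convergent convergent_def by auto
  next
    case False
    then show ?thesis unfolding T'_def by auto
  qed
  then obtain Z where Z: "\<And>\<omega>. (\<lambda>j. T' j \<omega>) \<longlonglongrightarrow> Z \<omega>" by metis
  have Zm[measurable]: "Z \<in> borel_measurable normal_product"
    by (rule borel_measurable_LIMSEQ_metric[OF T'm Z])
  have aeZ: "AE \<omega> in normal_product. (\<lambda>j. T j \<omega>) \<longlonglongrightarrow> Z \<omega>"
    using aeC
  proof eventually_elim
    case (elim \<omega>)
    then show ?case using Z[of \<omega>] by (simp add: T'_def)
  qed
  define L where "L = distr normal_product borel Z"
  have "(\<integral>z. iexp (z \<bullet> u) \<partial>L) = complex_of_real (exp (- v / 2))" if v: "(\<lambda>k. (a k \<bullet> u)\<^sup>2) sums v" for u v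
  proof -
    have L1: "(\<lambda>j. \<integral>\<omega>. iexp (T j \<omega> \<bullet> u) \<partial>normal_product) \<longlonglongrightarrow> (\<integral>\<omega>. iexp (Z \<omega> \<bullet> u) \<partial>normal_product)"
    proof (rule integral_dominated_convergence[where w = "\<lambda>_. 1"])
      show "AE \<omega> in normal_product. (\<lambda>j. iexp (T j \<omega> \<bullet> u)) \<longlonglongrightarrow> iexp (Z \<omega> \<bullet> u)"
        using aeZ by eventually_elim (intro tendsto_intros)
    qed auto
    have "(\<integral>\<omega>. iexp (T j \<omega> \<bullet> u) \<partial>normal_product) = complex_of_real (exp (- (\<Sum>k<r j. (a k \<bullet> u)\<^sup>2) / 2))" for j
    proof -
      have ind': "indep_vars (\<lambda>_. borel) (\<lambda>k \<omega>. (a k \<bullet> u) * \<omega> k) UNIV"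
        by (rule indep_vars_compose2[OF ind, where Y = "\<lambda>k x. (a k \<bullet> u) * x"]) simp
      have ind'': "indep_vars (\<lambda>_. borel) (\<lambda>k \<omega>. (a k \<bullet> u) * \<omega> k) {..<r j}"
        using indep_vars_subset[OF ind'] by blast
      have "(\<integral>\<omega>. iexp (T j \<omega> \<bullet> u) \<partial>normal_product) = char (distr normal_product borel (\<lambda>\<omega>. \<Sum>k<r j. (a k \<bullet> u) * \<omega> k)) 1"
        unfolding char_def by (subst integral_distr) (auto simp: T_def inner_sum_left mult.commute)
      also have "\<dots> = (\<Prod>k<r j. char (distr normal_product borel (\<lambda>\<omega>. (a k \<bullet> u) * \<omega> k)) 1)"
        by (rule char_distr_sum[OF ind''])
      also have "\<dots> = (\<Prod>k<r j. exp (complex_of_real (- (a k \<bullet> u)\<^sup>2 / 2)))"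
      proof (intro prod.cong refl)
        fix k
        have "char (distr normal_product borel (\<lambda>\<omega>. (a k \<bullet> u) * \<omega> k)) 1 = char (distr normal_product borel (\<lambda>\<omega>. \<omega> k)) (a k \<bullet> u)"
          unfolding char_def by (subst (1 2) integral_distr) auto
        also have "\<dots> = exp (complex_of_real (- (a k \<bullet> u)\<^sup>2 / 2))"
          unfolding normal_product_facts(2) char_std_normal_distribution by (simp only: exp_of_real)
        finally show "char (distr normal_product borel (\<lambda>\<omega>. (a k \<bullet> u) * \<omega> k)) 1 = exp (complex_of_real (- (a k \<bullet> u)\<^sup>2 / 2))" .
      qed
      also have "\<dots> = exp (\<Sum>k<r j. complex_of_real (- (a k \<bullet> u)\<^sup>2 / 2))" by (simp add: exp_sum)
      also have "(\<Sum>k<r j. complex_of_real (- (a k \<bullet> u)\<^sup>2 / 2)) = complex_of_real (- (\<Sum>k<r j. (a k \<bullet> u)\<^sup>2) / 2)"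
        by (simp add: sum_negf sum_divide_distrib)
      finally show ?thesis by (simp only: exp_of_real)
    qed
    moreover have "(\<lambda>j. complex_of_real (exp (- (\<Sum>k<r j. (a k \<bullet> u)\<^sup>2) / 2))) \<longlonglongrightarrow> complex_of_real (exp (- v / 2))"
    proof -
      have "filterlim r at_top sequentially" unfolding filterlim_at_top eventually_sequentially using rge order.trans by blast
      then have "(\<lambda>j. \<Sum>k<r j. (a k \<bullet> u)\<^sup>2) \<longlonglongrightarrow> v" using v[unfolded sums_def] by (rule filterlim_compose[rotated])
      then show ?thesis by (intro tendsto_intros) auto
    qed
    ultimately have "(\<integral>\<omega>. iexp (Z \<omega> \<bullet> u) \<partial>normal_product) = complex_of_real (exp (- v / 2))"
      using LIMSEQ_unique[OF L1] by simp
    then show ?thesis unfolding L_def by (subst integral_distr) auto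
  qed
  moreover have "prob_space L" unfolding L_def by (rule prob_space_distr) measurable
  ultimately show ?thesis unfolding L_def by (intro exI[of _ L]) (auto simp: L_def)
qed

subsection \<open>The central limit theorem in Hilbert space\<close>

text \<open>Describing the law as a scaled standard normal merges the density with the point mass at
  variance 0, so that moments and characteristic functions need no case distinction
  afterwards.\<close>

lemma normal_law_eq_distr:
  assumes "0 \<le> v"
  shows "normal_law 0 v = distr std_normal_distribution borel (\<lambda>x. sqrt v * x)"
proof (cases "v = 0")
  case True
  interpret prob_space std_normal_distribution by (rule prob_space_std_normal)
  have "distr std_normal_distribution borel (\<lambda>x. 0 :: real) = return borel 0" by (rule distr_const) simp
  then show ?thesis using True by (simp add: normal_law_def)
next
  case False
  interpret prob_space std_normal_distribution by (rule prob_space_std_normal)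
  have "distributed std_normal_distribution lborel (\<lambda>x. x) std_normal_density"
    unfolding distributed_def using distr_id2[of std_normal_distribution lborel] by (auto intro: distr_id2)
  then have "distributed std_normal_distribution lborel (\<lambda>x. 0 + sqrt v * x) (normal_density (0 + sqrt v * 0) (\<bar>sqrt v\<bar> * 1))"
    using False assms by (intro normal_density_affine) auto
  then have "distr std_normal_distribution lborel (\<lambda>x. sqrt v * x) = density lborel (\<lambda>x. ennreal (normal_density 0 (sqrt v) x))"
    using assms by (simp add: distributed_def)
  moreover have "distr std_normal_distribution borel (\<lambda>x. sqrt v * x) = distr std_normal_distribution lborel (\<lambda>x. sqrt v * x)"
    by (rule distr_cong) auto
  ultimately show ?thesis using False by (simp add: normal_law_def)
qed

lemma normal_law_moments:
  assumes "0 \<le> v"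
  shows "integrable (normal_law 0 v) (\<lambda>x. x)" "(\<integral>x. x \<partial>normal_law 0 v) = 0"
    "integrable (normal_law 0 v) (\<lambda>x. x\<^sup>2)" "(\<integral>x. x\<^sup>2 \<partial>normal_law 0 v) = v"
proof -
  have m: "(\<lambda>x. sqrt v * x) \<in> std_normal_distribution \<rightarrow>\<^sub>M borel" by measurable
  have i: "(\<lambda>x::real. x) \<in> borel_measurable borel" "(\<lambda>x::real. x\<^sup>2) \<in> borel_measurable borel" by simp_all
  show "integrable (normal_law 0 v) (\<lambda>x. x)"
    unfolding normal_law_eq_distr[OF assms] integrable_distr_eq[OF m i(1)]
    by (intro integrable_mult_right std_normal_moments)
  show "(\<integral>x. x \<partial>normal_law 0 v) = 0"
    unfolding normal_law_eq_distr[OF assms] integral_distr[OF m i(1)] integral_mult_right_zero std_normal_moments by simp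
  show "integrable (normal_law 0 v) (\<lambda>x. x\<^sup>2)"
    unfolding normal_law_eq_distr[OF assms] integrable_distr_eq[OF m i(2)] power_mult_distrib
    by (intro integrable_mult_right std_normal_moments)
  show "(\<integral>x. x\<^sup>2 \<partial>normal_law 0 v) = v"
    unfolding normal_law_eq_distr[OF assms] integral_distr[OF m i(2)] power_mult_distrib integral_mult_right_zero std_normal_moments
    using assms by simp
qed

lemma normal_law_from_char:
  fixes L :: "'h::{real_inner, second_countable_topology} measure"
  assumes L: "prob_space L" "sets L = sets borel"
    and char: "\<And>t. (\<integral>z. iexp (z \<bullet> (t *\<^sub>R h)) \<partial>L) = complex_of_real (exp (- (t\<^sup>2 * v) / 2))" and v: "0 \<le> v"
  shows "distr L borel (\<lambda>z. z \<bullet> h) = normal_law 0 v"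
  unfolding normal_law_eq_distr[OF v]
proof (rule Levy_uniqueness)
  interpret L: prob_space L by fact
  interpret N: prob_space std_normal_distribution by (rule prob_space_std_normal)
  note L(2)[measurable_cong]
  have m1[measurable]: "(\<lambda>z. z \<bullet> h) \<in> borel_measurable L" by measurable
  have m2[measurable]: "(\<lambda>x. sqrt v * x) \<in> borel_measurable std_normal_distribution" by measurable
  show "real_distribution (distr L borel (\<lambda>z. z \<bullet> h))" by (rule L.real_distribution_distr[OF m1])
  show "real_distribution (distr std_normal_distribution borel (\<lambda>x. sqrt v * x))" by (rule N.real_distribution_distr[OF m2])
  show "char (distr L borel (\<lambda>z. z \<bullet> h)) = char (distr std_normal_distribution borel (\<lambda>x. sqrt v * x))"
  proof
    fix t
    have "char (distr L borel (\<lambda>z. z \<bullet> h)) t = (\<integral>z. iexp (z \<bullet> (t *\<^sub>R h)) \<partial>L)"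
      unfolding char_def by (subst integral_distr) auto
    also have "\<dots> = complex_of_real (exp (- ((t * sqrt v)\<^sup>2) / 2))" unfolding char using v by (simp add: power_mult_distrib)
    also have "\<dots> = char std_normal_distribution (t * sqrt v)" unfolding char_std_normal_distribution by simp
    also have "\<dots> = char (distr std_normal_distribution borel (\<lambda>x. sqrt v * x)) t"
      unfolding char_def by (subst integral_distr) (auto simp: mult.assoc)
    finally show "char (distr L borel (\<lambda>z. z \<bullet> h)) t = char (distr std_normal_distribution borel (\<lambda>x. sqrt v * x)) t" .
  qed
qed

lemma compact_bounded_combinations:
  fixes R :: "'h::real_normed_vector set"
  assumes "finite R"
  shows "compact {\<Sum>y\<in>R. c y *\<^sub>R y | c :: 'h \<Rightarrow> real. \<forall>y\<in>R. \<bar>c y\<bar> \<le> b}"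
  using assms
proof induction
  case (insert x R)
  let ?C = "\<lambda>R. {\<Sum>y\<in>R. c y *\<^sub>R y | c :: 'h \<Rightarrow> real. \<forall>y\<in>R. \<bar>c y\<bar> \<le> b}"
  have "?C (insert x R) = (\<lambda>p. fst p *\<^sub>R x + snd p) ` ({-b..b} \<times> ?C R)"
  proof (intro equalityI subsetI)
    fix z assume "z \<in> ?C (insert x R)"
    then obtain c :: "'h \<Rightarrow> real" where c: "z = (\<Sum>y\<in>insert x R. c y *\<^sub>R y)" "\<forall>y\<in>insert x R. \<bar>c y\<bar> \<le> b" by blast
    then have "z = (\<lambda>p. fst p *\<^sub>R x + snd p) (c x, \<Sum>y\<in>R. c y *\<^sub>R y)" using insert by simp
    moreover have "(c x, \<Sum>y\<in>R. c y *\<^sub>R y) \<in> {-b..b} \<times> ?C R" using c(2) by (auto simp: abs_le_iff)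
    ultimately show "z \<in> (\<lambda>p. fst p *\<^sub>R x + snd p) ` ({-b..b} \<times> ?C R)" by blast
  next
    fix z assume "z \<in> (\<lambda>p. fst p *\<^sub>R x + snd p) ` ({-b..b} \<times> ?C R)"
    then obtain s and c :: "'h \<Rightarrow> real" where c: "z = s *\<^sub>R x + (\<Sum>y\<in>R. c y *\<^sub>R y)" "s \<in> {-b..b}" "\<forall>y\<in>R. \<bar>c y\<bar> \<le> b" by auto
    have "(\<Sum>y\<in>R. (c(x := s)) y *\<^sub>R y) = (\<Sum>y\<in>R. c y *\<^sub>R y)" using insert by (intro sum.cong) auto
    then have "z = (\<Sum>y\<in>insert x R. (c(x := s)) y *\<^sub>R y)" using c(1) insert by simp
    moreover have "\<forall>y\<in>insert x R. \<bar>(c(x := s)) y\<bar> \<le> b" using c by (auto simp: abs_le_iff)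
    ultimately show "z \<in> ?C (insert x R)" by blast
  qed
  moreover have "compact ((\<lambda>p. fst p *\<^sub>R x + snd p) ` ({-b..b} \<times> ?C R))"
    by (intro compact_continuous_image compact_Times insert.IH compact_Icc continuous_intros)
  ultimately show ?case by simp
qed auto

lemma (in prob_space) chebyshev_norm:
  fixes R :: "'a \<Rightarrow> 'b::real_normed_vector"
  assumes R: "integrable M (\<lambda>\<omega>. (norm (R \<omega>))\<^sup>2)" "(\<lambda>\<omega>. norm (R \<omega>)) \<in> borel_measurable M"
    and c: "(\<integral>\<omega>. (norm (R \<omega>))\<^sup>2 \<partial>M) \<le> c" and e: "0 < e"
  shows "prob {\<omega> \<in> space M. e < norm (R \<omega>)} \<le> c / e\<^sup>2"
proof -
  note R(2)[measurable]
  let ?A = "{\<omega> \<in> space M. e < norm (R \<omega>)}"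
  have A[measurable]: "?A \<in> sets M" by measurable
  have "e\<^sup>2 * prob ?A = (\<integral>\<omega>. e\<^sup>2 * indicator ?A \<omega> \<partial>M)" by simp
  also have "\<dots> \<le> (\<integral>\<omega>. (norm (R \<omega>))\<^sup>2 \<partial>M)"
  proof (rule integral_mono[OF _ R(1)])
    show "e\<^sup>2 * indicator ?A \<omega> \<le> (norm (R \<omega>))\<^sup>2" for \<omega>
      using e power_mono[of e "norm (R \<omega>)" 2] by (auto simp: indicator_def)
    show "integrable M (\<lambda>\<omega>. e\<^sup>2 * indicator ?A \<omega>)"
      by (intro integrable_mult_right integrable_real_indicator A) (simp add: less_top[symmetric])
  qed
  finally show ?thesis using c e by (simp add: field_simps)
qed

lemma (in prob_space) normalized_sum_moment:
  fixes Y :: "nat \<Rightarrow> 'a \<Rightarrow> 'b::{real_inner, second_countable_topology}"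
  assumes ind: "indep_vars (\<lambda>_. borel) Y UNIV"
    and bd: "\<And>i \<omega>. \<omega> \<in> space M \<Longrightarrow> norm (Y i \<omega>) \<le> K"
    and cent: "\<And>i h. (\<integral>\<omega>. Y i \<omega> \<bullet> h \<partial>M) = 0"
    and c: "\<And>i. (\<integral>\<omega>. (norm (Y i \<omega>))\<^sup>2 \<partial>M) \<le> c" "0 \<le> c"
  shows "integrable M (\<lambda>\<omega>. (norm ((1 / sqrt (real n)) *\<^sub>R (\<Sum>i<n. Y i \<omega>)))\<^sup>2)"
    and "(\<integral>\<omega>. (norm ((1 / sqrt (real n)) *\<^sub>R (\<Sum>i<n. Y i \<omega>)))\<^sup>2 \<partial>M) \<le> c"
proof -
  note sm = second_moment_sum[where n = n, OF ind bd cent]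
  have eq: "(norm ((1 / sqrt (real n)) *\<^sub>R (\<Sum>i<n. Y i \<omega>)))\<^sup>2 = (1 / real n) * (norm (\<Sum>i<n. Y i \<omega>))\<^sup>2" for \<omega>
    by (simp add: power_mult_distrib power_divide)
  show "integrable M (\<lambda>\<omega>. (norm ((1 / sqrt (real n)) *\<^sub>R (\<Sum>i<n. Y i \<omega>)))\<^sup>2)"
    unfolding eq by (intro integrable_mult_right sm(2))
  have "(\<integral>\<omega>. (norm ((1 / sqrt (real n)) *\<^sub>R (\<Sum>i<n. Y i \<omega>)))\<^sup>2 \<partial>M) = (1 / real n) * (\<Sum>i<n. \<integral>\<omega>. (norm (Y i \<omega>))\<^sup>2 \<partial>M)"
    by (simp only: eq integral_mult_right_zero sm(1))
  also have "\<dots> \<le> (1 / real n) * (\<Sum>i<n. c)" by (intro mult_left_mono sum_mono c) auto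
  \<comment> \<open>For n = 0 the factor 1 / real n is 0, and the bound rests on c >= 0.\<close>
  also have "\<dots> \<le> c" using c(2) by (cases "n = 0") auto
  finally show "(\<integral>\<omega>. (norm ((1 / sqrt (real n)) *\<^sub>R (\<Sum>i<n. Y i \<omega>)))\<^sup>2 \<partial>M) \<le> c" .
qed

locale hilbert_iid = prob_space M for M :: "'a measure" +
  fixes Y :: "nat \<Rightarrow> 'a \<Rightarrow> 'h::{real_inner, polish_space}" and B :: real
  assumes indY: "indep_vars (\<lambda>_. borel) Y UNIV"
    and lawY: "\<And>i. distr M borel (Y i) = distr M borel (Y 0)"
    and bdY: "\<And>i \<omega>. \<omega> \<in> space M \<Longrightarrow> norm (Y i \<omega>) \<le> B"
    and centY: "\<And>i h. (\<integral>\<omega>. Y i \<omega> \<bullet> h \<partial>M) = 0"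
begin

lemma measY[measurable]: "Y i \<in> borel_measurable M"
  using indY unfolding indep_vars_def by auto

definition S :: "nat \<Rightarrow> 'a \<Rightarrow> 'h" where "S n \<omega> = (1 / sqrt (real n)) *\<^sub>R (\<Sum>i<n. Y i \<omega>)"

lemma measS[measurable]: "S n \<in> borel_measurable M"
  unfolding S_def by measurable

lemma integral_Y_cong:
  fixes g :: "'h \<Rightarrow> real"
  assumes "g \<in> borel_measurable borel"
  shows "(\<integral>\<omega>. g (Y i \<omega>) \<partial>M) = (\<integral>\<omega>. g (Y 0 \<omega>) \<partial>M)"
  using integral_distr[OF measY assms, of i] integral_distr[OF measY assms, of 0] lawY[of i] by simp

text \<open>Each summand is a finitely valued part plus a remainder of small second moment.
  Independence keeps the normalized remainders small for all n, and the normalized finitely valued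
  parts lie, with high probability, in the compact set of combinations of finitely many vectors with
  bounded coefficients.\<close>

lemma tight_near:
  assumes e: "0 < e"
  shows "\<exists>C. compact C \<and> C \<noteq> {} \<and> (\<forall>n. prob {\<omega> \<in> space M. e < infdist (S n \<omega>) C} \<le> e)"
proof -
  obtain F :: "nat \<Rightarrow> 'h \<Rightarrow> 'h" where F: "\<And>i. simple_function borel (F i)" "\<And>x. (\<lambda>i. F i x) \<longlonglongrightarrow> x"
    "\<And>i x. norm (F i x) \<le> 2 * norm x" using ex_simple_identity by blast
  have Fm[measurable]: "F i \<in> borel_measurable borel" for i using F(1) by (rule borel_measurable_simple_function)
  obtain \<omega>0 where "\<omega>0 \<in> space M" using not_empty by blast
  then have B: "0 \<le> B" using bdY[of \<omega>0 0] norm_ge_zero[of "Y 0 \<omega>0"] by linarith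
  have FB: "norm (F k (Y i \<omega>)) \<le> 2 * B" if "\<omega> \<in> space M" for k i \<omega>
    using F(3)[of k "Y i \<omega>"] bdY[OF that, of i] by linarith
  have dB: "norm (Y i \<omega> - F k (Y i \<omega>)) \<le> 3 * B" if "\<omega> \<in> space M" for k i \<omega>
    using norm_triangle_ineq4[of "Y i \<omega>" "F k (Y i \<omega>)"] bdY[OF that, of i] FB[OF that, of k i] by linarith
  have int_d: "integrable M (\<lambda>\<omega>. norm (Y i \<omega> - F k (Y i \<omega>)))" "integrable M (\<lambda>\<omega>. (norm (Y i \<omega> - F k (Y i \<omega>)))\<^sup>2)" for i k
  proof -
    show "integrable M (\<lambda>\<omega>. norm (Y i \<omega> - F k (Y i \<omega>)))"
      by (rule integrable_bounded[of _ "3 * B"]) (use dB in auto)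
    show "integrable M (\<lambda>\<omega>. (norm (Y i \<omega> - F k (Y i \<omega>)))\<^sup>2)"
    proof (rule integrable_bounded)
      show "\<bar>(norm (Y i \<omega> - F k (Y i \<omega>)))\<^sup>2\<bar> \<le> (3 * B)\<^sup>2" if "\<omega> \<in> space M" for \<omega>
        using power_mono[OF dB[OF that, of i k], of 2] by simp
    qed measurable
  qed
  have "(\<lambda>k. \<integral>\<omega>. (norm (Y 0 \<omega> - F k (Y 0 \<omega>)))\<^sup>2 \<partial>M) \<longlonglongrightarrow> (\<integral>\<omega>. 0 \<partial>M)"
  proof (rule integral_dominated_convergence[where w = "\<lambda>_. (3 * B)\<^sup>2"])
    show "AE \<omega> in M. (\<lambda>k. (norm (Y 0 \<omega> - F k (Y 0 \<omega>)))\<^sup>2) \<longlonglongrightarrow> 0"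
    proof (rule AE_I2)
      fix \<omega>
      have "(\<lambda>k. (norm (Y 0 \<omega> - F k (Y 0 \<omega>)))\<^sup>2) \<longlonglongrightarrow> (norm (Y 0 \<omega> - Y 0 \<omega>))\<^sup>2"
        by (intro tendsto_intros F(2))
      then show "(\<lambda>k. (norm (Y 0 \<omega> - F k (Y 0 \<omega>)))\<^sup>2) \<longlonglongrightarrow> 0" by simp
    qed
    show "AE \<omega> in M. norm ((norm (Y 0 \<omega> - F k (Y 0 \<omega>)))\<^sup>2) \<le> (3 * B)\<^sup>2" for k
      using AE_space
    proof eventually_elim
      case (elim \<omega>)
      then show ?case using power_mono[OF dB[OF elim, of 0 k], of 2] by simp
    qed
  qed auto
  then have lim: "(\<lambda>k. \<integral>\<omega>. (norm (Y 0 \<omega> - F k (Y 0 \<omega>)))\<^sup>2 \<partial>M) \<longlonglongrightarrow> 0" by simp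
  \<comment> \<open>Chebyshev bounds the remainder by 4 \<eta>^2 / e^2, which is e / 2 for this
    choice.\<close>
  define \<eta> where "\<eta> = sqrt (e ^ 3 / 8)"
  have \<eta>: "0 < \<eta>" "\<eta>\<^sup>2 = e ^ 3 / 8" using e by (auto simp: \<eta>_def)
  have "\<forall>\<^sub>F k in sequentially. (\<integral>\<omega>. (norm (Y 0 \<omega> - F k (Y 0 \<omega>)))\<^sup>2 \<partial>M) < \<eta>\<^sup>2"
    using \<eta>(1) by (intro order_tendstoD(2)[OF lim]) simp
  then obtain k where k0: "(\<integral>\<omega>. (norm (Y 0 \<omega> - F k (Y 0 \<omega>)))\<^sup>2 \<partial>M) < \<eta>\<^sup>2" unfolding eventually_sequentially by blast
  have k2: "(\<integral>\<omega>. (norm (Y i \<omega> - F k (Y i \<omega>)))\<^sup>2 \<partial>M) \<le> \<eta>\<^sup>2" for i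
    using k0 integral_Y_cong[of "\<lambda>x. (norm (x - F k x))\<^sup>2" i] by simp
  have k1: "(\<integral>\<omega>. norm (Y i \<omega> - F k (Y i \<omega>)) \<partial>M) \<le> \<eta>" for i
    using expectation_abs_le_sqrt[OF int_d \<eta>(1) k2[of i]] by simp
  define R where "R = range (F k)"
  have R: "finite R" using F(1)[of k] by (simp add: simple_function_def R_def)
  have [measurable]: "{x. F k x = y} \<in> sets borel" for y by measurable
  define I where "I y x = (indicator {x. F k x = y} x :: real)" for y x
  have Im[measurable]: "I y \<in> borel_measurable borel" for y unfolding I_def by measurable
  have Ib: "\<bar>I y x\<bar> \<le> 1" for y x by (auto simp: I_def indicator_def)
  define p where "p y = (\<integral>\<omega>. I y (Y 0 \<omega>) \<partial>M)" for y
  have mean: "(\<integral>\<omega>. I y (Y i \<omega>) \<partial>M) = p y" for i y unfolding p_def by (rule integral_Y_cong) measurable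
  have int_I: "integrable M (\<lambda>\<omega>. I y (Y i \<omega>))" for i y
    by (rule integrable_bounded[of _ 1]) (use Ib in auto)
  have p: "0 \<le> p y" "p y \<le> 1" for y
  proof -
    show "0 \<le> p y" unfolding p_def by (intro Bochner_Integration.integral_nonneg) (auto simp: I_def)
    have "p y \<le> (\<integral>\<omega>. 1 \<partial>M)" unfolding p_def
      by (intro integral_mono int_I) (auto simp: I_def indicator_def)
    then show "p y \<le> 1" by (simp add: prob_space)
  qed
  define m where "m = (\<Sum>y\<in>R. p y *\<^sub>R y)"
  have FI: "F k x = (\<Sum>y\<in>R. I y x *\<^sub>R y)" for x
  proof -
    have "(\<Sum>y\<in>R. I y x *\<^sub>R y) = (\<Sum>y\<in>{F k x}. I y x *\<^sub>R y)"
      by (rule sum.mono_neutral_right[OF R]) (auto simp: R_def I_def)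
    then show ?thesis by (simp add: I_def)
  qed
  have Fmean: "(\<integral>\<omega>. F k (Y i \<omega>) \<bullet> h \<partial>M) = m \<bullet> h" for i h
    unfolding FI m_def by (simp add: inner_sum_left Bochner_Integration.integral_sum int_I mean)
  have int_Y: "integrable M (\<lambda>\<omega>. Y i \<omega> \<bullet> h)" for i h
    by (rule integrable_bounded[of _ "B * norm h"]) (use abs_inner_le[OF bdY] in auto)
  have int_F: "integrable M (\<lambda>\<omega>. F k (Y i \<omega>) \<bullet> h)" for i h
    by (rule integrable_bounded[of _ "2 * B * norm h"]) (use abs_inner_le[OF FB] in auto)
  \<comment> \<open>As the summands are centred, the mean of the finitely valued part is no larger
    than its L1 distance from them.\<close>
  have m\<eta>: "norm m \<le> \<eta>"
  proof (cases "m = 0")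
    case False
    have "norm m * norm m = (\<integral>\<omega>. F k (Y 0 \<omega>) \<bullet> m \<partial>M) - (\<integral>\<omega>. Y 0 \<omega> \<bullet> m \<partial>M)"
      unfolding Fmean centY by (simp add: dot_square_norm power2_eq_square)
    also have "\<dots> = (\<integral>\<omega>. (F k (Y 0 \<omega>) - Y 0 \<omega>) \<bullet> m \<partial>M)"
      using int_F int_Y by (simp add: inner_diff_left)
    also have "\<dots> \<le> (\<integral>\<omega>. norm (Y 0 \<omega> - F k (Y 0 \<omega>)) * norm m \<partial>M)"
    proof (rule integral_mono)
      show "integrable M (\<lambda>\<omega>. (F k (Y 0 \<omega>) - Y 0 \<omega>) \<bullet> m)" using int_F int_Y by (simp add: inner_diff_left)
      show "integrable M (\<lambda>\<omega>. norm (Y 0 \<omega> - F k (Y 0 \<omega>)) * norm m)" by (intro integrable_mult_left int_d)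
      show "(F k (Y 0 \<omega>) - Y 0 \<omega>) \<bullet> m \<le> norm (Y 0 \<omega> - F k (Y 0 \<omega>)) * norm m" for \<omega>
        using norm_cauchy_schwarz[of "F k (Y 0 \<omega>) - Y 0 \<omega>" m] by (simp add: norm_minus_commute)
    qed
    also have "\<dots> = (\<integral>\<omega>. norm (Y 0 \<omega> - F k (Y 0 \<omega>)) \<partial>M) * norm m" by simp
    also have "\<dots> \<le> \<eta> * norm m" using k1 by (intro mult_right_mono) auto
    finally show ?thesis using False by simp
  qed (use \<eta> in simp)
  \<comment> \<open>Adding \<open>m\<close> recentres the remainder, as the second moment
    computation requires; the matching centring of the indicators is in \<open>J\<close>.\<close>
  define D where "D i \<omega> = Y i \<omega> - F k (Y i \<omega>) + m" for i \<omega>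
  have indD: "indep_vars (\<lambda>_. borel) D UNIV"
    unfolding D_def[abs_def] by (rule indep_vars_compose2[OF indY, where Y = "\<lambda>_ x. x - F k x + m"]) measurable
  have bdD: "norm (D i \<omega>) \<le> 3 * B + norm m" if "\<omega> \<in> space M" for i \<omega>
    unfolding D_def using norm_triangle_ineq[of "Y i \<omega> - F k (Y i \<omega>)" m] dB[OF that, of i k] by linarith
  have centD: "(\<integral>\<omega>. D i \<omega> \<bullet> h \<partial>M) = 0" for i h
    using int_Y int_F by (simp add: D_def inner_add_left inner_diff_left Fmean centY prob_space)
  have sqD: "(\<integral>\<omega>. (norm (D i \<omega>))\<^sup>2 \<partial>M) \<le> 4 * \<eta>\<^sup>2" for i
  proof -
    have "(\<integral>\<omega>. (norm (D i \<omega>))\<^sup>2 \<partial>M) \<le> (\<integral>\<omega>. 2 * (norm (Y i \<omega> - F k (Y i \<omega>)))\<^sup>2 + 2 * (norm m)\<^sup>2 \<partial>M)"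
    proof (rule integral_mono)
      show "integrable M (\<lambda>\<omega>. (norm (D i \<omega>))\<^sup>2)"
      proof (rule integrable_bounded)
        show "(\<lambda>\<omega>. (norm (D i \<omega>))\<^sup>2) \<in> borel_measurable M" unfolding D_def by measurable
        show "\<bar>(norm (D i \<omega>))\<^sup>2\<bar> \<le> (3 * B + norm m)\<^sup>2" if "\<omega> \<in> space M" for \<omega>
          using power_mono[OF bdD[OF that, of i], of 2] by simp
      qed
      show "integrable M (\<lambda>\<omega>. 2 * (norm (Y i \<omega> - F k (Y i \<omega>)))\<^sup>2 + 2 * (norm m)\<^sup>2)"
        by (intro Bochner_Integration.integrable_add integrable_mult_right int_d integrable_const)
      fix \<omega>
      have "(norm (D i \<omega>))\<^sup>2 \<le> (norm (Y i \<omega> - F k (Y i \<omega>)) + norm m)\<^sup>2"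
        unfolding D_def by (intro power_mono norm_triangle_ineq) auto
      also have "(x + y)\<^sup>2 \<le> 2 * x\<^sup>2 + 2 * y\<^sup>2" for x y :: real
        using zero_le_power2[of "x - y"] by (simp add: power2_eq_square algebra_simps)
      finally show "(norm (D i \<omega>))\<^sup>2 \<le> 2 * (norm (Y i \<omega> - F k (Y i \<omega>)))\<^sup>2 + 2 * (norm m)\<^sup>2" .
    qed
    also have "\<dots> = 2 * (\<integral>\<omega>. (norm (Y i \<omega> - F k (Y i \<omega>)))\<^sup>2 \<partial>M) + 2 * (norm m)\<^sup>2"
      using int_d by (simp add: prob_space)
    also have "\<dots> \<le> 2 * \<eta>\<^sup>2 + 2 * \<eta>\<^sup>2"
      using k2[of i] power_mono[OF m\<eta>, of 2] by (intro add_mono mult_left_mono) auto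
    finally show ?thesis by simp
  qed
  note Dm = normalized_sum_moment[OF indD bdD centD sqD]
  define J where "J y i \<omega> = I y (Y i \<omega>) - p y" for y i \<omega>
  have Jm[measurable]: "J y i \<in> borel_measurable M" for y i unfolding J_def by measurable
  have Jb: "\<bar>J y i \<omega>\<bar> \<le> 1" for y i \<omega>
    using p[of y] by (auto simp: J_def I_def indicator_def abs_le_iff)
  have indJ: "indep_vars (\<lambda>_. borel) (J y) UNIV" for y
    unfolding J_def[abs_def] by (rule indep_vars_compose2[OF indY, where Y = "\<lambda>_ x. I y x - p y"]) measurable
  have centJ: "(\<integral>\<omega>. J y i \<omega> \<bullet> h \<partial>M) = 0" for y i h
    using int_I[of y i] by (simp add: J_def mean prob_space)
  have sqJ: "(\<integral>\<omega>. (norm (J y i \<omega>))\<^sup>2 \<partial>M) \<le> 1" for y i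
  proof -
    have le: "(norm (J y i \<omega>))\<^sup>2 \<le> 1" for \<omega> using Jb[of y i \<omega>] by (simp add: abs_square_le_1)
    have "(\<integral>\<omega>. (norm (J y i \<omega>))\<^sup>2 \<partial>M) \<le> (\<integral>\<omega>. 1 \<partial>M)"
      by (rule integral_mono[OF integrable_bounded[of _ 1]]) (use le in auto)
    then show ?thesis by (simp add: prob_space)
  qed
  have bdJ: "norm (J y i \<omega>) \<le> 1" for y i \<omega> using Jb by simp
  define c where "c n y \<omega> = (1 / sqrt (real n)) *\<^sub>R (\<Sum>i<n. J y i \<omega>)" for n y \<omega>
  have cm: "integrable M (\<lambda>\<omega>. (norm (c n y \<omega>))\<^sup>2)" "(\<integral>\<omega>. (norm (c n y \<omega>))\<^sup>2 \<partial>M) \<le> 1" for n y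
    unfolding c_def by (rule normalized_sum_moment[OF indJ bdJ centJ sqJ]; simp)+
  \<comment> \<open>A union bound over \<open>R\<close> gives card R / b^2 <= e / 2; the added 1
    makes b positive at once.\<close>
  define b where "b = sqrt (2 * (real (card R) + 1) / e)"
  have b: "0 < b" "b\<^sup>2 = 2 * (real (card R) + 1) / e" using e by (auto simp: b_def intro!: divide_pos_pos add_nonneg_pos)
  define C where "C = {\<Sum>y\<in>R. c y *\<^sub>R y | c :: 'h \<Rightarrow> real. \<forall>y\<in>R. \<bar>c y\<bar> \<le> b}"
  have "(\<Sum>y\<in>R. (\<lambda>_. 0) y *\<^sub>R y) \<in> C" unfolding C_def using b(1) by (intro CollectI exI[of _ "\<lambda>_. 0"]) auto
  then have Cne: "C \<noteq> {}" by blast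
  have Cc: "compact C" unfolding C_def by (rule compact_bounded_combinations[OF R])
  have "prob {\<omega> \<in> space M. e < infdist (S n \<omega>) C} \<le> e" for n
  proof -
    define Rn where "Rn \<omega> = (1 / sqrt (real n)) *\<^sub>R (\<Sum>i<n. D i \<omega>)" for \<omega>
    have [measurable]: "D i \<in> borel_measurable M" for i unfolding D_def by measurable
    have [measurable]: "Rn \<in> borel_measurable M" "c n y \<in> borel_measurable M" for y unfolding Rn_def c_def by measurable
    let ?A = "{\<omega> \<in> space M. e < norm (Rn \<omega>)}" and ?E = "\<lambda>y. {\<omega> \<in> space M. b < norm (c n y \<omega>)}"
    have PA: "prob ?A \<le> e / 2"
    proof -
      have "prob ?A \<le> (4 * \<eta>\<^sup>2) / e\<^sup>2"
      proof (rule chebyshev_norm)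
        show "integrable M (\<lambda>\<omega>. (norm (Rn \<omega>))\<^sup>2)" unfolding Rn_def by (intro Dm(1) mult_nonneg_nonneg zero_le_power2) auto
        show "(\<integral>\<omega>. (norm (Rn \<omega>))\<^sup>2 \<partial>M) \<le> 4 * \<eta>\<^sup>2" unfolding Rn_def by (intro Dm(2) mult_nonneg_nonneg zero_le_power2) auto
      qed (use e in auto)
      also have "\<dots> = e / 2" unfolding \<eta>(2) using e by (simp add: power2_eq_square power3_eq_cube)
      finally show ?thesis .
    qed
    have PE: "prob (?E y) \<le> 1 / b\<^sup>2" for y by (rule chebyshev_norm) (use cm b in auto)
    have "{\<omega> \<in> space M. e < infdist (S n \<omega>) C} \<subseteq> ?A \<union> (\<Union>y\<in>R. ?E y)"
    proof
      fix \<omega> assume w: "\<omega> \<in> {\<omega> \<in> space M. e < infdist (S n \<omega>) C}"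
      show "\<omega> \<in> ?A \<union> (\<Union>y\<in>R. ?E y)"
      proof (rule ccontr)
        assume "\<omega> \<notin> ?A \<union> (\<Union>y\<in>R. ?E y)"
        then have n: "norm (Rn \<omega>) \<le> e" "\<And>y. y \<in> R \<Longrightarrow> \<bar>c n y \<omega>\<bar> \<le> b" using w by (auto simp: not_less)
        have "Y i \<omega> = D i \<omega> + (\<Sum>y\<in>R. J y i \<omega> *\<^sub>R y)" for i
          unfolding D_def J_def FI m_def by (simp add: scaleR_diff_left sum_subtractf)
        then have "(\<Sum>i<n. Y i \<omega>) = (\<Sum>i<n. D i \<omega>) + (\<Sum>y\<in>R. (\<Sum>i<n. J y i \<omega>) *\<^sub>R y)"
          by (simp add: sum.distrib scaleR_sum_left sum.swap[of _ R])
        then have S: "S n \<omega> = Rn \<omega> + (\<Sum>y\<in>R. c n y \<omega> *\<^sub>R y)"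
          unfolding S_def Rn_def c_def by (simp add: scaleR_add_right scaleR_sum_right)
        have "(\<Sum>y\<in>R. c n y \<omega> *\<^sub>R y) \<in> C" unfolding C_def using n(2) by (intro CollectI exI[of _ "\<lambda>y. c n y \<omega>"]) auto
        then have "infdist (S n \<omega>) C \<le> dist (S n \<omega>) (\<Sum>y\<in>R. c n y \<omega> *\<^sub>R y)" by (rule infdist_le)
        also have "\<dots> = norm (Rn \<omega>)" unfolding S by (simp add: dist_norm)
        finally show False using n(1) w by auto
      qed
    qed
    moreover have "?A \<union> (\<Union>y\<in>R. ?E y) \<in> sets M" by (intro sets.Un sets.finite_UN R) measurable
    ultimately have "prob {\<omega> \<in> space M. e < infdist (S n \<omega>) C} \<le> prob (?A \<union> (\<Union>y\<in>R. ?E y))"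
      by (rule finite_measure_mono)
    also have "\<dots> \<le> prob ?A + prob (\<Union>y\<in>R. ?E y)" using R by (intro measure_Un_le) auto
    also have "prob (\<Union>y\<in>R. ?E y) \<le> (\<Sum>y\<in>R. prob (?E y))" using R by (intro measure_UNION_le) auto
    also have "(\<Sum>y\<in>R. prob (?E y)) \<le> (\<Sum>y\<in>R. 1 / b\<^sup>2)" by (intro sum_mono PE)
    also have "\<dots> \<le> e / 2"
    proof -
      have "real (card R) * e \<le> (real (card R) + 1) * e" using e by simp
      then show ?thesis unfolding b(2) using e by (simp add: field_simps add_pos_nonneg)
    qed
    finally show ?thesis using PA by simp
  qed
  then show ?thesis using Cc Cne by blast
qed

lemma tight:
  assumes "0 < e"
  shows "\<exists>K. compact K \<and> (\<forall>n. prob {\<omega> \<in> space M. S n \<omega> \<notin> K} \<le> e)"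
  by (rule tight_if_near_compact[OF measS tight_near assms])

text \<open>The scalar theorem normalizes by the standard deviation, so the characteristic function
  is read off at sqrt v. If v = 0 the projections vanish almost surely and the limit is the constant
  1.\<close>

lemma char_limit:
  "(\<lambda>n. \<integral>\<omega>. iexp (S n \<omega> \<bullet> u) \<partial>M) \<longlonglongrightarrow> complex_of_real (exp (- (\<integral>\<omega>. (Y 0 \<omega> \<bullet> u)\<^sup>2 \<partial>M) / 2))"
proof -
  define v where "v = (\<integral>\<omega>. (Y 0 \<omega> \<bullet> u)\<^sup>2 \<partial>M)"
  have v0: "0 \<le> v" by (simp add: v_def)
  have vi: "(\<integral>\<omega>. (Y i \<omega> \<bullet> u)\<^sup>2 \<partial>M) = v" for i
    unfolding v_def by (rule integral_Y_cong) measurable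
  have int2: "integrable M (\<lambda>\<omega>. (Y i \<omega> \<bullet> u)\<^sup>2)" for i
  proof (rule integrable_bounded)
    show "\<bar>(Y i \<omega> \<bullet> u)\<^sup>2\<bar> \<le> (B * norm u)\<^sup>2" if "\<omega> \<in> space M" for \<omega>
      using power_mono[OF abs_inner_le[OF bdY[OF that], of i u], of 2] by simp
  qed measurable
  show ?thesis
  proof (cases "v = 0")
    case True
    have "AE \<omega> in M. \<forall>i. Y i \<omega> \<bullet> u = 0"
    proof (subst AE_all_countable, rule allI)
      fix i
      have "AE \<omega> in M. (Y i \<omega> \<bullet> u)\<^sup>2 = 0"
        using integral_nonneg_eq_0_iff_AE[OF int2[of i]] vi[of i] True by simp
      then show "AE \<omega> in M. Y i \<omega> \<bullet> u = 0" by simp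
    qed
    then have "(\<integral>\<omega>. iexp (S n \<omega> \<bullet> u) \<partial>M) = (\<integral>\<omega>. 1 \<partial>M)" for n
      by (intro integral_cong_AE) (auto elim!: eventually_mono simp: S_def inner_sum_left)
    then show ?thesis using True by (simp add: v_def prob_space)
  next
    case False
    then have v: "0 < v" using v0 by simp
    have "weak_conv_m (\<lambda>n. distr M borel (\<lambda>\<omega>. (\<Sum>i<n. Y i \<omega> \<bullet> u) / sqrt (real n * (sqrt v)\<^sup>2))) std_normal_distribution"
    proof (rule central_limit_theorem_zero_mean)
      show "indep_vars (\<lambda>i. borel) (\<lambda>i \<omega>. Y i \<omega> \<bullet> u) UNIV"
        by (rule indep_vars_compose2[OF indY, where Y = "\<lambda>_ x. x \<bullet> u"]) measurable
      show "expectation (\<lambda>\<omega>. Y n \<omega> \<bullet> u) = 0" for n by (rule centY)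
      then show "variance (\<lambda>\<omega>. Y n \<omega> \<bullet> u) = (sqrt v)\<^sup>2" for n using vi[of n] v by simp
      show "distr M borel (\<lambda>\<omega>. Y n \<omega> \<bullet> u) = distr (distr M borel (Y 0)) borel (\<lambda>x. x \<bullet> u)" for n
        unfolding lawY[of n, symmetric] by (subst distr_distr) (auto simp: o_def)
    qed (use v int2 in auto)
    then have "(\<lambda>n. char (distr M borel (\<lambda>\<omega>. (\<Sum>i<n. Y i \<omega> \<bullet> u) / sqrt (real n * (sqrt v)\<^sup>2))) (sqrt v)) \<longlonglongrightarrow> char std_normal_distribution (sqrt v)"
      by (intro levy_continuity1 real_distribution_distr real_dist_normal_dist) auto
    moreover have "char (distr M borel (\<lambda>\<omega>. (\<Sum>i<n. Y i \<omega> \<bullet> u) / sqrt (real n * (sqrt v)\<^sup>2))) (sqrt v) = (\<integral>\<omega>. iexp (S n \<omega> \<bullet> u) \<partial>M)" for n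
    proof -
      have "sqrt v * ((\<Sum>i<n. Y i \<omega> \<bullet> u) / sqrt (real n * (sqrt v)\<^sup>2)) = S n \<omega> \<bullet> u" for \<omega>
        using v by (simp add: S_def inner_sum_left real_sqrt_mult)
      then show ?thesis unfolding char_def by (subst integral_distr) (auto simp: of_real_mult[symmetric] simp del: of_real_mult)
    qed
    moreover have "char std_normal_distribution (sqrt v) = complex_of_real (exp (- v / 2))"
      unfolding char_std_normal_distribution using v by simp
    ultimately show ?thesis by (simp add: v_def)
  qed
qed

theorem hilbert_central_limit:
  "\<exists>L. prob_space L \<and> sets L = sets borel \<and>
    (\<forall>h. distr L borel (\<lambda>z. z \<bullet> h) = normal_law 0 (\<integral>\<omega>. (Y 0 \<omega> \<bullet> h)\<^sup>2 \<partial>M)) \<and>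
    (\<forall>(f :: 'h \<Rightarrow> real) K. continuous_on UNIV f \<longrightarrow> (\<forall>x. \<bar>f x\<bar> \<le> K) \<longrightarrow> (\<lambda>n. \<integral>\<omega>. f (S n \<omega>) \<partial>M) \<longlonglongrightarrow> (\<integral>z. f z \<partial>L))"
proof -
  obtain a :: "nat \<Rightarrow> 'h" where a: "summable (\<lambda>k. (norm (a k))\<^sup>2)"
    "\<And>u. (\<lambda>k. (a k \<bullet> u)\<^sup>2) sums (\<integral>\<omega>. (Y 0 \<omega> \<bullet> u)\<^sup>2 \<partial>M)"
    using covariance_series[OF measY bdY, of 0] by blast
  from ex_gaussian_series_law[OF a(1)] obtain L where pL: "prob_space L" "sets L = sets borel"
    and cL: "\<forall>u v. (\<lambda>k. (a k \<bullet> u)\<^sup>2) sums v \<longrightarrow> (\<integral>z. iexp (z \<bullet> u) \<partial>L) = complex_of_real (exp (- v / 2))"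
    by (elim exE conjE)
  note L = pL cL[rule_format, OF a(2)]
  have N: "distr L borel (\<lambda>z. z \<bullet> h) = normal_law 0 (\<integral>\<omega>. (Y 0 \<omega> \<bullet> h)\<^sup>2 \<partial>M)" for h
  proof (rule normal_law_from_char[OF L(1,2)])
    fix t
    have "(\<integral>\<omega>. (Y 0 \<omega> \<bullet> (t *\<^sub>R h))\<^sup>2 \<partial>M) = t\<^sup>2 * (\<integral>\<omega>. (Y 0 \<omega> \<bullet> h)\<^sup>2 \<partial>M)"
      by (simp add: power_mult_distrib)
    then show "(\<integral>z. iexp (z \<bullet> (t *\<^sub>R h)) \<partial>L) = complex_of_real (exp (- (t\<^sup>2 * (\<integral>\<omega>. (Y 0 \<omega> \<bullet> h)\<^sup>2 \<partial>M)) / 2))"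
      unfolding L(3) by (rule arg_cong)
  qed simp
  have W: "(\<lambda>n. \<integral>\<omega>. f (S n \<omega>) \<partial>M) \<longlonglongrightarrow> (\<integral>z. f z \<partial>L)" if "continuous_on UNIV f" "\<And>x. \<bar>f x\<bar> \<le> K" for f and K :: real
  proof (rule weak_convergence_from_char[where B = K])
    show "(\<lambda>n. \<integral>\<omega>. iexp (S n \<omega> \<bullet> u) \<partial>M) \<longlonglongrightarrow> (\<integral>z. iexp (z \<bullet> u) \<partial>L)" for u
      unfolding L(3) by (rule char_limit)
  qed (fact measS tight L that | rule tight, assumption)+
  show ?thesis
  proof (intro exI[of _ L] conjI allI impI L N)
    fix f :: "'h \<Rightarrow> real" and K
    assume f: "continuous_on UNIV f" "\<forall>x. \<bar>f x\<bar> \<le> K"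
    show "(\<lambda>n. \<integral>\<omega>. f (S n \<omega>) \<partial>M) \<longlonglongrightarrow> (\<integral>z. f z \<partial>L)" by (rule W[OF f(1)]) (rule f(2)[rule_format])
  qed
qed

end

subsection \<open>Smooth charts\<close>

lemma has_derivative_atI:
  assumes "bounded_linear f'"
    and "\<And>e. 0 < e \<Longrightarrow> \<forall>\<^sub>F y in at x. norm (f y - f x - f' (y - x)) \<le> e * norm (y - x)"
  shows "(f has_derivative f') (at x)"
  unfolding has_derivative_at_alt
proof (intro conjI allI impI)
  interpret bounded_linear f' by fact
  fix e :: real assume "0 < e"
  from assms(2)[OF this] obtain d where d: "d > 0"
    "\<And>y. y \<noteq> x \<Longrightarrow> dist y x < d \<Longrightarrow> norm (f y - f x - f' (y - x)) \<le> e * norm (y - x)"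
    unfolding eventually_at by auto
  have "norm (f y - f x - f' (y - x)) \<le> e * norm (y - x)" if "norm (y - x) < d" for y
    using d(2)[of y] that zero by (cases "y = x") (auto simp: dist_norm)
  then show "\<exists>d>0. \<forall>y. norm (y - x) < d \<longrightarrow> norm (f y - f x - f' (y - x)) \<le> e * norm (y - x)"
    using d(1) by blast
qed fact

lemma has_derivative_atD:
  assumes "(f has_derivative f') (at x)" "0 < e"
  shows "\<exists>d>0. \<forall>y. norm (y - x) < d \<longrightarrow> norm (f y - f x - f' (y - x)) \<le> e * norm (y - x)"
  using assms unfolding has_derivative_at_alt by blast

text \<open>Passes from list-encoded multilinear derivatives to nested bounded operators, to which
  chain and product rules apply. For k = 0 and k = 1 the remainder estimate is already the one in
  operator norm.\<close>

lemma smooth_on_open_derivatives: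
  fixes f :: "'a::real_normed_vector \<Rightarrow> 'b::real_normed_vector"
  assumes "smooth_on_open S f"
  shows "\<exists>(A :: 'a \<Rightarrow> 'a \<Rightarrow>\<^sub>L 'b) (A2 :: 'a \<Rightarrow> 'a \<Rightarrow>\<^sub>L 'a \<Rightarrow>\<^sub>L 'b).
    \<forall>x\<in>S. (f has_derivative blinfun_apply (A x)) (at x) \<and> (A has_derivative blinfun_apply (A2 x)) (at x)"
proof -
  have S: "open S" using assms unfolding smooth_on_open_def by (rule conjunct1)
  from assms[unfolded smooth_on_open_def, THEN conjunct2] obtain D where
    *: "(\<forall>x\<in>S. D 0 x [] = f x) \<and> (\<forall>k. \<forall>x\<in>S. bounded_multilinear k (D k x)) \<and>
      (\<forall>k. \<forall>x\<in>S. \<forall>\<epsilon>>0. \<forall>\<^sub>F y in at x. \<forall>vs. length vs = k \<longrightarrow>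
        norm (D k y vs - D k x vs - D (Suc k) x ((y - x) # vs)) \<le> \<epsilon> * norm (y - x) * prod_list (map norm vs))"
    by (rule exE)
  have D0: "\<And>x. x \<in> S \<Longrightarrow> D 0 x [] = f x"
    and ml: "\<And>k x. x \<in> S \<Longrightarrow> bounded_multilinear k (D k x)"
    and ev: "\<And>k x e. x \<in> S \<Longrightarrow> 0 < e \<Longrightarrow> \<forall>\<^sub>F y in at x. \<forall>vs. length vs = k \<longrightarrow>
        norm (D k y vs - D k x vs - D (Suc k) x ((y - x) # vs)) \<le> e * norm (y - x) * prod_list (map norm vs)"
    using * by simp_all
  define A where "A x = Blinfun (\<lambda>h. D 1 x [h])" for x
  define A2 where "A2 x = Blinfun (\<lambda>h. Blinfun (\<lambda>k. D 2 x [h, k]))" for x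
  have mlin: "linear (\<lambda>v. D k x (vs[i := v]))" if "x \<in> S" "length vs = k" "i < k" for x vs k i
    using ml[OF that(1), of k, unfolded bounded_multilinear_def, THEN conjunct1, rule_format, OF conjI[OF that(2,3)]] .
  have lin1: "linear (\<lambda>v. D 1 x [v])" if "x \<in> S" for x
    using mlin[OF that, of "[0]" 1 0] by simp
  have bl1: "bounded_linear (\<lambda>v. D 1 x [v])" if x: "x \<in> S" for x
  proof -
    obtain C where C: "\<And>vs. length vs = 1 \<Longrightarrow> norm (D 1 x vs) \<le> C * prod_list (map norm vs)"
      using ml[OF x, of 1] unfolding bounded_multilinear_def by auto
    have "norm (D 1 x [v]) \<le> norm v * C" for v using C[of "[v]"] by (simp add: mult.commute)
    with lin1[OF x] show ?thesis by (auto simp: bounded_linear_def bounded_linear_axioms_def)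
  qed
  have A: "A x h = D 1 x [h]" if "x \<in> S" for x h
    unfolding A_def bounded_linear_Blinfun_apply[OF bl1[OF that]] ..
  have lin2: "linear (\<lambda>k. D 2 x [h, k])" "linear (\<lambda>h. D 2 x [h, k])" if "x \<in> S" for x h k
  proof -
    have "linear (\<lambda>v. D 2 x ([h, k][1 := v]))" "linear (\<lambda>v. D 2 x ([h, k][0 := v]))"
      by (rule mlin[OF that]; simp)+
    then show "linear (\<lambda>k. D 2 x [h, k])" "linear (\<lambda>h. D 2 x [h, k])" by simp_all
  qed
  have bd2: "\<exists>C\<ge>0. \<forall>h k. norm (D 2 x [h, k]) \<le> C * norm h * norm k" if x: "x \<in> S" for x
  proof -
    obtain C where C: "\<And>vs. length vs = 2 \<Longrightarrow> norm (D 2 x vs) \<le> C * prod_list (map norm vs)"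
      using ml[OF x, of 2] unfolding bounded_multilinear_def by auto
    have "norm (D 2 x [h, k]) \<le> \<bar>C\<bar> * norm h * norm k" for h k
    proof -
      have "norm (D 2 x [h, k]) \<le> C * (norm h * norm k)" using C[of "[h, k]"] by simp
      also have "\<dots> \<le> \<bar>C\<bar> * (norm h * norm k)" by (intro mult_right_mono) auto
      finally show ?thesis by (simp add: mult.assoc)
    qed
    then show ?thesis by (intro exI[of _ "\<bar>C\<bar>"]) auto
  qed
  have bl2: "bounded_linear (\<lambda>k. D 2 x [h, k])" if x: "x \<in> S" for x h
  proof -
    obtain C where C: "\<And>h k. norm (D 2 x [h, k]) \<le> C * norm h * norm k" using bd2[OF x] by blast
    have "norm (D 2 x [h, k]) \<le> norm k * (C * norm h)" for k using C[of h k] by (simp add: mult.commute)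
    with lin2(1)[OF x] show ?thesis by (auto simp: bounded_linear_def bounded_linear_axioms_def)
  qed
  have B2: "blinfun_apply (Blinfun (\<lambda>k. D 2 x [h, k])) k = D 2 x [h, k]" if "x \<in> S" for x h k
    by (simp add: bounded_linear_Blinfun_apply[OF bl2[OF that]])
  have bl3: "bounded_linear (\<lambda>h. Blinfun (\<lambda>k. D 2 x [h, k]))" if x: "x \<in> S" for x
  proof -
    obtain C where C: "C \<ge> 0" "\<And>h k. norm (D 2 x [h, k]) \<le> C * norm h * norm k" using bd2[OF x] by blast
    show ?thesis
    proof (rule bounded_linear_intro)
      show "Blinfun (\<lambda>k. D 2 x [h + h', k]) = Blinfun (\<lambda>k. D 2 x [h, k]) + Blinfun (\<lambda>k. D 2 x [h', k])" for h h'
        by (rule blinfun_eqI) (unfold plus_blinfun.rep_eq B2[OF x], rule linear_add[OF lin2(2)[OF x]])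
      show "Blinfun (\<lambda>k. D 2 x [r *\<^sub>R h, k]) = r *\<^sub>R Blinfun (\<lambda>k. D 2 x [h, k])" for r h
        by (rule blinfun_eqI) (unfold scaleR_blinfun.rep_eq B2[OF x], rule linear_scale[OF lin2(2)[OF x]])
      show "norm (Blinfun (\<lambda>k. D 2 x [h, k])) \<le> norm h * C" for h
        using C by (intro norm_blinfun_bound) (auto simp: B2[OF x] mult.commute)
    qed
  qed
  have A2: "A2 x h k = D 2 x [h, k]" if "x \<in> S" for x h k
    unfolding A2_def by (simp add: bounded_linear_Blinfun_apply[OF bl3[OF that]] B2[OF that])
  have evS: "\<forall>\<^sub>F y in at x. y \<in> S" if "x \<in> S" for x
    using S that by (rule eventually_at_in_open')
  show ?thesis
  proof (intro exI ballI conjI)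
    fix x assume x: "x \<in> S"
    show "(f has_derivative A x) (at x)"
    proof (rule has_derivative_atI)
      fix e :: real assume "0 < e"
      from ev[OF x this, of 0] evS[OF x]
      show "\<forall>\<^sub>F y in at x. norm (f y - f x - A x (y - x)) \<le> e * norm (y - x)"
        by eventually_elim (use x in \<open>simp add: D0 A\<close>)
    qed (rule blinfun.bounded_linear_right)
    show "(A has_derivative A2 x) (at x)"
    proof (rule has_derivative_atI)
      fix e :: real assume e: "0 < e"
      from ev[OF x this, of 1] evS[OF x]
      show "\<forall>\<^sub>F y in at x. norm (A y - A x - A2 x (y - x)) \<le> e * norm (y - x)"
      proof eventually_elim
        case (elim y)
        have "norm (D 1 y [v] - D 1 x [v] - D 2 x [y - x, v]) \<le> e * norm (y - x) * norm v" for v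
          using elim(1)[rule_format, of "[v]"] by (simp add: numeral_2_eq_2)
        then show ?case using e x elim(2)
          by (intro norm_blinfun_bound) (auto simp: minus_blinfun.rep_eq A A2)
      qed
    qed (rule blinfun.bounded_linear_right)
  qed
qed

lemma frechet_deriv_eq:
  assumes "(f has_derivative blinfun_apply D) (at x)"
  shows "frechet_deriv f x = D"
  unfolding frechet_deriv_def
proof (rule the_equality[where P = "\<lambda>D. (f has_derivative blinfun_apply D) (at x)", OF assms])
  fix D' assume "(f has_derivative blinfun_apply D') (at x)"
  then have "blinfun_apply D' = blinfun_apply D" using assms has_derivative_unique by blast
  then show "D' = D" by (simp add: blinfun_apply_inject)
qed

lemma sqarc_has_derivative_within:
  assumes s: "s \<in> {-1/2..1}"
  shows "(sqarc has_derivative (\<lambda>h. dsqarc s * h)) (at s within {-1/2..1})"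
  unfolding has_derivative_within_alt
proof (intro conjI allI impI)
  fix e :: real assume "0 < e"
  from sqarc_expansion[OF this] s
  show "\<exists>d>0. \<forall>y\<in>{-1/2..1}. norm (y - s) < d \<longrightarrow> norm (sqarc y - sqarc s - dsqarc s * (y - s)) \<le> e * norm (y - s)"
    unfolding real_norm_def by meson
qed (rule bounded_linear_mult_right)

text \<open>At x = \<sigma> e the inner product attains 1, where the squared arc cosine has only a
  one-sided derivative. As the inner function never leaves \<open>I\<close>, the composition is
  still differentiable in the full sense.\<close>

lemma has_derivative_compose_within:
  fixes t :: "'e::real_normed_vector \<Rightarrow> real"
  assumes t: "(t has_derivative t') (at e)" and V: "open V" "e \<in> V" "t ` V \<subseteq> I"
    and F: "(F has_derivative F') (at (t e) within I)"
  shows "((\<lambda>e. F (t e)) has_derivative (\<lambda>h. F' (t' h))) (at e)"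
proof -
  have "((\<lambda>e. F (t e)) has_derivative (\<lambda>h. F' (t' h))) (at e within V)"
    by (rule has_derivative_in_compose[OF has_derivative_at_withinI[OF t] has_derivative_subset[OF F V(3)]])
  then show ?thesis unfolding at_within_open[OF V(2,1)] .
qed

lemma norm_inner_compose: "norm (blinfun_inner_right x o\<^sub>L B) \<le> norm x * norm B"
proof -
  have "norm (blinfun_inner_right x) \<le> norm x"
    by (rule norm_blinfun_bound) (auto simp: Cauchy_Schwarz_ineq2)
  then have "norm (blinfun_inner_right x) * norm B \<le> norm x * norm B" by (rule mult_right_mono) simp
  then show ?thesis using norm_blinfun_compose[of "blinfun_inner_right x" B] by linarith
qed

section \<open>Geometry of a chart of the sphere\<close>

locale sphere_chart =
  fixes U :: "'h::{real_inner, polish_space} set" and \<tau> :: "'h \<Rightarrow> 'e::{real_inner, complete_space}" and \<mu> :: 'h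
    and A :: "'e \<Rightarrow> 'e \<Rightarrow>\<^sub>L 'h" and A2 :: "'e \<Rightarrow>\<^sub>L 'e \<Rightarrow>\<^sub>L 'h"
  assumes chart: "smooth_chart U \<tau>" and mu: "\<mu> \<in> U"
    and derA: "\<And>e. e \<in> \<tau> ` U \<Longrightarrow> (inv_into U \<tau> has_derivative A e) (at e)"
    and derA2: "(A has_derivative A2) (at (\<tau> \<mu>))"

lemma ex_sphere_chart:
  assumes chart: "smooth_chart U \<tau>" and mu: "\<mu> \<in> U"
  obtains A A2 where "sphere_chart U \<tau> \<mu> A A2"
proof -
  have "smooth_on_open (\<tau> ` U) (inv_into U \<tau>)" using chart by (simp add: smooth_chart_def)
  from smooth_on_open_derivatives[OF this] obtain A A2 where
    "\<forall>x\<in>\<tau> ` U. (inv_into U \<tau> has_derivative blinfun_apply (A x)) (at x) \<and> (A has_derivative blinfun_apply (A2 x)) (at x)"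
    by (elim exE)
  then show ?thesis using chart mu by (intro that[of A "A2 (\<tau> \<mu>)"] sphere_chart.intro) auto
qed

context sphere_chart
begin

abbreviation "\<sigma> \<equiv> inv_into U \<tau>"
abbreviation "\<Omega> \<equiv> \<tau> ` U"
abbreviation "e0 \<equiv> \<tau> \<mu>"
abbreviation "A0 \<equiv> A e0"

lemma U_sphere: "x \<in> U \<Longrightarrow> norm x = 1"
  using chart unfolding smooth_chart_def openin_sphere_iff_rho by auto

lemma open_O: "open \<Omega>" using chart by (simp add: smooth_chart_def)

lemma e0_O: "e0 \<in> \<Omega>" using mu by simp

lemma homeo: "homeomorphism U \<Omega> \<tau> \<sigma>" using chart by (simp add: smooth_chart_def)

lemma \<sigma>_\<tau>: "x \<in> U \<Longrightarrow> \<sigma> (\<tau> x) = x" using homeo by (simp add: homeomorphism_def)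

lemma \<sigma>_U: "e \<in> \<Omega> \<Longrightarrow> \<sigma> e \<in> U" by (rule inv_into_into)

lemma \<sigma>_norm: "e \<in> \<Omega> \<Longrightarrow> norm (\<sigma> e) = 1" using \<sigma>_U U_sphere by blast

lemma \<tau>_extension:
  "\<exists>g Dg V. open V \<and> \<mu> \<in> V \<and> (\<forall>x\<in>U \<inter> V. g x = \<tau> x) \<and> (g has_derivative blinfun_apply Dg) (at \<mu>)"
proof -
  have "smooth_on_subset U \<tau>" using chart by (simp add: smooth_chart_def)
  then obtain V g where V: "\<mu> \<in> V" "smooth_on_open V g" "\<And>x. x \<in> U \<inter> V \<Longrightarrow> g x = \<tau> x"
    using mu unfolding smooth_on_subset_def by metis
  from smooth_on_open_derivatives[OF V(2)] obtain Dg D2g where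
    Dg: "\<forall>x\<in>V. (g has_derivative blinfun_apply (Dg x)) (at x) \<and> (Dg has_derivative blinfun_apply (D2g x)) (at x)"
    by (elim exE)
  show ?thesis
  proof (intro exI conjI ballI)
    show "open V" using V(2) by (simp add: smooth_on_open_def)
    show "(g has_derivative blinfun_apply (Dg \<mu>)) (at \<mu>)" using Dg V(1) by blast
  qed (use V in auto)
qed

text \<open>Near e0 the local extension g of the chart satisfies g (\<sigma> e) = e, so by the chain
  rule Dg is a bounded left inverse of \<open>A0\<close>. In infinite dimension this is more than
  injectivity, and it is what makes the Hessian coercive.\<close>

lemma A0_bounded_below: "\<exists>c>0. \<forall>h. c * norm h \<le> norm (A0 h)"
proof -
  from \<tau>_extension obtain g Dg V where V: "open V" "\<mu> \<in> V" "\<forall>x\<in>U \<inter> V. g x = \<tau> x"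
    "(g has_derivative blinfun_apply Dg) (at \<mu>)"
    by (elim exE conjE)
  have c: "isCont \<sigma> e0" using derA[OF e0_O] by (rule has_derivative_continuous)
  have "((\<lambda>e. g (\<sigma> e)) has_derivative (\<lambda>h. Dg (A0 h))) (at e0)"
    using has_derivative_compose[OF derA[OF e0_O], of g Dg] V(4) \<sigma>_\<tau>[OF mu] by simp
  moreover have "\<forall>\<^sub>F e in at e0. g (\<sigma> e) = e"
  proof -
    have "\<forall>\<^sub>F e in at e0. e \<in> \<Omega>" using open_O e0_O by (rule eventually_at_in_open')
    moreover have "\<forall>\<^sub>F e in at e0. \<sigma> e \<in> V"
      using c V(1,2) \<sigma>_\<tau>[OF mu] unfolding isCont_def by (intro topological_tendstoD) auto
    ultimately show ?thesis
    proof eventually_elim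
      case (elim e)
      then have "g (\<sigma> e) = \<tau> (\<sigma> e)" using \<sigma>_U by (intro V(3)[rule_format]) auto
      then show ?case using f_inv_into_f[OF elim(1)] by simp
    qed
  qed
  ultimately have "((\<lambda>e. e) has_derivative (\<lambda>h. Dg (A0 h))) (at e0)"
    using V(2,3) mu \<sigma>_\<tau>[OF mu] by (intro has_derivative_transform_eventually[of "\<lambda>e. g (\<sigma> e)" _ e0 UNIV "\<lambda>e. e"]) auto
  then have "(\<lambda>h. Dg (A0 h)) = (\<lambda>h. h)" by (rule has_derivative_unique) (rule has_derivative_ident)
  then have id: "Dg (A0 h) = h" for h by (rule fun_cong)
  have pos: "norm Dg + 1 > 0" by (simp add: add_nonneg_pos)
  have "1 / (norm Dg + 1) * norm h \<le> norm (A0 h)" for h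
  proof -
    have "norm h \<le> norm Dg * norm (A0 h)" using norm_blinfun[of Dg "A0 h"] by (simp add: id)
    also have "\<dots> \<le> (norm Dg + 1) * norm (A0 h)" by (intro mult_right_mono) auto
    finally show ?thesis using pos by (simp add: field_simps)
  qed
  then show ?thesis using pos by (intro exI[of _ "1 / (norm Dg + 1)"]) auto
qed

text \<open>Differentiability of an ambient extension at \<mu> bounds the displacement in the chart
  by the ambient distance, in which the sample mean is controlled.\<close>

lemma \<tau>_lipschitz_at: "\<exists>C>0. \<exists>d>0. \<forall>p\<in>U. norm (p - \<mu>) < d \<longrightarrow> norm (\<tau> p - e0) \<le> C * norm (p - \<mu>)"
proof -
  from \<tau>_extension obtain g Dg V where V: "open V" "\<mu> \<in> V" "\<forall>x\<in>U \<inter> V. g x = \<tau> x"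
    "(g has_derivative blinfun_apply Dg) (at \<mu>)"
    by (elim exE conjE)
  obtain d1 where d1: "d1 > 0" "\<And>y. dist y \<mu> < d1 \<Longrightarrow> y \<in> V" using V(1,2) unfolding open_dist by blast
  obtain d2 where d2: "d2 > 0" "\<And>y. norm (y - \<mu>) < d2 \<Longrightarrow> norm (g y - g \<mu> - Dg (y - \<mu>)) \<le> 1 * norm (y - \<mu>)"
    using has_derivative_atD[OF V(4), of 1] by auto
  have "norm (\<tau> p - e0) \<le> (norm Dg + 1) * norm (p - \<mu>)" if p: "p \<in> U" "norm (p - \<mu>) < min d1 d2" for p
  proof -
    have "g p = \<tau> p" "g \<mu> = \<tau> \<mu>" using p d1 V(2,3) mu by (auto simp: dist_norm)
    then have "norm (\<tau> p - e0 - Dg (p - \<mu>)) \<le> norm (p - \<mu>)" using d2(2)[of p] p by simp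
    moreover have "norm (Dg (p - \<mu>)) \<le> norm Dg * norm (p - \<mu>)" by (rule norm_blinfun)
    ultimately show ?thesis
      using norm_triangle_ineq[of "\<tau> p - e0 - Dg (p - \<mu>)" "Dg (p - \<mu>)"] by (simp add: distrib_right)
  qed
  then show ?thesis using d1(1) d2(1)
    by (intro exI[of _ "norm Dg + 1"] conjI exI[of _ "min d1 d2"]) (auto simp: add_nonneg_pos)
qed

text \<open>Differentiates \<open>\<sigma> e \<bullet> \<sigma> e = 1\<close>.\<close>

lemma \<sigma>_orthogonal: "e \<in> \<Omega> \<Longrightarrow> \<sigma> e \<bullet> A e h = 0"
proof -
  assume e: "e \<in> \<Omega>"
  have "((\<lambda>e. \<sigma> e \<bullet> \<sigma> e) has_derivative (\<lambda>h. \<sigma> e \<bullet> A e h + A e h \<bullet> \<sigma> e)) (at e)"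
    by (intro has_derivative_inner derA e)
  moreover have "((\<lambda>e. \<sigma> e \<bullet> \<sigma> e) has_derivative (\<lambda>h. 0)) (at e)"
  proof (rule has_derivative_transform_within_open[OF _ open_O e])
    show "((\<lambda>e. 1) has_derivative (\<lambda>h. 0)) (at e)" by (rule has_derivative_const)
    show "1 = \<sigma> e \<bullet> \<sigma> e" if "e \<in> \<Omega>" for e using \<sigma>_norm[OF that] by (simp add: norm_eq_1)
  qed
  ultimately have "(\<lambda>h. \<sigma> e \<bullet> A e h + A e h \<bullet> \<sigma> e) = (\<lambda>h. 0)" by (rule has_derivative_unique)
  from fun_cong[OF this, of h] show ?thesis by (simp add: inner_commute)
qed

text \<open>Differentiates the orthogonality of \<sigma> e and \<open>A e k\<close> once more. The
  normal part of the second derivative is thus determined by the first derivative.\<close>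

lemma second_fundamental_form: "\<mu> \<bullet> A2 h k = - (A0 h \<bullet> A0 k)"
proof -
  have "((\<lambda>e. A e k) has_derivative (\<lambda>h. A2 h k)) (at e0)"
    using bounded_linear.has_derivative[OF blinfun.bounded_linear_left derA2] .
  then have "((\<lambda>e. \<sigma> e \<bullet> A e k) has_derivative (\<lambda>h. \<sigma> e0 \<bullet> A2 h k + A0 h \<bullet> A0 k)) (at e0)"
    by (intro has_derivative_inner derA e0_O)
  moreover have "((\<lambda>e. \<sigma> e \<bullet> A e k) has_derivative (\<lambda>h. 0)) (at e0)"
    by (rule has_derivative_transform_within_open[OF has_derivative_const open_O e0_O, of 0]) (simp add: \<sigma>_orthogonal)
  ultimately have "(\<lambda>h. \<sigma> e0 \<bullet> A2 h k + A0 h \<bullet> A0 k) = (\<lambda>h. 0)" by (rule has_derivative_unique)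
  from fun_cong[OF this, of h] show ?thesis using \<sigma>_\<tau>[OF mu] by (simp add: eq_neg_iff_add_eq_0)
qed

lemma open_region: "open {e \<in> \<Omega>. x \<bullet> \<sigma> e > -1/2}"
proof -
  have "continuous_on \<Omega> \<sigma>" using homeo by (simp add: homeomorphism_def)
  then have "continuous_on \<Omega> (\<lambda>e. x \<bullet> \<sigma> e)" by (intro continuous_intros)
  then have "open (\<Omega> \<inter> (\<lambda>e. x \<bullet> \<sigma> e) -` {-1/2<..})" using open_O by (intro continuous_open_preimage) auto
  moreover have "{e \<in> \<Omega>. x \<bullet> \<sigma> e > -1/2} = \<Omega> \<inter> (\<lambda>e. x \<bullet> \<sigma> e) -` {-1/2<..}" by auto
  ultimately show ?thesis by simp
qed

lemma inner_\<sigma>_le: "norm x = 1 \<Longrightarrow> e \<in> \<Omega> \<Longrightarrow> \<bar>x \<bullet> \<sigma> e\<bar> \<le> 1"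
  using Cauchy_Schwarz_ineq2[of x "\<sigma> e"] \<sigma>_norm by simp

text \<open>The margin -1/2 keeps away from antipodal points, where the squared distance is not
  differentiable.\<close>

lemma psi_formula:
  assumes x: "norm x = 1" and e: "e \<in> \<Omega>" "x \<bullet> \<sigma> e > -1/2"
  shows "psi_chart U \<tau> x e = dsqarc (x \<bullet> \<sigma> e) *\<^sub>R (blinfun_inner_right x o\<^sub>L A e)"
    and "((\<lambda>e. sqarc (x \<bullet> \<sigma> e)) has_derivative blinfun_apply (dsqarc (x \<bullet> \<sigma> e) *\<^sub>R (blinfun_inner_right x o\<^sub>L A e))) (at e)"
proof -
  let ?V = "{e \<in> \<Omega>. x \<bullet> \<sigma> e > -1/2}"
  have t: "((\<lambda>e. x \<bullet> \<sigma> e) has_derivative (\<lambda>h. x \<bullet> A e h)) (at e)"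
    by (intro has_derivative_inner_right derA e)
  have I: "x \<bullet> \<sigma> e \<in> {-1/2..1}" if "e \<in> ?V" for e
    using inner_\<sigma>_le[OF x, of e] that by (auto simp: abs_le_iff)
  have "((\<lambda>e. sqarc (x \<bullet> \<sigma> e)) has_derivative (\<lambda>h. dsqarc (x \<bullet> \<sigma> e) * (x \<bullet> A e h))) (at e)"
  proof (rule has_derivative_compose_within[OF t open_region[of x]])
    show eV: "e \<in> ?V" using e by simp
    show "(\<lambda>e. x \<bullet> \<sigma> e) ` ?V \<subseteq> {-1/2..1}" using I by blast
    show "(sqarc has_derivative (\<lambda>h. dsqarc (x \<bullet> \<sigma> e) * h)) (at (x \<bullet> \<sigma> e) within {-1/2..1})"
      by (rule sqarc_has_derivative_within) (rule I[OF eV])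
  qed
  moreover have "blinfun_apply (dsqarc (x \<bullet> \<sigma> e) *\<^sub>R (blinfun_inner_right x o\<^sub>L A e)) = (\<lambda>h. dsqarc (x \<bullet> \<sigma> e) * (x \<bullet> A e h))"
    by (simp add: fun_eq_iff scaleR_blinfun.rep_eq)
  ultimately show d: "((\<lambda>e. sqarc (x \<bullet> \<sigma> e)) has_derivative blinfun_apply (dsqarc (x \<bullet> \<sigma> e) *\<^sub>R (blinfun_inner_right x o\<^sub>L A e))) (at e)"
    by simp
  have "((\<lambda>e. (rho_chart U \<tau> x e)\<^sup>2) has_derivative blinfun_apply (dsqarc (x \<bullet> \<sigma> e) *\<^sub>R (blinfun_inner_right x o\<^sub>L A e))) (at e)"
  proof (rule has_derivative_transform_within_open[OF d open_O e(1)])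
    show "sqarc (x \<bullet> \<sigma> e) = (rho_chart U \<tau> x e)\<^sup>2" if "e \<in> \<Omega>" for e
      using inner_\<sigma>_le[OF x that] by (simp add: rho_chart_def rho_def sqarc_eq)
  qed
  then show "psi_chart U \<tau> x e = dsqarc (x \<bullet> \<sigma> e) *\<^sub>R (blinfun_inner_right x o\<^sub>L A e)"
    unfolding psi_chart_def by (rule frechet_deriv_eq)
qed

section \<open>Gradient and Hessian in the chart\<close>

definition compose_op :: "'h \<Rightarrow> ('e \<Rightarrow>\<^sub>L 'h) \<Rightarrow>\<^sub>L ('e \<Rightarrow>\<^sub>L real)" where
  "compose_op x = bounded_bilinear.prod_right (o\<^sub>L) (blinfun_inner_right x)"

lemma compose_op_apply: "compose_op x B = blinfun_inner_right x o\<^sub>L B"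
  unfolding compose_op_def by (simp add: bounded_bilinear.prod_right.rep_eq[OF bounded_bilinear_blinfun_compose])

text \<open>The value of the Hessian at \<open>\<tau> \<mu>\<close>, extended to a continuous function of all \<open>x\<close>.\<close>

definition hess :: "'h \<Rightarrow> 'e \<Rightarrow>\<^sub>L 'e \<Rightarrow>\<^sub>L real" where
  "hess x = ddsq (x \<bullet> \<mu>) *\<^sub>R (blinfun_scaleR_left (blinfun_inner_right x o\<^sub>L A0) o\<^sub>L (blinfun_inner_right x o\<^sub>L A0))
    + dsq (x \<bullet> \<mu>) *\<^sub>R (compose_op x o\<^sub>L A2)"

text \<open>A fixed linear image of the ambient gradient
  \<open>dsq (x \<bullet> \<mu>) *\<^sub>R x\<close>, so that averages of \<open>psi\<close> are
  images of averages in the space of the observations.\<close>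

definition psi :: "'h \<Rightarrow> 'e \<Rightarrow>\<^sub>L real" where
  "psi x = blinfun_inner_right (dsq (x \<bullet> \<mu>) *\<^sub>R x) o\<^sub>L A0"

lemma hess_apply: "hess x h = (ddsq (x \<bullet> \<mu>) * (x \<bullet> A0 h)) *\<^sub>R (blinfun_inner_right x o\<^sub>L A0)
    + dsq (x \<bullet> \<mu>) *\<^sub>R (blinfun_inner_right x o\<^sub>L A2 h)"
  by (simp add: hess_def plus_blinfun.rep_eq scaleR_blinfun.rep_eq compose_op_apply blinfun_scaleR_left.rep_eq)

lemma psi_eq:
  assumes x: "norm x = 1" "0 \<le> x \<bullet> \<mu>"
  shows "psi_chart U \<tau> x e0 = psi x"
proof -
  have s: "x \<bullet> \<mu> \<le> 1" using inner_\<sigma>_le[OF x(1) e0_O] \<sigma>_\<tau>[OF mu] by simp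
  have "psi_chart U \<tau> x e0 = dsqarc (x \<bullet> \<mu>) *\<^sub>R (blinfun_inner_right x o\<^sub>L A0)"
    using psi_formula(1)[OF x(1) e0_O] x(2) \<sigma>_\<tau>[OF mu] by simp
  also have "\<dots> = psi x"
    unfolding psi_def using x s by (intro blinfun_eqI) (simp add: dsq_eq scaleR_blinfun.rep_eq)
  finally show ?thesis .
qed

text \<open>The radius d is the same for all x, since the expansion is averaged over samples of
  unbounded size. The error splits into the remainders of \<open>dsqarc\<close> (\<open>T1\<close>),
  of \<sigma> (\<open>T2\<close>) and of \<open>A\<close> (\<open>T3\<close>), and a product of two
  increments (\<open>T4\<close>).\<close>

lemma psi_expansion:
  assumes eps: "0 < \<epsilon>"
  shows "\<exists>d>0. \<forall>x e. norm x = 1 \<longrightarrow> 0 \<le> x \<bullet> \<mu> \<longrightarrow> norm (e - e0) < d \<longrightarrow> e \<in> \<Omega> \<and> -1/2 < x \<bullet> \<sigma> e \<and>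
    norm (psi_chart U \<tau> x e - psi x - hess x (e - e0)) \<le> \<epsilon> * norm (e - e0)"
proof -
  obtain C where C: "0 \<le> C" "\<And>s. s \<in> {-1/2..1} \<Longrightarrow> \<bar>dsqarc s\<bar> \<le> C" "\<And>s. s \<in> {-1/2..1} \<Longrightarrow> \<bar>ddsqarc s\<bar> \<le> C"
    using ex_bound_dsqarc by blast
  define K0 where "K0 = norm A0 + 1"
  define K2 where "K2 = norm A2"
  have K: "1 \<le> K0" "0 \<le> K2" "norm A0 \<le> K0" by (auto simp: K0_def K2_def)
  \<comment> \<open>The coefficients of the four error terms, plus 1 to keep E at least 1.\<close>
  define E where "E = K0 * K0 + C * K0 + C + K2 + 1"
  have E: "1 \<le> E" unfolding E_def using K C by (auto intro!: add_nonneg_nonneg mult_nonneg_nonneg)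
  define e1 where "e1 = min 1 (\<epsilon> / E)"
  have e1: "0 < e1" "e1 \<le> 1" "E * e1 \<le> \<epsilon>"
  proof -
    show "0 < e1" "e1 \<le> 1" using eps E by (auto simp: e1_def)
    have "E * e1 \<le> E * (\<epsilon> / E)" unfolding e1_def using E by (intro mult_left_mono) auto
    then show "E * e1 \<le> \<epsilon>" using E by simp
  qed
  obtain d0 where d0: "d0 > 0" "\<And>e. dist e e0 < d0 \<Longrightarrow> e \<in> \<Omega>" using open_O e0_O unfolding open_dist by blast
  obtain d1 where d1: "d1 > 0" "\<And>e. norm (e - e0) < d1 \<Longrightarrow> norm (\<sigma> e - \<mu> - A0 (e - e0)) \<le> e1 * norm (e - e0)"
    using has_derivative_atD[OF derA[OF e0_O] e1(1)] \<sigma>_\<tau>[OF mu] by auto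
  obtain d2 where d2: "d2 > 0" "\<And>e. norm (e - e0) < d2 \<Longrightarrow> norm (A e - A0 - A2 (e - e0)) \<le> e1 * norm (e - e0)"
    using has_derivative_atD[OF derA2 e1(1)] by auto
  obtain d3 where d3: "d3 > 0" "\<And>s t. s \<in> {-1/2..1} \<Longrightarrow> t \<in> {-1/2..1} \<Longrightarrow> \<bar>t - s\<bar> < d3 \<Longrightarrow>
      \<bar>dsqarc t - dsqarc s - ddsqarc s * (t - s)\<bar> \<le> e1 * \<bar>t - s\<bar>"
    using dsqarc_expansion[OF e1(1)] by blast
  \<comment> \<open>In order: e in the image of the chart, the remainders of \<sigma> and
    \<open>A\<close>, the range of the expansion of \<open>dsqarc\<close>, |t - s| <= 1/4 so that t
    stays above -1/2, and |dsqarc t - dsqarc s| <= e1. Cosines move by at most K0 times the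
    displacement.\<close>
  define d where "d = Min {d0, d1, d2, d3 / K0, 1 / (4 * K0), e1 / ((C + 1) * K0)}"
  have dpos: "0 < d" unfolding d_def using d0 d1 d2 d3 K C e1 by auto
  have dle: "d \<le> d0" "d \<le> d1" "d \<le> d2" "d \<le> d3 / K0" "d \<le> 1 / (4 * K0)" "d \<le> e1 / ((C + 1) * K0)"
    unfolding d_def by (rule Min_le; simp)+
  have "e \<in> \<Omega> \<and> -1/2 < x \<bullet> \<sigma> e \<and> norm (psi_chart U \<tau> x e - psi x - hess x (e - e0)) \<le> \<epsilon> * norm (e - e0)"
    if x: "norm x = 1" "0 \<le> x \<bullet> \<mu>" and ed: "norm (e - e0) < d" for x e
  proof -
    define D where "D = e - e0"
    define n where "n = norm D"
    have n: "0 \<le> n" "n < d" using ed by (auto simp: n_def D_def)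
    have eO: "e \<in> \<Omega>" using d0(2) ed dle by (simp add: dist_norm)
    define s where "s = x \<bullet> \<mu>"
    define t where "t = x \<bullet> \<sigma> e"
    have s01: "0 \<le> s" "s \<le> 1" using x inner_\<sigma>_le[OF x(1) e0_O] \<sigma>_\<tau>[OF mu] by (auto simp: s_def)
    have r\<sigma>: "norm (\<sigma> e - \<mu> - A0 D) \<le> e1 * n" using d1(2)[of e] ed dle by (simp add: D_def n_def)
    have rA: "norm (A e - A0 - A2 D) \<le> e1 * n" using d2(2)[of e] ed dle by (simp add: D_def n_def)
    have "norm (A0 D) \<le> norm A0 * n" unfolding n_def by (rule norm_blinfun)
    moreover have "e1 * n \<le> 1 * n" using e1 n by (intro mult_right_mono) auto
    ultimately have n\<sigma>: "norm (\<sigma> e - \<mu>) \<le> K0 * n"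
      using norm_triangle_ineq[of "\<sigma> e - \<mu> - A0 D" "A0 D"] r\<sigma> by (simp add: K0_def distrib_right)
    have ts: "t - s = x \<bullet> (\<sigma> e - \<mu>)" by (simp add: t_def s_def inner_diff_right)
    have xi: "\<bar>x \<bullet> y\<bar> \<le> norm y" for y using Cauchy_Schwarz_ineq2[of x y] x by simp
    have ts_le: "\<bar>t - s\<bar> \<le> K0 * n" unfolding ts using xi n\<sigma> order.trans by blast
    have K0n: "K0 * n \<le> K0 * d" using n K by (intro mult_left_mono) auto
    have "K0 * n < d3" "K0 * n \<le> 1/4" "(C + 1) * (K0 * n) \<le> e1"
    proof -
      have "K0 * n < K0 * d" using n K by simp
      also have "\<dots> \<le> K0 * (d3 / K0)" using dle K by (intro mult_left_mono) auto
      finally show "K0 * n < d3" using K by simp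
      have "K0 * n \<le> K0 * (1 / (4 * K0))" using K0n mult_left_mono[OF dle(5), of K0] K by linarith
      then show "K0 * n \<le> 1/4" using K by simp
      have C1: "0 < (C + 1) * K0" using C K by (intro mult_pos_pos) auto
      have "(C + 1) * K0 * n \<le> (C + 1) * K0 * (e1 / ((C + 1) * K0))"
        using n dle C1 by (intro mult_left_mono) auto
      also have "\<dots> = e1" using C1 by (metis less_irrefl nonzero_mult_div_cancel_left times_divide_eq_right)
      finally show "(C + 1) * (K0 * n) \<le> e1" by (simp add: mult.assoc)
    qed
    note small = this
    have tI: "-1/2 < t" "t \<le> 1" using ts_le small(2) s01 inner_\<sigma>_le[OF x(1) eO] by (auto simp: t_def abs_le_iff)
    have sI: "s \<in> {-1/2..1}" "t \<in> {-1/2..1}" using s01 tI by auto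
    have ex: "\<bar>dsqarc t - dsqarc s - ddsqarc s * (t - s)\<bar> \<le> e1 * (K0 * n)"
      using d3(2)[OF sI] ts_le small(1) mult_left_mono[OF ts_le, of e1] e1 by linarith
    have df: "\<bar>dsqarc t - dsqarc s\<bar> \<le> e1"
    proof -
      have "\<bar>ddsqarc s * (t - s)\<bar> \<le> C * (K0 * n)" unfolding abs_mult by (intro mult_mono C(3) sI ts_le C(1)) auto
      moreover have "e1 * (K0 * n) \<le> 1 * (K0 * n)" using e1 K n by (intro mult_right_mono) auto
      ultimately have "\<bar>dsqarc t - dsqarc s\<bar> \<le> (C + 1) * (K0 * n)" using ex by (simp add: distrib_right)
      then show ?thesis using small(3) by linarith
    qed
    define q where "q B = blinfun_inner_right x o\<^sub>L B" for B :: "'e \<Rightarrow>\<^sub>L 'h"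
    have q: "norm (q B) \<le> norm B" for B unfolding q_def using norm_inner_compose[of x B] x by simp
    have qapp: "q B h = x \<bullet> B h" for B h by (simp add: q_def)
    define T1 where "T1 = (dsqarc t - dsqarc s - ddsqarc s * (t - s)) *\<^sub>R q A0"
    define T2 where "T2 = (ddsqarc s * (x \<bullet> (\<sigma> e - \<mu> - A0 D))) *\<^sub>R q A0"
    define T3 where "T3 = dsqarc t *\<^sub>R q (A e - A0 - A2 D)"
    define T4 where "T4 = (dsqarc t - dsqarc s) *\<^sub>R q (A2 D)"
    have p1: "psi_chart U \<tau> x e = dsqarc t *\<^sub>R q (A e)" unfolding q_def t_def by (rule psi_formula(1)[OF x(1) eO tI(1)[unfolded t_def]])
    have p0: "psi x = dsqarc s *\<^sub>R q A0"
      unfolding psi_def q_def using s01 by (intro blinfun_eqI) (simp add: dsq_eq scaleR_blinfun.rep_eq s_def)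
    have h0: "hess x D = (ddsqarc s * (x \<bullet> A0 D)) *\<^sub>R q A0 + dsqarc s *\<^sub>R q (A2 D)"
      unfolding hess_apply q_def using s01 by (simp add: dsq_eq ddsq_eq s_def)
    have split: "psi_chart U \<tau> x e - psi x - hess x D = T1 + T2 + T3 + T4"
    proof (rule blinfun_eqI)
      fix h
      show "blinfun_apply (psi_chart U \<tau> x e - psi x - hess x D) h = blinfun_apply (T1 + T2 + T3 + T4) h"
        unfolding p1 p0 h0 T1_def T2_def T3_def T4_def ts
        by (simp add: minus_blinfun.rep_eq plus_blinfun.rep_eq scaleR_blinfun.rep_eq qapp inner_diff_right algebra_simps)
    qed
    have "norm T1 \<le> e1 * (K0 * n) * K0"
      unfolding T1_def norm_scaleR using ex order.trans[OF q K(3)] e1 K n by (intro mult_mono) auto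
    moreover have "norm T2 \<le> (C * (e1 * n)) * K0"
      unfolding T2_def norm_scaleR abs_mult using C(3)[OF sI(1)] order.trans[OF xi r\<sigma>] order.trans[OF q K(3)] C(1) e1 n
      by (intro mult_mono) auto
    moreover have "norm T3 \<le> C * (e1 * n)"
      unfolding T3_def norm_scaleR using C(2)[OF sI(2)] order.trans[OF q rA] C(1) by (intro mult_mono) auto
    moreover have "norm T4 \<le> e1 * (K2 * n)"
    proof -
      have "norm (A2 D) \<le> K2 * n" unfolding K2_def n_def by (rule norm_blinfun)
      then show ?thesis unfolding T4_def norm_scaleR using df order.trans[OF q] e1 by (intro mult_mono) auto
    qed
    ultimately have "norm (T1 + T2 + T3 + T4) \<le> e1 * (K0 * n) * K0 + (C * (e1 * n)) * K0 + C * (e1 * n) + e1 * (K2 * n)"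
      using norm_triangle_ineq[of "T1 + T2 + T3" T4] norm_triangle_ineq[of "T1 + T2" T3] norm_triangle_ineq[of T1 T2] by linarith
    also have "\<dots> = (E - 1) * e1 * n" by (simp add: E_def algebra_simps)
    also have "\<dots> \<le> \<epsilon> * n" using e1 n by (intro mult_right_mono) (auto simp: left_diff_distrib)
    finally show ?thesis using eO tI(1) split by (simp add: D_def n_def t_def)
  qed
  then show ?thesis using dpos by blast
qed

lemma hess_eq:
  assumes x: "norm x = 1" "0 \<le> x \<bullet> \<mu>"
  shows "hess_chart U \<tau> x e0 = hess x"
  unfolding hess_chart_def
proof (rule frechet_deriv_eq, rule has_derivative_atI)
  fix r :: real assume "0 < r"
  from psi_expansion[OF this] obtain d where d: "d > 0"
    "\<And>e. norm (e - e0) < d \<Longrightarrow> norm (psi_chart U \<tau> x e - psi x - hess x (e - e0)) \<le> r * norm (e - e0)"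
    using x by blast
  have "\<forall>\<^sub>F e in at e0. dist e e0 < d" using d(1) by (auto simp: eventually_at)
  then show "\<forall>\<^sub>F e in at e0. norm (psi_chart U \<tau> x e - psi_chart U \<tau> x e0 - hess x (e - e0)) \<le> r * norm (e - e0)"
    by eventually_elim (use d(2) in \<open>auto simp: dist_norm psi_eq[OF x]\<close>)
qed (rule blinfun.bounded_linear_right)

end

subsection \<open>The sample mean\<close>

text \<open>A function of the data alone, so that its continuity in the data can be stated.\<close>

definition sample_mean :: "(nat \<Rightarrow> 'h::real_inner) \<Rightarrow> nat \<Rightarrow> 'h" where
  "sample_mean z n = sphere_minimizer (\<lambda>p. (1 / real n) * (\<Sum>i<n. (rho (z i) p)\<^sup>2))"

definition sample_G :: "(nat \<Rightarrow> 'h::real_inner) \<Rightarrow> nat \<Rightarrow> 'h \<Rightarrow> real" where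
  "sample_G z n p = (1 / real n) * (\<Sum>i<n. sqarc (z i \<bullet> p))"

lemma unit_inner_bounds:
  fixes x p :: "'h::real_inner"
  assumes "norm x = 1" "norm p \<le> 1" shows "-1 \<le> x \<bullet> p" "x \<bullet> p \<le> 1" "\<bar>x \<bullet> p\<bar> \<le> 1"
  using Cauchy_Schwarz_ineq2[of x p] assms by (auto simp: abs_le_iff)

text \<open>The direction y is left free: a data point is taken for measurability at fixed n, and a
  fixed point of the support for growth that does not degenerate as n increases.\<close>

lemma sample_mean_minimizes:
  fixes z :: "nat \<Rightarrow> 'h::{real_inner, complete_space}"
  assumes n: "0 < n" and z: "\<And>i. i < n \<Longrightarrow> norm (z i) = 1"
    and y: "norm y = 1" "\<And>i. i < n \<Longrightarrow> 0 \<le> z i \<bullet> y" and k: "k = (1 / real n) * (\<Sum>i<n. z i \<bullet> y)" "0 < k"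
  shows "norm (sample_mean z n) = 1"
    and "norm q \<le> 1 \<Longrightarrow> sample_G z n (sample_mean z n) + k / 2 * (norm (sample_mean z n - q))\<^sup>2 \<le> sample_G z n q"
proof -
  have "\<exists>p. norm p = 1 \<and> (\<forall>q. norm q \<le> 1 \<longrightarrow> sample_G z n p + k / 2 * (norm (p - q))\<^sup>2 \<le> sample_G z n q)"
  proof (rule ball_strong_minimizer[OF y(1) k(2)])
    show "continuous_on (cball 0 1) (sample_G z n)"
      unfolding sample_G_def by (intro continuous_intros continuous_on_compose2[OF continuous_sqarc[of UNIV]]) auto
    show "0 \<le> sample_G z n p" for p unfolding sample_G_def by (intro mult_nonneg_nonneg sum_nonneg sqarc_nonneg) auto
    show "sample_G z n ((1/2) *\<^sub>R (p + q)) \<le> (sample_G z n p + sample_G z n q) / 2" if p: "norm p \<le> 1" and q: "norm q \<le> 1" for p q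
    proof -
      have "sample_G z n ((1/2) *\<^sub>R (p + q)) \<le> (1 / real n) * (\<Sum>i<n. (sqarc (z i \<bullet> p) + sqarc (z i \<bullet> q)) / 2)"
        unfolding sample_G_def
      proof (intro mult_left_mono sum_mono)
        fix i assume "i \<in> {..<n}"
        then have zi: "norm (z i) = 1" using z by auto
        show "sqarc (z i \<bullet> (1/2) *\<^sub>R (p + q)) \<le> (sqarc (z i \<bullet> p) + sqarc (z i \<bullet> q)) / 2"
          using sqarc_midconvex[OF unit_inner_bounds(1,2)[OF zi p] unit_inner_bounds(1,2)[OF zi q]] by (simp add: inner_add_right)
      qed simp
      also have "\<dots> = (sample_G z n p + sample_G z n q) / 2"
        unfolding sample_G_def by (simp add: sum_divide_distrib[symmetric] sum.distrib add_divide_distrib)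
      finally show ?thesis .
    qed
    show "sample_G z n (p + d *\<^sub>R y) \<le> sample_G z n p - 2 * d * k" if p: "norm p \<le> 1" "norm (p + d *\<^sub>R y) \<le> 1" and d: "0 \<le> d" for p d
    proof -
      have "sample_G z n (p + d *\<^sub>R y) \<le> (1 / real n) * (\<Sum>i<n. sqarc (z i \<bullet> p) - 2 * d * (z i \<bullet> y))"
        unfolding sample_G_def
      proof (intro mult_left_mono sum_mono)
        fix i assume i: "i \<in> {..<n}"
        then have zi: "norm (z i) = 1" using z by auto
        have "0 \<le> d * (z i \<bullet> y)" using y(2)[of i] i d by simp
        then have "sqarc (z i \<bullet> (p + d *\<^sub>R y)) \<le> sqarc (z i \<bullet> p) - 2 * (z i \<bullet> (p + d *\<^sub>R y) - z i \<bullet> p)"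
          by (intro sqarc_decrease unit_inner_bounds[OF zi p(1)] unit_inner_bounds[OF zi p(2)]) (simp add: inner_add_right)
        then show "sqarc (z i \<bullet> (p + d *\<^sub>R y)) \<le> sqarc (z i \<bullet> p) - 2 * d * (z i \<bullet> y)" by (simp add: inner_add_right)
      qed simp
      also have "\<dots> = sample_G z n p - 2 * d * k"
        unfolding sample_G_def k(1) by (simp add: sum_subtractf sum_distrib_left right_diff_distrib mult.left_commute)
      finally show ?thesis .
    qed
  qed
  then obtain p where p: "norm p = 1" "\<And>q. norm q \<le> 1 \<Longrightarrow> sample_G z n p + k / 2 * (norm (p - q))\<^sup>2 \<le> sample_G z n q" by blast
  have "sample_mean z n = p"
    unfolding sample_mean_def
  proof (rule sphere_minimizer_eqI[OF p(1) _ p(2)])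
    show "(1 / real n) * (\<Sum>i<n. (rho (z i) q)\<^sup>2) = sample_G z n q" if "norm q = 1" for q
      unfolding sample_G_def rho_def using z that
      by (intro arg_cong2[where f = "(*)"] sum.cong refl) (auto simp: sqarc_eq unit_inner_bounds)
  qed (use k in auto)
  then show "norm (sample_mean z n) = 1"
    and "norm q \<le> 1 \<Longrightarrow> sample_G z n (sample_mean z n) + k / 2 * (norm (sample_mean z n - q))\<^sup>2 \<le> sample_G z n q"
    using p by auto
qed

text \<open>A closed set containing almost every sample, on which the minimizer exists and is unique
  for n > 0.\<close>

definition acute_samples :: "nat \<Rightarrow> (nat \<Rightarrow> 'h::real_inner) set" where
  "acute_samples n = {z. \<forall>i<n. norm (z i) = 1 \<and> (\<forall>j<n. 0 \<le> z i \<bullet> z j)}"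

text \<open>The first data point serves as direction: its product with itself contributes 1 to the
  sum, so k is at least 1 / n.\<close>

lemma acute_sample_mean:
  fixes z :: "nat \<Rightarrow> 'h::{real_inner, complete_space}"
  assumes n: "0 < n" and z: "z \<in> acute_samples n"
  shows "norm (sample_mean z n) = 1"
    and "norm q \<le> 1 \<Longrightarrow> sample_G z n (sample_mean z n) + 1 / (2 * real n) * (norm (sample_mean z n - q))\<^sup>2 \<le> sample_G z n q"
proof -
  define k where "k = (1 / real n) * (\<Sum>i<n. z i \<bullet> z 0)"
  have z0: "norm (z 0) = 1" using n z by (auto simp: acute_samples_def)
  have zi: "\<And>i. i < n \<Longrightarrow> norm (z i) = 1" "\<And>i. i < n \<Longrightarrow> 0 \<le> z i \<bullet> z 0" using z n by (auto simp: acute_samples_def)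
  have "z 0 \<bullet> z 0 \<le> (\<Sum>i<n. z i \<bullet> z 0)" using n zi by (intro member_le_sum) auto
  then have k1: "1 / real n \<le> k" unfolding k_def using z0 n by (simp add: norm_eq_1 divide_right_mono)
  then have "0 < k" using n by (intro less_le_trans[OF _ k1]) simp
  note m = sample_mean_minimizes[OF n zi(1) z0 zi(2) k_def this]
  show "norm (sample_mean z n) = 1" using m(1) by blast
  assume q: "norm q \<le> 1"
  have "1 / (2 * real n) * (norm (sample_mean z n - q))\<^sup>2 \<le> k / 2 * (norm (sample_mean z n - q))\<^sup>2"
    using k1 by (intro mult_right_mono) auto
  then show "sample_G z n (sample_mean z n) + 1 / (2 * real n) * (norm (sample_mean z n - q))\<^sup>2 \<le> sample_G z n q"
    using m(2)[OF _ _ q] by linarith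
qed

text \<open>Stability of minimizers: the functionals of nearby data differ little, uniformly on the
  sphere, and quadratic growth converts a small excess into a small distance.\<close>

lemma continuous_sample_mean:
  assumes n: "0 < n"
  shows "continuous_on (acute_samples n) (\<lambda>z. sample_mean z n :: 'h::{real_inner, complete_space})"
  unfolding continuous_on_sequentially
proof (intro allI ballI impI)
  fix zk :: "nat \<Rightarrow> nat \<Rightarrow> 'h" and z
  assume z: "z \<in> acute_samples n" and "(\<forall>k. zk k \<in> acute_samples n) \<and> zk \<longlonglongrightarrow> z"
  then have zk: "\<And>k. zk k \<in> acute_samples n" and lim: "zk \<longlonglongrightarrow> z" by auto
  have lim_i: "(\<lambda>k. zk k i) \<longlonglongrightarrow> z i" for i
    using continuous_on_tendsto_compose[OF continuous_on_product_coordinates[of i] lim] by simp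
  define p where "p = sample_mean z n"
  define pk where "pk k = sample_mean (zk k) n" for k
  have np: "norm p = 1" "norm (pk k) = 1" for k using acute_sample_mean(1)[OF n] z zk by (auto simp: p_def pk_def)
  have "uniformly_continuous_on {-1..1} sqarc"
    by (intro compact_uniformly_continuous continuous_sqarc) simp
  have "(\<lambda>k. (norm (p - pk k))\<^sup>2) \<longlonglongrightarrow> 0"
  proof (rule LIMSEQ_I)
    fix r :: real assume r: "0 < r"
    \<comment> \<open>The functionals differ by at most e, used at both minimizers: |p - pk|^2 / (2
      n) <= 2 e, and 4 n e = r / 2.\<close>
    define e where "e = r / (8 * real n)"
    have e: "0 < e" using r n by (simp add: e_def)
    have uc: "\<exists>d>0. \<forall>s\<in>{-1..1}. \<forall>t\<in>{-1..1}. dist t s < d \<longrightarrow> dist (sqarc t) (sqarc s) < e"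
      using \<open>uniformly_continuous_on {-1..1} sqarc\<close> e unfolding uniformly_continuous_on_def by meson
    from uc obtain d where d: "d > 0" "\<forall>s\<in>{-1..1}. \<forall>t\<in>{-1..1}. dist t s < d \<longrightarrow> dist (sqarc t) (sqarc s) < e"
      by (elim exE conjE)
    have "\<forall>\<^sub>F k in sequentially. \<forall>i\<in>{..<n}. dist (zk k i) (z i) < d"
      by (intro eventually_ball_finite ballI tendstoD[OF lim_i d(1)]) simp
    then obtain k0 where k0: "\<And>k i. k \<ge> k0 \<Longrightarrow> i < n \<Longrightarrow> dist (zk k i) (z i) < d"
      unfolding eventually_sequentially by auto
    have "norm ((norm (p - pk k))\<^sup>2 - 0) < r" if k: "k \<ge> k0" for k
    proof -
      have diff: "\<bar>sample_G z n q - sample_G (zk k) n q\<bar> \<le> e" if q: "norm q = 1" for q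
      proof -
        have "\<bar>(\<Sum>i<n. sqarc (z i \<bullet> q)) - (\<Sum>i<n. sqarc (zk k i \<bullet> q))\<bar> \<le> (\<Sum>i<n. e)"
          unfolding sum_subtractf[symmetric]
        proof (rule order.trans[OF sum_abs], rule sum_mono)
          fix i assume "i \<in> {..<n}"
          then have i: "i < n" by simp
          have u: "norm (z i) = 1" "norm (zk k i) = 1" using z zk[of k] i by (auto simp: acute_samples_def)
          have "\<bar>(zk k i - z i) \<bullet> q\<bar> \<le> norm (zk k i - z i) * norm q" by (rule Cauchy_Schwarz_ineq2)
          then have "dist (zk k i \<bullet> q) (z i \<bullet> q) < d"
            using k0[OF k i] q by (simp add: dist_real_def dist_norm inner_diff_left)
          then have "dist (sqarc (zk k i \<bullet> q)) (sqarc (z i \<bullet> q)) < e"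
            using d(2) unit_inner_bounds[OF u(1), of q] unit_inner_bounds[OF u(2), of q] q by auto
          then show "\<bar>sqarc (z i \<bullet> q) - sqarc (zk k i \<bullet> q)\<bar> \<le> e" by (simp add: dist_real_def abs_minus_commute)
        qed
        then have "(1 / real n) * \<bar>(\<Sum>i<n. sqarc (z i \<bullet> q)) - (\<Sum>i<n. sqarc (zk k i \<bullet> q))\<bar> \<le> (1 / real n) * (real n * e)"
          by (intro mult_left_mono) auto
        also have "\<dots> = e" using n by simp
        finally show ?thesis unfolding sample_G_def right_diff_distrib[symmetric] abs_mult by simp
      qed
      have "sample_G z n p + 1 / (2 * real n) * (norm (p - pk k))\<^sup>2 \<le> sample_G z n (pk k)"
        unfolding p_def using acute_sample_mean(2)[OF n z, of "pk k"] np by simp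
      moreover have "sample_G (zk k) n (pk k) \<le> sample_G (zk k) n p"
      proof -
        have "0 \<le> 1 / (2 * real n) * (norm (pk k - p))\<^sup>2" by simp
        then show ?thesis using acute_sample_mean(2)[OF n zk[of k], of p] np unfolding pk_def[symmetric] by linarith
      qed
      ultimately have "1 / (2 * real n) * (norm (p - pk k))\<^sup>2 \<le> 2 * e"
        using diff[OF np(1)] diff[OF np(2)[of k]] by linarith
      then have "(norm (p - pk k))\<^sup>2 \<le> 4 * real n * e" using n by (simp add: field_simps)
      also have "\<dots> < r" using r n by (simp add: e_def)
      finally show ?thesis by simp
    qed
    then show "\<exists>no. \<forall>k\<ge>no. norm ((norm (p - pk k))\<^sup>2 - 0) < r" by blast
  qed
  then have "(\<lambda>k. sqrt ((norm (p - pk k))\<^sup>2)) \<longlonglongrightarrow> sqrt 0" by (rule tendsto_real_sqrt)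
  then have "(\<lambda>k. norm (pk k - p)) \<longlonglongrightarrow> 0" by (simp add: norm_minus_commute)
  then have "pk \<longlonglongrightarrow> p" using LIM_zero_iff tendsto_norm_zero_iff by blast
  then show "((\<lambda>z. sample_mean z n) \<circ> zk) \<longlonglongrightarrow> sample_mean z n" by (simp add: o_def p_def pk_def[abs_def])
qed

lemma closed_acute_samples: "closed (acute_samples n :: (nat \<Rightarrow> 'h::real_inner) set)"
proof -
  have eq: "acute_samples n = (\<Inter>i\<in>{..<n}. {z :: nat \<Rightarrow> 'h. norm (z i) = 1}) \<inter> (\<Inter>i\<in>{..<n}. \<Inter>j\<in>{..<n}. {z. 0 \<le> z i \<bullet> z j})"
    by (auto simp: acute_samples_def)
  show ?thesis unfolding eq
    by (intro closed_Int closed_INT ballI closed_Collect_eq closed_Collect_le continuous_intros continuous_on_product_coordinates)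
qed

section \<open>Samples from a law with acute support\<close>

locale mean_sample = prob_space M for M :: "'w measure" +
  fixes X :: "'w \<Rightarrow> 'h::{real_inner, polish_space}" and Xs :: "nat \<Rightarrow> 'w \<Rightarrow> 'h"
  assumes compl: "complete_measure M"
    and X_elem: "random_element M X"
    and supp: "AE \<omega> in M. X \<omega> \<in> support_of M X"
    and diam: "\<forall>x\<in>support_of M X. \<forall>y\<in>support_of M X. rho x y \<le> pi / 2"
    and indep: "indep_vars (\<lambda>_. restrict_space borel (sphere 0 1)) Xs UNIV"
    and copies: "\<And>i. distr M (restrict_space borel (sphere 0 1)) (Xs i) = distr M (restrict_space borel (sphere 0 1)) X"
begin

lemma sphere_measurable:
  fixes f :: "'w \<Rightarrow> 'h"
  assumes "f \<in> M \<rightarrow>\<^sub>M restrict_space borel (sphere 0 1)"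
  shows "f \<in> borel_measurable M" "\<omega> \<in> space M \<Longrightarrow> norm (f \<omega>) = 1"
  using assms by (auto simp: measurable_restrict_space2_iff)

lemma X_meas[measurable]: "X \<in> borel_measurable M"
  using X_elem sphere_measurable(1) unfolding random_element_def by blast

lemma X_norm: "\<omega> \<in> space M \<Longrightarrow> norm (X \<omega>) = 1"
  using X_elem sphere_measurable(2) unfolding random_element_def by blast

lemma Xs_sphere: "Xs i \<in> M \<rightarrow>\<^sub>M restrict_space borel (sphere 0 1)"
  using indep unfolding indep_vars_def by auto

lemma Xs_meas[measurable]: "Xs i \<in> borel_measurable M"
  by (rule sphere_measurable(1)[OF Xs_sphere])

lemma Xs_norm: "\<omega> \<in> space M \<Longrightarrow> norm (Xs i \<omega>) = 1"
  by (rule sphere_measurable(2)[OF Xs_sphere])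

lemma id_restrict: "(\<lambda>x. x) \<in> restrict_space borel (sphere 0 1) \<rightarrow>\<^sub>M (borel :: 'h measure)"
  by (rule measurable_restrict_space1) simp

lemma Xs_indep: "indep_vars (\<lambda>_. borel) Xs UNIV"
  using indep_vars_compose2[OF indep, where Y = "\<lambda>_ x. x" and N = "\<lambda>_. borel"] id_restrict by simp

definition N :: "'h measure" where "N = distr M borel X"

lemma Xs_law: "distr M borel (Xs i) = N"
proof -
  have "distr M borel (Xs i) = distr (distr M (restrict_space borel (sphere 0 1)) (Xs i)) borel (\<lambda>x. x)"
    by (subst distr_distr[OF id_restrict Xs_sphere]) (simp add: o_def)
  also have "\<dots> = distr (distr M (restrict_space borel (sphere 0 1)) X) borel (\<lambda>x. x)" unfolding copies ..
  also have "\<dots> = N"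
    using X_elem unfolding random_element_def N_def by (subst distr_distr[OF id_restrict]) (auto simp: o_def)
  finally show ?thesis .
qed

definition S :: "'h set" where "S = support_of M X"

lemma closed_S: "closed S"
proof -
  have "open (- S)"
  proof (subst open_subopen, rule ballI)
    fix x assume x: "x \<in> - S"
    show "\<exists>T. open T \<and> x \<in> T \<and> T \<subseteq> - S"
    proof (cases "x \<in> sphere 0 1")
      case False
      moreover have "closed (sphere 0 1 :: 'h set)"
        unfolding sphere_def by (intro closed_Collect_eq continuous_intros)
      then have "open (- sphere 0 1 :: 'h set)" by (rule open_Compl)
      ultimately show ?thesis by (intro exI[of _ "- sphere 0 1"]) (auto simp: S_def support_of_def)
    next
      case True
      with x obtain W where W: "openin (top_of_set (sphere 0 1)) W" "x \<in> W" "\<not> measure M {\<omega> \<in> space M. X \<omega> \<in> W} > 0"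
        unfolding S_def support_of_def by blast
      then obtain V where V: "open V" "W = sphere 0 1 \<inter> V" unfolding openin_open by blast
      have "V \<subseteq> - S"
      proof
        fix y assume "y \<in> V"
        show "y \<in> - S"
        proof
          assume "y \<in> S"
          then have "y \<in> W" using V \<open>y \<in> V\<close> by (auto simp: S_def support_of_def)
          then show False using \<open>y \<in> S\<close> W unfolding S_def support_of_def by blast
        qed
      qed
      then show ?thesis using V W by blast
    qed
  qed
  then show ?thesis by (simp add: closed_def)
qed

lemma S_unit: "x \<in> S \<Longrightarrow> norm x = 1" by (auto simp: S_def support_of_def)

lemma inner_S_nonneg:
  assumes "x \<in> S" "y \<in> S" shows "0 \<le> x \<bullet> y"
proof -
  have b: "-1 \<le> x \<bullet> y" "x \<bullet> y \<le> 1" using unit_inner_bounds[of x y] S_unit assms by auto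
  have "arccos (x \<bullet> y) \<le> pi / 2" using diam assms by (auto simp: S_def rho_def)
  then have "cos (pi / 2) \<le> cos (arccos (x \<bullet> y))"
    using b by (intro cos_monotone_0_pi_le arccos_lbound) auto
  then show ?thesis using b by simp
qed

sublocale law: acute_law N S
proof (intro acute_law.intro acute_law_axioms.intro)
  show "prob_space N" unfolding N_def by (rule prob_space_distr) measurable
  show "sets N = sets borel" by (simp add: N_def)
  have [measurable]: "S \<in> sets borel" using closed_S by (rule borel_closed)
  show "AE x in N. x \<in> S" unfolding N_def using supp by (subst AE_distr_iff) (auto simp: S_def[symmetric])
  show "0 < measure N V" if "x \<in> S" "open V" "x \<in> V" for x V
  proof -
    have "openin (top_of_set (sphere 0 1)) (sphere 0 1 \<inter> V)" using that(2) by (rule openin_open_Int)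
    then have "0 < measure M {\<omega> \<in> space M. X \<omega> \<in> sphere 0 1 \<inter> V}"
      using that S_unit[OF that(1)] unfolding S_def support_of_def by auto
    also have "{\<omega> \<in> space M. X \<omega> \<in> sphere 0 1 \<inter> V} = X -` V \<inter> space M" using X_norm by auto
    also have "measure M (X -` V \<inter> space M) = measure N V" using that(2) unfolding N_def by (subst measure_distr) auto
    finally show ?thesis .
  qed
qed (auto simp: S_unit inner_S_nonneg)

lemma S_meas[measurable]: "S \<in> sets borel" using closed_S by (rule borel_closed)

lemma AE_Xs_S: "AE \<omega> in M. \<forall>i. Xs i \<omega> \<in> S"
proof (subst AE_all_countable, rule allI)
  fix i
  have "AE x in distr M borel (Xs i). x \<in> S" unfolding Xs_law by (rule law.AE_S)
  then show "AE \<omega> in M. Xs i \<omega> \<in> S" by (subst (asm) AE_distr_iff) auto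
qed

lemma AE_X_S: "AE \<omega> in M. X \<omega> \<in> S" using supp by (simp add: S_def)

lemma integral_N: "f \<in> borel_measurable borel \<Longrightarrow> (\<integral>x. f x \<partial>N) = (\<integral>\<omega>. f (X \<omega>) \<partial>M)" for f :: "'h \<Rightarrow> real"
  unfolding N_def by (rule integral_distr) measurable

lemma integral_Xs: "f \<in> borel_measurable borel \<Longrightarrow> (\<integral>\<omega>. f (Xs i \<omega>) \<partial>M) = (\<integral>\<omega>. f (X \<omega>) \<partial>M)" for f :: "'h \<Rightarrow> real"
  using integral_distr[OF Xs_meas[of i], of f] integral_N[of f] by (simp add: Xs_law)

lemma intrinsic_mean_properties:
  "norm (intrinsic_mean M X) = 1" "norm q \<le> 1 \<Longrightarrow> law.G (intrinsic_mean M X) \<le> law.G q"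
proof -
  from law.ex_mean obtain m k where m: "norm m = 1" "0 < k" "\<forall>q. norm q \<le> 1 \<longrightarrow> law.G m + k * (norm (m - q))\<^sup>2 \<le> law.G q"
    by (elim exE conjE)
  have "intrinsic_mean M X = m"
    unfolding intrinsic_mean_def
  proof (rule sphere_minimizer_eqI[OF m(1,2) m(3)[rule_format]])
    fix q :: 'h assume q: "norm q = 1"
    have "(\<integral>\<omega>. (rho (X \<omega>) q)\<^sup>2 \<partial>M) = (\<integral>\<omega>. sqarc (X \<omega> \<bullet> q) \<partial>M)"
      using X_norm q by (intro Bochner_Integration.integral_cong refl) (simp add: rho_def sqarc_eq unit_inner_bounds)
    also have "\<dots> = law.G q" unfolding law.G_def by (subst integral_N) (auto intro!: measurable_compose[OF _ law.measurable_sqarc])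
    finally show "(\<integral>\<omega>. (rho (X \<omega>) q)\<^sup>2 \<partial>M) = law.G q" .
  qed
  moreover have "law.G m \<le> law.G q" if "norm q \<le> 1"
  proof -
    have "0 \<le> k * (norm (m - q))\<^sup>2" using m(2) by simp
    then show ?thesis using m(3)[rule_format, OF that] by linarith
  qed
  ultimately show "norm (intrinsic_mean M X) = 1" "norm q \<le> 1 \<Longrightarrow> law.G (intrinsic_mean M X) \<le> law.G q"
    using m(1) by auto
qed

lemma sample_intrinsic_mean_eq: "sample_intrinsic_mean Xs n \<omega> = sample_mean (\<lambda>i. Xs i \<omega>) n"
  by (simp add: sample_intrinsic_mean_def sample_mean_def)

text \<open>Almost surely the sample is acute, and on the closed set of acute samples the mean is a
  continuous function of the data. For n = 0 the functional is constant and the value does not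
  depend on the outcome.\<close>

lemma sample_intrinsic_mean_meas: "sample_intrinsic_mean Xs n \<in> borel_measurable M"
proof (cases "n = 0")
  case True
  then have "sample_intrinsic_mean Xs n = (\<lambda>\<omega>. sphere_minimizer (\<lambda>p. 0))"
    by (simp add: sample_intrinsic_mean_def fun_eq_iff)
  then show ?thesis by simp
next
  case False
  then have n: "0 < n" by simp
  define \<Phi> where "\<Phi> z = (if z \<in> acute_samples n then sample_mean z n else (0::'h))" for z
  have "\<Phi> \<in> borel_measurable borel"
    unfolding \<Phi>_def
    by (rule borel_measurable_continuous_on_if[OF borel_closed[OF closed_acute_samples] continuous_sample_mean[OF n]]) simp
  then have m: "(\<lambda>\<omega>. \<Phi> (\<lambda>i. Xs i \<omega>)) \<in> borel_measurable M"
    by (rule measurable_compose[rotated]) (rule measurable_coordinatewise_then_product, measurable)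
  have "AE \<omega> in M. sample_intrinsic_mean Xs n \<omega> = \<Phi> (\<lambda>i. Xs i \<omega>)"
    using AE_Xs_S
  proof eventually_elim
    case (elim \<omega>)
    then have "(\<lambda>i. Xs i \<omega>) \<in> acute_samples n"
      unfolding acute_samples_def using S_unit inner_S_nonneg by blast
    then show ?case by (simp add: \<Phi>_def sample_intrinsic_mean_eq)
  qed
  then show ?thesis by (rule complete_measure.borel_measurable_AE_cong[OF compl m])
qed

end

subsection \<open>Operators on Hilbert spaces\<close>

lemma blinfun_inverse_eq:
  assumes "is_blinfun_inverse A B"
  shows "blinfun_inverse A = B"
  unfolding blinfun_inverse_def
proof (rule the_equality[where P = "is_blinfun_inverse A", OF assms])
  fix B' assume B': "is_blinfun_inverse A B'"
  show "B' = B"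
  proof (rule blinfun_eqI)
    fix x
    have "B' (A (B x)) = B x" using B' unfolding is_blinfun_inverse_def
      by (metis blinfun_apply_blinfun_compose blinfun_apply_id_blinfun)
    moreover have "A (B x) = x" using assms unfolding is_blinfun_inverse_def
      by (metis blinfun_apply_blinfun_compose blinfun_apply_id_blinfun)
    ultimately show "B' x = B x" by simp
  qed
qed

text \<open>Surjectivity is the Lax-Milgram argument; coercivity gives injectivity and the bound 1 /
  c for the inverse.\<close>

lemma symmetric_coercive_inverse:
  fixes T :: "'e::{real_normed_vector, complete_space} \<Rightarrow>\<^sub>L 'e \<Rightarrow>\<^sub>L real"
  assumes sym: "\<And>x y. T x y = T y x" and c: "0 < c" "\<And>x. c * (norm x)\<^sup>2 \<le> T x x"
  shows "\<exists>B. is_blinfun_inverse T B"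
proof -
  have surj: "\<exists>u. T u = \<phi>" for \<phi>
  proof -
    have "\<exists>u. \<forall>v. T u v = \<phi> v"
      by (rule symmetric_lax_milgram[OF bounded_bilinear.comp1[OF bounded_bilinear_blinfun_apply blinfun.bounded_linear_right] sym c blinfun.bounded_linear_right])
    then show ?thesis using blinfun_eqI by metis
  qed
  have lower: "c * norm x \<le> norm (T x)" for x
  proof (cases "x = 0")
    case False
    have "c * (norm x)\<^sup>2 \<le> norm (T x) * norm x"
      using c(2)[of x] norm_blinfun[of "T x" x] by simp
    then show ?thesis using False by (simp add: power2_eq_square)
  qed simp
  have inj: "T x = T y \<Longrightarrow> x = y" for x y
    using lower[of "x - y"] c(1) by (simp add: blinfun.diff_right zero_le_mult_iff mult_le_0_iff)
  define g where "g \<phi> = (SOME u. T u = \<phi>)" for \<phi>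
  have Tg: "T (g \<phi>) = \<phi>" for \<phi> unfolding g_def using someI_ex[OF surj] .
  have gT: "g (T u) = u" for u by (rule inj) (rule Tg)
  have "bounded_linear g"
  proof (rule bounded_linear_intro)
    show "g (x + y) = g x + g y" for x y by (rule inj) (simp add: Tg blinfun.add_right)
    show "g (r *\<^sub>R x) = r *\<^sub>R g x" for r x by (rule inj) (simp add: Tg blinfun.scaleR_right)
    show "norm (g x) \<le> norm x * (1 / c)" for x using lower[of "g x"] c(1) by (simp add: Tg field_simps)
  qed
  then have "blinfun_apply (Blinfun g) = g" by (rule bounded_linear_Blinfun_apply)
  then have "is_blinfun_inverse T (Blinfun g)"
    unfolding is_blinfun_inverse_def by (auto intro!: blinfun_eqI simp: Tg gT)
  then show ?thesis by blast
qed

section \<open>Riesz representatives, tensors and adjoints\<close>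

definition riesz_rep :: "('e::real_inner \<Rightarrow>\<^sub>L real) \<Rightarrow> 'e" where
  "riesz_rep = inv blinfun_inner_right"

lemma inj_blinfun_inner_right: "inj (blinfun_inner_right :: 'e::real_inner \<Rightarrow> 'e \<Rightarrow>\<^sub>L real)"
proof (rule injI)
  fix x y :: 'e assume "blinfun_inner_right x = blinfun_inner_right y"
  then have "x \<bullet> (x - y) = y \<bullet> (x - y)" by (metis blinfun_inner_right.rep_eq)
  then have "(x - y) \<bullet> (x - y) = 0" by (simp add: inner_diff_left)
  then show "x = y" by simp
qed

lemma riesz_rep_inner: "riesz_rep \<phi> \<bullet> v = \<phi> v" for \<phi> :: "'e::{real_inner, complete_space} \<Rightarrow>\<^sub>L real"
proof -
  obtain u where "\<And>v. u \<bullet> v = \<phi> v" using riesz[OF blinfun.bounded_linear_right[of \<phi>]] by blast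
  then have "blinfun_inner_right u = \<phi>" by (intro blinfun_eqI) simp
  then have "blinfun_inner_right (riesz_rep \<phi>) = \<phi>" unfolding riesz_rep_def by (metis f_inv_into_f rangeI)
  then show ?thesis by (metis blinfun_inner_right.rep_eq)
qed

lemma riesz_rep_blinfun_inner_right: "riesz_rep (blinfun_inner_right u) = u"
  unfolding riesz_rep_def by (rule inv_f_f[OF inj_blinfun_inner_right])

lemma dual_inner_eq: "dual_inner \<phi> \<theta> = \<theta> (riesz_rep \<phi>)" for \<phi> \<theta> :: "'e::{real_inner, complete_space} \<Rightarrow>\<^sub>L real"
  unfolding dual_inner_def riesz_rep_def[symmetric] using riesz_rep_inner[of \<theta> "riesz_rep \<phi>"] by (simp add: inner_commute)

lemma bounded_linear_riesz_rep: "bounded_linear (riesz_rep :: ('e::{real_inner, complete_space} \<Rightarrow>\<^sub>L real) \<Rightarrow> 'e)"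
proof (rule bounded_linear_intro)
  have ext: "x = y" if "\<And>v. x \<bullet> v = y \<bullet> v" for x y :: 'e
    using that[of "x - y"] by (metis eq_iff_diff_eq_0 inner_diff_left inner_eq_zero_iff)
  fix \<phi> \<theta> :: "'e \<Rightarrow>\<^sub>L real" and r
  show "riesz_rep (\<phi> + \<theta>) = riesz_rep \<phi> + riesz_rep \<theta>"
    by (rule ext) (simp add: riesz_rep_inner inner_add_left plus_blinfun.rep_eq)
  show "riesz_rep (r *\<^sub>R \<phi>) = r *\<^sub>R riesz_rep \<phi>"
    by (rule ext) (simp add: riesz_rep_inner scaleR_blinfun.rep_eq)
  have "norm (riesz_rep \<phi>) * norm (riesz_rep \<phi>) = \<phi> (riesz_rep \<phi>)"
    using riesz_rep_inner[of \<phi> "riesz_rep \<phi>"] by (simp add: dot_square_norm power2_eq_square)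
  also have "\<dots> \<le> norm \<phi> * norm (riesz_rep \<phi>)" using norm_blinfun[of \<phi> "riesz_rep \<phi>"] by simp
  finally show "norm (riesz_rep \<phi>) \<le> norm \<phi> * 1" by (cases "riesz_rep \<phi> = 0") auto
qed

definition eval_op :: "'e::real_normed_vector \<Rightarrow> ('e \<Rightarrow>\<^sub>L real) \<Rightarrow>\<^sub>L real" where
  "eval_op = bounded_bilinear.prod_left blinfun_apply"

lemma eval_op_apply: "eval_op u \<phi> = \<phi> u"
  by (simp add: eval_op_def bounded_bilinear.prod_left.rep_eq[OF bounded_bilinear_blinfun_apply])

lemma bounded_linear_eval_op: "bounded_linear eval_op"
  unfolding eval_op_def by (rule bounded_bilinear.bounded_linear_prod_left[OF bounded_bilinear_blinfun_apply])

text \<open>As a composition of bounded maps the tensor is seen to be a bounded operator and to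
  depend continuously on both arguments.\<close>

lemma dual_tensor_eq: "dual_tensor \<phi> \<theta> = blinfun_scaleR_left \<theta> o\<^sub>L eval_op (riesz_rep \<phi>)"
  for \<phi> \<theta> :: "'e::{real_inner, complete_space} \<Rightarrow>\<^sub>L real"
proof -
  have "(\<lambda>\<eta>. dual_inner \<phi> \<eta> *\<^sub>R \<theta>) = blinfun_apply (blinfun_scaleR_left \<theta> o\<^sub>L eval_op (riesz_rep \<phi>))"
    by (simp add: fun_eq_iff dual_inner_eq eval_op_apply blinfun_scaleR_left.rep_eq)
  then show ?thesis unfolding dual_tensor_def by (simp add: blinfun_apply_inverse)
qed

lemma dual_tensor_apply: "dual_tensor \<phi> \<theta> \<eta> = dual_inner \<phi> \<eta> *\<^sub>R \<theta>" for \<phi> \<theta> :: "'e::{real_inner, complete_space} \<Rightarrow>\<^sub>L real"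
  by (simp add: dual_tensor_eq dual_inner_eq eval_op_apply blinfun_scaleR_left.rep_eq)

text \<open>The adjoint is written down explicitly; it is unique because testing against
  \<open>blinfun_inner_right u\<close> recovers the value at u.\<close>

lemma dual_adjoint_inner:
  fixes B :: "('e::{real_inner, complete_space} \<Rightarrow>\<^sub>L real) \<Rightarrow>\<^sub>L 'e"
  shows "dual_inner \<phi> (dual_adjoint B h) = B \<phi> \<bullet> h"
proof -
  define J :: "'e \<Rightarrow>\<^sub>L 'e \<Rightarrow>\<^sub>L real" where "J = Blinfun blinfun_inner_right"
  have J: "blinfun_apply J = blinfun_inner_right"
    unfolding J_def by (rule bounded_linear_Blinfun_apply) (rule bounded_linear_blinfun_inner_right)
  define Bt where "Bt = Blinfun (\<lambda>h. blinfun_inner_right h o\<^sub>L (B o\<^sub>L J))"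
  have "bounded_linear (\<lambda>h. blinfun_inner_right h o\<^sub>L (B o\<^sub>L J))"
    by (rule bounded_linear_compose[OF bounded_bilinear.bounded_linear_left[OF bounded_bilinear_blinfun_compose] bounded_linear_blinfun_inner_right])
  then have Bt: "Bt h = blinfun_inner_right h o\<^sub>L (B o\<^sub>L J)" for h unfolding Bt_def by (simp add: bounded_linear_Blinfun_apply)
  have "blinfun_inner_right (riesz_rep \<phi>) = \<phi>" for \<phi> :: "'e \<Rightarrow>\<^sub>L real" by (rule blinfun_eqI) (simp add: riesz_rep_inner)
  then have ok: "blinfun_apply B \<phi> \<bullet> h = dual_inner \<phi> (blinfun_apply Bt h)" for \<phi> h
    by (simp add: dual_inner_eq Bt J inner_commute)
  have "dual_adjoint B = Bt"
    unfolding dual_adjoint_def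
  proof (rule the_equality)
    fix C assume C: "\<forall>\<phi> h. blinfun_apply B \<phi> \<bullet> h = dual_inner \<phi> (blinfun_apply C h)"
    show "C = Bt"
    proof (intro blinfun_eqI)
      fix h u
      have "dual_inner (blinfun_inner_right u) (C h) = dual_inner (blinfun_inner_right u) (Bt h)" using C ok by metis
      then show "C h u = Bt h u" by (simp add: dual_inner_eq riesz_rep_blinfun_inner_right)
    qed
  qed (use ok in blast)
  then show ?thesis using ok by simp
qed

text \<open>Evaluations at two vectors separate operators of this nested type, and along each the
  expectation is a scalar integral.\<close>

lemma operator_expectation_eq:
  fixes f :: "'w \<Rightarrow> 'a::real_normed_vector \<Rightarrow>\<^sub>L 'b::real_normed_vector \<Rightarrow>\<^sub>L real"
  assumes f: "has_expectation M f v"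
  shows "operator_expectation M f = v"
  unfolding operator_expectation_def
proof (rule the_equality[where P = "has_expectation M f", OF f])
  fix w assume w: "has_expectation M f w"
  show "w = v"
  proof (intro blinfun_eqI)
    fix h :: 'a and k :: 'b
    have l: "bounded_linear (\<lambda>G. blinfun_apply (blinfun_apply G h) k :: real)"
      by (rule bounded_linear_compose[OF blinfun.bounded_linear_left blinfun.bounded_linear_left])
    show "w h k = v h k"
      using has_expectation_bounded_linear[OF w l] has_expectation_bounded_linear[OF f l] by (rule has_bochner_integral_eq)
  qed
qed

text \<open>The radius is \<open>2\<close> rather than \<open>1\<close> because the simple functions approximating the identity are only bounded by
  twice the norm of their argument.\<close>

definition tame :: "('h::real_normed_vector \<Rightarrow> 'b::real_normed_vector) \<Rightarrow> bool" where
  "tame f \<longleftrightarrow> continuous_on UNIV f \<and> (\<exists>K. \<forall>x. norm x \<le> 2 \<longrightarrow> norm (f x) \<le> K)"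

lemma tame_linear:
  assumes "bounded_linear f" shows "tame f"
proof -
  interpret bounded_linear f by fact
  obtain K where K: "K > 0" "\<And>x. norm (f x) \<le> norm x * K" using pos_bounded by blast
  have "norm (f x) \<le> 2 * K" if "norm x \<le> 2" for x
    using K(2)[of x] mult_right_mono[OF that, of K] K(1) by linarith
  then show ?thesis unfolding tame_def using linear_continuous_on[OF assms] by blast
qed

lemma tame_bilinear:
  assumes p: "bounded_bilinear p" and f: "tame f" and g: "tame g"
  shows "tame (\<lambda>x. p (f x) (g x))"
proof -
  interpret bounded_bilinear p by fact
  obtain K where K: "K > 0" "\<And>x y. norm (p x y) \<le> norm x * norm y * K" using pos_bounded by blast
  obtain A where A: "\<And>x. norm x \<le> 2 \<Longrightarrow> norm (f x) \<le> A" using f unfolding tame_def by blast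
  obtain B where B: "\<And>x. norm x \<le> 2 \<Longrightarrow> norm (g x) \<le> B" using g unfolding tame_def by blast
  have "norm (p (f x) (g x)) \<le> A * B * K" if x: "norm x \<le> 2" for x
  proof -
    have "norm (f x) * norm (g x) \<le> A * B"
      using A[OF x] B[OF x] order.trans[OF norm_ge_zero A[OF x]] by (intro mult_mono) auto
    then have "norm (f x) * norm (g x) * K \<le> A * B * K" using K(1) by (intro mult_right_mono) auto
    then show ?thesis using K(2)[of "f x" "g x"] by linarith
  qed
  moreover have "continuous_on UNIV (\<lambda>x. p (f x) (g x))"
    using f g unfolding tame_def by (intro continuous_on) auto
  ultimately show ?thesis unfolding tame_def by blast
qed

lemma tame_add:
  assumes f: "tame f" and g: "tame g" shows "tame (\<lambda>x. f x + g x)"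
proof -
  obtain A where A: "\<And>x. norm x \<le> 2 \<Longrightarrow> norm (f x) \<le> A" using f unfolding tame_def by blast
  obtain B where B: "\<And>x. norm x \<le> 2 \<Longrightarrow> norm (g x) \<le> B" using g unfolding tame_def by blast
  have "norm (f x + g x) \<le> A + B" if x: "norm x \<le> 2" for x using norm_triangle_mono[OF A[OF x] B[OF x]] .
  moreover have "continuous_on UNIV (\<lambda>x. f x + g x)" using f g unfolding tame_def by (intro continuous_intros) auto
  ultimately show ?thesis unfolding tame_def by blast
qed

lemma tame_dsq: "tame (\<lambda>x. dsq (x \<bullet> m))" "tame (\<lambda>x. ddsq (x \<bullet> m))" for m :: "'h::real_inner"
proof -
  from ex_bound_dsq obtain C where C: "0 < C" "\<forall>s. \<bar>dsq s\<bar> \<le> C" "\<forall>s. \<bar>ddsq s\<bar> \<le> C" by (elim exE conjE)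
  have "continuous_on UNIV (\<lambda>x. dsq (x \<bullet> m))" "continuous_on UNIV (\<lambda>x. ddsq (x \<bullet> m))"
    by (rule continuous_on_compose2[OF continuous_dsq], intro continuous_intros, simp)
      (rule continuous_on_compose2[OF continuous_ddsq], intro continuous_intros, simp)
  then show "tame (\<lambda>x. dsq (x \<bullet> m))" "tame (\<lambda>x. ddsq (x \<bullet> m))"
    unfolding tame_def using C(2,3) by auto
qed

text \<open>A single v is both the expectation of every \<open>f\<close> almost surely equal to
  \<open>g (X \<omega>)\<close> and the L1 limit of the averages. The first part lets the chart
  derivatives be replaced by their continuous extensions.\<close>

lemma (in mean_sample) tame_expectation:
  fixes g :: "'h \<Rightarrow> 'b::banach"
  assumes "tame g"
  shows "\<exists>v. (\<forall>f. (AE \<omega> in M. f \<omega> = g (X \<omega>)) \<longrightarrow> has_expectation M f v) \<and>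
    (\<lambda>n. \<integral>\<omega>. norm ((1 / real n) *\<^sub>R (\<Sum>i<n. g (Xs i \<omega>)) - v) \<partial>M) \<longlonglongrightarrow> 0 \<and>
    (\<forall>n. integrable M (\<lambda>\<omega>. norm ((1 / real n) *\<^sub>R (\<Sum>i<n. g (Xs i \<omega>)) - v)))"
proof -
  obtain C where g: "continuous_on UNIV g" and C: "\<And>x. norm x \<le> 2 \<Longrightarrow> norm (g x) \<le> C"
    using assms unfolding tame_def by blast
  have n1: "norm (X \<omega>) \<le> 1" "norm (Xs i \<omega>) \<le> 1" if "\<omega> \<in> space M" for \<omega> i
    using X_norm[OF that] Xs_norm[OF that] by simp_all
  have law: "distr M borel (Xs i) = distr M borel X" for i using Xs_law by (simp add: N_def)
  from ex_simple_identity obtain F :: "nat \<Rightarrow> 'h \<Rightarrow> 'h" where F0: "\<forall>i. simple_function borel (F i)"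
    "\<forall>x. (\<lambda>i. F i x) \<longlonglongrightarrow> x" "\<forall>i x. norm (F i x) \<le> 2 * norm x" by (elim exE conjE)
  note F = F0[rule_format]
  have "\<exists>v. (\<forall>i. Bochner_Integration.simple_bochner_integrable M (\<lambda>\<omega>. g (F i (X \<omega>)))) \<and>
    (\<lambda>i. Bochner_Integration.simple_bochner_integral M (\<lambda>\<omega>. g (F i (X \<omega>)))) \<longlonglongrightarrow> v"
  proof (rule ex_expectation_limit[OF X_meas n1(1) g C F])
    fix v
    assume "\<And>i. Bochner_Integration.simple_bochner_integrable M (\<lambda>\<omega>. g (F i (X \<omega>)))"
      "(\<lambda>i. Bochner_Integration.simple_bochner_integral M (\<lambda>\<omega>. g (F i (X \<omega>)))) \<longlonglongrightarrow> v"
    then show ?thesis by (intro exI conjI allI)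
  qed
  then obtain v where v0: "\<forall>i. Bochner_Integration.simple_bochner_integrable M (\<lambda>\<omega>. g (F i (X \<omega>)))"
    and v2: "(\<lambda>i. Bochner_Integration.simple_bochner_integral M (\<lambda>\<omega>. g (F i (X \<omega>)))) \<longlonglongrightarrow> v"
    by (elim exE conjE)
  note v = v0[rule_format] v2
  have "has_expectation M f v" if "AE \<omega> in M. f \<omega> = g (X \<omega>)" for f
    by (rule ex_has_expectation[OF prob_space_axioms compl X_meas n1(1) g C that F v(2,1)])
  moreover note law_of_large_numbers_L1(1,3)[OF Xs_indep law X_meas n1 g C F v(2,1)]
  ultimately show ?thesis by blast
qed

section \<open>Gradient and Hessian as functions of the observation\<close>

context sphere_chart
begin

definition Q :: "'h \<Rightarrow> 'e \<Rightarrow>\<^sub>L real" where "Q x = blinfun_inner_right x o\<^sub>L A0"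

lemma Q_apply: "Q x h = x \<bullet> A0 h" by (simp add: Q_def)

lemma bounded_linear_Q: "bounded_linear Q"
  unfolding Q_def
  by (rule bounded_linear_compose[OF bounded_bilinear.bounded_linear_left[OF bounded_bilinear_blinfun_compose] bounded_linear_blinfun_inner_right])

lemma psi_Q: "psi x = Q (dsq (x \<bullet> \<mu>) *\<^sub>R x)" by (simp add: psi_def Q_def)

lemma tame_psi: "tame psi"
proof -
  have "psi = (\<lambda>x. dsq (x \<bullet> \<mu>) *\<^sub>R Q x)"
    by (simp add: fun_eq_iff psi_Q linear_scale[OF bounded_linear.linear[OF bounded_linear_Q]])
  then show ?thesis by (simp add: tame_bilinear[OF bounded_bilinear_scaleR tame_dsq(1) tame_linear[OF bounded_linear_Q]])
qed

lemma tame_hess: "tame hess"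
proof -
  have q: "tame (\<lambda>x. blinfun_inner_right x o\<^sub>L A0)" using tame_linear[OF bounded_linear_Q] by (simp add: Q_def[abs_def])
  have "bounded_linear (\<lambda>x. blinfun_scaleR_left (blinfun_inner_right x o\<^sub>L A0))"
    using bounded_linear_compose[OF bounded_linear_blinfun_scaleR_left bounded_linear_Q] by (simp add: Q_def)
  then have s: "tame (\<lambda>x. blinfun_scaleR_left (blinfun_inner_right x o\<^sub>L A0))" by (rule tame_linear)
  have "bounded_linear compose_op"
    unfolding compose_op_def
    by (rule bounded_linear_compose[OF bounded_bilinear.bounded_linear_prod_right[OF bounded_bilinear_blinfun_compose] bounded_linear_blinfun_inner_right])
  then have c: "tame (\<lambda>x. compose_op x o\<^sub>L A2)"
    by (intro tame_linear bounded_linear_compose[OF bounded_bilinear.bounded_linear_left[OF bounded_bilinear_blinfun_compose]])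
  show ?thesis unfolding hess_def
    by (intro tame_add tame_bilinear[OF bounded_bilinear_scaleR] tame_dsq tame_bilinear[OF bounded_bilinear_blinfun_compose] s q c)
qed

lemma hess_apply2: "hess x h k = ddsq (x \<bullet> \<mu>) * (x \<bullet> A0 h) * (x \<bullet> A0 k) + dsq (x \<bullet> \<mu>) * (x \<bullet> A2 h k)"
  by (simp add: hess_apply plus_blinfun.rep_eq scaleR_blinfun.rep_eq)

lemma tame_dual_tensor: "tame (\<lambda>x. dual_tensor (psi x) (psi x))"
proof -
  have lin: "tame (\<lambda>x. l (psi x))" if "bounded_linear l" for l :: "('e \<Rightarrow>\<^sub>L real) \<Rightarrow> 'b::real_normed_vector"
    using tame_bilinear[OF _ tame_psi tame_psi, of "\<lambda>a b. l a"] tame_psi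
  proof -
    interpret l: bounded_linear l by fact
    obtain K where K: "K > 0" "\<And>x. norm (l x) \<le> norm x * K" using l.pos_bounded by blast
    obtain B where B: "\<And>x. norm x \<le> 2 \<Longrightarrow> norm (psi x) \<le> B" using tame_psi unfolding tame_def by blast
    have "norm (l (psi x)) \<le> B * K" if "norm x \<le> 2" for x
      using K(2)[of "psi x"] mult_right_mono[OF B[OF that], of K] K(1) by linarith
    moreover have "continuous_on UNIV (\<lambda>x. l (psi x))" using tame_psi unfolding tame_def by (intro l.continuous_on) blast
    ultimately show ?thesis unfolding tame_def by blast
  qed
  show ?thesis unfolding dual_tensor_eq
    by (intro tame_bilinear[OF bounded_bilinear_blinfun_compose] lin bounded_linear_blinfun_scaleR_left
      bounded_linear_compose[OF bounded_linear_eval_op bounded_linear_riesz_rep])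
qed

end

subsection \<open>Asymptotic normality of the sample mean in a chart\<close>

locale chart_mean_sample = mean_sample M X Xs + sphere_chart U \<tau> "intrinsic_mean M X" A A2
  for M :: "'w measure" and X :: "'w \<Rightarrow> 'h::{real_inner, polish_space}" and Xs :: "nat \<Rightarrow> 'w \<Rightarrow> 'h"
    and U :: "'h set" and \<tau> :: "'h \<Rightarrow> 'e::{real_inner, complete_space}"
    and A :: "'e \<Rightarrow> 'e \<Rightarrow>\<^sub>L 'h" and A2 :: "'e \<Rightarrow>\<^sub>L 'e \<Rightarrow>\<^sub>L 'h"
begin

abbreviation "\<mu> \<equiv> intrinsic_mean M X"

lemmas mu_norm = intrinsic_mean_properties(1)

lemma mu_S: "x \<in> S \<Longrightarrow> 0 \<le> x \<bullet> \<mu>" "x \<in> S \<Longrightarrow> x \<bullet> \<mu> \<le> 1"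
  using law.mean_inner_nonneg[OF mu_norm intrinsic_mean_properties(2)] unit_inner_bounds(2)[OF S_unit] mu_norm by auto

lemma ex_gradient: "\<exists>b. \<forall>h. b \<bullet> h = (\<integral>x. (dsq (x \<bullet> \<mu>) *\<^sub>R x) \<bullet> h \<partial>N)"
proof -
  from ex_bound_dsq obtain C where C: "0 < C" "\<forall>s. \<bar>dsq s\<bar> \<le> C" by (elim exE conjE)
  show ?thesis
  proof (rule law.weak_integral_exists)
    show "AE x in N. norm (dsq (x \<bullet> \<mu>) *\<^sub>R x) \<le> C"
      using law.AE_S by eventually_elim (use C S_unit in simp)
  qed measurable
qed

definition b :: 'h where "b = (SOME b. \<forall>h. b \<bullet> h = (\<integral>x. (dsq (x \<bullet> \<mu>) *\<^sub>R x) \<bullet> h \<partial>N))"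

lemma b_inner_N: "b \<bullet> h = (\<integral>x. (dsq (x \<bullet> \<mu>) *\<^sub>R x) \<bullet> h \<partial>N)"
  using someI_ex[OF ex_gradient] unfolding b_def[symmetric] by blast

lemma b_mu: "b = - norm b *\<^sub>R \<mu>" and b_pos: "0 < norm b"
  using law.mean_gradient[OF mu_norm intrinsic_mean_properties(2) b_inner_N] by auto

lemma b_inner: "b \<bullet> h = (\<integral>\<omega>. dsq (X \<omega> \<bullet> \<mu>) * (X \<omega> \<bullet> h) \<partial>M)"
  unfolding b_inner_N by (subst integral_N) auto

text \<open>b is a multiple of \<mu>, hence normal to the range of \<open>A0\<close>. So the ambient
  gradients may be centred by b without changing their images under \<open>Q\<close>.\<close>

lemma Q_b: "Q b = 0"
proof (rule blinfun_eqI)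
  fix h
  have "\<mu> \<bullet> A0 h = 0" using \<sigma>_orthogonal[OF e0_O, of h] \<sigma>_\<tau>[OF mu] by simp
  then show "Q b h = blinfun_apply 0 h" unfolding Q_apply by (subst b_mu) simp
qed

abbreviation "\<Lambda> \<equiv> operator_expectation M (\<lambda>\<omega>. hess_chart U \<tau> (X \<omega>) e0)"

lemma AE_hess: "AE \<omega> in M. hess_chart U \<tau> (X \<omega>) e0 = hess (X \<omega>)"
  using AE_X_S by eventually_elim (intro hess_eq S_unit mu_S)

lemma AE_psi: "AE \<omega> in M. psi_chart U \<tau> (X \<omega>) e0 = psi (X \<omega>)"
  using AE_X_S by eventually_elim (intro psi_eq S_unit mu_S)

lemma hess_expectation: "has_expectation M (\<lambda>\<omega>. hess (X \<omega>)) \<Lambda>"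
  and hess_lln: "(\<lambda>n. \<integral>\<omega>. norm ((1 / real n) *\<^sub>R (\<Sum>i<n. hess (Xs i \<omega>)) - \<Lambda>) \<partial>M) \<longlonglongrightarrow> 0"
    "integrable M (\<lambda>\<omega>. norm ((1 / real n) *\<^sub>R (\<Sum>i<n. hess (Xs i \<omega>)) - \<Lambda>))"
proof -
  from tame_expectation[OF tame_hess] obtain v where
    v: "\<forall>f. (AE \<omega> in M. f \<omega> = hess (X \<omega>)) \<longrightarrow> has_expectation M f v"
      "(\<lambda>n. \<integral>\<omega>. norm ((1 / real n) *\<^sub>R (\<Sum>i<n. hess (Xs i \<omega>)) - v) \<partial>M) \<longlonglongrightarrow> 0"
      "\<forall>n. integrable M (\<lambda>\<omega>. norm ((1 / real n) *\<^sub>R (\<Sum>i<n. hess (Xs i \<omega>)) - v))"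
    by (elim exE conjE)
  have "\<Lambda> = v" by (rule operator_expectation_eq[OF v(1)[rule_format, OF AE_hess]])
  moreover have "has_expectation M (\<lambda>\<omega>. hess (X \<omega>)) v" by (rule v(1)[rule_format]) simp
  ultimately show "has_expectation M (\<lambda>\<omega>. hess (X \<omega>)) \<Lambda>"
    "(\<lambda>n. \<integral>\<omega>. norm ((1 / real n) *\<^sub>R (\<Sum>i<n. hess (Xs i \<omega>)) - \<Lambda>) \<partial>M) \<longlonglongrightarrow> 0"
    "integrable M (\<lambda>\<omega>. norm ((1 / real n) *\<^sub>R (\<Sum>i<n. hess (Xs i \<omega>)) - \<Lambda>))"
    using v(2,3) by simp_all
qed

lemma integrable_X:
  fixes f :: "'h \<Rightarrow> real"
  assumes "f \<in> borel_measurable borel" "\<And>x. norm x = 1 \<Longrightarrow> \<bar>f x\<bar> \<le> K"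
  shows "integrable M (\<lambda>\<omega>. f (X \<omega>))"
  by (rule integrable_bounded[of _ K]) (use assms X_norm in auto)

text \<open>On the tangent space the second derivative of the chart contributes \<open>norm b\<close> times the metric:
  \<open>b\<close> is normal to the sphere, and the second fundamental form of the sphere is minus the metric.\<close>

lemma \<Lambda>_apply: "\<Lambda> h k = (\<integral>\<omega>. ddsq (X \<omega> \<bullet> \<mu>) * (X \<omega> \<bullet> A0 h) * (X \<omega> \<bullet> A0 k) \<partial>M) + norm b * (A0 h \<bullet> A0 k)"
proof -
  from ex_bound_dsq obtain C where C: "0 < C" "\<forall>s. \<bar>dsq s\<bar> \<le> C" "\<forall>s. \<bar>ddsq s\<bar> \<le> C" by (elim exE conjE)
  have l: "bounded_linear (\<lambda>G. blinfun_apply (blinfun_apply G h) k :: real)"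
    by (rule bounded_linear_compose[OF blinfun.bounded_linear_left blinfun.bounded_linear_left])
  have "\<Lambda> h k = (\<integral>\<omega>. hess (X \<omega>) h k \<partial>M)"
    using has_bochner_integral_integral_eq[OF has_expectation_bounded_linear[OF hess_expectation l]] by simp
  also have "\<dots> = (\<integral>\<omega>. ddsq (X \<omega> \<bullet> \<mu>) * (X \<omega> \<bullet> A0 h) * (X \<omega> \<bullet> A0 k) + dsq (X \<omega> \<bullet> \<mu>) * (X \<omega> \<bullet> A2 h k) \<partial>M)"
    by (simp add: hess_apply2)
  also have "\<dots> = (\<integral>\<omega>. ddsq (X \<omega> \<bullet> \<mu>) * (X \<omega> \<bullet> A0 h) * (X \<omega> \<bullet> A0 k) \<partial>M) + (\<integral>\<omega>. dsq (X \<omega> \<bullet> \<mu>) * (X \<omega> \<bullet> A2 h k) \<partial>M)"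
  proof (rule Bochner_Integration.integral_add)
    have ab: "\<bar>x \<bullet> y\<bar> \<le> norm y" if "norm x = 1" for x y :: 'h using abs_inner_le[of x 1 y] that by simp
    show "integrable M (\<lambda>\<omega>. ddsq (X \<omega> \<bullet> \<mu>) * (X \<omega> \<bullet> A0 h) * (X \<omega> \<bullet> A0 k))"
    proof (rule integrable_X[where K = "C * norm (A0 h) * norm (A0 k)"])
      show "\<bar>ddsq (x \<bullet> \<mu>) * (x \<bullet> A0 h) * (x \<bullet> A0 k)\<bar> \<le> C * norm (A0 h) * norm (A0 k)" if "norm x = 1" for x
        unfolding abs_mult using C ab[OF that] by (intro mult_mono mult_nonneg_nonneg) auto
    qed measurable
    show "integrable M (\<lambda>\<omega>. dsq (X \<omega> \<bullet> \<mu>) * (X \<omega> \<bullet> A2 h k))"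
    proof (rule integrable_X[where K = "C * norm (A2 h k)"])
      show "\<bar>dsq (x \<bullet> \<mu>) * (x \<bullet> A2 h k)\<bar> \<le> C * norm (A2 h k)" if "norm x = 1" for x
        unfolding abs_mult using C ab[OF that] by (intro mult_mono) auto
    qed measurable
  qed
  also have "(\<integral>\<omega>. dsq (X \<omega> \<bullet> \<mu>) * (X \<omega> \<bullet> A2 h k) \<partial>M) = b \<bullet> A2 h k" by (rule b_inner[symmetric])
  also have "b \<bullet> A2 h k = norm b * (A0 h \<bullet> A0 k)" by (subst b_mu) (simp add: second_fundamental_form)
  finally show ?thesis .
qed

text \<open>The integral in \<open>\<Lambda>_apply\<close> is nonnegative on the diagonal by
  convexity of the squared arc cosine, and the lower bound on \<open>A0\<close> makes the other term
  coercive.\<close>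

lemma ex_\<Lambda>_inverse: "\<exists>B. is_blinfun_inverse \<Lambda> B"
proof -
  from A0_bounded_below obtain c where c: "0 < c" "\<forall>h. c * norm h \<le> norm (A0 h)" by (elim exE conjE)
  show ?thesis
  proof (rule symmetric_coercive_inverse)
    show "\<Lambda> x y = \<Lambda> y x" for x y
      unfolding \<Lambda>_apply by (simp add: inner_commute[of "A0 x"] mult.assoc mult.commute[of "X _ \<bullet> A0 x"])
    show "0 < norm b * c\<^sup>2" using b_pos c by simp
    show "norm b * c\<^sup>2 * (norm x)\<^sup>2 \<le> \<Lambda> x x" for x
    proof -
      have "0 \<le> (\<integral>\<omega>. ddsq (X \<omega> \<bullet> \<mu>) * (X \<omega> \<bullet> A0 x) * (X \<omega> \<bullet> A0 x) \<partial>M)"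
        by (intro Bochner_Integration.integral_nonneg) (simp add: mult.assoc ddsq_nonneg)
      moreover have "(c * norm x)\<^sup>2 \<le> (norm (A0 x))\<^sup>2" using c by (intro power_mono) auto
      then have "norm b * (c * norm x)\<^sup>2 \<le> norm b * (A0 x \<bullet> A0 x)"
        unfolding dot_square_norm by (intro mult_left_mono) auto
      ultimately show ?thesis unfolding \<Lambda>_apply by (simp add: power_mult_distrib mult.assoc)
    qed
  qed
qed

abbreviation "\<Gamma> \<equiv> blinfun_inverse \<Lambda>"

lemma \<Lambda>_inverse: "is_blinfun_inverse \<Lambda> \<Gamma>"
  using ex_\<Lambda>_inverse blinfun_inverse_eq by metis

lemma \<Gamma>_\<Lambda>: "\<Gamma> (\<Lambda> h) = h"
  using \<Lambda>_inverse unfolding is_blinfun_inverse_def by (metis blinfun_apply_blinfun_compose blinfun_apply_id_blinfun)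

text \<open>Solving \<open>Q s + \<Lambda> D = 0\<close> for the displacement D in the chart gives D
  = L s, the leading term of the displacement caused by a score s.\<close>

definition L :: "'h \<Rightarrow> 'e" where "L x = - \<Gamma> (Q x)"

lemma bounded_linear_L: "bounded_linear L"
  unfolding L_def by (intro bounded_linear_minus bounded_linear_compose[OF blinfun.bounded_linear_right bounded_linear_Q])

lemma L_b: "L b = 0" by (simp add: L_def Q_b)

lemma L_psi: "\<Gamma> (psi x) = - L (dsq (x \<bullet> \<mu>) *\<^sub>R x - b)"
  using linear_diff[OF bounded_linear.linear[OF bounded_linear_L], of "dsq (x \<bullet> \<mu>) *\<^sub>R x" b]
  by (simp add: L_b) (simp add: L_def psi_Q)

section \<open>The sample mean in terms of the score\<close>

definition y0 :: 'h where "y0 = (SOME y. y \<in> S)"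

lemma y0: "y0 \<in> S" unfolding y0_def using law.S_nonempty by (simp add: some_in_eq)

definition kap :: real where "kap = (\<integral>x. x \<bullet> y0 \<partial>N)"

lemma kap_pos: "0 < kap" unfolding kap_def by (rule law.inner_mean_pos[OF y0])

text \<open>The growth rate of the empirical functional obtained with the direction
  \<open>y0\<close>. By the law of large numbers it exceeds kap / 2 with probability tending to 1,
  whereas a data point as direction only guarantees 1 / n.\<close>

definition kap_n :: "nat \<Rightarrow> (nat \<Rightarrow> 'h) \<Rightarrow> real" where "kap_n n z = (1 / real n) * (\<Sum>i<n. z i \<bullet> y0)"

text \<open>An average of centred gradients, hence of order n^(-1/2) in probability; the deviations
  of the sample mean are measured against it.\<close>

definition score :: "nat \<Rightarrow> (nat \<Rightarrow> 'h) \<Rightarrow> 'h" where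
  "score n z = (1 / real n) *\<^sub>R (\<Sum>i<n. dsq (z i \<bullet> \<mu>) *\<^sub>R z i - b)"

definition hess_n :: "nat \<Rightarrow> (nat \<Rightarrow> 'h) \<Rightarrow> 'e \<Rightarrow>\<^sub>L 'e \<Rightarrow>\<^sub>L real" where
  "hess_n n z = (1 / real n) *\<^sub>R (\<Sum>i<n. hess (z i))"

lemma score_add_b: "0 < n \<Longrightarrow> score n z + b = (1 / real n) *\<^sub>R (\<Sum>i<n. dsq (z i \<bullet> \<mu>) *\<^sub>R z i)"
  by (simp add: score_def sum_subtractf scaleR_diff_right sum_constant_scaleR)

text \<open>Strong convexity of the empirical functional on the ball and the tangent inequality at \<open>\<mu>\<close>; the
  multiplier term \<open>b \<bullet> (\<mu> - p)\<close> has a favourable sign.\<close>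

lemma sample_mean_distance:
  assumes n: "0 < n" and z: "\<And>i. i < n \<Longrightarrow> z i \<in> S" and k: "kap / 2 \<le> kap_n n z"
  shows "norm (sample_mean z n) = 1" "\<And>q. norm q \<le> 1 \<Longrightarrow> sample_G z n (sample_mean z n) \<le> sample_G z n q"
    "norm (sample_mean z n - \<mu>) \<le> 4 / kap * norm (score n z)"
proof -
  have kpos: "0 < kap_n n z" using k kap_pos by linarith
  note m = sample_mean_minimizes[OF n S_unit[OF z] S_unit[OF y0] inner_S_nonneg[OF z y0] kap_n_def kpos]
  define p where "p = sample_mean z n"
  show p1: "norm (sample_mean z n) = 1" using m(1) by blast
  show "sample_G z n (sample_mean z n) \<le> sample_G z n q" if "norm q \<le> 1" for q
  proof -
    have "0 \<le> kap_n n z / 2 * (norm (sample_mean z n - q))\<^sup>2" using kpos by simp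
    moreover have "sample_G z n (sample_mean z n) + kap_n n z / 2 * (norm (sample_mean z n - q))\<^sup>2 \<le> sample_G z n q"
      by (rule m(2)) (use that in auto)
    ultimately show ?thesis by linarith
  qed
  have pn: "norm p \<le> 1" using p1 by (simp add: p_def)
  have m2: "sample_G z n p + kap_n n z / 2 * (norm (p - \<mu>))\<^sup>2 \<le> sample_G z n \<mu>"
    unfolding p_def using m(2)[of \<mu>] mu_norm by simp
  have tang: "sample_G z n \<mu> + (score n z + b) \<bullet> (p - \<mu>) \<le> sample_G z n p"
  proof -
    have "(score n z + b) \<bullet> (p - \<mu>) = (1 / real n) * (\<Sum>i<n. dsq (z i \<bullet> \<mu>) * (z i \<bullet> p - z i \<bullet> \<mu>))"
      unfolding score_add_b[OF n] by (simp add: inner_sum_left inner_diff_right right_diff_distrib sum_subtractf diff_divide_distrib)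
    then have "sample_G z n \<mu> + (score n z + b) \<bullet> (p - \<mu>) = (1 / real n) * (\<Sum>i<n. sqarc (z i \<bullet> \<mu>) + dsq (z i \<bullet> \<mu>) * (z i \<bullet> p - z i \<bullet> \<mu>))"
      unfolding sample_G_def by (simp only: sum.distrib distrib_left)
    also have "\<dots> \<le> (1 / real n) * (\<Sum>i<n. sqarc (z i \<bullet> p))"
    proof (intro mult_left_mono sum_mono)
      fix i assume "i \<in> {..<n}"
      then have zi: "z i \<in> S" using z by simp
      show "sqarc (z i \<bullet> \<mu>) + dsq (z i \<bullet> \<mu>) * (z i \<bullet> p - z i \<bullet> \<mu>) \<le> sqarc (z i \<bullet> p)"
        unfolding dsq_eq[OF mu_S[OF zi]]
        by (rule sqarc_tangent[OF mu_S[OF zi] unit_inner_bounds(1,2)[OF S_unit[OF zi] pn]])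
    qed simp
    finally show ?thesis unfolding sample_G_def .
  qed
  have bsgn: "b \<bullet> (p - \<mu>) \<ge> 0"
  proof -
    have "b \<bullet> (p - \<mu>) = norm b * (1 - \<mu> \<bullet> p)"
      by (subst b_mu) (use mu_norm in \<open>simp add: inner_diff_right norm_eq_1 right_diff_distrib\<close>)
    moreover have "\<mu> \<bullet> p \<le> 1" by (rule unit_inner_bounds(2)[OF mu_norm pn])
    ultimately show ?thesis by simp
  qed
  have "\<bar>score n z \<bullet> (p - \<mu>)\<bar> \<le> norm (score n z) * norm (p - \<mu>)" by (rule Cauchy_Schwarz_ineq2)
  then have "kap_n n z / 2 * (norm (p - \<mu>))\<^sup>2 \<le> norm (score n z) * norm (p - \<mu>)"
    using m2 tang bsgn unfolding inner_add_left by linarith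
  moreover have "kap / 4 * (norm (p - \<mu>))\<^sup>2 \<le> kap_n n z / 2 * (norm (p - \<mu>))\<^sup>2"
    using k by (intro mult_right_mono) auto
  ultimately have "kap / 4 * norm (p - \<mu>) * norm (p - \<mu>) \<le> norm (score n z) * norm (p - \<mu>)"
    by (simp add: power2_eq_square)
  then have "kap / 4 * norm (p - \<mu>) \<le> norm (score n z)"
    using kap_pos by (cases "p = \<mu>") auto
  then show "norm (sample_mean z n - \<mu>) \<le> 4 / kap * norm (score n z)"
    using kap_pos by (simp add: p_def field_simps)
qed

lemma U_nhd: "\<exists>r>0. \<forall>p. norm p = 1 \<longrightarrow> norm (p - \<mu>) < r \<longrightarrow> p \<in> U"
proof -
  have "openin (top_of_set (sphere 0 1)) U" using chart by (simp add: smooth_chart_def)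
  then obtain V where V: "open V" "U = sphere 0 1 \<inter> V" unfolding openin_open by blast
  then have "\<mu> \<in> V" using mu by blast
  then obtain r where "r > 0" "ball \<mu> r \<subseteq> V" using V(1) open_contains_ball by blast
  then show ?thesis using V(2) by (intro exI[of _ r]) (auto simp: subset_iff dist_norm norm_minus_commute)
qed

text \<open>In the chart the sample mean minimizes over an open set, because it minimizes over the
  whole ball. The bound on the cosines makes each summand differentiable there.\<close>

lemma chart_stationary:
  assumes n: "0 < n" and z: "\<And>i. i < n \<Longrightarrow> z i \<in> S" and k: "kap / 2 \<le> kap_n n z"
    and p: "sample_mean z n \<in> U" and reg: "\<And>i. i < n \<Longrightarrow> -1/2 < z i \<bullet> sample_mean z n"
  shows "(\<Sum>i<n. psi_chart U \<tau> (z i) (\<tau> (sample_mean z n))) = 0"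
proof (rule blinfun_eqI)
  fix h
  define e where "e = \<tau> (sample_mean z n)"
  have e: "e \<in> \<Omega>" "\<sigma> e = sample_mean z n" using p \<sigma>_\<tau> by (auto simp: e_def)
  have d: "((\<lambda>e. sqarc (z i \<bullet> \<sigma> e)) has_derivative blinfun_apply (psi_chart U \<tau> (z i) e)) (at e)" if i: "i < n" for i
    using psi_formula(1,2)[OF S_unit[OF z[OF i]] e(1)] reg[OF i] e(2) by simp
  have "((\<lambda>e. sample_G z n (\<sigma> e)) has_derivative (\<lambda>h. (1 / real n) * (\<Sum>i<n. psi_chart U \<tau> (z i) e h))) (at e)"
    unfolding sample_G_def by (intro has_derivative_mult_right has_derivative_sum) (use d in auto)
  then have "(\<lambda>h. (1 / real n) * (\<Sum>i<n. psi_chart U \<tau> (z i) e h)) = (\<lambda>h. 0)"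
  proof (rule differential_zero_maxmin[OF e(1) open_O])
    show "(\<forall>y\<in>\<Omega>. sample_G z n (\<sigma> y) \<le> sample_G z n (\<sigma> e)) \<or> (\<forall>y\<in>\<Omega>. sample_G z n (\<sigma> e) \<le> sample_G z n (\<sigma> y))"
      unfolding e(2) using sample_mean_distance(2)[OF n z k] \<sigma>_norm by simp
  qed
  from fun_cong[OF this, of h] n have "(\<Sum>i<n. psi_chart U \<tau> (z i) e h) = 0" by simp
  then show "blinfun_apply (\<Sum>i<n. psi_chart U \<tau> (z i) (\<tau> (sample_mean z n))) h = blinfun_apply 0 h"
    unfolding e_def[symmetric] by (simp add: blinfun.sum_left)
qed

text \<open>Deterministic: all randomness is in the conditions on the data. \<open>K\<close> is
  chosen before \<epsilon>, so that after scaling by sqrt n the error is an arbitrarily small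
  multiple of a tight sequence.\<close>

lemma chart_expansion:
  "\<exists>K>0. \<forall>\<epsilon>>0. \<exists>d>0. \<forall>n z. 0 < n \<longrightarrow> (\<forall>i<n. z i \<in> S) \<longrightarrow> kap / 2 \<le> kap_n n z \<longrightarrow> norm (score n z) < d \<longrightarrow>
    norm (hess_n n z - \<Lambda>) \<le> \<epsilon> \<longrightarrow>
    sample_mean z n \<in> U \<and> norm (\<tau> (sample_mean z n) - e0 - L (score n z)) \<le> K * \<epsilon> * norm (score n z)"
proof -
  from \<tau>_lipschitz_at obtain C dt where C: "0 < C" and dt: "0 < dt"
    "\<forall>p\<in>U. norm (p - \<mu>) < dt \<longrightarrow> norm (\<tau> p - e0) \<le> C * norm (p - \<mu>)" by (elim exE conjE)
  from U_nhd obtain r where r: "0 < r" "\<forall>p. norm p = 1 \<longrightarrow> norm (p - \<mu>) < r \<longrightarrow> p \<in> U" by (elim exE conjE)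
  \<comment> \<open>The displacement in the chart is at most R times the score: the Lipschitz
    constant of the chart times the factor from \<open>sample_mean_distance\<close>.\<close>
  define R where "R = C * (4 / kap)"
  have R: "0 < R" using C kap_pos by (simp add: R_def)
  \<comment> \<open>Two errors of size \<epsilon> |D|, from the expansion and from the empirical
    Hessian, are mapped by the inverse Hessian.\<close>
  define K where "K = (norm \<Gamma> + 1) * 2 * R"
  have K: "0 < K" using R by (simp add: K_def add_nonneg_pos)
  show ?thesis
  proof (rule exI[of _ K], intro conjI K allI impI)
    fix \<epsilon> :: real assume eps: "0 < \<epsilon>"
    from psi_expansion[OF eps] obtain dp where dp: "0 < dp" "\<forall>x e. norm x = 1 \<longrightarrow> 0 \<le> x \<bullet> \<mu> \<longrightarrow> norm (e - e0) < dp \<longrightarrow>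
      e \<in> \<Omega> \<and> -1/2 < x \<bullet> \<sigma> e \<and> norm (psi_chart U \<tau> x e - psi x - hess x (e - e0)) \<le> \<epsilon> * norm (e - e0)"
      by (elim exE conjE)
    \<comment> \<open>The first two bounds put the sample mean into \<open>U\<close> and into the
      range of the Lipschitz bound, the third brings the displacement below
      \<open>dp\<close>.\<close>
    define d where "d = min (min (r * kap / 4) (dt * kap / 4)) (dp / R)"
    have d: "0 < d" using r dt dp R kap_pos by (simp add: d_def)
    have "sample_mean z n \<in> U \<and> norm (\<tau> (sample_mean z n) - e0 - L (score n z)) \<le> K * \<epsilon> * norm (score n z)"
      if n: "0 < n" and z0: "\<forall>i<n. z i \<in> S" and k: "kap / 2 \<le> kap_n n z" and s: "norm (score n z) < d"
        and H: "norm (hess_n n z - \<Lambda>) \<le> \<epsilon>" for n z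
    proof -
      have z: "\<And>i. i < n \<Longrightarrow> z i \<in> S" using z0 by blast
      define p where "p = sample_mean z n"
      note sd = sample_mean_distance[OF n z k, folded p_def]
      have s3: "norm (score n z) < r * kap / 4" "norm (score n z) < dt * kap / 4" "norm (score n z) < dp / R"
        using s by (auto simp: d_def)
      have "4 / kap * norm (score n z) < r" "4 / kap * norm (score n z) < dt"
        using s3 kap_pos by (auto simp: field_simps)
      then have pr: "norm (p - \<mu>) < r" "norm (p - \<mu>) < dt" using sd(3) by auto
      have pU: "p \<in> U" using r(2) sd(1) pr(1) by blast
      define e where "e = \<tau> p"
      define D where "D = e - e0"
      have "norm D \<le> C * norm (p - \<mu>)" unfolding D_def e_def using dt(2) pU pr(2) by blast
      also have "\<dots> \<le> C * (4 / kap * norm (score n z))" using sd(3) C by (intro mult_left_mono) auto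
      finally have nD: "norm D \<le> R * norm (score n z)" by (simp add: R_def mult.assoc)
      also have "\<dots> < dp" using s3(3) R by (simp add: field_simps)
      finally have Ddp: "norm (e - e0) < dp" by (simp add: D_def)
      have ex: "-1/2 < z i \<bullet> \<sigma> e \<and> norm (psi_chart U \<tau> (z i) e - psi (z i) - hess (z i) D) \<le> \<epsilon> * norm D" if "i < n" for i
        using dp(2)[rule_format, OF S_unit[OF z[OF that]] mu_S(1)[OF z[OF that]] Ddp] by (simp add: D_def)
      have \<sigma>e: "\<sigma> e = p" using pU \<sigma>_\<tau> by (simp add: e_def)
      have stat: "(\<Sum>i<n. psi_chart U \<tau> (z i) e) = 0"
        unfolding e_def p_def by (rule chart_stationary[OF n z k]) (use pU ex \<sigma>e in \<open>auto simp: p_def\<close>)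
      have psum: "(1 / real n) *\<^sub>R (\<Sum>i<n. psi (z i)) = Q (score n z)"
      proof -
        interpret Q: bounded_linear Q by (rule bounded_linear_Q)
        have "(1 / real n) *\<^sub>R (\<Sum>i<n. psi (z i)) = Q ((1 / real n) *\<^sub>R (\<Sum>i<n. dsq (z i \<bullet> \<mu>) *\<^sub>R z i))"
          by (simp only: psi_Q Q.sum Q.scaleR)
        also have "\<dots> = Q (score n z + b)" by (simp only: score_add_b[OF n])
        also have "\<dots> = Q (score n z)" by (simp add: Q.add Q_b)
        finally show ?thesis .
      qed
      \<comment> \<open>The chart gradients drop out by stationarity; what remains of their
        expansion is the linearized equation.\<close>
      have eq: "(1 / real n) *\<^sub>R (\<Sum>i<n. psi_chart U \<tau> (z i) e - psi (z i) - hess (z i) D) = - (Q (score n z) + hess_n n z D)"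
      proof -
        have "(\<Sum>i<n. hess (z i)) D = (\<Sum>i<n. hess (z i) D)" by (simp add: blinfun.sum_left)
        then have "hess_n n z D = (1 / real n) *\<^sub>R (\<Sum>i<n. hess (z i) D)" by (simp add: hess_n_def scaleR_blinfun.rep_eq)
        then show ?thesis by (simp add: sum_subtractf stat scaleR_diff_right psum)
      qed
      have "norm (Q (score n z) + hess_n n z D) = norm ((1 / real n) *\<^sub>R (\<Sum>i<n. psi_chart U \<tau> (z i) e - psi (z i) - hess (z i) D))"
        unfolding eq norm_minus_cancel ..
      also have "\<dots> = (1 / real n) * norm (\<Sum>i<n. psi_chart U \<tau> (z i) e - psi (z i) - hess (z i) D)" by simp
      also have "\<dots> \<le> (1 / real n) * (\<Sum>i<n. \<epsilon> * norm D)"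
        using ex by (intro mult_left_mono sum_norm_le) auto
      also have "\<dots> = \<epsilon> * norm D" using n by simp
      finally have e1: "norm (Q (score n z) + hess_n n z D) \<le> \<epsilon> * norm D" .
      have "norm ((hess_n n z - \<Lambda>) D) \<le> norm (hess_n n z - \<Lambda>) * norm D" by (rule norm_blinfun)
      also have "\<dots> \<le> \<epsilon> * norm D" using H by (intro mult_right_mono) auto
      finally have e2: "norm ((hess_n n z - \<Lambda>) D) \<le> \<epsilon> * norm D" .
      have eq2: "Q (score n z) + \<Lambda> D = (Q (score n z) + hess_n n z D) - (hess_n n z - \<Lambda>) D"
        by (simp add: minus_blinfun.rep_eq)
      have e3: "norm (Q (score n z) + \<Lambda> D) \<le> 2 * (\<epsilon> * norm D)"
        unfolding eq2 using norm_triangle_ineq4[of "Q (score n z) + hess_n n z D" "(hess_n n z - \<Lambda>) D"] e1 e2 by linarith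
      have "D - L (score n z) = \<Gamma> (Q (score n z) + \<Lambda> D)" by (simp add: blinfun.add_right \<Gamma>_\<Lambda> L_def)
      then have "norm (D - L (score n z)) \<le> norm \<Gamma> * norm (Q (score n z) + \<Lambda> D)" by (simp add: norm_blinfun)
      also have "\<dots> \<le> (norm \<Gamma> + 1) * (2 * (\<epsilon> * norm D))" using e3 by (intro mult_mono) auto
      also have "\<dots> \<le> (norm \<Gamma> + 1) * (2 * (\<epsilon> * (R * norm (score n z))))"
        using nD eps by (intro mult_left_mono) auto
      also have "\<dots> = K * \<epsilon> * norm (score n z)" by (simp add: K_def mult_ac)
      finally show ?thesis using pU by (simp add: D_def e_def p_def)
    qed
    then show "\<exists>d>0. \<forall>n z. 0 < n \<longrightarrow> (\<forall>i<n. z i \<in> S) \<longrightarrow> kap / 2 \<le> kap_n n z \<longrightarrow> norm (score n z) < d \<longrightarrow>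
        norm (hess_n n z - \<Lambda>) \<le> \<epsilon> \<longrightarrow>
        sample_mean z n \<in> U \<and> norm (\<tau> (sample_mean z n) - e0 - L (score n z)) \<le> K * \<epsilon> * norm (score n z)"
      using d by (intro exI[of _ d] conjI allI impI) auto
  qed
qed

section \<open>The covariance operator\<close>

abbreviation "\<F> \<equiv> operator_expectation M (\<lambda>\<omega>. dual_tensor (psi_chart U \<tau> (X \<omega>) e0) (psi_chart U \<tau> (X \<omega>) e0))"

abbreviation "\<T> \<equiv> \<Gamma> o\<^sub>L \<F> o\<^sub>L dual_adjoint \<Gamma>"

lemma \<F>_expectation: "has_expectation M (\<lambda>\<omega>. dual_tensor (psi (X \<omega>)) (psi (X \<omega>))) \<F>"
proof -
  from tame_expectation[OF tame_dual_tensor] obtain v where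
    v: "\<forall>f. (AE \<omega> in M. f \<omega> = dual_tensor (psi (X \<omega>)) (psi (X \<omega>))) \<longrightarrow> has_expectation M f v"
    by (elim exE conjE)
  have "AE \<omega> in M. dual_tensor (psi_chart U \<tau> (X \<omega>) e0) (psi_chart U \<tau> (X \<omega>) e0) = dual_tensor (psi (X \<omega>)) (psi (X \<omega>))"
    using AE_psi by eventually_elim simp
  then have "\<F> = v" by (rule operator_expectation_eq[OF v[rule_format]])
  moreover have "has_expectation M (\<lambda>\<omega>. dual_tensor (psi (X \<omega>)) (psi (X \<omega>))) v" by (rule v[rule_format]) simp
  ultimately show ?thesis by simp
qed

text \<open>The tensor applied to the adjoint image of h2 is the number
  \<open>\<Gamma> (psi x) \<bullet> h2\<close> times \<open>psi x\<close>, so pairing with h1 under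
  the expectation leaves a product of two projections.\<close>

lemma \<T>_inner: "h1 \<bullet> \<T> h2 = (\<integral>\<omega>. (\<Gamma> (psi (X \<omega>)) \<bullet> h1) * (\<Gamma> (psi (X \<omega>)) \<bullet> h2) \<partial>M)"
proof -
  have l: "bounded_linear (\<lambda>G. h1 \<bullet> \<Gamma> (blinfun_apply G (dual_adjoint \<Gamma> h2)))"
    by (intro bounded_linear_compose[OF bounded_linear_inner_right]
        bounded_linear_compose[OF blinfun.bounded_linear_right blinfun.bounded_linear_left])
  have "h1 \<bullet> \<T> h2 = h1 \<bullet> \<Gamma> (\<F> (dual_adjoint \<Gamma> h2))" by simp
  also have "\<dots> = (\<integral>\<omega>. h1 \<bullet> \<Gamma> (dual_tensor (psi (X \<omega>)) (psi (X \<omega>)) (dual_adjoint \<Gamma> h2)) \<partial>M)"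
    using has_bochner_integral_integral_eq[OF has_expectation_bounded_linear[OF \<F>_expectation l]] by simp
  also have "\<dots> = (\<integral>\<omega>. (\<Gamma> (psi (X \<omega>)) \<bullet> h1) * (\<Gamma> (psi (X \<omega>)) \<bullet> h2) \<partial>M)"
    by (simp add: dual_tensor_apply dual_adjoint_inner blinfun.scaleR_right inner_commute mult.commute)
  finally show ?thesis .
qed

text \<open>Projections in the chart space are rewritten as projections in the separable space of
  the observations, where measurability and the limit theorem are available.\<close>

lemma ex_L_adjoint: "\<exists>w. \<forall>x. L x \<bullet> h = x \<bullet> w"
proof -
  have "bounded_linear (\<lambda>x. L x \<bullet> h)" by (rule bounded_linear_compose[OF bounded_linear_inner_left bounded_linear_L])
  from riesz[OF this] obtain w where "\<forall>x. w \<bullet> x = L x \<bullet> h" by (elim exE)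
  then have "\<forall>x. L x \<bullet> h = x \<bullet> w" by (simp add: inner_commute)
  then show ?thesis by (rule exI)
qed

definition xi :: "'h \<Rightarrow> 'h" where "xi x = dsq (x \<bullet> \<mu>) *\<^sub>R x - b"

lemma L_psi_xi: "\<Gamma> (psi x) = - L (xi x)" unfolding xi_def by (rule L_psi)

lemma xi_meas[measurable]: "xi \<in> borel_measurable borel" unfolding xi_def by measurable

lemma ex_xi_bound: "\<exists>B. \<forall>x. norm x = 1 \<longrightarrow> norm (xi x) \<le> B"
proof -
  from ex_bound_dsq obtain C where C: "0 < C" "\<forall>s. \<bar>dsq s\<bar> \<le> C" by (elim exE conjE)
  have "norm (xi x) \<le> C + norm b" if "norm x = 1" for x
    using norm_triangle_ineq4[of "dsq (x \<bullet> \<mu>) *\<^sub>R x" b] C(2)[rule_format, of "x \<bullet> \<mu>"] that unfolding xi_def by simp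
  then show ?thesis by blast
qed

lemma xi_inner_integral: "(\<integral>\<omega>. xi (X \<omega>) \<bullet> h \<partial>M) = 0"
proof -
  from ex_bound_dsq obtain C where C: "0 < C" "\<forall>s. \<bar>dsq s\<bar> \<le> C" by (elim exE conjE)
  have "integrable M (\<lambda>\<omega>. dsq (X \<omega> \<bullet> \<mu>) * (X \<omega> \<bullet> h))"
  proof (rule integrable_X[where K = "C * norm h"])
    show "\<bar>dsq (x \<bullet> \<mu>) * (x \<bullet> h)\<bar> \<le> C * norm h" if "norm x = 1" for x
      unfolding abs_mult using C abs_inner_le[of x 1 h] that by (intro mult_mono) auto
  qed measurable
  then show ?thesis by (simp add: xi_def inner_diff_left b_inner prob_space)
qed

definition V :: "'e \<Rightarrow> real" where "V h = (\<integral>\<omega>. (\<Gamma> (psi (X \<omega>)) \<bullet> h)\<^sup>2 \<partial>M)"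

lemma integrable_psi_prod: "integrable M (\<lambda>\<omega>. (\<Gamma> (psi (X \<omega>)) \<bullet> h1) * (\<Gamma> (psi (X \<omega>)) \<bullet> h2))"
proof -
  from ex_xi_bound obtain B where B: "\<forall>x. norm x = 1 \<longrightarrow> norm (xi x) \<le> B" by (elim exE)
  from ex_L_adjoint[of h1] obtain w1 where w1: "\<forall>x. L x \<bullet> h1 = x \<bullet> w1" by (elim exE)
  from ex_L_adjoint[of h2] obtain w2 where w2: "\<forall>x. L x \<bullet> h2 = x \<bullet> w2" by (elim exE)
  have eq: "(\<Gamma> (psi x) \<bullet> h1) * (\<Gamma> (psi x) \<bullet> h2) = (xi x \<bullet> w1) * (xi x \<bullet> w2)" for x
    by (simp add: L_psi_xi w1 w2)
  show ?thesis unfolding eq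
  proof (rule integrable_X[where K = "(B * norm w1) * (B * norm w2)"])
    show "\<bar>(xi x \<bullet> w1) * (xi x \<bullet> w2)\<bar> \<le> (B * norm w1) * (B * norm w2)" if "norm x = 1" for x
    proof -
      have xb: "norm (xi x) \<le> B" using B that by blast
      then have "0 \<le> B" using norm_ge_zero order.trans by blast
      then show ?thesis unfolding abs_mult using abs_inner_le[OF xb] by (intro mult_mono) auto
    qed
  qed measurable
qed

lemma psi_inner_integral: "(\<integral>\<omega>. \<Gamma> (psi (X \<omega>)) \<bullet> h \<partial>M) = 0"
proof -
  from ex_L_adjoint[of h] obtain w where w: "\<forall>x. L x \<bullet> h = x \<bullet> w" by (elim exE)
  show ?thesis using xi_inner_integral[of w] by (simp add: L_psi_xi w)
qed

text \<open>Symmetric forms are determined by their diagonal values, so covariance operators can be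
  compared through variances of projections alone.\<close>

lemma \<T>_polarization: "h1 \<bullet> \<T> h2 = (V (h1 + h2) - V (h1 - h2)) / 4"
proof -
  have sq: "integrable M (\<lambda>\<omega>. (\<Gamma> (psi (X \<omega>)) \<bullet> h)\<^sup>2)" for h
    using integrable_psi_prod[of h h] by (simp add: power2_eq_square)
  have "V (h1 + h2) - V (h1 - h2) = (\<integral>\<omega>. (\<Gamma> (psi (X \<omega>)) \<bullet> (h1 + h2))\<^sup>2 - (\<Gamma> (psi (X \<omega>)) \<bullet> (h1 - h2))\<^sup>2 \<partial>M)"
    unfolding V_def using sq by simp
  also have "\<dots> = (\<integral>\<omega>. 4 * ((\<Gamma> (psi (X \<omega>)) \<bullet> h1) * (\<Gamma> (psi (X \<omega>)) \<bullet> h2)) \<partial>M)"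
    by (intro Bochner_Integration.integral_cong refl) (simp add: inner_add_right inner_diff_right power2_eq_square algebra_simps)
  also have "\<dots> = 4 * (h1 \<bullet> \<T> h2)" unfolding \<T>_inner by simp
  finally show ?thesis by simp
qed

lemma covariance_formula:
  "h1 \<bullet> \<T> h2 = covariance M (\<lambda>\<omega>. \<Gamma> (psi_chart U \<tau> (X \<omega>) e0) \<bullet> h1) (\<lambda>\<omega>. \<Gamma> (psi_chart U \<tau> (X \<omega>) e0) \<bullet> h2)"
proof -
  have meas: "(\<lambda>\<omega>. \<Gamma> (psi (X \<omega>)) \<bullet> h) \<in> borel_measurable M" for h
  proof -
    from ex_L_adjoint[of h] obtain w where w: "\<forall>x. L x \<bullet> h = x \<bullet> w" by (elim exE)
    show ?thesis by (simp add: L_psi_xi w)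
  qed
  have AEeq: "AE \<omega> in M. \<Gamma> (psi_chart U \<tau> (X \<omega>) e0) \<bullet> h = \<Gamma> (psi (X \<omega>)) \<bullet> h" for h
    using AE_psi by eventually_elim simp
  have meas': "(\<lambda>\<omega>. \<Gamma> (psi_chart U \<tau> (X \<omega>) e0) \<bullet> h) \<in> borel_measurable M" for h
    by (rule complete_measure.borel_measurable_AE_cong[OF compl meas AEeq])
  have mean: "(\<integral>\<omega>. \<Gamma> (psi_chart U \<tau> (X \<omega>) e0) \<bullet> h \<partial>M) = 0" for h
    using integral_cong_AE[OF meas' meas AEeq] psi_inner_integral by simp
  have "covariance M (\<lambda>\<omega>. \<Gamma> (psi_chart U \<tau> (X \<omega>) e0) \<bullet> h1) (\<lambda>\<omega>. \<Gamma> (psi_chart U \<tau> (X \<omega>) e0) \<bullet> h2)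
    = (\<integral>\<omega>. (\<Gamma> (psi_chart U \<tau> (X \<omega>) e0) \<bullet> h1) * (\<Gamma> (psi_chart U \<tau> (X \<omega>) e0) \<bullet> h2) \<partial>M)"
    unfolding covariance_def mean by simp
  also have "\<dots> = (\<integral>\<omega>. (\<Gamma> (psi (X \<omega>)) \<bullet> h1) * (\<Gamma> (psi (X \<omega>)) \<bullet> h2) \<partial>M)"
  proof (rule integral_cong_AE)
    show "AE \<omega> in M. (\<Gamma> (psi_chart U \<tau> (X \<omega>) e0) \<bullet> h1) * (\<Gamma> (psi_chart U \<tau> (X \<omega>) e0) \<bullet> h2) = (\<Gamma> (psi (X \<omega>)) \<bullet> h1) * (\<Gamma> (psi (X \<omega>)) \<bullet> h2)"
      using AE_psi by eventually_elim simp
  qed (intro borel_measurable_times meas meas')+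
  finally show ?thesis unfolding \<T>_inner ..
qed

section \<open>The limit theorem in the chart\<close>

definition Sn :: "nat \<Rightarrow> 'w \<Rightarrow> 'h" where "Sn n \<omega> = (1 / sqrt (real n)) *\<^sub>R (\<Sum>i<n. xi (Xs i \<omega>))"

lemma Sn_score: "0 < n \<Longrightarrow> score n (\<lambda>i. Xs i \<omega>) = (1 / sqrt (real n)) *\<^sub>R Sn n \<omega>"
  by (simp add: score_def Sn_def xi_def)

lemma Sn_meas[measurable]: "Sn n \<in> borel_measurable M" unfolding Sn_def by measurable

text \<open>Tightness is exported together with the limit law: it bounds the scores and provides the
  compact set near which test functions are uniformly continuous.\<close>

lemma Sn_limit:
  "\<exists>L0. prob_space L0 \<and> sets L0 = sets borel \<and>
    (\<forall>h. distr L0 borel (\<lambda>z. z \<bullet> h) = normal_law 0 (\<integral>\<omega>. (xi (X \<omega>) \<bullet> h)\<^sup>2 \<partial>M)) \<and>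
    (\<forall>(f :: 'h \<Rightarrow> real) K. continuous_on UNIV f \<longrightarrow> (\<forall>x. \<bar>f x\<bar> \<le> K) \<longrightarrow> (\<lambda>n. \<integral>\<omega>. f (Sn n \<omega>) \<partial>M) \<longlonglongrightarrow> (\<integral>z. f z \<partial>L0)) \<and>
    (\<forall>e>0. \<exists>K. compact K \<and> (\<forall>n. prob {\<omega> \<in> space M. Sn n \<omega> \<notin> K} \<le> e))"
proof -
  from ex_xi_bound obtain B where B: "\<forall>x. norm x = 1 \<longrightarrow> norm (xi x) \<le> B" by (elim exE)
  interpret H: hilbert_iid M "\<lambda>i \<omega>. xi (Xs i \<omega>)" B
  proof (intro hilbert_iid.intro hilbert_iid_axioms.intro prob_space_axioms)
    show "indep_vars (\<lambda>_. borel) (\<lambda>i \<omega>. xi (Xs i \<omega>)) UNIV"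
      by (rule indep_vars_compose2[OF Xs_indep, where Y = "\<lambda>_. xi"]) measurable
    have "distr M borel (\<lambda>\<omega>. xi (Xs i \<omega>)) = distr N borel xi" for i
      unfolding Xs_law[of i, symmetric] by (subst distr_distr) (auto simp: o_def)
    then show "distr M borel (\<lambda>\<omega>. xi (Xs i \<omega>)) = distr M borel (\<lambda>\<omega>. xi (Xs 0 \<omega>))" for i by simp
    show "norm (xi (Xs i \<omega>)) \<le> B" if "\<omega> \<in> space M" for i \<omega> using B Xs_norm[OF that] by blast
    show "(\<integral>\<omega>. xi (Xs i \<omega>) \<bullet> h \<partial>M) = 0" for i h
      using integral_Xs[of "\<lambda>x. xi x \<bullet> h" i] xi_inner_integral[of h] by simp
  qed
  have S: "H.S = Sn" by (simp add: fun_eq_iff H.S_def Sn_def)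
  from H.hilbert_central_limit obtain L0 where L0: "prob_space L0" "sets L0 = sets borel"
    "\<forall>h. distr L0 borel (\<lambda>z. z \<bullet> h) = normal_law 0 (\<integral>\<omega>. (xi (Xs 0 \<omega>) \<bullet> h)\<^sup>2 \<partial>M)"
    "\<forall>(f :: 'h \<Rightarrow> real) K. continuous_on UNIV f \<longrightarrow> (\<forall>x. \<bar>f x\<bar> \<le> K) \<longrightarrow> (\<lambda>n. \<integral>\<omega>. f (H.S n \<omega>) \<partial>M) \<longlonglongrightarrow> (\<integral>z. f z \<partial>L0)"
    by (elim exE conjE)
  show ?thesis
  proof (rule exI[of _ L0], intro conjI allI impI)
    show "prob_space L0" "sets L0 = sets borel" by (rule L0(1), rule L0(2))
    show "distr L0 borel (\<lambda>z. z \<bullet> h) = normal_law 0 (\<integral>\<omega>. (xi (X \<omega>) \<bullet> h)\<^sup>2 \<partial>M)" for h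
      using L0(3) integral_Xs[of "\<lambda>x. (xi x \<bullet> h)\<^sup>2" 0] by simp
    show "(\<lambda>n. \<integral>\<omega>. f (Sn n \<omega>) \<partial>M) \<longlonglongrightarrow> (\<integral>z. f z \<partial>L0)"
      if "continuous_on UNIV f" "\<forall>x. \<bar>f x\<bar> \<le> K" for f :: "'h \<Rightarrow> real" and K
      using L0(4)[rule_format, OF that(1) that(2)[rule_format]] by (simp add: S)
    show "\<exists>K. compact K \<and> (\<forall>n. prob {\<omega> \<in> space M. Sn n \<omega> \<notin> K} \<le> e)" if "0 < e" for e
      using H.tight[OF that] by (simp add: S)
  qed
qed

lemma kap_n_eventually:
  assumes e: "0 < e"
  shows "\<forall>\<^sub>F n in sequentially. prob {\<omega> \<in> space M. kap / 2 < \<bar>kap_n n (\<lambda>i. Xs i \<omega>) - kap\<bar>} < e"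
proof -
  from tame_expectation[OF tame_linear[OF bounded_linear_inner_left[of y0]]] obtain v where
    v: "\<forall>f. (AE \<omega> in M. f \<omega> = X \<omega> \<bullet> y0) \<longrightarrow> has_expectation M f v"
      "(\<lambda>n. \<integral>\<omega>. norm ((1 / real n) *\<^sub>R (\<Sum>i<n. Xs i \<omega> \<bullet> y0) - v) \<partial>M) \<longlonglongrightarrow> 0"
      "\<forall>n. integrable M (\<lambda>\<omega>. norm ((1 / real n) *\<^sub>R (\<Sum>i<n. Xs i \<omega> \<bullet> y0) - v))"
    by (elim exE conjE)
  have "has_expectation M (\<lambda>\<omega>. X \<omega> \<bullet> y0) v" by (rule v(1)[rule_format]) simp
  from has_bochner_integral_integral_eq[OF has_expectation_bounded_linear[OF this bounded_linear_ident]]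
  have vk: "v = kap" unfolding kap_def by (subst integral_N) auto
  show ?thesis
    using markov_tendsto[OF v(3)[rule_format] norm_ge_zero v(2), of "kap / 2" e] kap_pos e
    by (simp add: vk kap_n_def)
qed

text \<open>The limit law in the chart space is the image under \<open>L\<close> of the Gaussian law
  of the centred gradients. The sign in \<open>L_psi_xi\<close> disappears in the square.\<close>

lemma Z_marginal:
  assumes L0: "prob_space L0" "sets L0 = sets borel"
    and marg: "\<And>h. distr L0 borel (\<lambda>z. z \<bullet> h) = normal_law 0 (\<integral>\<omega>. (xi (X \<omega>) \<bullet> h)\<^sup>2 \<partial>M)"
  shows "distr (distr L0 borel L) borel (\<lambda>z. z \<bullet> h) = normal_law 0 (V h)"
proof -
  from ex_L_adjoint[of h] obtain w where w: "\<forall>x. L x \<bullet> h = x \<bullet> w" by (elim exE)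
  have L_cont: "continuous_on UNIV L" using bounded_linear_L by (rule linear_continuous_on)
  have Lm: "L \<in> L0 \<rightarrow>\<^sub>M borel"
    using borel_measurable_continuous_onI[OF L_cont] by (simp add: measurable_cong_sets[OF L0(2) refl])
  have im: "(\<lambda>z::'e. z \<bullet> h) \<in> borel_measurable borel"
    by (intro borel_measurable_continuous_onI continuous_intros)
  have "distr (distr L0 borel L) borel (\<lambda>z. z \<bullet> h) = distr L0 borel (\<lambda>z. z \<bullet> w)"
    unfolding distr_distr[OF im Lm] by (simp add: o_def w)
  also have "\<dots> = normal_law 0 (V h)" unfolding marg V_def by (simp add: L_psi_xi w)
  finally show ?thesis .
qed

text \<open>First and second moments are transported from the normal marginals; mixed moments follow
  by polarization.\<close>

lemma gaussian_limit_law: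
  assumes Z: "prob_space Z" "sets Z = sets borel" and marg: "\<And>h. distr Z borel (\<lambda>z. z \<bullet> h) = normal_law 0 (V h)"
  shows "gaussian_law Z" "has_mean Z 0" "has_covariance_operator Z \<T>"
proof -
  have V0: "0 \<le> V h" for h by (simp add: V_def)
  show "gaussian_law Z" unfolding gaussian_law_def using Z marg V0 by blast
  have im: "(\<lambda>z::'e. z \<bullet> h) \<in> borel_measurable borel" for h
    by (intro borel_measurable_continuous_onI continuous_intros)
  have m: "(\<lambda>z. z \<bullet> h) \<in> borel_measurable Z" for h using im by (simp add: measurable_cong_sets[OF Z(2) refl])
  have i1a: "integrable Z (\<lambda>z. z \<bullet> h)" for h
    using normal_law_moments(1)[OF V0[of h]] unfolding marg[of h, symmetric] by (rule integrable_distr[OF m])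
  have i1: "(\<integral>z. z \<bullet> h \<partial>Z) = 0" for h
    using normal_law_moments(2)[OF V0[of h]] unfolding marg[of h, symmetric]
    by (subst (asm) integral_distr[OF m]) simp_all
  have i2a: "integrable Z (\<lambda>z. (z \<bullet> h)\<^sup>2)" for h
    using normal_law_moments(3)[OF V0[of h]] unfolding marg[of h, symmetric] by (rule integrable_distr[OF m])
  have i2: "(\<integral>z. (z \<bullet> h)\<^sup>2 \<partial>Z) = V h" for h
    using normal_law_moments(4)[OF V0[of h]] unfolding marg[of h, symmetric]
    by (subst (asm) integral_distr[OF m]) simp_all
  show "has_mean Z 0" unfolding has_mean_def using i1 i1a by simp
  show "has_covariance_operator Z \<T>"
    unfolding has_covariance_operator_def
  proof (intro allI)
    fix h1 h2
    have "covariance Z (\<lambda>z. z \<bullet> h1) (\<lambda>z. z \<bullet> h2) = (\<integral>z. (z \<bullet> h1) * (z \<bullet> h2) \<partial>Z)"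
      unfolding covariance_def i1 by simp
    also have "\<dots> = (\<integral>z. ((z \<bullet> (h1 + h2))\<^sup>2 - (z \<bullet> (h1 - h2))\<^sup>2) / 4 \<partial>Z)"
      by (intro Bochner_Integration.integral_cong refl) (simp add: inner_add_right inner_diff_right power2_eq_square algebra_simps)
    also have "\<dots> = (V (h1 + h2) - V (h1 - h2)) / 4" using i2a by (simp add: i2)
    finally show "h1 \<bullet> \<T> h2 = covariance Z (\<lambda>z. z \<bullet> h1) (\<lambda>z. z \<bullet> h2)" unfolding \<T>_polarization ..
  qed
qed

lemma chart_mean_measurable:
  assumes W: "W \<in> borel_measurable M"
  shows "(\<lambda>\<omega>. if sample_intrinsic_mean Xs n \<omega> \<in> U then \<tau> (sample_intrinsic_mean Xs n \<omega>) else W \<omega>) \<in> borel_measurable M"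
proof -
  note m[measurable] = sample_intrinsic_mean_meas[of n]
  have "openin (top_of_set (sphere 0 1)) U" using chart by (simp add: smooth_chart_def)
  then obtain V where V: "open V" "U = sphere 0 1 \<inter> V" unfolding openin_open by blast
  have "closed (sphere 0 1 :: 'h set)" unfolding sphere_def by (intro closed_Collect_eq continuous_intros)
  then have [measurable]: "U \<in> sets borel" unfolding V(2) using V(1) by (intro sets.Int borel_closed borel_open)
  have "continuous_on U \<tau>" using homeo by (simp add: homeomorphism_def)
  then have t: "(\<lambda>x. if x \<in> U then \<tau> x else 0) \<in> borel_measurable borel"
    by (rule borel_measurable_continuous_on_if[rotated]) auto
  have "(\<lambda>\<omega>. if sample_intrinsic_mean Xs n \<omega> \<in> U then (\<lambda>x. if x \<in> U then \<tau> x else 0) (sample_intrinsic_mean Xs n \<omega>) else W \<omega>) \<in> borel_measurable M"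
    by (rule measurable_If[OF measurable_compose[OF m t] W]) measurable
  moreover have "(\<lambda>\<omega>. if sample_intrinsic_mean Xs n \<omega> \<in> U then (\<lambda>x. if x \<in> U then \<tau> x else 0) (sample_intrinsic_mean Xs n \<omega>) else W \<omega>)
    = (\<lambda>\<omega>. if sample_intrinsic_mean Xs n \<omega> \<in> U then \<tau> (sample_intrinsic_mean Xs n \<omega>) else W \<omega>)"
    by (rule ext) simp
  ultimately show ?thesis by simp
qed

text \<open>A Slutsky argument with three exceptional events: \<open>Sn\<close> outside the compact
  set, the empirical growth rate far from kap, the empirical Hessian far from \<Lambda>. Off them
  \<open>Y n \<omega>\<close> is almost surely within \<delta> of \<open>L (Sn n \<omega>)\<close>
  for large n.\<close>

lemma chart_convergence:
  fixes f :: "'e \<Rightarrow> real" and Y :: "nat \<Rightarrow> 'w \<Rightarrow> 'e"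
  assumes f: "continuous_on UNIV f" "\<And>x. \<bar>f x\<bar> \<le> B"
    and Ym[measurable]: "\<And>n. Y n \<in> borel_measurable M"
    and Y: "\<And>n \<omega>. sample_intrinsic_mean Xs n \<omega> \<in> U \<Longrightarrow> Y n \<omega> = sqrt (real n) *\<^sub>R (\<tau> (sample_intrinsic_mean Xs n \<omega>) - e0)"
    and tight: "\<And>e. 0 < e \<Longrightarrow> \<exists>K. compact K \<and> (\<forall>n. prob {\<omega> \<in> space M. Sn n \<omega> \<notin> K} \<le> e)"
    and lim: "(\<lambda>n. \<integral>\<omega>. f (L (Sn n \<omega>)) \<partial>M) \<longlonglongrightarrow> l"
  shows "(\<lambda>n. \<integral>\<omega>. f (Y n \<omega>) \<partial>M) \<longlonglongrightarrow> l"
proof (rule LIMSEQ_I)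
  fix r :: real assume r: "0 < r"
  have B: "0 \<le> B" using f(2)[of 0] by linarith
  have L_cont: "continuous_on UNIV L" using bounded_linear_L by (rule linear_continuous_on)
  have fm[measurable]: "f \<in> borel_measurable borel" using f(1) by (rule borel_measurable_continuous_onI)
  have Lm[measurable]: "L \<in> borel_measurable borel" using L_cont by (rule borel_measurable_continuous_onI)
  \<comment> \<open>The error e off the exceptional set plus 2 B times its probability, at most 3 e,
    stays below r / 2.\<close>
  define e where "e = r / (2 * (2 + 6 * B))"
  have e: "0 < e" "(2 + 6 * B) * e = r / 2" using r B by (auto simp: e_def field_simps add_pos_nonneg)
  from tight[OF e(1)] obtain K where K: "compact K" "\<forall>n. prob {\<omega> \<in> space M. Sn n \<omega> \<notin> K} \<le> e" by (elim exE conjE)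
  obtain R where R: "0 < R" "\<And>x. x \<in> K \<Longrightarrow> norm x \<le> R"
    using compact_imp_bounded[OF K(1)] unfolding bounded_pos by blast
  have "compact (L ` K)" using K(1) L_cont continuous_on_subset compact_continuous_image by blast
  from uniform_near_compact[OF this f(1) e(1)] obtain \<delta> where \<delta>: "0 < \<delta>" "\<forall>x\<in>L ` K. \<forall>y. dist y x < \<delta> \<longrightarrow> \<bar>f y - f x\<bar> < e"
    by (elim exE conjE)
  from chart_expansion obtain K1 where K1: "0 < K1" "\<forall>\<epsilon>>0. \<exists>d>0. \<forall>n z. 0 < n \<longrightarrow> (\<forall>i<n. z i \<in> S) \<longrightarrow> kap / 2 \<le> kap_n n z \<longrightarrow> norm (score n z) < d \<longrightarrow>
    norm (hess_n n z - \<Lambda>) \<le> \<epsilon> \<longrightarrow>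
    sample_mean z n \<in> U \<and> norm (\<tau> (sample_mean z n) - e0 - L (score n z)) \<le> K1 * \<epsilon> * norm (score n z)"
    by (elim exE conjE)
  \<comment> \<open>The linearization error scaled by sqrt n is at most K1 \<epsilon> R = \<delta> /
    2.\<close>
  define \<epsilon> where "\<epsilon> = \<delta> / (2 * K1 * R)"
  have eps: "0 < \<epsilon>" "K1 * \<epsilon> * R < \<delta>" using \<delta>(1) K1(1) R(1) by (auto simp: \<epsilon>_def field_simps)
  from K1(2)[rule_format, OF eps(1)] obtain d where d: "0 < d" "\<forall>n z. 0 < n \<longrightarrow> (\<forall>i<n. z i \<in> S) \<longrightarrow> kap / 2 \<le> kap_n n z \<longrightarrow> norm (score n z) < d \<longrightarrow>
    norm (hess_n n z - \<Lambda>) \<le> \<epsilon> \<longrightarrow>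
    sample_mean z n \<in> U \<and> norm (\<tau> (sample_mean z n) - e0 - L (score n z)) \<le> K1 * \<epsilon> * norm (score n z)"
    by (elim exE conjE)
  define A2' where "A2' n = {\<omega> \<in> space M. kap / 2 < \<bar>kap_n n (\<lambda>i. Xs i \<omega>) - kap\<bar>}" for n
  define A3 where "A3 n = {\<omega> \<in> space M. \<epsilon> < norm ((1 / real n) *\<^sub>R (\<Sum>i<n. hess (Xs i \<omega>)) - \<Lambda>)}" for n
  define A1 where "A1 n = {\<omega> \<in> space M. Sn n \<omega> \<notin> K}" for n
  have [measurable]: "K \<in> sets borel" using K(1) by (rule borel_compact)
  have A1m: "A1 n \<in> sets M" for n unfolding A1_def by measurable
  have A2m: "A2' n \<in> sets M" for n unfolding A2'_def kap_n_def by measurable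
  have A3m: "A3 n \<in> sets M" for n
    unfolding A3_def using borel_measurable_integrable[OF hess_lln(2)[of n]] by measurable
  have ev3: "\<forall>\<^sub>F n in sequentially. prob (A3 n) < e"
    unfolding A3_def by (rule markov_tendsto[OF hess_lln(2) norm_ge_zero hess_lln(1) eps(1) e(1)])
  have ev2: "\<forall>\<^sub>F n in sequentially. prob (A2' n) < e" unfolding A2'_def by (rule kap_n_eventually[OF e(1)])
  \<comment> \<open>When \<open>Sn\<close> lies in the compact set, the score is at most R / sqrt n,
    which eventually falls into the range d of the expansion.\<close>
  have "(\<lambda>n. R / sqrt (real n)) \<longlonglongrightarrow> 0" by real_asymp
  then have evd: "\<forall>\<^sub>F n in sequentially. R / sqrt (real n) < d" by (rule order_tendstoD(2)) (rule d(1))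
  have evl: "\<forall>\<^sub>F n in sequentially. \<bar>(\<integral>\<omega>. f (L (Sn n \<omega>)) \<partial>M) - l\<bar> < r / 2"
    using tendstoD[OF lim, of "r / 2"] r by (simp add: dist_real_def)
  have "\<forall>\<^sub>F n in sequentially. norm ((\<integral>\<omega>. f (Y n \<omega>) \<partial>M) - l) < r"
    using ev2 ev3 evd evl eventually_gt_at_top[of 0]
  proof eventually_elim
    case (elim n)
    then have n: "0 < n" by simp
    have prob3: "prob (A1 n \<union> A2' n \<union> A3 n) \<le> 3 * e"
    proof -
      have "prob (A1 n \<union> A2' n \<union> A3 n) \<le> prob (A1 n \<union> A2' n) + prob (A3 n)"
        using A1m A2m A3m by (intro measure_Un_le) auto
      also have "prob (A1 n \<union> A2' n) \<le> prob (A1 n) + prob (A2' n)" using A1m A2m by (intro measure_Un_le) auto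
      also have "prob (A1 n) \<le> e" unfolding A1_def using K(2) by blast
      finally show ?thesis using elim(1,2) by simp
    qed
    have "\<bar>(\<integral>\<omega>. f (Y n \<omega>) \<partial>M) - (\<integral>\<omega>. f (L (Sn n \<omega>)) \<partial>M)\<bar> \<le> e + (2 * B) * (3 * e)"
    proof (rule expectation_diff_le[OF _ _ _ prob3])
      show "integrable M (\<lambda>\<omega>. f (Y n \<omega>))"
        by (rule integrable_bounded[of _ B]) (use f(2) measurable_compose[OF Ym fm] in auto)
      show "integrable M (\<lambda>\<omega>. f (L (Sn n \<omega>)))"
        by (rule integrable_bounded[of _ B]) (use f(2) measurable_compose[OF measurable_compose[OF Sn_meas Lm] fm] in auto)
      show "A1 n \<union> A2' n \<union> A3 n \<in> sets M" using A1m A2m A3m by blast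
      show "\<bar>f (Y n \<omega>) - f (L (Sn n \<omega>))\<bar> \<le> 2 * B" for \<omega> using f(2)[of "Y n \<omega>"] f(2)[of "L (Sn n \<omega>)"] by linarith
      show "AE \<omega> in M. \<omega> \<notin> A1 n \<union> A2' n \<union> A3 n \<longrightarrow> \<bar>f (Y n \<omega>) - f (L (Sn n \<omega>))\<bar> \<le> e"
        using AE_Xs_S AE_space
      proof (eventually_elim, intro impI)
        fix \<omega> assume zS: "\<forall>i. Xs i \<omega> \<in> S" and sp: "\<omega> \<in> space M" and w: "\<omega> \<notin> A1 n \<union> A2' n \<union> A3 n"
        define z where "z i = Xs i \<omega>" for i
        have zi: "\<forall>i<n. z i \<in> S" using zS by (simp add: z_def)
        have SK: "Sn n \<omega> \<in> K" using w sp by (auto simp: A1_def)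
        have "\<bar>kap_n n z - kap\<bar> \<le> kap / 2" using w sp by (auto simp: A2'_def z_def[abs_def] not_less)
        then have k: "kap / 2 \<le> kap_n n z" by linarith
        have H: "norm (hess_n n z - \<Lambda>) \<le> \<epsilon>" using w sp by (auto simp: A3_def hess_n_def z_def not_less)
        have sc: "score n z = (1 / sqrt (real n)) *\<^sub>R Sn n \<omega>" unfolding z_def by (rule Sn_score[OF n])
        have nsc: "sqrt (real n) * norm (score n z) = norm (Sn n \<omega>)" using n by (simp add: sc)
        have "norm (score n z) \<le> R / sqrt (real n)" unfolding sc using R(2)[OF SK] n by (simp add: divide_right_mono)
        then have "norm (score n z) < d" using elim(3) by linarith
        from d(2)[rule_format, OF n zi[rule_format] k this H]
        have pU: "sample_mean z n \<in> U" and bd: "norm (\<tau> (sample_mean z n) - e0 - L (score n z)) \<le> K1 * \<epsilon> * norm (score n z)" by auto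
        have sm: "sample_intrinsic_mean Xs n \<omega> = sample_mean z n" unfolding z_def by (rule sample_intrinsic_mean_eq)
        have Yn: "Y n \<omega> = sqrt (real n) *\<^sub>R (\<tau> (sample_mean z n) - e0)" using Y[of n \<omega>] pU unfolding sm by simp
        have LS: "L (Sn n \<omega>) = sqrt (real n) *\<^sub>R L (score n z)"
          unfolding sc using n by (simp add: linear_scale[OF bounded_linear.linear[OF bounded_linear_L]])
        have "norm (Y n \<omega> - L (Sn n \<omega>)) = sqrt (real n) * norm (\<tau> (sample_mean z n) - e0 - L (score n z))"
          unfolding Yn LS scaleR_diff_right[symmetric] norm_scaleR by simp
        also have "\<dots> \<le> sqrt (real n) * (K1 * \<epsilon> * norm (score n z))" using bd by (intro mult_left_mono) auto
        also have "\<dots> = K1 * \<epsilon> * norm (Sn n \<omega>)" unfolding nsc[symmetric] by simp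
        also have "\<dots> \<le> K1 * \<epsilon> * R" using R(2)[OF SK] K1(1) eps(1) by (intro mult_left_mono) auto
        also have "\<dots> < \<delta>" by (rule eps(2))
        finally have "dist (Y n \<omega>) (L (Sn n \<omega>)) < \<delta>" by (simp add: dist_norm)
        then show "\<bar>f (Y n \<omega>) - f (L (Sn n \<omega>))\<bar> \<le> e" using \<delta>(2) SK by (intro less_imp_le) blast
      qed
    qed (use e B in auto)
    also have "e + (2 * B) * (3 * e) \<le> r / 2" using e B by (simp add: algebra_simps)
    finally show ?case using elim(4) unfolding real_norm_def by linarith
  qed
  then show "\<exists>no. \<forall>n\<ge>no. norm ((\<integral>\<omega>. f (Y n \<omega>) \<partial>M) - l) < r" unfolding eventually_sequentially .
qed

theorem chart_central_limit:
  assumes W: "\<And>n. W n \<in> borel_measurable M"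
  defines "Y \<equiv> \<lambda>n \<omega>. sqrt (real n) *\<^sub>R ((if sample_intrinsic_mean Xs n \<omega> \<in> U then \<tau> (sample_intrinsic_mean Xs n \<omega>) else W n \<omega>) - e0)"
  shows "\<exists>Z. gaussian_law Z \<and> has_mean Z 0 \<and> has_covariance_operator Z \<T> \<and> converges_in_distribution M Y Z"
proof -
  from Sn_limit obtain L0 where L0: "prob_space L0" "sets L0 = sets borel"
    "\<forall>h. distr L0 borel (\<lambda>z. z \<bullet> h) = normal_law 0 (\<integral>\<omega>. (xi (X \<omega>) \<bullet> h)\<^sup>2 \<partial>M)"
    "\<forall>(f :: 'h \<Rightarrow> real) K. continuous_on UNIV f \<longrightarrow> (\<forall>x. \<bar>f x\<bar> \<le> K) \<longrightarrow> (\<lambda>n. \<integral>\<omega>. f (Sn n \<omega>) \<partial>M) \<longlonglongrightarrow> (\<integral>z. f z \<partial>L0)"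
    "\<forall>e>0. \<exists>K. compact K \<and> (\<forall>n. prob {\<omega> \<in> space M. Sn n \<omega> \<notin> K} \<le> e)"
    by (elim exE conjE)
  interpret L0: prob_space L0 by (rule L0)
  have L_cont: "continuous_on UNIV L" using bounded_linear_L by (rule linear_continuous_on)
  have Lm: "L \<in> L0 \<rightarrow>\<^sub>M borel"
    using borel_measurable_continuous_onI[OF L_cont] by (simp add: measurable_cong_sets[OF L0(2) refl])
  define Z where "Z = distr L0 borel L"
  have Z: "prob_space Z" "sets Z = sets borel" unfolding Z_def using L0.prob_space_distr[OF Lm] by auto
  have marg: "distr Z borel (\<lambda>z. z \<bullet> h) = normal_law 0 (V h)" for h
    unfolding Z_def by (rule Z_marginal[OF L0(1,2) L0(3)[rule_format]])
  have Ym: "Y n \<in> borel_measurable M" for n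
  proof -
    have "continuous_on UNIV (\<lambda>y. sqrt (real n) *\<^sub>R (y - e0))" by (intro continuous_intros)
    from measurable_compose[OF chart_mean_measurable[OF W] borel_measurable_continuous_onI[OF this]]
    show ?thesis unfolding Y_def .
  qed
  have "(\<lambda>n. \<integral>\<omega>. f (Y n \<omega>) \<partial>M) \<longlonglongrightarrow> (\<integral>z. f z \<partial>Z)" if f: "continuous_on UNIV f" "bounded (range f)" for f :: "'e \<Rightarrow> real"
  proof -
    obtain B where B: "\<And>x. \<bar>f x\<bar> \<le> B" using f(2) unfolding bounded_iff by auto
    have fL: "continuous_on UNIV (\<lambda>x. f (L x))" by (rule continuous_on_compose2[OF f(1) L_cont]) simp
    have "(\<integral>z. f z \<partial>Z) = (\<integral>z. f (L z) \<partial>L0)"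
      unfolding Z_def by (rule integral_distr[OF Lm borel_measurable_continuous_onI[OF f(1)]])
    then have "(\<lambda>n. \<integral>\<omega>. f (L (Sn n \<omega>)) \<partial>M) \<longlonglongrightarrow> (\<integral>z. f z \<partial>Z)" using L0(4)[rule_format, OF fL B] by simp
    then show ?thesis
      by (intro chart_convergence[OF f(1) B Ym _ L0(5)[rule_format]]) (simp_all add: Y_def)
  qed
  then have "converges_in_distribution M Y Z"
    unfolding converges_in_distribution_def using Ym Z by blast
  then show ?thesis using gaussian_limit_law[OF Z marg] by blast
qed

end

theorem theorem3p2:
  fixes M :: "'w measure"
    and X :: "'w \<Rightarrow> 'h::{real_inner, polish_space}"
    and Xs :: "nat \<Rightarrow> 'w \<Rightarrow> 'h"
    and \<mu> :: 'h and \<mu>hat :: "nat \<Rightarrow> 'w \<Rightarrow> 'h"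
    and U :: "'h set" and \<tau> :: "'h \<Rightarrow> 'e::{real_inner, complete_space}"
    and W :: "nat \<Rightarrow> 'w \<Rightarrow> 'e"
    and \<mu>\<tau> :: 'e and \<mu>hat\<tau> :: "nat \<Rightarrow> 'w \<Rightarrow> 'e"
    and \<Lambda> :: "'e \<Rightarrow>\<^sub>L 'e \<Rightarrow>\<^sub>L real" and F :: "('e \<Rightarrow>\<^sub>L real) \<Rightarrow>\<^sub>L ('e \<Rightarrow>\<^sub>L real)"
    and T :: "'e \<Rightarrow>\<^sub>L 'e"
  assumes infinite_dim: "\<nexists>B :: 'h set. finite B \<and> span B = UNIV"
    and prob: "prob_space M" and compl: "complete_measure M"
    and X: "random_element M X"
    and supp: "AE \<omega> in M. X \<omega> \<in> support_of M X"
    and diam: "\<forall>x\<in>support_of M X. \<forall>y\<in>support_of M X. rho x y \<le> pi / 2"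
    and indep: "prob_space.indep_vars M (\<lambda>_. restrict_space borel (sphere 0 1)) Xs UNIV"
    and copies: "\<And>i. distr M (restrict_space borel (sphere 0 1)) (Xs i) =
                      distr M (restrict_space borel (sphere 0 1)) X"
    and mu: "\<mu> = intrinsic_mean M X"
    and muhat: "\<mu>hat = sample_intrinsic_mean Xs"
    and chart: "smooth_chart U \<tau>" "\<mu> \<in> U"
    and mu_tau: "\<mu>\<tau> = \<tau> \<mu>"
    and W: "\<And>n. W n \<in> borel_measurable M"
    and muhat_tau: "\<And>n \<omega>. \<mu>hat\<tau> n \<omega> = (if \<mu>hat n \<omega> \<in> U then \<tau> (\<mu>hat n \<omega>) else W n \<omega>)"
    and Lambda: "\<Lambda> = operator_expectation M (\<lambda>\<omega>. hess_chart U \<tau> (X \<omega>) \<mu>\<tau>)"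
    and F: "F = operator_expectation M
              (\<lambda>\<omega>. dual_tensor (psi_chart U \<tau> (X \<omega>) \<mu>\<tau>) (psi_chart U \<tau> (X \<omega>) \<mu>\<tau>))"
    and T: "T = blinfun_inverse \<Lambda> o\<^sub>L F o\<^sub>L dual_adjoint (blinfun_inverse \<Lambda>)"
  shows "continuously_invertible \<Lambda> \<and>
    (\<exists>Z_law. gaussian_law Z_law \<and> has_mean Z_law 0 \<and> has_covariance_operator Z_law T \<and>
       converges_in_distribution M (\<lambda>n \<omega>. sqrt (real n) *\<^sub>R (\<mu>hat\<tau> n \<omega> - \<mu>\<tau>)) Z_law) \<and>
    (\<forall>h1 h2. h1 \<bullet> T h2 =
       covariance M (\<lambda>\<omega>. blinfun_inverse \<Lambda> (psi_chart U \<tau> (X \<omega>) \<mu>\<tau>) \<bullet> h1)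
                    (\<lambda>\<omega>. blinfun_inverse \<Lambda> (psi_chart U \<tau> (X \<omega>) \<mu>\<tau>) \<bullet> h2))"
proof -
  have ms: "mean_sample M X Xs"
    by (intro mean_sample.intro mean_sample_axioms.intro prob compl X supp diam indep copies)
  obtain A A2 where "sphere_chart U \<tau> \<mu> A A2" by (rule ex_sphere_chart[OF chart])
  then have "chart_mean_sample M X Xs U \<tau> A A2"
    unfolding mu by (intro chart_mean_sample.intro ms)
  then interpret C: chart_mean_sample M X Xs U \<tau> A A2 .
  have e: "\<mu>\<tau> = \<tau> (intrinsic_mean M X)" by (simp add: mu_tau mu)
  have "continuously_invertible \<Lambda>"
    unfolding continuously_invertible_def Lambda e by (rule C.ex_\<Lambda>_inverse)
  moreover have "\<mu>hat\<tau> = (\<lambda>n \<omega>. if sample_intrinsic_mean Xs n \<omega> \<in> U then \<tau> (sample_intrinsic_mean Xs n \<omega>) else W n \<omega>)"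
    by (simp add: fun_eq_iff muhat_tau muhat)
  then have "\<exists>Z_law. gaussian_law Z_law \<and> has_mean Z_law 0 \<and> has_covariance_operator Z_law T \<and>
       converges_in_distribution M (\<lambda>n \<omega>. sqrt (real n) *\<^sub>R (\<mu>hat\<tau> n \<omega> - \<mu>\<tau>)) Z_law"
    unfolding T F Lambda e using C.chart_central_limit[OF W] by simp
  moreover have "\<forall>h1 h2. h1 \<bullet> T h2 =
       covariance M (\<lambda>\<omega>. blinfun_inverse \<Lambda> (psi_chart U \<tau> (X \<omega>) \<mu>\<tau>) \<bullet> h1)
                    (\<lambda>\<omega>. blinfun_inverse \<Lambda> (psi_chart U \<tau> (X \<omega>) \<mu>\<tau>) \<bullet> h2)"
    unfolding T F Lambda e by (intro allI C.covariance_formula)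
  ultimately show ?thesis by blast
qed

end
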